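(* Let $\Omega=\mathbb{T}^d$ be the flat torus and let $\Psi\in C^{1,1}(\mathbb{T}^d)$. Let $J,J_*:\mathbb{R}\to\mathbb{R}$ and $c>0$ be such that $$G(s)+G^*(q)\ \ge\ sq+c\,|J(s)-J_*(q)|^2\qquad\text{for all } s,q\in\mathbb{R}.$$ If $(m,v)\in\mathcal{H}$ is a solution of the problem $\min_{\mathcal{H}}\mathcal{B}$, then $J(m)$ satisfies, for every $t_1>0$, $$\|J(m(\cdot+\delta))-J(m)\|_{L^2([t_1,T]\times\mathbb{T}^d)}\le C|\delta|,$$ where $m(\cdot+\delta)$ denotes the spatial translation $(t,x)\mapsto m(t,x+\delta)$, $\delta\in\mathbb{R}^d$, and the constant $C$ depends on $t_1$ and on the data $\Psi$ and $G$. Hence $J(m)$ is of class $L^2_{loc}((0,T];H^1(\mathbb{T}^d))$.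
   Context: Let $T>0$ and $d\ge1$. $G$ is a convex function with $G(0)=0$ and $G'=g$ on $\mathbb{R}^+$, where $g:[0,\infty)\to[0,+\infty]$ is increasing; $G^*(q)=\sup_{s}\{sq-G(s)\}$ is its convex conjugate. The initial datum $\overline{m_0}$ is a given probability density on $\mathbb{T}^d$, and $\Psi:\mathbb{T}^d\to\mathbb{R}$ is a given final cost. $\mathcal{H}$ is the set of pairs $(m,v)$ where $m\in L^1((0,T)\times\mathbb{T}^d)$, $m\ge0$ a.e., $\int_{\mathbb{T}^d}m(t,x)\,dx=1$ for a.e. $t$, $v$ is a measurable vector field on $(0,T)\times\mathbb{T}^d$ with $mv\in L^1$, and $\partial_tm+\nabla\cdot(mv)=0$ with $m_0=\overline{m_0}$ in the weak sense: for all $\phi\in C^1_c([0,T)\times\mathbb{T}^d)$, $$\int_0^T\!\!\int_{\mathbb{T}^d}(m\,\partial_t\phi+mv\cdot\nabla\phi)\,dx\,dt+\int_{\mathbb{T}^d}\phi(0,x)\overline{m_0}(x)\,dx=0.$$ For $(m,v)\in\mathcal{H}$, $$\mathcal{B}(m,v)=\int_0^T\!\!\int_{\mathbb{T}^d}\Big(\tfrac12m|v|^2+G(m)\Big)dx\,dt+\int_{\mathbb{T}^d}\Psi\,dm_T,$$ where the first integral takes values in $[0,+\infty]$. When $\int_0^T\int m|v|^2\,dx\,dt<\infty$, $m$ is identified with a continuous curve $t\mapsto m_t$ on $[0,T]$ with values in the probability measures on $\mathbb{T}^d$ endowed with the Wasserstein distance $W_2$, and $m_T$ is its value at $t=T$.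 A solution of $\min_{\mathcal{H}}\mathcal{B}$ is a pair in $\mathcal{H}$ attaining the infimum of $\mathcal{B}$ over $\mathcal{H}$.
   Formalization: A solution of the minimisation problem is understood to have finite minimal value; if the functional is identically +∞ (e.g. G = +∞ on (1/2,∞)), every pair attains the infimum and the claim is false. *)

theory Defs
  imports "HOL-Probability.Probability"
begin

text \<open>
  The flat torus is \<open>\<real>\<^sup>d / \<int>\<^sup>d\<close> with \<open>d = CARD('n)\<close>. Functions on it are \<open>\<int>\<^sup>d\<close>-periodic
  functions on \<^typ>\<open>real ^ 'n\<close>, integrals over it are integrals over the unit cell \<open>[0,1)\<^sup>d\<close>,
  and measures on it are Borel measures on \<^typ>\<open>real ^ 'n\<close> concentrated on the unit cell.
\<close>

definition int_lattice :: "(real ^ 'n) set" where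
  "int_lattice = {k. \<forall>i. k $ i \<in> \<int>}"

definition unit_cell :: "(real ^ 'n) set" where
  "unit_cell = {x. \<forall>i. 0 \<le> x $ i \<and> x $ i < 1}"

definition periodic :: "(real ^ 'n \<Rightarrow> 'b) \<Rightarrow> bool" where
  "periodic f \<longleftrightarrow> (\<forall>x. \<forall>k\<in>int_lattice. f (x + k) = f x)"

definition torus_dist :: "real ^ 'n \<Rightarrow> real ^ 'n \<Rightarrow> real" where
  "torus_dist x y = infdist (x - y) int_lattice"

definition C11_torus :: "(real ^ 'n \<Rightarrow> real) \<Rightarrow> bool" where
  "C11_torus f \<longleftrightarrow> periodic f \<and>
     (\<exists>Df L. (\<forall>x. GDERIV f x :> Df x) \<and> L-lipschitz_on UNIV Df)"

definition prob_density_torus :: "(real ^ 'n \<Rightarrow> real) \<Rightarrow> bool" where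
  "prob_density_torus \<rho> \<longleftrightarrow> periodic \<rho> \<and> set_integrable lebesgue unit_cell \<rho> \<and>
     (AE x in lebesgue. 0 \<le> \<rho> x) \<and> (LINT x:unit_cell|lebesgue. \<rho> x) = 1"


subsection \<open>Wasserstein distance on the torus\<close>

definition torus_prob :: "(real ^ 'n) measure \<Rightarrow> bool" where
  "torus_prob \<mu> \<longleftrightarrow> sets \<mu> = sets borel \<and> prob_space \<mu> \<and> emeasure \<mu> unit_cell = 1"

definition couplings ::
  "(real ^ 'n) measure \<Rightarrow> (real ^ 'n) measure \<Rightarrow> ((real ^ 'n) \<times> (real ^ 'n)) measure set" where
  "couplings \<mu> \<nu> =
     {\<pi>. sets \<pi> = sets borel \<and> distr \<pi> borel fst = \<mu> \<and> distr \<pi> borel snd = \<nu>}"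

definition W2 :: "(real ^ 'n) measure \<Rightarrow> (real ^ 'n) measure \<Rightarrow> real" where
  "W2 \<mu> \<nu> = sqrt (INF \<pi>\<in>couplings \<mu> \<nu>. LINT z|\<pi>. (torus_dist (fst z) (snd z))\<^sup>2)"


subsection \<open>The congestion cost\<close>

text \<open>
  \<open>G\<close> is the primitive of \<open>g\<close> vanishing at 0. As \<open>g\<close> may jump and may take the value \<open>+\<infinity>\<close>,
  \<open>G' = g\<close> is stated in integrated form; the lemmas below give convexity and, wherever \<open>g\<close>
  is finite and continuous, the pointwise derivative. On negative numbers \<open>G\<close> is \<open>+\<infinity>\<close>, so
  that the supremum in the conjugate is effectively over \<open>s \<ge> 0\<close>.
\<close>

definition primitive :: "(real \<Rightarrow> ennreal) \<Rightarrow> real \<Rightarrow> ennreal" where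
  "primitive g s = (if s < 0 then \<infinity> else \<integral>\<^sup>+r\<in>{0..s}. g r \<partial>lborel)"

definition conjugate :: "(real \<Rightarrow> ennreal) \<Rightarrow> real \<Rightarrow> ereal" where
  "conjugate G q = (SUP s. ereal (s * q) - enn2ereal (G s))"

lemma primitive_0: "primitive g 0 = 0"
  by (simp add: primitive_def)

lemma primitive_measurable:
  fixes g :: "real \<Rightarrow> ennreal"
  assumes "mono_on {0..} g" "S \<subseteq> {0..}" "S \<in> sets borel"
  shows "(\<lambda>r. g r * indicator S r) \<in> borel_measurable borel"
proof -
  have "mono (\<lambda>r. g (max 0 r))"
    using assms(1) by (auto simp: mono_def mono_on_def)
  then have "(\<lambda>r. g (max 0 r)) \<in> borel_measurable borel"
  proof (intro borel_measurableI_greater)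
    fix a
    have "is_interval {r. a < g (max 0 r)}"
      using \<open>mono _\<close> unfolding is_interval_1 mono_def by (auto intro: less_le_trans)
    then have "{r. a < g (max 0 r)} \<in> sets borel"
      using real_interval_borel_measurable by blast
    then show "{r \<in> space borel. a < g (max 0 r)} \<in> sets borel" by simp
  qed
  then have "(\<lambda>r. g (max 0 r) * indicator S r) \<in> borel_measurable borel"
    using assms(3) by measurable
  also have "(\<lambda>r. g (max 0 r) * indicator S r) = (\<lambda>r. g r * indicator S r)"
    using assms(2) by (auto simp: fun_eq_iff indicator_def max_def)
  finally show ?thesis .
qed

lemma primitive_bounds:
  assumes "mono_on {0..} g" "0 \<le> a" "a \<le> b"
  shows "primitive g a + g a * ennreal (b - a) \<le> primitive g b"
    and "primitive g b \<le> primitive g a + g b * ennreal (b - a)"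
proof -
  have "(\<lambda>r. g r * indicator {0..b} r) = (\<lambda>r. g r * indicator {0..a} r + g r * indicator {a<..b} r)"
    using assms by (auto simp: fun_eq_iff indicator_def)
  then have *: "primitive g b = primitive g a + (\<integral>\<^sup>+r\<in>{a<..b}. g r \<partial>lborel)"
    using assms by (simp add: primitive_def, subst nn_integral_add)
      (auto intro!: primitive_measurable)
  have e: "(\<integral>\<^sup>+r\<in>{a<..b}. x \<partial>lborel) = x * ennreal (b - a)" for x :: ennreal
    using assms by (simp add: nn_integral_cmult_indicator)
  have "g a * ennreal (b - a) \<le> (\<integral>\<^sup>+r\<in>{a<..b}. g r \<partial>lborel)"
    unfolding e[symmetric] using assms
    by (intro nn_integral_mono) (auto simp: indicator_def mono_on_def)
  then show "primitive g a + g a * ennreal (b - a) \<le> primitive g b"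
    unfolding * by (rule add_left_mono)
  have "(\<integral>\<^sup>+r\<in>{a<..b}. g r \<partial>lborel) \<le> g b * ennreal (b - a)"
    unfolding e[symmetric] using assms
    by (intro nn_integral_mono) (auto simp: indicator_def mono_on_def)
  then show "primitive g b \<le> primitive g a + g b * ennreal (b - a)"
    unfolding * by (rule add_left_mono)
qed

lemma primitive_convex:
  assumes g: "mono_on {0..} g" and u: "0 < u" "u < 1"
  shows "primitive g ((1 - u) * x + u * y)
           \<le> ennreal (1 - u) * primitive g x + ennreal u * primitive g y"
proof -
  have main: "primitive g ((1 - u) * x + u * y)
           \<le> ennreal (1 - u) * primitive g x + ennreal u * primitive g y"
    if xy: "0 \<le> x" "x \<le> y" and u: "0 < u" "u < 1" for x y u :: real
  proof -
    define z where "z = (1 - u) * x + u * y"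
    have z: "z - x = u * (y - x)" "y - z = (1 - u) * (y - x)"
      by (auto simp: z_def algebra_simps)
    then have xz: "x \<le> z" "z \<le> y"
      using xy u by (metis diff_ge_0_iff_ge mult_nonneg_nonneg less_imp_le)+
    let ?P = "primitive g"
    have 1: "?P z \<le> ?P x + g z * ennreal (z - x)"
      using primitive_bounds(2)[OF g xy(1) xz(1)] .
    have 2: "?P z + g z * ennreal (y - z) \<le> ?P y"
      using primitive_bounds(1)[OF g _ xz(2)] xy xz by auto
    have "?P z = ennreal (1 - u) * ?P z + ennreal u * ?P z"
      using u by (simp add: distrib_right[symmetric] ennreal_plus[symmetric] del: ennreal_plus)
    also have "\<dots> \<le> ennreal (1 - u) * (?P x + g z * ennreal (z - x)) + ennreal u * ?P z"
      using 1 by (intro add_right_mono mult_left_mono) auto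
    also have "\<dots> = ennreal (1 - u) * ?P x + ennreal u * (?P z + g z * ennreal (y - z))"
    proof -
      have "ennreal (1 - u) * (g z * ennreal (z - x)) = ennreal u * (g z * ennreal (y - z))"
        using u xy unfolding z by (simp add: ennreal_mult mult_ac)
      then show ?thesis by (simp add: distrib_left add_ac)
    qed
    also have "\<dots> \<le> ennreal (1 - u) * ?P x + ennreal u * ?P y"
      using 2 by (intro add_left_mono mult_left_mono) auto
    finally show ?thesis unfolding z_def .
  qed
  consider "x < 0" | "y < 0" | "0 \<le> x" "x \<le> y" | "0 \<le> y" "y \<le> x" by linarith
  then show ?thesis
  proof cases
    case 1
    then show ?thesis using u by (simp add: primitive_def ennreal_mult_top)
  next
    case 2
    then show ?thesis using u by (simp add: primitive_def ennreal_mult_top)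
  next
    case 3
    then show ?thesis using main u by blast
  next
    case 4
    then show ?thesis using main[of y x "1 - u"] u by (simp add: add.commute)
  qed
qed

lemma primitive_deriv:
  assumes g: "mono_on {0..} g" and s: "0 < s" and fin: "g s < \<infinity>" and cont: "isCont g s"
  shows "((\<lambda>r. enn2real (primitive g r)) has_real_derivative enn2real (g s)) (at s)"
proof -
  let ?P = "\<lambda>r. enn2real (primitive g r)" and ?g = "\<lambda>r. enn2real (g r)"
  have ev: "\<forall>\<^sub>F r in at s. g r < \<infinity>"
    using cont fin unfolding isCont_def by (rule order_tendstoD(2))
  then obtain e where e: "e > 0" "\<And>r. r \<noteq> s \<Longrightarrow> dist r s < e \<Longrightarrow> g r < \<infinity>"
    unfolding eventually_at by auto
  define b where "b = s + e / 2"
  have b: "s < b" "g b < \<infinity>" using e by (auto simp: b_def dist_real_def)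
  have gfin: "g r < \<infinity>" if "0 \<le> r" "r \<le> b" for r
    using g that b(2) le_less_trans[of "g r" "g b"] by (auto simp: mono_on_def)
  have Pfin: "primitive g r < \<infinity>" if "0 \<le> r" "r \<le> b" for r
  proof -
    have "primitive g r \<le> primitive g 0 + g r * ennreal (r - 0)"
      using primitive_bounds(2)[OF g order_refl that(1)] .
    also have "\<dots> < \<infinity>"
      using gfin[OF that] by (simp add: primitive_0 ennreal_mult_less_top)
    finally show ?thesis .
  qed
  have bd: "?g x * (y - x) \<le> ?P y - ?P x" "?P y - ?P x \<le> ?g y * (y - x)"
    if xy: "0 \<le> x" "x \<le> y" "y \<le> b" for x y
  proof -
    have f: "ennreal (?P x) = primitive g x" "ennreal (?P y) = primitive g y"
      "ennreal (?g x) = g x" "ennreal (?g y) = g y"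
      using xy Pfin[of x] Pfin[of y] gfin[of x] gfin[of y] by (auto simp: ennreal_enn2real_if)
    have "ennreal (?P x + ?g x * (y - x)) \<le> ennreal (?P y)"
      using primitive_bounds(1)[OF g xy(1,2)] xy by (simp add: f ennreal_mult)
    then show "?g x * (y - x) \<le> ?P y - ?P x" by (simp add: ennreal_le_iff)
    have "ennreal (?P y) \<le> ennreal (?P x + ?g y * (y - x))"
      using primitive_bounds(2)[OF g xy(1,2)] xy by (simp add: f ennreal_mult)
    then show "?P y - ?P x \<le> ?g y * (y - x)" using xy by (simp add: ennreal_le_iff del: ennreal_plus)
  qed
  have lim: "((\<lambda>r. ?g r) \<longlongrightarrow> ?g s) (at s)"
    using cont fin unfolding isCont_def by (intro tendsto_enn2real) (auto simp: ennreal_enn2real_if)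
  have near: "\<forall>\<^sub>F r in at s. r \<noteq> s \<and> 0 \<le> r \<and> r \<le> b"
    unfolding eventually_at using s b(1)
    by (intro exI[of _ "min s (b - s)"]) (auto simp: dist_real_def)
  have q: "min (?g s) (?g r) \<le> (?P r - ?P s) / (r - s) \<and> (?P r - ?P s) / (r - s) \<le> max (?g s) (?g r)"
    if r: "r \<noteq> s" "0 \<le> r" "r \<le> b" for r
  proof (cases "s < r")
    case True
    then have "?g s \<le> (?P r - ?P s) / (r - s)" "(?P r - ?P s) / (r - s) \<le> ?g r"
      using bd[of s r] r s by (simp_all add: pos_le_divide_eq pos_divide_le_eq)
    then show ?thesis by linarith
  next
    case False
    then have "r < s" using r by simp
    moreover have "(?P r - ?P s) / (r - s) = (?P s - ?P r) / (s - r)"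
      by (metis minus_diff_eq minus_divide_divide)
    ultimately have "?g r \<le> (?P r - ?P s) / (r - s)" "(?P r - ?P s) / (r - s) \<le> ?g s"
      using bd[of r s] r s b(1) by (simp_all add: pos_le_divide_eq pos_divide_le_eq)
    then show ?thesis by linarith
  qed
  have "((\<lambda>r. (?P r - ?P s) / (r - s)) \<longlongrightarrow> ?g s) (at s)"
  proof (rule tendsto_sandwich)
    show "\<forall>\<^sub>F r in at s. min (?g s) (?g r) \<le> (?P r - ?P s) / (r - s)"
      "\<forall>\<^sub>F r in at s. (?P r - ?P s) / (r - s) \<le> max (?g s) (?g r)"
      using near q by (auto elim!: eventually_mono)
    show "((\<lambda>r. min (?g s) (?g r)) \<longlongrightarrow> ?g s) (at s)"
      using tendsto_min[OF tendsto_const lim, of "?g s"] by simp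
    show "((\<lambda>r. max (?g s) (?g r)) \<longlongrightarrow> ?g s) (at s)"
      using tendsto_max[OF tendsto_const lim, of "?g s"] by simp
  qed
  then show ?thesis by (simp add: has_field_derivative_iff)
qed

subsection \<open>Admissible pairs\<close>

text \<open>
  \<open>\<phi>\<close> is a \<open>C\<^sup>1\<close> function on \<open>[0,T) \<times> \<T>\<^sup>d\<close> with compact support in \<open>[0,T) \<times> \<T>\<^sup>d\<close> (so it need not
  vanish at \<open>t = 0\<close>), with time derivative \<open>\<phi>t\<close> and spatial gradient \<open>\<phi>x\<close>.
\<close>

definition C1c_test ::
  "real \<Rightarrow> (real \<times> (real ^ 'n) \<Rightarrow> real) \<Rightarrow> (real \<times> (real ^ 'n) \<Rightarrow> real)
     \<Rightarrow> (real \<times> (real ^ 'n) \<Rightarrow> real ^ 'n) \<Rightarrow> bool" where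
  "C1c_test T \<phi> \<phi>t \<phi>x \<longleftrightarrow>
     (\<forall>t\<in>{0..<T}. periodic (\<lambda>x. \<phi> (t, x))) \<and>
     (\<forall>z\<in>{0..<T} \<times> UNIV.
        (\<phi> has_derivative (\<lambda>(\<tau>, h). \<phi>t z * \<tau> + \<phi>x z \<bullet> h)) (at z within {0..<T} \<times> UNIV)) \<and>
     continuous_on ({0..<T} \<times> UNIV) \<phi>t \<and> continuous_on ({0..<T} \<times> UNIV) \<phi>x \<and>
     (\<exists>T'<T. \<forall>t\<in>{T'..<T} \<inter> {0..}. \<forall>x. \<phi> (t, x) = 0)"

definition admissible ::
  "real \<Rightarrow> (real ^ 'n \<Rightarrow> real) \<Rightarrow>
     ((real \<times> (real ^ 'n) \<Rightarrow> real) \<times> (real \<times> (real ^ 'n) \<Rightarrow> real ^ 'n)) set" where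
  "admissible T m0 = {(m, v).
     (\<forall>t\<in>{0<..<T}. periodic (\<lambda>x. m (t, x)) \<and> periodic (\<lambda>x. v (t, x))) \<and>
     set_integrable lebesgue ({0<..<T} \<times> unit_cell) m \<and>
     (AE z in lebesgue. z \<in> {0<..<T} \<times> unit_cell \<longrightarrow> 0 \<le> m z) \<and>
     (AE t in lebesgue. t \<in> {0<..<T} \<longrightarrow> (LINT x:unit_cell|lebesgue. m (t, x)) = 1) \<and>
     set_borel_measurable lebesgue ({0<..<T} \<times> unit_cell) v \<and>
     set_integrable lebesgue ({0<..<T} \<times> unit_cell) (\<lambda>z. m z *\<^sub>R v z) \<and>
     (\<forall>\<phi> \<phi>t \<phi>x. C1c_test T \<phi> \<phi>t \<phi>x \<longrightarrow>
        (LINT z:{0<..<T} \<times> unit_cell|lebesgue. m z * \<phi>t z + (m z *\<^sub>R v z) \<bullet> \<phi>x z)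
        + (LINT x:unit_cell|lebesgue. \<phi> (0, x) * m0 x) = 0)}"


subsection \<open>The functional and its minimisers\<close>

text \<open>
  \<open>\<mu>\<close> is a \<open>W\<^sub>2\<close>-continuous curve on \<open>[0,T]\<close> with \<open>\<mu> t = m(t,\<cdot>) dx\<close> for almost every \<open>t\<close>. Such a
  curve is unique, and exists for admissible pairs of finite kinetic energy.
\<close>

definition continuous_curve ::
  "real \<Rightarrow> (real \<times> (real ^ 'n) \<Rightarrow> real) \<Rightarrow> (real \<Rightarrow> (real ^ 'n) measure) \<Rightarrow> bool" where
  "continuous_curve T m \<mu> \<longleftrightarrow>
     (\<forall>t\<in>{0..T}. torus_prob (\<mu> t)) \<and>
     (\<forall>t\<in>{0..T}. ((\<lambda>s. W2 (\<mu> s) (\<mu> t)) \<longlongrightarrow> 0) (at t within {0..T})) \<and>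
     (AE t in lebesgue. t \<in> {0<..<T} \<longrightarrow>
        (\<forall>A\<in>sets borel. emeasure (\<mu> t) A = (\<integral>\<^sup>+x\<in>A \<inter> unit_cell. ennreal (m (t, x)) \<partial>lebesgue)))"

definition final_measure :: "real \<Rightarrow> (real \<times> (real ^ 'n) \<Rightarrow> real) \<Rightarrow> (real ^ 'n) measure" where
  "final_measure T m = (THE \<nu>. \<exists>\<mu>. continuous_curve T m \<mu> \<and> \<nu> = \<mu> T)"

definition functional_B ::
  "real \<Rightarrow> (real \<Rightarrow> ennreal) \<Rightarrow> (real ^ 'n \<Rightarrow> real) \<Rightarrow>
     (real \<times> (real ^ 'n) \<Rightarrow> real) \<times> (real \<times> (real ^ 'n) \<Rightarrow> real ^ 'n) \<Rightarrow> ereal" where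
  "functional_B T G \<Psi> = (\<lambda>(m, v).
     if (\<integral>\<^sup>+z\<in>{0<..<T} \<times> unit_cell. ennreal (m z * (norm (v z))\<^sup>2) \<partial>lebesgue) < \<infinity>
     then enn2ereal (\<integral>\<^sup>+z\<in>{0<..<T} \<times> unit_cell.
              (ennreal (1 / 2 * m z * (norm (v z))\<^sup>2) + G (m z)) \<partial>lebesgue)
          + ereal (LINT x|final_measure T m. \<Psi> x)
     else \<infinity>)"

text \<open>
  A minimum is understood to be finite: if the functional is identically \<open>+\<infinity>\<close> (for instance when
  \<open>G = +\<infinity>\<close> on \<open>(1/2, \<infinity>)\<close>, as the torus has volume 1), the problem has no solution.
\<close>

definition is_solution ::
  "real \<Rightarrow> (real \<Rightarrow> ennreal) \<Rightarrow> (real ^ 'n \<Rightarrow> real) \<Rightarrow> (real ^ 'n \<Rightarrow> real) \<Rightarrow>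
     (real \<times> (real ^ 'n) \<Rightarrow> real) \<Rightarrow> (real \<times> (real ^ 'n) \<Rightarrow> real ^ 'n) \<Rightarrow> bool" where
  "is_solution T G \<Psi> m0 m v \<longleftrightarrow> (m, v) \<in> admissible T m0 \<and>
     functional_B T G \<Psi> (m, v) = (INF p\<in>admissible T m0. functional_B T G \<Psi> p) \<and>
     functional_B T G \<Psi> (m, v) < \<infinity>"


subsection \<open>Function spaces of the conclusion\<close>

definition in_L2 :: "'a::euclidean_space set \<Rightarrow> ('a \<Rightarrow> 'b::euclidean_space) \<Rightarrow> bool" where
  "in_L2 S f \<longleftrightarrow> set_borel_measurable lebesgue S f \<and>
     set_integrable lebesgue S (\<lambda>z. (norm (f z))\<^sup>2)"

definition L2_norm :: "'a::euclidean_space set \<Rightarrow> ('a \<Rightarrow> 'b::euclidean_space) \<Rightarrow> real" where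
  "L2_norm S f = sqrt (LINT z:S|lebesgue. (norm (f z))\<^sup>2)"

text \<open>\<open>u \<in> H\<^sup>1(\<T>\<^sup>d)\<close> with weak gradient \<open>w\<close>.\<close>

definition H1_torus :: "(real ^ 'n \<Rightarrow> real) \<Rightarrow> (real ^ 'n \<Rightarrow> real ^ 'n) \<Rightarrow> bool" where
  "H1_torus u w \<longleftrightarrow> periodic u \<and> periodic w \<and> in_L2 unit_cell u \<and> in_L2 unit_cell w \<and>
     (\<forall>\<phi> D\<phi>. periodic \<phi> \<and> (\<forall>x. GDERIV \<phi> x :> D\<phi> x) \<and> continuous_on UNIV D\<phi> \<longrightarrow>
        (LINT x:unit_cell|lebesgue. u x *\<^sub>R D\<phi> x) = - (LINT x:unit_cell|lebesgue. \<phi> x *\<^sub>R w x))"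

definition in_L2_H1 :: "real \<Rightarrow> real \<Rightarrow> (real \<times> (real ^ 'n) \<Rightarrow> real) \<Rightarrow> bool" where
  "in_L2_H1 a b u \<longleftrightarrow> (\<exists>w. in_L2 ({a..b} \<times> unit_cell) u \<and> in_L2 ({a..b} \<times> unit_cell) w \<and>
     (AE t in lebesgue. t \<in> {a..b} \<longrightarrow> H1_torus (\<lambda>x. u (t, x)) (\<lambda>x. w (t, x))))"

text \<open>\<open>L\<^sup>2\<^sub>l\<^sub>o\<^sub>c((0,T]; H\<^sup>1(\<T>\<^sup>d))\<close>: the compact subsets of \<open>(0,T]\<close> are those of the intervals \<open>[a,T]\<close>.\<close>

definition in_L2loc_H1 :: "real \<Rightarrow> (real \<times> (real ^ 'n) \<Rightarrow> real) \<Rightarrow> bool" where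
  "in_L2loc_H1 T u \<longleftrightarrow> (\<forall>a>0. in_L2_H1 a T u)"

end

theory Submission
  imports Defs
begin

text \<open>
  The condition on \<open>G\<close> is a quantified uniform convexity: used at \<open>s\<^sub>0\<close> and \<open>s\<^sub>1\<close> with the slope
  \<open>q = g((s\<^sub>0 + s\<^sub>1)/2)\<close>, it improves the midpoint inequality for \<open>G\<close> by \<open>c/4 |J(s\<^sub>0) - J(s\<^sub>1)|\<^sup>2\<close>.
  Let \<open>\<eta>\<close> be a \<open>C\<^sup>1\<close> cutoff with \<open>\<eta>(0) = 0\<close> and \<open>\<eta> = 1\<close> on \<open>[t\<^sub>1,T]\<close>. Translating a solution by
  \<open>\<plusminus>\<eta>(t)\<delta>\<close> keeps it admissible with velocity changed by \<open>\<minusplus>\<eta>'(t)\<delta>\<close>; the average of the two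
  translates (in the variables \<open>m\<close> and \<open>mv\<close>) is the competitor. By symmetry the first order terms in
  \<open>\<delta>\<close> cancel, so the kinetic energy and the final cost grow by \<open>O(|\<delta>|\<^sup>2)\<close>, the congestion term does
  not grow, and minimality bounds the gain, which is the squared \<open>L\<^sup>2\<close> norm of the difference
  \<open>J(m(\<cdot> + \<delta>)) - J(m(\<cdot> - \<delta>))\<close>. No duality is needed. The \<open>H\<^sup>1\<close> statement follows as the difference
  quotients are bounded in \<open>L\<^sup>2\<close>.
\<close>

subsection \<open>The torus\<close>

text \<open>Two obstacles shape the proof. The final cost is evaluated at
  \<open>final_measure\<close>, a definite description, so the competitor must have a W_2-continuous
  curve, and only one: existence rests on compactness of the probability measures on the torus,
  uniqueness on a countable family of C^1 test functions. And \<open>J\<close> is an arbitrary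
  function: the midpoint gain that drives the estimate also yields continuity of \<open>J\<close>
  where \<open>G\<close> is finite, hence measurability of J(m). The constant: |\<eta>'| is at most
  2/t1 and the mass over space-time is T, so the kinetic energy grows by at most (T/2)(2/t1)^2
  |\<delta>|^2; the final cost grows by at most L |\<delta>|^2, with L the Lipschitz constant of the
  gradient of \<Psi>. Dividing by the gain factor c/4 and replacing \<delta> by \<delta>/2 gives C^2
  = ((T/2)(2/t1)^2 + L)/c. For H^1, a weak limit of the difference quotients would leave a null set
  of times depending on the test function; strongly convergent midpoint combinations give one null
  set for all of them.\<close>

definition tfrac :: "real ^ 'n \<Rightarrow> real ^ 'n" where
  "tfrac x = (\<chi> i. frac (x $ i))"

lemma tfrac_nth [simp]: "tfrac x $ i = frac (x $ i)"
  by (simp add: tfrac_def)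

lemma tfrac_in_cell [simp]: "tfrac x \<in> unit_cell"
  by (simp add: unit_cell_def frac_ge_0 frac_lt_1)

lemma tfrac_id: "x \<in> unit_cell \<Longrightarrow> tfrac x = x"
  by (simp add: unit_cell_def vec_eq_iff frac_eq)

lemma diff_tfrac_lattice [simp]: "x - tfrac x \<in> int_lattice"
  by (simp add: int_lattice_def frac_def)

lemma int_lattice_0 [simp]: "0 \<in> int_lattice"
  by (simp add: int_lattice_def)

lemma int_lattice_uminus [simp]: "- k \<in> int_lattice \<longleftrightarrow> k \<in> int_lattice"
  by (simp add: int_lattice_def)

lemma int_lattice_diff: "k \<in> int_lattice \<Longrightarrow> l \<in> int_lattice \<Longrightarrow> k - l \<in> int_lattice"
  by (simp add: int_lattice_def)

lemma tfrac_add_lattice: "k \<in> int_lattice \<Longrightarrow> tfrac (x + k) = tfrac x"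
proof -
  assume "k \<in> int_lattice"
  then have "frac (x $ i + k $ i) = frac (x $ i)" for i
    by (simp add: int_lattice_def frac_add_int_right)
  then show ?thesis by (simp add: vec_eq_iff)
qed

text \<open>Exactly one lattice vector brings a point into the cell: the lattice translates of the
  cell tile space. Sums of cell indicators over the lattice are therefore 1.\<close>

lemma tfrac_eq_iff: "x - k \<in> unit_cell \<and> k \<in> int_lattice \<longleftrightarrow> k = x - tfrac x"
proof
  assume "x - k \<in> unit_cell \<and> k \<in> int_lattice"
  then have "tfrac (x + - k) = x - k" "tfrac (x + - k) = tfrac x"
    using tfrac_id[of "x - k"] by (simp, intro tfrac_add_lattice, simp)
  then show "k = x - tfrac x" by (simp add: algebra_simps)
next
  assume "k = x - tfrac x"
  then show "x - k \<in> unit_cell \<and> k \<in> int_lattice" by simp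
qed

lemma periodic_tfrac: "periodic f \<Longrightarrow> f (tfrac x) = f x"
proof -
  assume "periodic f"
  then have "f (tfrac x + (x - tfrac x)) = f (tfrac x)"
    unfolding periodic_def using diff_tfrac_lattice by blast
  then show ?thesis by simp
qed

lemma periodic_shift: "periodic f \<Longrightarrow> periodic (\<lambda>x. f (x + a))"
proof -
  assume *: "periodic f"
  have "f ((x + k) + a) = f (x + a)" if "k \<in> int_lattice" for x k
  proof -
    have "x + k + a = (x + a) + k" by simp
    then show ?thesis using * that unfolding periodic_def by metis
  qed
  then show ?thesis unfolding periodic_def by blast
qed

lemma periodicD: "periodic f \<Longrightarrow> k \<in> int_lattice \<Longrightarrow> f (x + k) = f x"
  by (simp add: periodic_def)

lemma measurable_tfrac [measurable]: "tfrac \<in> borel_measurable borel"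
proof (subst borel_measurable_euclidean_space, intro ballI)
  fix b :: "real^'n" assume "b \<in> Basis"
  then obtain i where "b = axis i 1" by (auto simp: Basis_vec_def)
  then have "(\<lambda>x. tfrac x \<bullet> b) = (\<lambda>x. frac (x $ i))"
    by (simp add: inner_axis)
  then show "(\<lambda>x. tfrac x \<bullet> b) \<in> borel_measurable borel"
    unfolding frac_def by simp
qed

lemma unit_cell_borel [measurable]: "(unit_cell :: (real^'n) set) \<in> sets borel"
proof -
  have "unit_cell = {x::real^'n. x = tfrac x}"
    by (metis (mono_tags, lifting) Collect_cong Collect_mem_eq tfrac_id tfrac_in_cell)
  moreover have "{x::real^'n. x = tfrac x} \<in> sets borel"
    by measurable
  ultimately show ?thesis by simp
qed

lemma countable_int_lattice: "countable (int_lattice :: (real^'n) set)"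
proof -
  have "int_lattice \<subseteq> (\<lambda>f. \<chi> i. real_of_int (f i)) ` (UNIV :: ('n \<Rightarrow> int) set)"
  proof
    fix x :: "real^'n" assume "x \<in> int_lattice"
    then have "x = (\<chi> i. real_of_int \<lfloor>x $ i\<rfloor>)"
      by (simp add: int_lattice_def vec_eq_iff)
    then show "x \<in> (\<lambda>f. \<chi> i. real_of_int (f i)) ` (UNIV :: ('n \<Rightarrow> int) set)"
      by (rule image_eqI[where x="\<lambda>i. \<lfloor>x $ i\<rfloor>"]) simp
  qed
  moreover have "countable (UNIV :: ('n \<Rightarrow> int) set)"
    using countable_PiE[of "UNIV :: 'n set" "\<lambda>_. UNIV :: int set"] by (simp add: PiE_UNIV_domain)
  ultimately show ?thesis using countable_subset by blast
qed

lemma unit_cell_subset: "unit_cell \<subseteq> cbox (0 :: real^'n) 1"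
  by (auto simp: unit_cell_def mem_box_cart less_imp_le)

lemma emeasure_unit_cell_finite: "emeasure lborel (unit_cell :: (real^'n) set) < \<infinity>"
proof -
  have "emeasure lborel (unit_cell :: (real^'n) set) \<le> emeasure lborel (cbox (0 :: real^'n) 1)"
    by (intro emeasure_mono unit_cell_subset) simp
  then show ?thesis by (simp add: emeasure_lborel_cbox_eq order_le_less_trans)
qed

text \<open>Closedness makes the infimum in \<open>torus_dist\<close> a minimum, attained at some
  lattice vector.\<close>

lemma closed_int_lattice: "closed (int_lattice :: (real^'n) set)"
proof -
  have "int_lattice = (\<Inter>i. {x::real^'n. x $ i \<in> \<int>})"
    by (auto simp: int_lattice_def)
  moreover have "closed {x::real^'n. x $ i \<in> \<int>}" for i
    using continuous_closed_vimage[OF closed_Ints, of "\<lambda>x::real^'n. x $ i"]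
    by (simp add: vimage_def)
  ultimately show ?thesis by (metis closed_INT)
qed

section \<open>Translation invariance of integrals over the unit cell\<close>

lemma nn_integral_cell_tile:
  fixes f :: "real^'n \<Rightarrow> ennreal"
  assumes [measurable]: "f \<in> borel_measurable borel"
  shows "(\<integral>\<^sup>+x. f x \<partial>lborel) = (\<integral>\<^sup>+k. (\<integral>\<^sup>+x\<in>unit_cell. f (x + k) \<partial>lborel) \<partial>count_space int_lattice)"
proof -
  \<comment> \<open>The indicators of the lattice translates of the cell form a partition of unity;
    inserting it and exchanging the integral with the countable lattice sum splits the integral into
    cell integrals.\<close>
  have one: "(\<integral>\<^sup>+k. indicator unit_cell (x - k) \<partial>count_space int_lattice) = (1::ennreal)" for x :: "real^'n"
  proof -
    have "(\<integral>\<^sup>+k. indicator unit_cell (x - k) \<partial>count_space int_lattice)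
        = (\<integral>\<^sup>+k. indicator {x - tfrac x} k \<partial>count_space int_lattice)"
      using tfrac_eq_iff[of x] by (intro nn_integral_cong) (auto simp: indicator_def)
    also have "\<dots> = 1" by (subst nn_integral_indicator) auto
    finally show ?thesis .
  qed
  have "(\<integral>\<^sup>+x. f x \<partial>lborel) = (\<integral>\<^sup>+x. f x * (\<integral>\<^sup>+k. indicator unit_cell (x - k) \<partial>count_space int_lattice) \<partial>lborel)"
    by (simp add: one)
  also have "\<dots> = (\<integral>\<^sup>+x. \<integral>\<^sup>+k. f x * indicator unit_cell (x - k) \<partial>count_space int_lattice \<partial>lborel)"
    by (simp add: nn_integral_cmult)
  also have "\<dots> = (\<integral>\<^sup>+k. \<integral>\<^sup>+x. f x * indicator unit_cell (x - k) \<partial>lborel \<partial>count_space int_lattice)"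
    by (intro nn_integral_count_space_nn_integral countable_int_lattice) measurable
  also have "\<dots> = (\<integral>\<^sup>+k. (\<integral>\<^sup>+x\<in>unit_cell. f (x + k) \<partial>lborel) \<partial>count_space int_lattice)"
  proof (rule nn_integral_cong)
    fix k :: "real^'n"
    have "(\<integral>\<^sup>+x. f x * indicator unit_cell (x - k) \<partial>lborel)
       = (\<integral>\<^sup>+x. f x * indicator unit_cell (x - k) \<partial>distr lborel borel ((+) k))"
      by (simp add: lborel_distr_plus)
    also have "\<dots> = (\<integral>\<^sup>+x\<in>unit_cell. f (x + k) \<partial>lborel)"
      by (subst nn_integral_distr) (simp_all add: add.commute)
    finally show "(\<integral>\<^sup>+x. f x * indicator unit_cell (x - k) \<partial>lborel) = (\<integral>\<^sup>+x\<in>unit_cell. f (x + k) \<partial>lborel)" .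
  qed
  finally show ?thesis .
qed

text \<open>Translating the cell cuts it along lattice cells. Periodicity moves every piece back
  into the original cell, where the pieces tile it again, so their integrals add up to the unshifted
  one.\<close>

lemma nn_integral_cell_shift:
  fixes f :: "real^'n \<Rightarrow> ennreal"
  assumes [measurable]: "f \<in> borel_measurable borel" and per: "periodic f"
  shows "(\<integral>\<^sup>+x\<in>unit_cell. f (x + a) \<partial>lborel) = (\<integral>\<^sup>+x\<in>unit_cell. f x \<partial>lborel)"
proof -
  have "(\<integral>\<^sup>+x\<in>unit_cell. f (x + a) \<partial>lborel)
      = (\<integral>\<^sup>+x. f (x + a) * indicator unit_cell x \<partial>distr lborel borel ((+) (- a)))"
    by (simp add: lborel_distr_plus)
  also have "\<dots> = (\<integral>\<^sup>+x. f x * indicator unit_cell (x - a) \<partial>lborel)"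
    by (subst nn_integral_distr) (simp_all add: add.commute)
  also have "\<dots> = (\<integral>\<^sup>+k. (\<integral>\<^sup>+x\<in>unit_cell. (f (x + k) * indicator unit_cell (x + k - a)) \<partial>lborel) \<partial>count_space int_lattice)"
    by (rule nn_integral_cell_tile) measurable
  also have "\<dots> = (\<integral>\<^sup>+k. \<integral>\<^sup>+x. f x * indicator unit_cell x * indicator unit_cell (x - a + k) \<partial>lborel \<partial>count_space int_lattice)"
    by (intro nn_integral_cong) (auto simp: periodicD[OF per] indicator_def diff_add_eq)
  also have "\<dots> = (\<integral>\<^sup>+x. \<integral>\<^sup>+k. f x * indicator unit_cell x * indicator unit_cell (x - a + k) \<partial>count_space int_lattice \<partial>lborel)"
    by (intro nn_integral_count_space_nn_integral[symmetric] countable_int_lattice) measurable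
  also have "\<dots> = (\<integral>\<^sup>+x\<in>unit_cell. f x \<partial>lborel)"
  proof (rule nn_integral_cong)
    fix x :: "real^'n"
    have "(\<integral>\<^sup>+k. indicator unit_cell (x - a + k) \<partial>count_space int_lattice)
        = (\<integral>\<^sup>+k. indicator {tfrac (x - a) - (x - a)} k \<partial>count_space int_lattice)"
    proof (intro nn_integral_cong)
      fix k :: "real^'n" assume "k \<in> space (count_space int_lattice)"
      then have "x - a + k \<in> unit_cell \<longleftrightarrow> k = tfrac (x - a) - (x - a)"
        using tfrac_eq_iff[of "x - a" "- k"] by (auto simp: algebra_simps)
      then show "indicator unit_cell (x - a + k) = (indicator {tfrac (x - a) - (x - a)} k :: ennreal)"
        by (simp add: indicator_def)
    qed
    also have "\<dots> = 1"
    proof -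
      have "tfrac (x - a) - (x - a) \<in> int_lattice"
        using diff_tfrac_lattice[of "x - a"] int_lattice_uminus[of "x - a - tfrac (x - a)"] by simp
      then show ?thesis by (subst nn_integral_indicator) auto
    qed
    finally show "(\<integral>\<^sup>+k. f x * indicator unit_cell x * indicator unit_cell (x - a + k) \<partial>count_space int_lattice)
        = f x * indicator unit_cell x" by (simp add: nn_integral_cmult)
  qed
  finally show ?thesis .
qed

declare borel_Times [measurable]

lemma nn_integral_Times:
  fixes f :: "real \<times> (real^'n) \<Rightarrow> ennreal"
  assumes [measurable]: "f \<in> borel_measurable borel" "I \<in> sets borel" "A \<in> sets borel"
  shows "(\<integral>\<^sup>+z\<in>I \<times> A. f z \<partial>lborel) = (\<integral>\<^sup>+t\<in>I. (\<integral>\<^sup>+x\<in>A. f (t, x) \<partial>lborel) \<partial>lborel)"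
proof -
  have "(\<integral>\<^sup>+z\<in>I \<times> A. f z \<partial>lborel) = (\<integral>\<^sup>+z. f z * indicator (I \<times> A) z \<partial>(lborel \<Otimes>\<^sub>M lborel))"
    by (simp add: lborel_prod)
  also have "\<dots> = (\<integral>\<^sup>+t. \<integral>\<^sup>+x. f (t, x) * indicator (I \<times> A) (t, x) \<partial>lborel \<partial>lborel)"
    by (subst lborel.nn_integral_fst[symmetric]) (simp_all add: lborel_prod)
  also have "\<dots> = (\<integral>\<^sup>+t\<in>I. (\<integral>\<^sup>+x\<in>A. f (t, x) \<partial>lborel) \<partial>lborel)"
    by (intro nn_integral_cong) (auto simp: indicator_def intro!: nn_integral_cong)
  finally show ?thesis .
qed

text \<open>The slices are shifted independently of each other, so the shift may depend measurably
  on time; it will be \<open>\<eta> t *\<^sub>R \<delta>\<close>.\<close>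

lemma nn_integral_spacetime_shift:
  fixes f :: "real \<times> (real^'n) \<Rightarrow> ennreal"
  assumes [measurable]: "f \<in> borel_measurable borel" "I \<in> sets borel" "a \<in> borel_measurable borel"
    and per: "\<And>t. t \<in> I \<Longrightarrow> periodic (\<lambda>x. f (t, x))"
  shows "(\<integral>\<^sup>+z\<in>I \<times> unit_cell. f (fst z, snd z + a (fst z)) \<partial>lborel) = (\<integral>\<^sup>+z\<in>I \<times> unit_cell. f z \<partial>lborel)"
proof -
  have [measurable]: "(\<lambda>z. f (fst z, snd z + a (fst z))) \<in> borel_measurable borel"
    by (simp add: borel_prod[symmetric]) measurable
  show ?thesis
  proof (subst (1 2) nn_integral_Times)
    show "(\<integral>\<^sup>+t\<in>I. (\<integral>\<^sup>+x\<in>unit_cell. f (fst (t, x), snd (t, x) + a (fst (t, x))) \<partial>lborel) \<partial>lborel)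
        = (\<integral>\<^sup>+t\<in>I. (\<integral>\<^sup>+x\<in>unit_cell. f (t, x) \<partial>lborel) \<partial>lborel)"
    proof (rule nn_integral_cong)
      fix t
      show "(\<integral>\<^sup>+x\<in>unit_cell. f (fst (t, x), snd (t, x) + a (fst (t, x))) \<partial>lborel) * indicator I t
        = (\<integral>\<^sup>+x\<in>unit_cell. f (t, x) \<partial>lborel) * indicator I t"
        using nn_integral_cell_shift[of "\<lambda>x. f (t, x)" "a t"] per[of t] by (simp add: indicator_def)
    qed
  qed simp_all
qed

lemma spacetime_shift_integral:
  fixes f :: "real \<times> (real^'n) \<Rightarrow> real"
  assumes [measurable]: "f \<in> borel_measurable borel" "I \<in> sets borel" "a \<in> borel_measurable borel"
    and per: "\<And>t. t \<in> I \<Longrightarrow> periodic (\<lambda>x. f (t, x))"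
    and int: "set_integrable lborel (I \<times> unit_cell) f"
  shows "set_integrable lborel (I \<times> unit_cell) (\<lambda>z. f (fst z, snd z + a (fst z)))"
    and "(LINT z:I \<times> unit_cell|lborel. f (fst z, snd z + a (fst z))) = (LINT z:I \<times> unit_cell|lborel. f z)"
proof -
  let ?h = "\<lambda>z. f (fst z, snd z + a (fst z))"
  have [measurable]: "?h \<in> borel_measurable borel"
    by (simp add: borel_prod[symmetric]) measurable
  \<comment> \<open>Stated for compositions with an arbitrary Borel \<open>\<phi>\<close>, so that
    the absolute value gives integrability and the positive and negative parts give the
    integral.\<close>
  have *: "(\<integral>\<^sup>+z\<in>I \<times> unit_cell. \<phi> (?h z) \<partial>lborel) = (\<integral>\<^sup>+z\<in>I \<times> unit_cell. \<phi> (f z) \<partial>lborel)"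
    if [measurable]: "\<phi> \<in> borel_measurable borel" for \<phi> :: "real \<Rightarrow> ennreal"
    using nn_integral_spacetime_shift[of "\<lambda>z. \<phi> (f z)" I a] per
    by (auto simp: periodic_def)
  have e: "\<phi> (indicator A z * c) = \<phi> c * indicator A z" if "\<phi> 0 = (0::ennreal)"
    for \<phi> :: "real \<Rightarrow> ennreal" and A and z :: "real \<times> (real^'n)" and c :: real
    using that by (simp add: indicator_def)
  note e' = e[of "\<lambda>x. ennreal \<bar>x\<bar>", simplified] e[of "\<lambda>x. ennreal x", simplified] e[of "\<lambda>x. ennreal (- x)", simplified]
  show 1: "set_integrable lborel (I \<times> unit_cell) ?h"
    using int *[of "\<lambda>x. ennreal \<bar>x\<bar>"] unfolding set_integrable_def integrable_iff_bounded
    by (simp only: real_scaleR_def real_norm_def e'(1)) simp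
  show "(LINT z:I \<times> unit_cell|lborel. ?h z) = (LINT z:I \<times> unit_cell|lborel. f z)"
    using 1 int *[of "\<lambda>x. ennreal x"] *[of "\<lambda>x. ennreal (- x)"]
    unfolding set_integrable_def set_lebesgue_integral_def
    by (simp only: real_scaleR_def real_lebesgue_integral_def e') simp
qed

subsection \<open>A continuous parametrisation of the unit cell by the line\<close>

text \<open>In base 2N + 1 with digits below N the expansions have gaps. If the digits first differ
  at place m, that term contributes at least (2N + 1)^(-m), while the later ones contribute at most
  half of this. Two sums closer than half a unit at place J must therefore agree up to J.\<close>

lemma digit_expansion_separation:
  fixes a b :: "nat \<Rightarrow> nat"
  assumes N: "\<And>k. a k < N" "\<And>k. b k < N"
    and close: "\<bar>(\<Sum>k. a k / (2 * real N + 1) ^ k) - (\<Sum>k. b k / (2 * real N + 1) ^ k)\<bar> < 1 / (2 * (2 * real N + 1) ^ J)"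
  shows "\<forall>k\<le>J. a k = b k"
proof (rule ccontr)
  define B where "B = 2 * real N + 1"
  have N0: "0 < N" using N(1)[of 0] by simp
  then have B: "B \<ge> 3" by (simp add: B_def)
  assume "\<not> (\<forall>k\<le>J. a k = b k)"
  then obtain k0 where k0: "k0 \<le> J" "a k0 \<noteq> b k0" by auto
  define m where "m = (LEAST k. a k \<noteq> b k)"
  have m: "a m \<noteq> b m" "m \<le> J" "\<And>k. k < m \<Longrightarrow> a k = b k"
    unfolding m_def
    using LeastI[of "\<lambda>k. a k \<noteq> b k", OF k0(2)] order_trans[OF Least_le[of "\<lambda>k. a k \<noteq> b k", OF k0(2)] k0(1)]
      not_less_Least[of _ "\<lambda>k. a k \<noteq> b k"] by blast+
  define d where "d k = real (a k) - real (b k)" for k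
  have dN: "\<bar>d k\<bar> \<le> N" for k using N[of k] by (auto simp: d_def)
  have geo: "summable (\<lambda>k. N * (1 / B) ^ k)" using B by (intro summable_mult summable_geometric) simp
  have sa: "summable (\<lambda>k. a k / B ^ k)" "summable (\<lambda>k. b k / B ^ k)"
    using N B by (auto intro!: summable_comparison_test'[OF geo] simp: power_divide divide_simps less_imp_le)
  have sd: "summable (\<lambda>k. d k / B ^ k)"
    using summable_diff[OF sa] by (simp add: d_def diff_divide_distrib)
  have "(\<Sum>k. a k / B ^ k) - (\<Sum>k. b k / B ^ k) = (\<Sum>k. d k / B ^ k)"
    using suminf_diff[OF sa] by (simp add: d_def diff_divide_distrib)
  also have "\<dots> = (\<Sum>k. d (k + Suc m) / B ^ (k + Suc m)) + (\<Sum>k<Suc m. d k / B ^ k)"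
    by (rule suminf_split_initial_segment[OF sd])
  also have "(\<Sum>k<Suc m. d k / B ^ k) = d m / B ^ m"
    using m(3) by (simp add: d_def)
  finally have split: "(\<Sum>k. a k / B ^ k) - (\<Sum>k. b k / B ^ k) = (\<Sum>k. d (k + Suc m) / B ^ (k + Suc m)) + d m / B ^ m" .
  have tail: "\<bar>\<Sum>k. d (k + Suc m) / B ^ (k + Suc m)\<bar> \<le> 1 / (2 * B ^ m)"
  proof -
    have bd: "norm (d (k + Suc m) / B ^ (k + Suc m)) \<le> (N / B ^ Suc m) * (1 / B) ^ k" for k
    proof -
      have "\<bar>d (k + Suc m)\<bar> / B ^ (k + Suc m) \<le> N / B ^ (k + Suc m)"
        using dN[of "k + Suc m"] B by (intro divide_right_mono) auto
      then show ?thesis using B by (simp add: power_add power_divide abs_mult mult_ac)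
    qed
    have sg: "summable (\<lambda>k. (N / B ^ Suc m) * (1 / B) ^ k)" using B by (intro summable_mult summable_geometric) simp
    have sn: "summable (\<lambda>k. norm (d (k + Suc m) / B ^ (k + Suc m)))"
      by (rule summable_comparison_test'[OF sg]) (use bd in auto)
    have "norm (\<Sum>k. d (k + Suc m) / B ^ (k + Suc m)) \<le> (\<Sum>k. norm (d (k + Suc m) / B ^ (k + Suc m)))"
      by (rule summable_norm[OF sn])
    also have "\<dots> \<le> (\<Sum>k. (N / B ^ Suc m) * (1 / B) ^ k)"
      by (rule suminf_le[OF bd sn sg])
    also have "\<dots> = (N / B ^ Suc m) * (1 / (1 - 1 / B))"
      using B by (subst suminf_mult) (auto intro!: summable_geometric simp: suminf_geometric)
    \<comment> \<open>Here B - 1 = 2N, so the geometric tail is exactly half a unit at place m; this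
      is the reason for the base 2N + 1.\<close>
    also have "\<dots> = 1 / (2 * B ^ m)"
    proof -
      have "1 / (1 - 1 / B) = B / (2 * N)" using B N0 by (simp add: B_def field_simps)
      then show ?thesis using B N0 by simp
    qed
    finally show ?thesis by simp
  qed
  have "1 / B ^ m \<le> \<bar>d m / B ^ m\<bar>"
  proof -
    have "1 \<le> \<bar>d m\<bar>" using m(1) by (auto simp: d_def)
    then show ?thesis using B by (simp add: divide_right_mono)
  qed
  moreover have "1 / B ^ m = 1 / (2 * B ^ m) + 1 / (2 * B ^ m)" by simp
  ultimately have "1 / (2 * B ^ m) \<le> \<bar>(\<Sum>k. a k / B ^ k) - (\<Sum>k. b k / B ^ k)\<bar>"
    unfolding split using tail by linarith
  moreover have "1 / (2 * B ^ J) \<le> 1 / (2 * B ^ m)"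
    using B m(2) by (simp add: divide_simps power_increasing)
  ultimately show False using close unfolding B_def[symmetric] by linarith
qed

text \<open>One letter, a set of coordinates, records the binary digit of all coordinates at the
  same place. A point of the cell becomes a single word over a finite alphabet, which is how several
  dimensions are encoded by one real number.\<close>

definition binary_digit :: "nat \<Rightarrow> real ^ 'n \<Rightarrow> 'n set" where
  "binary_digit j x = {i. odd \<lfloor>2 ^ Suc j * x $ i\<rfloor>}"

lemma vimage_binary_digit:
  "binary_digit j -` {S} = {x :: real^'n. \<forall>i\<in>UNIV. i \<in> S \<longleftrightarrow> odd \<lfloor>2 ^ Suc j * x $ i\<rfloor>}"
  unfolding vimage_def binary_digit_def by (rule Collect_cong) blast

lemma measurable_binary_digit: "(binary_digit j :: real^'n \<Rightarrow> _) \<in> borel \<rightarrow>\<^sub>M count_space UNIV"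
proof (rule iffD2[OF measurable_count_space_eq2[OF finite]], intro conjI ballI)
  fix S :: "'n set"
  have "{x :: real^'n. \<forall>i\<in>UNIV. i \<in> S \<longleftrightarrow> odd \<lfloor>2 ^ Suc j * x $ i\<rfloor>} \<in> sets borel"
    by measurable
  then show "binary_digit j -` {S} \<inter> space borel \<in> sets borel"
    by (simp only: vimage_binary_digit space_borel Int_UNIV_right)
qed simp

text \<open>The digits before J determine the integer part of 2^J times each coordinate, since
  doubling adds the next digit to twice the integer part; equal integer parts leave a gap of at most
  1.\<close>

lemma binary_digit_close:
  assumes "x \<in> unit_cell" "y \<in> unit_cell" "\<And>j. j < J \<Longrightarrow> binary_digit j x = binary_digit j y"
  shows "\<bar>x $ i - y $ i\<bar> \<le> 1 / 2 ^ J"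
proof -
  have "\<lfloor>2 ^ J * x $ i\<rfloor> = \<lfloor>2 ^ J * y $ i\<rfloor>"
    using assms(3)
  proof (induction J)
    case 0
    have "\<lfloor>x $ i\<rfloor> = 0" "\<lfloor>y $ i\<rfloor> = 0"
      using assms(1,2) by (auto simp: unit_cell_def floor_eq_iff)
    then show ?case by simp
  next
    case (Suc J)
    have half: "\<lfloor>2 ^ Suc J * z\<rfloor> = 2 * \<lfloor>2 ^ J * z\<rfloor> + (if odd \<lfloor>2 ^ Suc J * z\<rfloor> then 1 else 0)" for z :: real
    proof -
      have "\<lfloor>2 ^ Suc J * z\<rfloor> = 2 * \<lfloor>2 ^ J * z\<rfloor> \<or> \<lfloor>2 ^ Suc J * z\<rfloor> = 2 * \<lfloor>2 ^ J * z\<rfloor> + 1"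
      proof -
        have "\<lfloor>2 * y\<rfloor> = 2 * \<lfloor>y\<rfloor> \<or> \<lfloor>2 * y\<rfloor> = 2 * \<lfloor>y\<rfloor> + 1" for y :: real by linarith
        from this[of "2 ^ J * z"] show ?thesis by (simp add: mult.assoc)
      qed
      then show ?thesis by auto
    qed
    have "odd \<lfloor>2 ^ Suc J * x $ i\<rfloor> \<longleftrightarrow> odd \<lfloor>2 ^ Suc J * y $ i\<rfloor>"
      using Suc.prems[of J] by (auto simp: binary_digit_def set_eq_iff simp del: power_Suc)
    moreover have "\<lfloor>2 ^ J * x $ i\<rfloor> = \<lfloor>2 ^ J * y $ i\<rfloor>" using Suc by simp
    ultimately have "2 * \<lfloor>2 ^ J * x $ i\<rfloor> + (if odd \<lfloor>2 ^ Suc J * x $ i\<rfloor> then 1 else 0)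
        = 2 * \<lfloor>2 ^ J * y $ i\<rfloor> + (if odd \<lfloor>2 ^ Suc J * y $ i\<rfloor> then 1 else 0)" by (simp only:)
    then show ?case by (simp only: half[symmetric])
  qed
  then have "\<bar>2 ^ J * x $ i - 2 ^ J * y $ i\<bar> \<le> 1" by linarith
  then have "2 ^ J * \<bar>x $ i - y $ i\<bar> \<le> 1"
    by (simp add: right_diff_distrib[symmetric] abs_mult)
  then show ?thesis by (simp add: pos_le_divide_eq mult.commute)
qed

text \<open>\<open>\<iota>\<close> reads the word of binary digits in the sparse base 2N + 1. Its
  values lie in a Cantor-like set: close values share many digits and hence come from close points.
  So the inverse of \<open>\<iota>\<close> is uniformly continuous on the range, although
  \<open>\<iota>\<close> itself is not continuous, and extends to the line as \<open>q\<close>.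
  Boundedness of \<open>\<iota>\<close> will provide tightness.\<close>

lemma continuous_cell_parametrisation:
  obtains q :: "real \<Rightarrow> real ^ 'n" and \<iota> :: "real ^ 'n \<Rightarrow> real" and b :: real
  where "continuous_on UNIV q" "\<iota> \<in> borel_measurable borel" "\<And>x. x \<in> unit_cell \<Longrightarrow> q (\<iota> x) = x"
    "\<And>x. 0 \<le> \<iota> x" "\<And>x. \<iota> x \<le> b"
proof -
  obtain e :: "'n set \<Rightarrow> nat" and N where e: "e ` UNIV = {i. i < N}" "inj e"
    using finite_imp_inj_to_nat_seg[of "UNIV :: 'n set set"] by auto
  have eN: "e S < N" for S using e(1) by blast
  from eN[of undefined] have N0: "0 < N" by linarith
  define B where "B = 2 * real N + 1"
  have B: "B \<ge> 3" using N0 by (simp add: B_def)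
  define \<iota> where "\<iota> x = (\<Sum>j. e (binary_digit j x) / B ^ j)" for x :: "real^'n"
  have geo: "summable (\<lambda>k. N * (1 / B) ^ k)" using B by (intro summable_mult summable_geometric) simp
  have le: "e (binary_digit j x) / B ^ j \<le> N * (1 / B) ^ j" for j x
    using eN[of "binary_digit j x"] B by (simp add: power_divide divide_simps less_imp_le)
  have sm: "summable (\<lambda>j. e (binary_digit j x) / B ^ j)" for x
    using le B by (intro summable_comparison_test'[OF geo]) auto
  have meas: "\<iota> \<in> borel_measurable borel"
  proof -
    have m: "(\<lambda>x. real (e (binary_digit j x))) \<in> borel_measurable borel" for j
      using measurable_compose[OF measurable_binary_digit, of "\<lambda>S. real (e S)" borel] by simp
    have "(\<lambda>x. real (e (binary_digit j x)) / B ^ j) \<in> borel_measurable borel" for j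
      by (rule borel_measurable_divide[OF m borel_measurable_const])
    then have "(\<lambda>x. \<Sum>j. real (e (binary_digit j x)) / B ^ j) \<in> borel_measurable borel"
      by (rule borel_measurable_suminf)
    then show ?thesis by (simp only: \<iota>_def[abs_def])
  qed
  define X where "X = \<iota> ` unit_cell"
  have close: "\<forall>i. \<bar>x $ i - y $ i\<bar> \<le> 1 / 2 ^ J"
    if "x \<in> unit_cell" "y \<in> unit_cell" "\<bar>\<iota> x - \<iota> y\<bar> < 1 / (2 * B ^ J)" for x y J
  proof -
    have "\<bar>(\<Sum>k. e (binary_digit k x) / (2 * real N + 1) ^ k) - (\<Sum>k. e (binary_digit k y) / (2 * real N + 1) ^ k)\<bar>
        < 1 / (2 * (2 * real N + 1) ^ J)"
      using that(3) unfolding \<iota>_def B_def .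
    with eN have "\<forall>k\<le>J. e (binary_digit k x) = e (binary_digit k y)"
      by (intro digit_expansion_separation[of "\<lambda>k. e (binary_digit k x)" N "\<lambda>k. e (binary_digit k y)" J]) blast+
    then have "binary_digit k x = binary_digit k y" if "k < J" for k
      using injD[OF e(2)] less_imp_le[OF that] by blast
    then show ?thesis using binary_digit_close[OF that(1,2)] by blast
  qed
  have close': "norm (x - y) \<le> CARD('n) / 2 ^ J"
    if "x \<in> unit_cell" "y \<in> unit_cell" "\<bar>\<iota> x - \<iota> y\<bar> < 1 / (2 * B ^ J)" for x y J
  proof -
    have "norm (x - y) \<le> (\<Sum>i\<in>UNIV. \<bar>(x - y) $ i\<bar>)" by (rule norm_le_l1_cart)
    also have "\<dots> \<le> (\<Sum>i\<in>(UNIV::'n set). 1 / 2 ^ J)"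
      using close[OF that] by (intro sum_mono) simp
    finally show ?thesis by simp
  qed
  have small: "\<exists>J. CARD('n) / 2 ^ J < \<epsilon>" if "\<epsilon> > 0" for \<epsilon> :: real
  proof -
    have "0 < \<epsilon> / CARD('n)" using that by simp
    then have "\<exists>J. (1/2) ^ J < \<epsilon> / CARD('n)" by (rule real_arch_pow_inv) simp
    then obtain J where "(1/2) ^ J < \<epsilon> / CARD('n)" by blast
    then have "CARD('n) / 2 ^ J < \<epsilon>"
      by (simp add: power_divide pos_less_divide_eq mult.commute)
    then show ?thesis by blast
  qed
  have inj: "inj_on \<iota> unit_cell"
  proof (rule inj_onI, rule ccontr)
    fix x y :: "real^'n" assume xy: "x \<in> unit_cell" "y \<in> unit_cell" "\<iota> x = \<iota> y" "x \<noteq> y"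
    then have "0 < norm (x - y)" by simp
    then obtain J where J: "CARD('n) / 2 ^ J < norm (x - y)" using small by blast
    have "norm (x - y) \<le> CARD('n) / 2 ^ J"
      by (rule close'[OF xy(1,2)]) (use xy(3) B in simp)
    with J show False by linarith
  qed
  define h where "h = inv_into unit_cell \<iota>"
  have h: "h (\<iota> x) = x" if "x \<in> unit_cell" for x
    using inj that by (simp add: h_def)
  \<comment> \<open>The modulus is explicit: 1 / (2 B^J) separates words that differ at a place up
    to J, and J is chosen with CARD('n) / 2^J below \<epsilon>.\<close>
  have "uniformly_continuous_on X h"
    unfolding uniformly_continuous_on_def
  proof (intro allI impI)
    fix \<epsilon> :: real assume "\<epsilon> > 0"
    then obtain J where J: "CARD('n) / 2 ^ J < \<epsilon>" using small by blast
    have "dist (h y) (h x) < \<epsilon>" if "x \<in> X" "y \<in> X" "dist y x < 1 / (2 * B ^ J)" for x y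
    proof -
      from that obtain x' y' where xy: "x' \<in> unit_cell" "x = \<iota> x'" "y' \<in> unit_cell" "y = \<iota> y'"
        unfolding X_def by blast
      then have "norm (y' - x') \<le> CARD('n) / 2 ^ J"
        using that(3) by (intro close') (simp_all add: dist_real_def)
      then show ?thesis using J xy h by (simp add: dist_norm)
    qed
    then show "\<exists>d>0. \<forall>x\<in>X. \<forall>x'\<in>X. dist x' x < d \<longrightarrow> dist (h x') (h x) < \<epsilon>"
      using B by (intro exI[of _ "1 / (2 * B ^ J)"]) auto
  qed
  \<comment> \<open>Uniform continuity extends the inverse to the closure of its domain; Tietze's
    theorem extends it from this closed set to the line.\<close>
  then obtain g where g: "uniformly_continuous_on (closure X) g" "\<And>x. x \<in> X \<Longrightarrow> h x = g x"
  proof (rule uniformly_continuous_on_extension_on_closure)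
    fix g assume "uniformly_continuous_on (closure X) g" "\<And>x. x \<in> X \<Longrightarrow> h x = g x"
    then show thesis by (rule that)
  qed
  obtain q where q: "continuous_on UNIV q" "\<And>x. x \<in> closure X \<Longrightarrow> q x = g x"
  proof (rule Tietze_unbounded)
    show "continuous_on (closure X) g" using g(1) by (rule uniformly_continuous_imp_continuous)
    show "closedin (top_of_set UNIV) (closure X)" by simp
    fix q assume "continuous_on UNIV q" "\<And>x. x \<in> closure X \<Longrightarrow> q x = g x"
    then show thesis by (rule that)
  qed
  show ?thesis
  proof (rule that[of q \<iota> "\<Sum>k. N * (1 / B) ^ k"])
    show "q (\<iota> x) = x" if "x \<in> unit_cell" for x
    proof -
      have "\<iota> x \<in> X" using that by (simp add: X_def)
      then have "q (\<iota> x) = g (\<iota> x)" using closure_subset[of X] q(2) by blast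
      also have "\<dots> = h (\<iota> x)" using \<open>\<iota> x \<in> X\<close> g(2) by simp
      finally show ?thesis using h[OF that] by simp
    qed
    show "0 \<le> \<iota> x" for x unfolding \<iota>_def using B by (intro suminf_nonneg sm) auto
    show "\<iota> x \<le> (\<Sum>k. N * (1 / B) ^ k)" for x unfolding \<iota>_def by (intro suminf_le le sm geo)
  qed (rule q(1) meas)+
qed

subsection \<open>Wasserstein distance\<close>

lemma torus_dist_nonneg [simp]: "0 \<le> torus_dist x y"
  by (simp add: torus_dist_def infdist_nonneg)

lemma torus_dist_le: "k \<in> int_lattice \<Longrightarrow> torus_dist x y \<le> norm (x - y - k)"
  unfolding torus_dist_def dist_norm[symmetric] by (rule infdist_le)

lemma torus_dist_tfrac_le: "torus_dist x (tfrac y) \<le> norm (x - y)"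
  using torus_dist_le[of "y - tfrac y" x "tfrac y"] by simp

lemma norm_unit_cell_le: "x \<in> unit_cell \<Longrightarrow> norm (x :: real^'n) \<le> CARD('n)"
proof -
  assume "x \<in> unit_cell"
  then have "(\<Sum>i\<in>UNIV. \<bar>x $ i\<bar>) \<le> (\<Sum>i\<in>(UNIV::'n set). 1)"
    by (intro sum_mono) (auto simp: unit_cell_def less_imp_le)
  then show ?thesis using norm_le_l1_cart[of x] by simp
qed

lemma torus_dist_bound: "torus_dist x y \<le> 2 * real CARD('n)" for x y :: "real^'n"
proof -
  have "torus_dist x y \<le> norm (x - y - ((x - tfrac x) - (y - tfrac y)))"
    by (intro torus_dist_le int_lattice_diff diff_tfrac_lattice)
  also have "\<dots> = norm (tfrac x - tfrac y)" by (simp add: algebra_simps)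
  also have "\<dots> \<le> norm (tfrac x) + norm (tfrac y)" by (rule norm_triangle_ineq4)
  also have "\<dots> \<le> real CARD('n) + real CARD('n)" by (intro add_mono norm_unit_cell_le tfrac_in_cell)
  finally show ?thesis by simp
qed

lemma torus_dist_sq_bound: "(torus_dist x y)\<^sup>2 \<le> (2 * real CARD('n))\<^sup>2" for x y :: "real^'n"
  by (rule power_mono[OF torus_dist_bound torus_dist_nonneg])

lemma borel_measurable_sets_eq: "sets M = sets borel \<Longrightarrow> f \<in> borel \<rightarrow>\<^sub>M N \<Longrightarrow> f \<in> M \<rightarrow>\<^sub>M N"
  by (subst measurable_cong_sets[of M borel N N]) auto

lemma borel_measurable_fst_snd:
  "fst \<in> borel_measurable (borel :: ('a::{second_countable_topology} \<times> 'b::{second_countable_topology}) measure)"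
  "snd \<in> borel_measurable (borel :: ('a::{second_countable_topology} \<times> 'b::{second_countable_topology}) measure)"
  by (auto intro!: borel_measurable_continuous_onI continuous_intros)

lemma measurable_torus_dist [measurable]:
  "(\<lambda>z. torus_dist (fst z) (snd z)) \<in> borel_measurable (borel :: ((real^'n) \<times> (real^'n)) measure)"
proof (rule borel_measurable_continuous_onI)
  have "continuous_on UNIV (\<lambda>z :: (real^'n) \<times> (real^'n). fst z - snd z)"
    by (intro continuous_intros)
  then show "continuous_on UNIV (\<lambda>z :: (real^'n) \<times> (real^'n). torus_dist (fst z) (snd z))"
    unfolding torus_dist_def by (rule continuous_on_infdist)
qed

text \<open>The lattice vector nearest to x - y may be added to y without changing f(y), so the
  Lipschitz bound applies to the shortest representative of the difference.\<close>

lemma periodic_lipschitz_torus_dist: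
  fixes f :: "real^'n \<Rightarrow> real"
  assumes "periodic f" "L-lipschitz_on UNIV f"
  shows "\<bar>f x - f y\<bar> \<le> L * torus_dist x y"
proof -
  have "(int_lattice :: (real^'n) set) \<noteq> {}" using int_lattice_0 by blast
  then obtain k where k: "k \<in> int_lattice" "torus_dist x y = dist (x - y) k"
    unfolding torus_dist_def using infdist_attains_inf[OF closed_int_lattice] by blast
  have "\<bar>f x - f y\<bar> = dist (f x) (f (y + k))"
    by (simp add: periodicD[OF assms(1) k(1)] dist_real_def)
  also have "\<dots> \<le> L * dist x (y + k)" using assms(2) by (simp add: lipschitz_onD)
  also have "dist x (y + k) = torus_dist x y" by (simp add: k(2) dist_norm algebra_simps)
  finally show ?thesis .
qed

lemma torus_probD:
  assumes "torus_prob \<mu>"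
  shows "sets \<mu> = sets borel" "prob_space \<mu>" "space \<mu> = UNIV" "AE x in \<mu>. x \<in> unit_cell"
proof -
  show 1: "sets \<mu> = sets borel" "prob_space \<mu>" using assms by (auto simp: torus_prob_def)
  then show "space \<mu> = UNIV" using sets_eq_imp_space_eq[OF 1(1)] by simp
  interpret prob_space \<mu> by fact
  show "AE x in \<mu>. x \<in> unit_cell"
    using assms prob_eq_1[of unit_cell] 1 by (simp add: torus_prob_def emeasure_eq_measure)
qed

lemma couplingsD:
  assumes "\<pi> \<in> couplings \<mu> \<nu>"
  shows "sets \<pi> = sets borel" "distr \<pi> borel fst = \<mu>" "distr \<pi> borel snd = \<nu>"
  using assms by (auto simp: couplings_def)

lemma couplings_prob_space:
  assumes "torus_prob \<mu>" "\<pi> \<in> couplings \<mu> \<nu>"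
  shows "prob_space \<pi>"
proof -
  have "fst \<in> \<pi> \<rightarrow>\<^sub>M borel"
    by (rule borel_measurable_sets_eq[OF couplingsD(1)[OF assms(2)] borel_measurable_fst_snd(1)])
  moreover have "prob_space (distr \<pi> borel fst)"
    using couplingsD[OF assms(2)] torus_probD[OF assms(1)] by simp
  ultimately show ?thesis by (rule prob_space_distrD)
qed

text \<open>The product measure is a coupling. Without a coupling the infimum in \<open>W2\<close>
  would be taken over an empty set of reals.\<close>

lemma couplings_nonempty:
  fixes \<mu> \<nu> :: "(real^'n) measure"
  assumes "torus_prob \<mu>" "torus_prob \<nu>"
  shows "couplings \<mu> \<nu> \<noteq> {}"
proof -
  note m = torus_probD[OF assms(1)] and n = torus_probD[OF assms(2)]
  interpret m: prob_space \<mu> by fact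
  interpret n: prob_space \<nu> by fact
  have s: "sets (\<mu> \<Otimes>\<^sub>M \<nu>) = sets borel"
    using sets_pair_measure_cong[OF m(1) n(1)] by (simp only: borel_prod)
  have ms: "fst \<in> \<mu> \<Otimes>\<^sub>M \<nu> \<rightarrow>\<^sub>M borel" "snd \<in> \<mu> \<Otimes>\<^sub>M \<nu> \<rightarrow>\<^sub>M borel"
    by (rule borel_measurable_sets_eq[OF s] borel_measurable_fst_snd)+
  have "distr (\<mu> \<Otimes>\<^sub>M \<nu>) borel fst = \<mu>"
  proof (rule measure_eqI)
    fix A :: "(real^'n) set" assume "A \<in> sets (distr (\<mu> \<Otimes>\<^sub>M \<nu>) borel fst)"
    then have A: "A \<in> sets borel" by simp
    have "fst -` A \<inter> space (\<mu> \<Otimes>\<^sub>M \<nu>) = A \<times> space \<nu>"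
      by (auto simp: space_pair_measure m(3) n(3))
    then have "emeasure (distr (\<mu> \<Otimes>\<^sub>M \<nu>) borel fst) A = emeasure (\<mu> \<Otimes>\<^sub>M \<nu>) (A \<times> space \<nu>)"
      using A ms by (simp add: emeasure_distr)
    also have "\<dots> = emeasure \<mu> A * emeasure \<nu> (space \<nu>)"
      using A m(1) by (intro n.emeasure_pair_measure_Times) auto
    finally show "emeasure (distr (\<mu> \<Otimes>\<^sub>M \<nu>) borel fst) A = emeasure \<mu> A"
      by (simp add: n.emeasure_space_1)
  qed (simp add: m(1))
  moreover have "distr (\<mu> \<Otimes>\<^sub>M \<nu>) borel snd = \<nu>"
  proof (rule measure_eqI)
    fix A :: "(real^'n) set" assume "A \<in> sets (distr (\<mu> \<Otimes>\<^sub>M \<nu>) borel snd)"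
    then have A: "A \<in> sets borel" by simp
    have "snd -` A \<inter> space (\<mu> \<Otimes>\<^sub>M \<nu>) = space \<mu> \<times> A"
      by (auto simp: space_pair_measure m(3) n(3))
    then have "emeasure (distr (\<mu> \<Otimes>\<^sub>M \<nu>) borel snd) A = emeasure (\<mu> \<Otimes>\<^sub>M \<nu>) (space \<mu> \<times> A)"
      using A ms by (simp add: emeasure_distr)
    also have "\<dots> = emeasure \<mu> (space \<mu>) * emeasure \<nu> A"
      using A n(1) by (intro n.emeasure_pair_measure_Times) auto
    finally show "emeasure (distr (\<mu> \<Otimes>\<^sub>M \<nu>) borel snd) A = emeasure \<nu> A"
      by (simp add: m.emeasure_space_1)
  qed (simp add: n(1))
  ultimately show ?thesis using s unfolding couplings_def by blast
qed

text \<open>Both integrals are expectations under \<pi>, so their difference is bounded by L times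
  the mean torus distance, and the mean by the root of the mean square.\<close>

lemma coupling_lipschitz:
  fixes f :: "real^'n \<Rightarrow> real"
  assumes mu: "torus_prob \<mu>" and pi: "\<pi> \<in> couplings \<mu> \<nu>"
    and f: "periodic f" "L-lipschitz_on UNIV f"
  shows "\<bar>(LINT x|\<mu>. f x) - (LINT x|\<nu>. f x)\<bar> \<le> L * sqrt (LINT z|\<pi>. (torus_dist (fst z) (snd z))\<^sup>2)"
proof -
  interpret prob_space \<pi> using couplings_prob_space[OF mu pi] .
  note c = couplingsD[OF pi]
  note [measurable_cong] = c(1)
  have L: "0 \<le> L" using f(2) by (rule lipschitz_on_nonneg)
  have fm [measurable]: "f \<in> borel_measurable borel"
    using lipschitz_on_continuous_on[OF f(2)] by (rule borel_measurable_continuous_onI)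
  have fst_m [measurable]: "fst \<in> \<pi> \<rightarrow>\<^sub>M borel" and snd_m [measurable]: "snd \<in> \<pi> \<rightarrow>\<^sub>M borel"
    by (rule borel_measurable_sets_eq[OF c(1)] borel_measurable_fst_snd)+
  have td [measurable]: "(\<lambda>z. torus_dist (fst z) (snd z)) \<in> borel_measurable \<pi>"
    by (rule borel_measurable_sets_eq[OF c(1) measurable_torus_dist])
  have bd: "\<bar>f x\<bar> \<le> \<bar>f 0\<bar> + L * (2 * real CARD('n))" for x
  proof -
    have "\<bar>f x - f 0\<bar> \<le> L * (2 * real CARD('n))"
      using periodic_lipschitz_torus_dist[OF f, of x 0] mult_left_mono[OF torus_dist_bound[of x 0] L] by linarith
    then show ?thesis by linarith
  qed
  have i1: "integrable \<pi> (\<lambda>z. f (fst z))"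
    by (rule integrable_const_bound[of _ "\<bar>f 0\<bar> + L * (2 * real CARD('n))"]) (use bd in auto)
  have i2: "integrable \<pi> (\<lambda>z. f (snd z))"
    by (rule integrable_const_bound[of _ "\<bar>f 0\<bar> + L * (2 * real CARD('n))"]) (use bd in auto)
  have i3: "integrable \<pi> (\<lambda>z. torus_dist (fst z) (snd z))"
    by (rule integrable_const_bound[of _ "2 * real CARD('n)"]) (use torus_dist_bound in auto)
  have i4: "integrable \<pi> (\<lambda>z. (torus_dist (fst z) (snd z))\<^sup>2)"
    by (rule integrable_const_bound[of _ "(2 * real CARD('n))\<^sup>2"])
      (use torus_dist_sq_bound[where 'n='n] in auto)
  have "(LINT x|\<mu>. f x) = (LINT z|\<pi>. f (fst z))"
    unfolding c(2)[symmetric] by (rule integral_distr) simp_all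
  moreover have "(LINT x|\<nu>. f x) = (LINT z|\<pi>. f (snd z))"
    unfolding c(3)[symmetric] by (rule integral_distr) simp_all
  ultimately have "(LINT x|\<mu>. f x) - (LINT x|\<nu>. f x) = (LINT z|\<pi>. f (fst z) - f (snd z))"
    using i1 i2 by simp
  also have "\<bar>\<dots>\<bar> \<le> (LINT z|\<pi>. \<bar>f (fst z) - f (snd z)\<bar>)" by (rule integral_abs_bound)
  also have "\<dots> \<le> (LINT z|\<pi>. L * torus_dist (fst z) (snd z))"
    by (rule integral_mono) (use i1 i2 i3 periodic_lipschitz_torus_dist[OF f] in auto)
  also have "\<dots> = L * (LINT z|\<pi>. torus_dist (fst z) (snd z))" by simp
  also have "\<dots> \<le> L * sqrt (LINT z|\<pi>. (torus_dist (fst z) (snd z))\<^sup>2)"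
  proof (rule mult_left_mono[OF _ L], rule real_le_rsqrt)
    \<comment> \<open>Nonnegativity of the variance serves as Jensen's inequality.\<close>
    show "(LINT z|\<pi>. torus_dist (fst z) (snd z))\<^sup>2 \<le> (LINT z|\<pi>. (torus_dist (fst z) (snd z))\<^sup>2)"
      using variance_positive[of "\<lambda>z. torus_dist (fst z) (snd z)"] unfolding variance_eq[OF i3 i4] by simp
  qed
  finally show ?thesis .
qed

lemma W2_nonneg:
  assumes "torus_prob \<mu>" "torus_prob \<nu>"
  shows "0 \<le> W2 \<mu> \<nu>"
  unfolding W2_def by (intro real_sqrt_ge_zero cINF_greatest couplings_nonempty assms) simp

lemma W2_lipschitz:
  fixes f :: "real^'n \<Rightarrow> real"
  assumes "torus_prob \<mu>" "torus_prob \<nu>" and f: "periodic f" "L-lipschitz_on UNIV f"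
  shows "\<bar>(LINT x|\<mu>. f x) - (LINT x|\<nu>. f x)\<bar> \<le> L * W2 \<mu> \<nu>"
\<comment> \<open>The bound for couplings is divided by L before the infimum is taken; for L = 0 any
  single coupling is enough.\<close>
proof (cases "L = 0")
  case True
  obtain \<pi> where "\<pi> \<in> couplings \<mu> \<nu>" using couplings_nonempty[OF assms(1,2)] by blast
  from coupling_lipschitz[OF assms(1) this f] True show ?thesis by simp
next
  case False
  then have L: "0 < L" using lipschitz_on_nonneg[OF f(2)] by simp
  let ?D = "\<bar>(LINT x|\<mu>. f x) - (LINT x|\<nu>. f x)\<bar> / L"
  have D: "?D\<^sup>2 \<le> (LINT z|\<pi>. (torus_dist (fst z) (snd z))\<^sup>2)" if "\<pi> \<in> couplings \<mu> \<nu>" for \<pi>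
  proof -
    have "?D \<le> sqrt (LINT z|\<pi>. (torus_dist (fst z) (snd z))\<^sup>2)"
      using coupling_lipschitz[OF assms(1) that f] L by (simp add: pos_divide_le_eq mult.commute)
    then show ?thesis using L by (simp add: real_le_rsqrt sqrt_ge_absD)
  qed
  have "?D\<^sup>2 \<le> (INF \<pi>\<in>couplings \<mu> \<nu>. LINT z|\<pi>. (torus_dist (fst z) (snd z))\<^sup>2)"
    by (rule cINF_greatest[OF couplings_nonempty[OF assms(1,2)] D])
  then have "?D \<le> W2 \<mu> \<nu>" unfolding W2_def by (rule real_le_rsqrt)
  then show ?thesis using L by (simp add: pos_divide_le_eq mult.commute)
qed

text \<open>The joint law of X and Y is a coupling, so its cost bounds the infimum from
  above.\<close>

lemma W2_le_random_variables:
  fixes X Y :: "'a \<Rightarrow> real^'n"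
  assumes [measurable]: "X \<in> borel_measurable \<Omega>" "Y \<in> borel_measurable \<Omega>"
    and XY: "distr \<Omega> borel X = \<mu>" "distr \<Omega> borel Y = \<nu>"
  shows "W2 \<mu> \<nu> \<le> sqrt (LINT \<omega>|\<Omega>. (torus_dist (X \<omega>) (Y \<omega>))\<^sup>2)"
proof -
  define \<pi> where "\<pi> = distr \<Omega> borel (\<lambda>\<omega>. (X \<omega>, Y \<omega>))"
  have m [measurable]: "(\<lambda>\<omega>. (X \<omega>, Y \<omega>)) \<in> borel_measurable \<Omega>" by (rule borel_measurable_Pair) simp_all
  have f: "fst \<in> borel_measurable (borel :: ((real^'n) \<times> (real^'n)) measure)"
    "snd \<in> borel_measurable (borel :: ((real^'n) \<times> (real^'n)) measure)"
    by (auto intro!: borel_measurable_continuous_onI continuous_intros)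
  have "distr \<pi> borel fst = \<mu>" "distr \<pi> borel snd = \<nu>"
    unfolding \<pi>_def XY[symmetric] by (subst distr_distr[OF _ m]; simp add: f comp_def)+
  then have "\<pi> \<in> couplings \<mu> \<nu>" by (simp add: couplings_def \<pi>_def)
  then have "(INF \<pi>\<in>couplings \<mu> \<nu>. LINT z|\<pi>. (torus_dist (fst z) (snd z))\<^sup>2) \<le> (LINT z|\<pi>. (torus_dist (fst z) (snd z))\<^sup>2)"
    by (intro cINF_lower bdd_belowI[where m=0]) auto
  also have "\<dots> = (LINT \<omega>|\<Omega>. (torus_dist (X \<omega>) (Y \<omega>))\<^sup>2)"
    unfolding \<pi>_def by (subst integral_distr[OF m]) simp_all
  finally show ?thesis unfolding W2_def by simp
qed

lemma W2_tendsto_lipschitz: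
  fixes f :: "real^'n \<Rightarrow> real"
  assumes "\<forall>\<^sub>F s in F. torus_prob (\<mu> s)" "torus_prob \<nu>" "((\<lambda>s. W2 (\<mu> s) \<nu>) \<longlongrightarrow> 0) F"
    and f: "periodic f" "L-lipschitz_on UNIV f"
  shows "((\<lambda>s. LINT x|\<mu> s. f x) \<longlongrightarrow> (LINT x|\<nu>. f x)) F"
proof (rule Lim_null[THEN iffD2], rule Lim_null_comparison)
  show "\<forall>\<^sub>F s in F. norm ((LINT x|\<mu> s. f x) - (LINT x|\<nu>. f x)) \<le> L * W2 (\<mu> s) \<nu>"
    using assms(1) by eventually_elim (use W2_lipschitz[OF _ assms(2) f] in simp)
  show "((\<lambda>s. L * W2 (\<mu> s) \<nu>) \<longlongrightarrow> 0) F"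
    using tendsto_mult_left[OF assms(3), of L] by simp
qed

text \<open>
  Prokhorov's theorem on the torus: the measures are lifted to the line along a right inverse of
  the parametrisation \<open>q\<close>; Helly's and Skorohod's theorems apply there, and \<open>q\<close>, being continuous,
  transports almost sure convergence back to the torus.
\<close>

theorem torus_prob_seq_compact:
  fixes M :: "nat \<Rightarrow> (real^'n) measure"
  assumes M: "\<And>j. torus_prob (M j)"
  shows "\<exists>r \<nu>. strict_mono (r :: nat \<Rightarrow> nat) \<and> torus_prob \<nu> \<and> (\<lambda>j. W2 (M (r j)) \<nu>) \<longlonglongrightarrow> 0"
proof -
  obtain q :: "real \<Rightarrow> real ^ 'n" and \<iota> :: "real ^ 'n \<Rightarrow> real" and b :: real
    where q: "continuous_on UNIV q" and i_m [measurable]: "\<iota> \<in> borel_measurable borel"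
      and qi: "\<And>x. x \<in> unit_cell \<Longrightarrow> q (\<iota> x) = x" and ib: "\<And>x. 0 \<le> \<iota> x" "\<And>x. \<iota> x \<le> b"
    by (rule continuous_cell_parametrisation) blast
  have q_m [measurable]: "q \<in> borel_measurable borel" using q by (rule borel_measurable_continuous_onI)
  define N where "N j = distr (M j) borel \<iota>" for j
  have i_mj: "\<iota> \<in> borel_measurable (M j)" for j
    using i_m measurable_cong_sets[OF torus_probD(1)[OF M] refl] by blast
  have rd: "real_distribution (N j)" for j
    unfolding N_def using prob_space.real_distribution_distr[OF torus_probD(2)[OF M] i_mj] .
  have b0: "0 \<le> b" using ib(1)[of 0] ib(2)[of 0] by linarith
  \<comment> \<open>All lifted measures live on the bounded interval [0, b]; the left end -1
    includes the point 0 in a half-open interval.\<close>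
  have "tight N" unfolding tight_def
  proof (intro conjI allI impI)
    fix \<epsilon> :: real assume "\<epsilon> > 0"
    have "measure (N j) {-1<..b} = 1" for j
    proof -
      have "\<iota> -` {-1<..b} \<inter> space (M j) = space (M j)"
      proof -
        have "-1 < \<iota> x" for x using ib(1)[of x] by linarith
        then show ?thesis using ib(2) by auto
      qed
      then show ?thesis unfolding N_def
        using i_mj[of j] by (simp add: measure_distr prob_space.prob_space[OF torus_probD(2)[OF M]])
    qed
    then show "\<exists>a b. a < b \<and> (\<forall>n. 1 - \<epsilon> < measure (N n) {a<..b})"
      using b0 \<open>\<epsilon> > 0\<close> by (intro exI[of _ "-1"] exI[of _ b]) auto
  qed (rule rd)
  then obtain r N' where r: "strict_mono r" "real_distribution N'" "weak_conv_m (N \<circ> id \<circ> r) N'"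
    using tight_imp_convergent_subsubsequence[of N id] strict_mono_id by blast
  have "real_distribution ((N \<circ> id \<circ> r) n)" for n using rd by simp
  from Skorohod[OF this r(2,3)] obtain \<Omega> :: "real measure" and Ys Y where sk:
    "prob_space \<Omega> \<and> (\<forall>n. Ys n \<in> \<Omega> \<rightarrow>\<^sub>M borel) \<and> (\<forall>n. distr \<Omega> borel (Ys n) = (N \<circ> id \<circ> r) n) \<and>
     Y \<in> \<Omega> \<rightarrow>\<^sub>M lborel \<and> distr \<Omega> borel Y = N' \<and> (\<forall>x\<in>space \<Omega>. (\<lambda>n. Ys n x) \<longlonglongrightarrow> Y x)"
    by (elim exE)
  then have Om: "prob_space \<Omega>" and Ys_m: "\<And>n. Ys n \<in> \<Omega> \<rightarrow>\<^sub>M borel" and Ys: "\<And>n. distr \<Omega> borel (Ys n) = N (r n)"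
    and Y_m: "Y \<in> \<Omega> \<rightarrow>\<^sub>M lborel" and lim: "\<And>x. x \<in> space \<Omega> \<Longrightarrow> (\<lambda>n. Ys n x) \<longlonglongrightarrow> Y x"
    by simp_all
  interpret prob_space \<Omega> by fact
  have Y_m': "Y \<in> \<Omega> \<rightarrow>\<^sub>M borel" using Y_m by simp
  define X where "X n = (\<lambda>\<omega>. q (Ys n \<omega>))" for n
  \<comment> \<open>The limit \<open>q (Y \<omega>)\<close> may leave the cell, which is not closed.
    Its class is represented again in the cell, and \<open>torus_dist\<close> does not see the
    change.\<close>
  define X' where "X' = (\<lambda>\<omega>. tfrac (q (Y \<omega>)))"
  have X_m [measurable]: "X n \<in> \<Omega> \<rightarrow>\<^sub>M borel" for n
    unfolding X_def by (rule measurable_compose[OF Ys_m q_m])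
  have qY: "(\<lambda>\<omega>. q (Y \<omega>)) \<in> \<Omega> \<rightarrow>\<^sub>M borel" by (rule measurable_compose[OF Y_m' q_m])
  have X'_m [measurable]: "X' \<in> \<Omega> \<rightarrow>\<^sub>M borel"
    unfolding X'_def by (rule measurable_compose[OF qY measurable_tfrac])
  define \<nu> where "\<nu> = distr \<Omega> borel X'"
  have "torus_prob \<nu>"
  proof -
    have "X' -` unit_cell \<inter> space \<Omega> = space \<Omega>" by (auto simp: X'_def)
    then have "emeasure \<nu> unit_cell = 1" by (simp add: \<nu>_def emeasure_distr emeasure_space_1)
    then show ?thesis unfolding torus_prob_def by (simp add: \<nu>_def prob_space_distr)
  qed
  moreover have law: "distr \<Omega> borel (X n) = M (r n)" for n
  proof -
    note t = torus_probD[OF M[of "r n"]]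
    have "distr \<Omega> borel (X n) = distr (distr \<Omega> borel (Ys n)) borel q"
      unfolding X_def by (subst distr_distr[OF q_m Ys_m]) (simp add: comp_def)
    also have "\<dots> = distr (M (r n)) borel (\<lambda>x. q (\<iota> x))"
      unfolding Ys N_def by (subst distr_distr[OF q_m i_mj]) (simp add: comp_def)
    \<comment> \<open>The measure is carried by the cell, where \<open>q\<close> inverts
      \<open>\<iota>\<close>.\<close>
    also have "\<dots> = distr (M (r n)) borel (\<lambda>x. x)"
    proof (rule distr_cong_AE)
      show "AE x in M (r n). q (\<iota> x) = x" using t(4) by eventually_elim (rule qi)
      show "(\<lambda>x. q (\<iota> x)) \<in> M (r n) \<rightarrow>\<^sub>M borel" by (rule measurable_compose[OF i_mj q_m])
      show "(\<lambda>x. x) \<in> M (r n) \<rightarrow>\<^sub>M borel" using measurable_ident_sets[OF t(1)] by (simp add: id_def)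
    qed simp_all
    also have "\<dots> = M (r n)" using distr_id2[OF t(1)[symmetric]] by (simp add: id_def)
    finally show ?thesis .
  qed
  moreover have "(\<lambda>n. W2 (M (r n)) \<nu>) \<longlonglongrightarrow> 0"
  proof (rule tendsto_sandwich[OF _ _ tendsto_const])
    show "\<forall>\<^sub>F n in sequentially. 0 \<le> W2 (M (r n)) \<nu>"
      using W2_nonneg[OF M \<open>torus_prob \<nu>\<close>] by simp
    show "\<forall>\<^sub>F n in sequentially. W2 (M (r n)) \<nu> \<le> sqrt (LINT \<omega>|\<Omega>. (torus_dist (X n \<omega>) (X' \<omega>))\<^sup>2)"
      by (intro always_eventually allI W2_le_random_variables law) (simp_all add: \<nu>_def)
    have pm: "(\<lambda>\<omega>. (X n \<omega>, X' \<omega>)) \<in> borel_measurable \<Omega>" for n by (rule borel_measurable_Pair) simp_all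
    have tm: "(\<lambda>\<omega>. torus_dist (X n \<omega>) (X' \<omega>)) \<in> borel_measurable \<Omega>" for n
      using measurable_compose[OF pm measurable_torus_dist] by simp
    have "(\<lambda>n. LINT \<omega>|\<Omega>. (torus_dist (X n \<omega>) (X' \<omega>))\<^sup>2) \<longlonglongrightarrow> (LINT \<omega>|\<Omega>. 0)"
    proof (rule integral_dominated_convergence[where w="\<lambda>_. (2 * real CARD('n))\<^sup>2"])
      show "AE \<omega> in \<Omega>. (\<lambda>n. (torus_dist (X n \<omega>) (X' \<omega>))\<^sup>2) \<longlonglongrightarrow> 0"
      proof (rule AE_I2)
        fix \<omega> assume "\<omega> \<in> space \<Omega>"
        then have "(\<lambda>n. X n \<omega>) \<longlonglongrightarrow> q (Y \<omega>)"
          unfolding X_def by (intro continuous_on_tendsto_compose[OF q lim]) auto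
        then have n0: "(\<lambda>n. norm (X n \<omega> - q (Y \<omega>))) \<longlonglongrightarrow> 0"
          using Lim_null tendsto_norm_zero by blast
        have "(\<lambda>n. torus_dist (X n \<omega>) (X' \<omega>)) \<longlonglongrightarrow> 0"
          by (rule tendsto_sandwich[OF _ _ tendsto_const n0]) (simp_all add: X'_def torus_dist_tfrac_le)
        from tendsto_power[OF this, of 2] show "(\<lambda>n. (torus_dist (X n \<omega>) (X' \<omega>))\<^sup>2) \<longlonglongrightarrow> 0" by simp
      qed
      show "AE \<omega> in \<Omega>. norm ((torus_dist (X n \<omega>) (X' \<omega>))\<^sup>2) \<le> (2 * real CARD('n))\<^sup>2" for n
        by (intro AE_I2) (use torus_dist_sq_bound[where 'n='n] in simp)
      show "(\<lambda>\<omega>. (torus_dist (X n \<omega>) (X' \<omega>))\<^sup>2) \<in> borel_measurable \<Omega>" for n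
        by (rule borel_measurable_power[OF tm])
    qed simp_all
    then have "(\<lambda>n. sqrt (LINT \<omega>|\<Omega>. (torus_dist (X n \<omega>) (X' \<omega>))\<^sup>2)) \<longlonglongrightarrow> sqrt (LINT \<omega>|\<Omega>. 0)"
      by (rule tendsto_real_sqrt)
    then show "(\<lambda>n. sqrt (LINT \<omega>|\<Omega>. (torus_dist (X n \<omega>) (X' \<omega>))\<^sup>2)) \<longlonglongrightarrow> 0" by simp
  qed
  ultimately show ?thesis using r(1) by blast
qed

subsection \<open>Periodic test functions\<close>

definition C1_torus :: "(real ^ 'n \<Rightarrow> real) \<Rightarrow> (real ^ 'n \<Rightarrow> real ^ 'n) \<Rightarrow> bool" where
  "C1_torus \<phi> D \<longleftrightarrow> periodic \<phi> \<and> (\<forall>x. GDERIV \<phi> x :> D x) \<and> continuous_on UNIV D"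

lemma periodic_bounded:
  fixes f :: "real^'n \<Rightarrow> 'b::real_normed_vector"
  assumes "periodic f" "continuous_on UNIV f"
  obtains B where "0 \<le> B" "\<And>x. norm (f x) \<le> B"
proof -
  have "compact (f ` cbox 0 1)"
    by (intro compact_continuous_image continuous_on_subset[OF assms(2)]) auto
  then obtain B where B: "\<forall>y\<in>f ` cbox 0 1. norm y \<le> B"
    using compact_imp_bounded bounded_iff by blast
  have "norm (f x) \<le> \<bar>B\<bar>" for x
  proof -
    have "f (tfrac x) \<in> f ` cbox 0 1" using unit_cell_subset tfrac_in_cell by blast
    with B have "norm (f (tfrac x)) \<le> B" by blast
    then show ?thesis using periodic_tfrac[OF assms(1), of x] by simp
  qed
  then show ?thesis using that[of "\<bar>B\<bar>"] by simp
qed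

lemma periodic_gradient:
  fixes f :: "real^'n \<Rightarrow> real"
  assumes "periodic f" "\<And>x. GDERIV f x :> D x"
  shows "periodic D"
  unfolding periodic_def
proof (intro allI ballI)
  fix x k :: "real^'n" assume k: "k \<in> int_lattice"
  have "((\<lambda>y. f (y + k)) has_derivative (\<lambda>h. h \<bullet> D (x + k))) (at x)"
  proof -
    have 1: "((\<lambda>y. y + k) has_derivative (\<lambda>h. h)) (at x)" by (auto intro!: derivative_eq_intros)
    have 2: "(f has_derivative (\<lambda>h. h \<bullet> D (x + k))) (at (x + k))" using assms(2)[of "x + k"] by (simp add: gderiv_def)
    show ?thesis by (rule has_derivative_compose[OF 1 2])
  qed
  moreover have "(\<lambda>y. f (y + k)) = f" using periodicD[OF assms(1) k] by blast
  ultimately have "(f has_derivative (\<lambda>h. h \<bullet> D (x + k))) (at x)" by simp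
  moreover have "(f has_derivative (\<lambda>h. h \<bullet> D x)) (at x)" using assms(2)[of x] by (simp add: gderiv_def)
  ultimately have "(\<lambda>h. h \<bullet> D (x + k)) = (\<lambda>h. h \<bullet> D x)" by (rule has_derivative_unique)
  then have "h \<bullet> D (x + k) = h \<bullet> D x" for h by meson
  then show "D (x + k) = D x" using vector_eq_ldot[of "D (x + k)" "D x"] by blast
qed

lemma gderiv_bounded_lipschitz:
  fixes f :: "real^'n \<Rightarrow> real"
  assumes "\<And>x. GDERIV f x :> D x" "\<And>x. norm (D x) \<le> B" "0 \<le> B"
  shows "B-lipschitz_on UNIV f"
proof (rule lipschitz_onI)
  fix x y :: "real^'n"
  have "norm (f x - f y) \<le> B * norm (x - y)"
  proof (rule differentiable_bound[of UNIV f "\<lambda>x h. h \<bullet> D x"])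
    fix x :: "real^'n"
    show "(f has_derivative (\<lambda>h. h \<bullet> D x)) (at x within UNIV)" using assms(1)[of x] by (simp add: gderiv_def)
    have "norm (h \<bullet> D x) \<le> B * norm h" for h
      using Cauchy_Schwarz_ineq2[of h "D x"] mult_left_mono[OF assms(2)[of x] norm_ge_zero[of h]]
      by (simp add: mult.commute)
    then show "onorm (\<lambda>h. h \<bullet> D x) \<le> B" by (rule onorm_bound[OF assms(3)])
  qed simp_all
  then show "dist (f x) (f y) \<le> B * dist x y" by (simp add: dist_norm)
qed fact

lemma C1_torus_lipschitz:
  assumes "C1_torus \<phi> D"
  obtains L where "L-lipschitz_on UNIV \<phi>"
proof -
  have "periodic D" using assms periodic_gradient unfolding C1_torus_def by blast
  then obtain B where "0 \<le> B" "\<And>x. norm (D x) \<le> B"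
    using periodic_bounded[of D] assms unfolding C1_torus_def by blast
  then have "B-lipschitz_on UNIV \<phi>"
    using assms unfolding C1_torus_def by (intro gderiv_bounded_lipschitz) auto
  then show ?thesis by (rule that)
qed

section \<open>Periodic C^1 approximations of boxes\<close>

definition pos_sq :: "real \<Rightarrow> real" where "pos_sq y = (max 0 y)\<^sup>2"

text \<open>The square removes the corner of max 0 y, so the bumps, ramp primitives and cutoffs
  built from it are C^1, the regularity asked of test functions.\<close>

lemma pos_sq_deriv: "(pos_sq has_real_derivative 2 * max 0 y) (at y)"
proof -
  consider "y < 0" | "y > 0" | "y = 0" by linarith
  then show ?thesis
  proof cases
    case 1
    have "((\<lambda>_. 0) has_real_derivative 2 * max 0 y) (at y)" using 1 by simp
    then show ?thesis
      by (rule has_field_derivative_transform_within_open[of _ _ _ "{..<0}"]) (use 1 in \<open>auto simp: pos_sq_def\<close>)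
  next
    case 2
    have "((\<lambda>y. y\<^sup>2) has_real_derivative 2 * max 0 y) (at y)" using 2 by (auto intro!: derivative_eq_intros)
    then show ?thesis
      by (rule has_field_derivative_transform_within_open[of _ _ _ "{0<..}"]) (use 2 in \<open>auto simp: pos_sq_def\<close>)
  next
    case 3
    have "((\<lambda>h. (pos_sq (0 + h) - pos_sq 0) / h) \<longlongrightarrow> 0) (at 0)"
    proof (rule Lim_null_comparison)
      show "\<forall>\<^sub>F h in at 0. norm ((pos_sq (0 + h) - pos_sq 0) / h) \<le> \<bar>h\<bar>"
        by (rule always_eventually) (auto simp: pos_sq_def max_def power2_eq_square)
      show "((\<lambda>h. \<bar>h\<bar>) \<longlongrightarrow> 0) (at (0::real))" by (intro tendsto_rabs_zero tendsto_ident_at)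
    qed
    then show ?thesis using 3 by (simp add: DERIV_def)
  qed
qed

lemma pos_sq_bounds: "0 \<le> pos_sq y" "y \<le> 1 \<Longrightarrow> pos_sq y \<le> 1"
  by (auto simp: pos_sq_def max_def power_le_one)

text \<open>On the circle of length 1 the arc (a, 1) has midpoint (1 + a)/2 and half-length (1 -
  a)/2. The first cosine is that of the angular distance of x to the midpoint, the second its value
  at the ends; for 0 \<le> a < 1 the difference is positive exactly on the open arc.\<close>

definition arc_level :: "real \<Rightarrow> real \<Rightarrow> real" where
  "arc_level a x = cos (2 * pi * x - pi * (1 + a)) - cos (pi * (1 - a))"

text \<open>Equal to 1 off the arc (a, 1) and, for large k, equal to 0 at any given point of it: a
  periodic C^1 approximation of the indicator of [0, a] within [0, 1). For a \<ge> 1 that indicator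
  is constant and no arc remains.\<close>

definition arc_bump :: "real \<Rightarrow> real \<Rightarrow> real \<Rightarrow> real" where
  "arc_bump k a x = (if a \<ge> 1 then 1 else pos_sq (1 - k * pos_sq (arc_level a x)))"

definition arc_bump' :: "real \<Rightarrow> real \<Rightarrow> real \<Rightarrow> real" where
  "arc_bump' k a x = (if a \<ge> 1 then 0 else
     2 * max 0 (1 - k * pos_sq (arc_level a x)) * (- (k * (2 * max 0 (arc_level a x) * (- sin (2 * pi * x - pi * (1 + a)) * (2 * pi))))))"

lemma arc_bump_deriv: "(arc_bump k a has_real_derivative arc_bump' k a x) (at x)"
proof (cases "a \<ge> 1")
  case True
  then have "arc_bump k a = (\<lambda>_. 1)" "arc_bump' k a x = 0" by (auto simp: arc_bump_def arc_bump'_def)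
  then show ?thesis by simp
next
  case False
  have 1: "(arc_level a has_real_derivative (- sin (2 * pi * x - pi * (1 + a)) * (2 * pi))) (at x)"
    unfolding arc_level_def[abs_def] by (auto intro!: derivative_eq_intros)
  have "((\<lambda>x. pos_sq (arc_level a x)) has_real_derivative (2 * max 0 (arc_level a x) * (- sin (2 * pi * x - pi * (1 + a)) * (2 * pi)))) (at x)"
    using DERIV_chain2[OF pos_sq_deriv 1] .
  then have 2: "((\<lambda>x. 1 - k * pos_sq (arc_level a x)) has_real_derivative (- (k * (2 * max 0 (arc_level a x) * (- sin (2 * pi * x - pi * (1 + a)) * (2 * pi)))))) (at x)"
    using DERIV_diff[OF DERIV_const[of 1] DERIV_cmult[of "\<lambda>x. pos_sq (arc_level a x)" _ x UNIV k]] by (simp only: diff_0)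
  have "((\<lambda>x. pos_sq (1 - k * pos_sq (arc_level a x))) has_real_derivative arc_bump' k a x) (at x)"
    using DERIV_chain2[OF pos_sq_deriv 2] False by (simp add: arc_bump'_def)
  moreover have "arc_bump k a = (\<lambda>x. pos_sq (1 - k * pos_sq (arc_level a x)))" using False by (auto simp: arc_bump_def)
  ultimately show ?thesis by simp
qed

lemma arc_bump'_continuous: "continuous_on UNIV (arc_bump' k a)"
  unfolding arc_bump'_def[abs_def] arc_level_def pos_sq_def by (cases "a \<ge> 1") (auto intro!: continuous_intros)

lemma arc_bump_int: "n \<in> \<int> \<Longrightarrow> arc_bump k a (x + n) = arc_bump k a x"
proof -
  assume "n \<in> \<int>"
  then obtain m where m: "n = of_int m" by (rule Ints_cases)
  have "2 * pi * (x + n) - pi * (1 + a) = (2 * pi * x - pi * (1 + a)) + 2 * pi * of_int m"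
    by (simp add: m algebra_simps)
  then have "cos (2 * pi * (x + n) - pi * (1 + a)) = cos (2 * pi * x - pi * (1 + a))"
    by (simp only: cos_add cos_int_2pin sin_int_2pin; simp?)
  then show ?thesis by (simp add: arc_bump_def arc_level_def)
qed

lemma arc_bump_bounds: "0 \<le> k \<Longrightarrow> 0 \<le> arc_bump k a x" "0 \<le> k \<Longrightarrow> arc_bump k a x \<le> 1"
  by (auto simp: arc_bump_def pos_sq_bounds)

lemma arc_bump_tendsto:
  assumes "0 \<le> a" "0 \<le> x" "x < 1"
  shows "(\<lambda>k. arc_bump (real k) a x) \<longlonglongrightarrow> (if x \<le> a then 1 else 0)"
proof (cases "a \<ge> 1")
  case True
  then show ?thesis using assms by (simp add: arc_bump_def)
next
  case a: False
  let ?\<theta> = "2 * pi * x - pi * (1 + a)"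
  show ?thesis
  proof (cases "x \<le> a")
    case True
    have "arc_level a x \<le> 0"
    \<comment> \<open>Monotonicity of the cosine is available on [0, \<pi>]; points left of a/2 have
      an angle below -\<pi> and are brought there by adding a full turn.\<close>
    proof (cases "?\<theta> \<ge> - pi")
      case t: True
      have "pi * (1 - a) \<le> - ?\<theta>" using True mult_left_mono[of x a "2 * pi"] by (simp add: algebra_simps)
      then have "cos (- ?\<theta>) \<le> cos (pi * (1 - a))"
        using a t by (intro cos_monotone_0_pi_le) auto
      then show ?thesis by (simp only: arc_level_def cos_minus; simp?)
    next
      case t: False
      have "pi * (1 - a) \<le> ?\<theta> + 2 * pi" using assms by (simp add: algebra_simps)
      then have "cos (?\<theta> + 2 * pi) \<le> cos (pi * (1 - a))"
        using a t by (intro cos_monotone_0_pi_le) auto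
      then show ?thesis by (simp only: arc_level_def cos_periodic; simp?)
    qed
    then have "pos_sq (arc_level a x) = 0" by (simp add: pos_sq_def)
    then show ?thesis using True a by (simp add: arc_bump_def pos_sq_def)
  next
    case False
    have "\<bar>?\<theta>\<bar> < pi * (1 - a)"
    proof -
      define A B where "A = pi * x" and "B = pi * a"
      have "A < pi" "B < A" using assms False by (simp_all add: A_def B_def)
      then have "\<bar>2 * A - pi - B\<bar> < pi - B" by linarith
      moreover have "?\<theta> = 2 * A - pi - B" "pi * (1 - a) = pi - B" by (simp_all add: A_def B_def algebra_simps)
      ultimately show ?thesis by (simp only:)
    qed
    moreover have "pi * (1 - a) \<le> pi" using assms by (simp add: algebra_simps)
    ultimately have "cos (pi * (1 - a)) < cos \<bar>?\<theta>\<bar>"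
      by (intro cos_monotone_0_pi) auto
    then have p: "0 < pos_sq (arc_level a x)" by (simp add: arc_level_def pos_sq_def)
    obtain K :: nat where K: "1 / pos_sq (arc_level a x) < real K" using reals_Archimedean2 by blast
    have "arc_bump (real k) a x = 0" if "k \<ge> K" for k
    proof -
      have "1 / pos_sq (arc_level a x) < real k" using K that by linarith
      then have "1 < real k * pos_sq (arc_level a x)" using p by (simp add: pos_divide_less_eq)
      then show ?thesis using a by (simp add: arc_bump_def pos_sq_def[of "1 - _"])
    qed
    then have "\<forall>\<^sub>F k in sequentially. arc_bump (real k) a x = 0"
      using eventually_sequentially by blast
    then show ?thesis using False tendsto_eventually by auto
  qed
qed

text \<open>As k grows this tends on the cell to the indicator of the box below \<open>a\<close>.
  Rational \<open>a\<close> give a countable family that determines a measure, so the null sets of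
  times attached to its members can be united into one.\<close>

definition test_fun :: "nat \<Rightarrow> ('n \<Rightarrow> real) \<Rightarrow> real ^ 'n \<Rightarrow> real" where
  "test_fun k a x = (\<Prod>i\<in>UNIV. arc_bump (real k) (a i) (x $ i))"

lemma test_fun_C1: fixes a :: "'n::finite \<Rightarrow> real" shows "\<exists>D. C1_torus (test_fun k a) D"
proof -
  let ?b = "\<lambda>i. arc_bump (real k) (a i)" and ?b' = "\<lambda>i. arc_bump' (real k) (a i)"
  define D where "D x = (\<chi> i. ?b' i (x $ i) * (\<Prod>j\<in>UNIV - {i}. ?b j (x $ j)))" for x :: "real^'n"
  have bc: "continuous_on UNIV (?b i)" for i
    by (intro continuous_at_imp_continuous_on ballI DERIV_isCont[OF arc_bump_deriv])
  have "periodic (test_fun k a)"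
    unfolding periodic_def
  proof (intro allI ballI)
    fix x k' :: "real^'n" assume "k' \<in> int_lattice"
    then have "k' $ i \<in> \<int>" for i unfolding int_lattice_def by blast
    then show "test_fun k a (x + k') = test_fun k a x"
      unfolding test_fun_def vector_add_component by (intro prod.cong refl arc_bump_int)
  qed
  moreover have "GDERIV (test_fun k a) x :> D x" for x
  proof -
    have "((\<lambda>x. \<Prod>i\<in>UNIV. ?b i (x $ i)) has_derivative
       (\<lambda>h. \<Sum>i\<in>UNIV. (?b' i (x $ i) * h $ i) * (\<Prod>j\<in>UNIV - {i}. ?b j (x $ j)))) (at x)"
    proof (rule has_derivative_prod)
      fix i :: 'n
      have "((\<lambda>x. x $ i) has_derivative (\<lambda>h. h $ i)) (at x)"
        by (rule bounded_linear_imp_has_derivative[OF bounded_linear_vec_nth])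
      from has_derivative_compose[OF this] arc_bump_deriv[of "real k" "a i" "x $ i"]
      show "((\<lambda>x. ?b i (x $ i)) has_derivative (\<lambda>h. ?b' i (x $ i) * h $ i)) (at x)"
        unfolding has_field_derivative_def by blast
    qed
    moreover have "(\<Sum>i\<in>UNIV. (?b' i (x $ i) * h $ i) * (\<Prod>j\<in>UNIV - {i}. ?b j (x $ j))) = h \<bullet> D x" for h
      by (simp add: D_def inner_vec_def mult_ac)
    ultimately show ?thesis by (simp add: gderiv_def test_fun_def[abs_def])
  qed
  moreover have "continuous_on UNIV D"
    unfolding D_def
    by (intro continuous_on_vec_lambda continuous_on_mult continuous_on_prod
        continuous_on_compose2[OF arc_bump'_continuous] continuous_on_compose2[OF bc] continuous_intros) auto
  ultimately show ?thesis unfolding C1_torus_def by blast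
qed

lemma test_fun_bounds: "0 \<le> test_fun k a x" "test_fun k a x \<le> 1"
  unfolding test_fun_def by (auto intro!: prod_nonneg prod_le_1 arc_bump_bounds)

lemma test_fun_tendsto:
  assumes "\<And>i. 0 \<le> a i" "x \<in> unit_cell"
  shows "(\<lambda>k. test_fun k a x) \<longlonglongrightarrow> indicator {..\<chi> i. a i} x"
proof -
  have "(\<lambda>k. test_fun k a x) \<longlonglongrightarrow> (\<Prod>i\<in>UNIV. if x $ i \<le> a i then 1 else 0)"
    unfolding test_fun_def using assms by (intro tendsto_prod arc_bump_tendsto) (auto simp: unit_cell_def)
  also have "(\<Prod>i\<in>UNIV. if x $ i \<le> a i then 1 else 0) = (indicator {..\<chi> i. a i} x :: real)"
    by (auto simp: indicator_def less_eq_vec_def prod_zero_iff)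
  finally show ?thesis .
qed

lemma measurable_test_fun [measurable]: "test_fun k a \<in> borel_measurable borel"
proof -
  obtain D where "C1_torus (test_fun k a) D" using test_fun_C1 by blast
  then obtain L where "L-lipschitz_on UNIV (test_fun k a)" by (rule C1_torus_lipschitz)
  then show ?thesis by (intro borel_measurable_continuous_onI lipschitz_on_continuous_on)
qed

text \<open>As k grows the moments yield the mass of the orthants with nonnegative rational corner.
  Approximating a real corner from above by rational ones yields all nonnegative corners, and
  orthants with a negative coordinate miss the cell. Orthants are stable under intersection and
  generate the Borel sets.\<close>

lemma torus_prob_eqI:
  fixes \<mu> \<nu> :: "(real^'n) measure"
  assumes "torus_prob \<mu>" "torus_prob \<nu>"
    and eq: "\<And>k (a :: 'n \<Rightarrow> rat). (LINT x|\<mu>. test_fun k (\<lambda>i. of_rat (a i)) x) = (LINT x|\<nu>. test_fun k (\<lambda>i. of_rat (a i)) x)"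
  shows "\<mu> = \<nu>"
proof -
  have T: "sets \<rho> = sets borel \<and> prob_space \<rho> \<and> space \<rho> = UNIV \<and> (AE x in \<rho>. x \<in> unit_cell)"
    if "torus_prob \<rho>" for \<rho> :: "(real^'n) measure"
    using torus_probD[OF that] by simp
  have lim1: "(\<lambda>k. LINT x|\<rho>. test_fun k a x) \<longlonglongrightarrow> measure \<rho> {..\<chi> i. a i}"
    if "torus_prob \<rho>" "\<And>i. 0 \<le> a i" for \<rho> and a :: "'n \<Rightarrow> real"
  proof -
    note t = T[OF that(1)]
    then interpret prob_space \<rho> by simp
    have m: "f \<in> borel_measurable borel \<Longrightarrow> f \<in> borel_measurable \<rho>" for f :: "real^'n \<Rightarrow> real"
      using t measurable_cong_sets by blast
    have "(\<lambda>k. LINT x|\<rho>. test_fun k a x) \<longlonglongrightarrow> (LINT x|\<rho>. indicator {..\<chi> i. a i} x)"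
    proof (rule integral_dominated_convergence[where w="\<lambda>_. 1"])
      show "AE x in \<rho>. (\<lambda>k. test_fun k a x) \<longlonglongrightarrow> indicator {..\<chi> i. a i} x"
        using t by (auto elim!: eventually_mono intro: test_fun_tendsto[OF that(2)])
    qed (auto intro!: m simp: test_fun_bounds abs_of_nonneg)
    then show ?thesis using t by simp
  qed
  have rat: "measure \<mu> {..\<chi> i. of_rat (a i)} = measure \<nu> {..\<chi> i. of_rat (a i)}" if "\<And>i. 0 \<le> a i" for a :: "'n \<Rightarrow> rat"
  proof -
    have a: "\<And>i. 0 \<le> (of_rat (a i) :: real)" using that by simp
    show ?thesis
      using lim1[OF assms(1) a] lim1[OF assms(2) a] unfolding eq by (rule LIMSEQ_unique)
  qed
  have real: "measure \<mu> {..a} = measure \<nu> {..a}" for a :: "real^'n"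
  proof (cases "\<forall>i. 0 \<le> a $ i")
    case False
    then obtain i where i: "a $ i < 0" using not_le by blast
    have "measure \<rho> {..a} = 0" if "torus_prob \<rho>" for \<rho>
    proof -
      note t = T[OF that]
      then interpret prob_space \<rho> by simp
      have "AE x in \<rho>. x \<notin> {..a}"
        using t i by (auto elim!: eventually_mono simp: unit_cell_def less_eq_vec_def) (meson le_less_trans not_le)
      then show ?thesis using t prob_eq_0[of "{..a}"] by simp
    qed
    then show ?thesis using assms by simp
  next
    case True
    \<comment> \<open>The rational corners lie strictly above \<open>a\<close>, so that every point
      of the closed orthant stays in all approximating orthants, while each other point eventually
      leaves them.\<close>
    have ex: "\<exists>r. a $ i < of_rat r \<and> of_rat r < a $ i + 1 / Suc j" for i j
      using of_rat_dense[of "a $ i" "a $ i + 1 / Suc j"] by simp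
    define r where "r j i = (SOME r. a $ i < of_rat r \<and> of_rat r < a $ i + 1 / Suc j)" for j :: nat and i
    have r: "a $ i < of_rat (r j i)" "of_rat (r j i) < a $ i + 1 / Suc j" for i j
      using someI_ex[OF ex, of i j] unfolding r_def by blast+
    have r0: "0 \<le> r j i" for j i
      using r(1)[of i j] True by (metis le_less_trans less_imp_le of_rat_less_eq of_rat_0 zero_le_of_rat_iff)
    have lim2: "(\<lambda>j. measure \<rho> {..\<chi> i. of_rat (r j i)}) \<longlonglongrightarrow> measure \<rho> {..a}" if "torus_prob \<rho>" for \<rho>
    proof -
      note t = T[OF that]
      then interpret prob_space \<rho> by simp
      have m: "f \<in> borel_measurable borel \<Longrightarrow> f \<in> borel_measurable \<rho>" for f :: "real^'n \<Rightarrow> real"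
        using t measurable_cong_sets by blast
      have "(\<lambda>j. LINT x|\<rho>. indicator {..\<chi> i. of_rat (r j i)} x) \<longlonglongrightarrow> (LINT x|\<rho>. indicator {..a} x :: real)"
      proof (rule integral_dominated_convergence[where w="\<lambda>_. 1"])
        show "AE x in \<rho>. (\<lambda>j. indicator {..\<chi> i. of_rat (r j i)} x) \<longlonglongrightarrow> (indicator {..a} x :: real)"
        proof (rule AE_I2)
          fix x
          show "(\<lambda>j. indicator {..\<chi> i. of_rat (r j i)} x) \<longlonglongrightarrow> (indicator {..a} x :: real)"
          proof (cases "x \<le> a")
            case True
            then have "x \<in> {..\<chi> i. of_rat (r j i)}" for j
              using r(1)[of _ j] by (auto simp: less_eq_vec_def intro: less_imp_le le_less_trans)
            then show ?thesis using True by simp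
          next
            case False
            then obtain i where i: "a $ i < x $ i" by (auto simp: less_eq_vec_def not_le)
            obtain J :: nat where J: "1 / (x $ i - a $ i) < real J" using reals_Archimedean2 by blast
            have "x \<notin> {..\<chi> i. of_rat (r j i)}" if "j \<ge> J" for j
            proof
              assume "x \<in> {..\<chi> i. of_rat (r j i)}"
              then have "x $ i \<le> of_rat (r j i)" by (simp add: less_eq_vec_def)
              then have "x $ i - a $ i < 1 / Suc j" using r(2)[of j i] by linarith
              moreover have "1 / (x $ i - a $ i) < Suc j" using J that by linarith
              then have "1 / Suc j < x $ i - a $ i" using i by (simp add: field_simps)
              ultimately show False by linarith
            qed
            then have "\<forall>\<^sub>F j in sequentially. indicator {..\<chi> i. of_rat (r j i)} x = (indicator {..a} x :: real)"
              using False unfolding eventually_sequentially by (intro exI[of _ J]) simp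
            then show ?thesis by (rule tendsto_eventually)
          qed
        qed
      qed (auto intro!: m)
      then show ?thesis using t by simp
    qed
    have "(\<lambda>j. measure \<mu> {..\<chi> i. of_rat (r j i)}) = (\<lambda>j. measure \<nu> {..\<chi> i. of_rat (r j i)})"
      using rat[OF r0] by simp
    then show ?thesis using lim2[OF assms(1)] lim2[OF assms(2)] LIMSEQ_unique by metis
  qed
  note t = T[OF assms(1)] T[OF assms(2)]
  interpret m: prob_space \<mu> using t by simp
  interpret n: prob_space \<nu> using t by simp
  show ?thesis
  proof (rule measure_eqI_generator_eq[of "range atMost" UNIV \<mu> \<nu> "\<lambda>j. {..\<chi> i. real j}"])
    show "Int_stable (range (atMost :: real^'n \<Rightarrow> _))"
    proof -
      have "{..a} \<inter> {..b} = {..\<chi> i. min (a $ i) (b $ i)}" for a b :: "real^'n"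
        by (auto simp: less_eq_vec_def)
      then show ?thesis unfolding Int_stable_def by blast
    qed
    show "emeasure \<mu> X = emeasure \<nu> X" if "X \<in> range atMost" for X
      using that real by (auto simp: m.emeasure_eq_measure n.emeasure_eq_measure)
    show "sets \<mu> = sigma_sets UNIV (range atMost)" "sets \<nu> = sigma_sets UNIV (range atMost)"
      using t by (simp_all add: borel_eq_atMost)
    show "(\<Union>j. {..(\<chi> i. real j) :: real^'n}) = UNIV"
    proof (intro set_eqI iffI UNIV_I)
      fix x :: "real^'n"
      obtain j where "norm x \<le> real j" using real_arch_simple by blast
      then have "x $ i \<le> real j" for i using component_le_norm_cart[of x i] by linarith
      then show "x \<in> (\<Union>j. {..(\<chi> i. real j)})" by (auto simp: less_eq_vec_def)
    qed
  qed auto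
qed

subsection \<open>Weak derivatives in time\<close>

text \<open>A Dynkin argument: the sets over which g integrates to 0 are closed under disjoint
  unions and, because the total integral is 0, under complements; the intervals are stable under
  intersection.\<close>

lemma set_lebesgue_integral_eq_zero_on_intervals:
  fixes g :: "real \<Rightarrow> real"
  assumes g: "integrable lborel g" and 0: "\<And>a b. (LINT t:{a<..<b}|lborel. g t) = 0" and g0: "(LINT t|lborel. g t) = 0"
  shows "AE t in lborel. g t = 0"
proof -
  have borel_eq: "sets (borel :: real measure) = sigma_sets UNIV (range (\<lambda>(a, b). {a<..<b}))"
    using arg_cong[where f=sets, OF borel_eq_box[where 'a=real]] by (simp add: box_real)
  have *: "(LINT t:A|lborel. g t) = 0" if "A \<in> sets borel" for A
  proof -
    have "A \<in> sigma_sets UNIV (range (\<lambda>(a, b). {a<..<b::real}))"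
      using that by (simp add: borel_eq)
    then show ?thesis
    proof (rule sigma_sets_induct_disjoint[rotated 2])
      have "{a<..<b} \<inter> {c<..<d} = {max a c<..<min b d}" for a b c d :: real by auto
      then show "Int_stable (range (\<lambda>(a, b). {a<..<b::real}))"
        unfolding Int_stable_def by (auto intro!: range_eqI[where x="(_, _)"])
      show "(LINT t:B|lborel. g t) = 0" if "B \<in> range (\<lambda>(a, b). {a<..<b})" for B
        using that 0 by auto
      show "(LINT t:{}|lborel. g t) = 0" by (simp add: set_lebesgue_integral_def)
    next
      fix B assume "B \<in> sigma_sets UNIV (range (\<lambda>(a, b). {a<..<b::real}))" and B0: "(LINT t:B|lborel. g t) = 0"
      then have B: "B \<in> sets borel" by (simp add: borel_eq)
      have i: "integrable lborel (\<lambda>t. indicator B t *\<^sub>R g t)" using g B by (intro integrable_mult_indicator) auto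
      have "(LINT t:UNIV - B|lborel. g t) = (LINT t|lborel. g t - indicator B t *\<^sub>R g t)"
        unfolding set_lebesgue_integral_def by (rule Bochner_Integration.integral_cong) (auto simp: indicator_def)
      also have "\<dots> = 0" using B0 g0 i g by (simp add: set_lebesgue_integral_def)
      finally show "(LINT t:UNIV - B|lborel. g t) = 0" .
    next
      fix B :: "nat \<Rightarrow> real set"
      assume d: "disjoint_family B" and s: "range B \<subseteq> sigma_sets UNIV (range (\<lambda>(a, b). {a<..<b::real}))"
        and z: "\<And>i. (LINT t:B i|lborel. g t) = 0"
      have B: "B i \<in> sets borel" for i using s by (auto simp: borel_eq)
      have "(LINT t:(\<Union>i. B i)|lborel. g t) = (\<Sum>i. (LINT t:B i|lborel. g t))"
      proof (rule lebesgue_integral_countable_add)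
        show "B i \<inter> B j = {}" if "i \<noteq> j" for i j using d that by (auto simp: disjoint_family_on_def)
        show "set_integrable lborel (\<Union>i. B i) g"
          unfolding set_integrable_def using B g by (intro integrable_mult_indicator) auto
      qed (use B in auto)
      then show "(LINT t:(\<Union>i. B i)|lborel. g t) = 0" by (simp add: z)
    qed auto
  qed
  show ?thesis by (rule sigma_finite_measure.density_zero[OF sigma_finite_lborel g]) (simp add: *)
qed

text \<open>A continuous unit step of width 1; its primitive \<open>ramp_int\<close> is C^1 and
  stays within 1/2 of max 0 y. Rescaled, differences of the two approximate an indicator and a
  piecewise linear function by functions that may be used as tests.\<close>

definition ramp :: "real \<Rightarrow> real" where "ramp y = max 0 y - max 0 (y - 1)"
definition ramp_int :: "real \<Rightarrow> real" where "ramp_int y = (pos_sq y - pos_sq (y - 1)) / 2"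

lemma ramp_int_deriv: "(ramp_int has_real_derivative ramp y) (at y)"
proof -
  have "((\<lambda>y. pos_sq (y - 1)) has_real_derivative 2 * max 0 (y - 1) * 1) (at y)"
    by (rule DERIV_chain2[OF pos_sq_deriv]) (auto intro!: derivative_eq_intros)
  from DERIV_cdivide[OF DERIV_diff[OF pos_sq_deriv this], of 2]
  show ?thesis unfolding ramp_int_def[abs_def] ramp_def by (simp add: diff_divide_distrib)
qed

lemma ramp_simps: "y \<le> 0 \<Longrightarrow> ramp y = 0" "1 \<le> y \<Longrightarrow> ramp y = 1" "0 \<le> ramp y" "ramp y \<le> 1"
  by (auto simp: ramp_def)

lemma ramp_int_close: "\<bar>ramp_int y - max 0 y\<bar> \<le> 1 / 2"
proof -
  consider "y \<le> 0" | "0 \<le> y" "y \<le> 1" | "1 \<le> y" by linarith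
  then show ?thesis
  proof cases
    case 2
    then have "0 \<le> (1 - y)\<^sup>2" "(1 - y)\<^sup>2 \<le> 1" by (auto intro!: power_le_one)
    moreover have "y\<^sup>2 / 2 - y = (1 - y)\<^sup>2 / 2 - 1 / 2" by (simp add: power2_eq_square field_simps)
    ultimately have "\<bar>y\<^sup>2 / 2 - y\<bar> \<le> 1 / 2" by linarith
    then show ?thesis using 2 by (simp add: ramp_int_def pos_sq_def)
  next
    case 3
    then have "ramp_int y = y - 1 / 2" by (simp add: ramp_int_def pos_sq_def power2_eq_square field_simps)
    then show ?thesis using 3 by simp
  qed (simp add: ramp_int_def pos_sq_def)
qed

lemma ramp_int_ge_1: "1 \<le> y \<Longrightarrow> ramp_int y = y - 1 / 2"
  by (simp add: ramp_int_def pos_sq_def power2_eq_square field_simps)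

text \<open>The natural test is the function \<zeta> with derivative the indicator of (a, b) and
  \<zeta> = 0 after b: it isolates the integral of F over (a, b). Fubini's theorem gives the same
  value for the candidate primitive \<open>H\<close>. As \<zeta> has corners, it is replaced by ramp
  primitives and a limit; equality over all intervals gives F = \<open>H\<close> almost
  everywhere.\<close>

lemma weak_derivative_imp_primitive:
  fixes F f :: "real \<Rightarrow> real"
  assumes F: "set_integrable lborel {0<..<T} F" and f: "set_integrable lborel {0<..<T} f"
    and T: "0 < T"
    and weak: "\<And>\<zeta> \<zeta>'. (\<And>t. (\<zeta> has_real_derivative \<zeta>' t) (at t)) \<Longrightarrow> continuous_on UNIV \<zeta>' \<Longrightarrow>
      (\<exists>b<T. \<forall>t\<ge>b. \<zeta> t = 0) \<Longrightarrow> (LINT t:{0<..<T}|lborel. F t * \<zeta>' t + f t * \<zeta> t) + \<zeta> 0 * c0 = 0"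
  shows "AE t in lborel. t \<in> {0<..<T} \<longrightarrow> F t = c0 + (LINT s:{0<..<t}|lborel. f s)"
proof -
  define fT where "fT s = indicator {0<..<T} s *\<^sub>R f s" for s
  define FT where "FT s = indicator {0<..<T} s *\<^sub>R F s" for s
  have fT: "integrable lborel fT" and FT: "integrable lborel FT"
    using F f unfolding set_integrable_def fT_def FT_def by auto
  have [measurable]: "fT \<in> borel_measurable borel" "FT \<in> borel_measurable borel"
    using fT FT by (auto dest: borel_measurable_integrable)
  define H where "H t = c0 + (LINT s|lborel. indicator {..<t} s *\<^sub>R fT s)" for t
  have Hf: "H t = c0 + (LINT s:{0<..<t}|lborel. f s)" if "t \<in> {0<..<T}" for t
    unfolding H_def set_lebesgue_integral_def fT_def using that
    by (auto intro!: Bochner_Integration.integral_cong simp: indicator_def)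
  \<comment> \<open>Integrating \<open>H\<close> over (a, b) and exchanging the integrals weights
    \<open>fT s\<close> with the length of the part of (a, b) after s; this length is -\<zeta>(s)
    for the \<zeta> defined below.\<close>
  have Fub: "integrable lborel (\<lambda>t. indicator {a<..<b} t *\<^sub>R H t) \<and>
      (LINT t|lborel. indicator {a<..<b} t *\<^sub>R H t) = c0 * (b - a) - (LINT s|lborel. fT s * (max 0 (s - a) - max 0 (s - b) - (b - a)))"
    if ab: "a < b" for a b
  proof -
    let ?g = "\<lambda>t s. indicator {a<..<b} t * (indicator {..<t} s * fT s)"
    have gm: "case_prod ?g \<in> borel_measurable (lborel \<Otimes>\<^sub>M lborel)"
    proof -
      have "(\<lambda>z. indicator {a<..<b} (fst z) * (indicator {z. snd z < fst z} z * fT (snd z))) \<in> borel_measurable (lborel \<Otimes>\<^sub>M lborel)"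
        by measurable
      moreover have "case_prod ?g = (\<lambda>z. indicator {a<..<b} (fst z) * (indicator {z. snd z < fst z} z * fT (snd z)))"
        by (auto simp: fun_eq_iff indicator_def)
      ultimately show ?thesis by simp
    qed
    have ii: "integrable lborel (indicator {a<..<b} :: real \<Rightarrow> real)"
      using ab by (intro integrable_real_indicator) auto
    have gi: "integrable (lborel \<Otimes>\<^sub>M lborel) (case_prod ?g)"
    proof (rule lborel_pair.Fubini_integrable[OF gm])
      have i: "integrable lborel (\<lambda>s. indicator {..<t} s * fT s)" for t
        using integrable_mult_indicator[OF _ fT, of "{..<t}"] by simp
      show "AE x in lborel. integrable lborel (\<lambda>y. case (x, y) of (t, s) \<Rightarrow> ?g t s)"
        using i by simp
      show "integrable lborel (\<lambda>x. LINT y|lborel. norm (case (x, y) of (t, s) \<Rightarrow> ?g t s))"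
      proof (rule Bochner_Integration.integrable_bound)
        show "integrable lborel (\<lambda>t. indicator {a<..<b} t * (LINT s|lborel. \<bar>fT s\<bar>))"
          by (rule integrable_mult_left) (rule ii)
        show "(\<lambda>x. LINT y|lborel. norm (case (x, y) of (t, s) \<Rightarrow> ?g t s)) \<in> borel_measurable lborel"
          using gm by (intro lborel.borel_measurable_lebesgue_integral) (simp add: split_def)
        show "AE x in lborel. norm (LINT y|lborel. norm (case (x, y) of (t, s) \<Rightarrow> ?g t s))
            \<le> norm (indicator {a<..<b} x * (LINT s|lborel. \<bar>fT s\<bar>))"
        proof (rule AE_I2)
          fix t :: real
          have "(LINT s|lborel. \<bar>?g t s\<bar>) \<le> (LINT s|lborel. indicator {a<..<b} t * \<bar>fT s\<bar>)"
            using i fT by (intro integral_mono) (auto simp: indicator_def)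
          then show "norm (LINT y|lborel. norm (case (t, y) of (t, s) \<Rightarrow> ?g t s))
            \<le> norm (indicator {a<..<b} t * (LINT s|lborel. \<bar>fT s\<bar>))" by simp
        qed
      qed
    qed
    have in1: "integrable lborel (\<lambda>t. LINT s|lborel. ?g t s)"
      using lborel_pair.integrable_fst'[OF gi] by simp
    have ind: "integrable lborel (\<lambda>t. indicator {a<..<b} t * c0)"
      by (rule integrable_mult_left) (rule ii)
    have eqH: "indicator {a<..<b} t *\<^sub>R H t = indicator {a<..<b} t * c0 + (LINT s|lborel. ?g t s)" for t
      by (simp add: H_def distrib_left)
    have "(LINT t|lborel. (LINT s|lborel. ?g t s)) = (LINT s|lborel. (LINT t|lborel. ?g t s))"
      by (rule lborel_pair.Fubini_integral[OF gi, symmetric])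
    also have "\<dots> = (LINT s|lborel. - (fT s * (max 0 (s - a) - max 0 (s - b) - (b - a))))"
    proof (rule Bochner_Integration.integral_cong[OF refl])
      fix s
      have "(LINT t|lborel. ?g t s) = (LINT t|lborel. indicator {max a s<..<b} t * fT s)"
        by (rule Bochner_Integration.integral_cong) (auto simp: indicator_def)
      also have "\<dots> = measure lborel {max a s<..<b} * fT s"
        by simp
      also have "measure lborel {max a s<..<b} = - (max 0 (s - a) - max 0 (s - b) - (b - a))"
      proof (cases "max a s \<le> b")
        case True
        then show ?thesis using ab by (auto simp: measure_def max_def)
      next
        case False
        then have "{max a s<..<b} = {}" by auto
        then show ?thesis using False ab by (simp add: max_def split: if_splits)
      qed
      finally show "(LINT t|lborel. ?g t s) = - (fT s * (max 0 (s - a) - max 0 (s - b) - (b - a)))" by (simp add: algebra_simps)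
    qed
    finally have "(LINT t|lborel. (LINT s|lborel. ?g t s)) = - (LINT s|lborel. fT s * (max 0 (s - a) - max 0 (s - b) - (b - a)))"
      by simp
    moreover have "(LINT t|lborel. indicator {a<..<b} t * c0) = c0 * (b - a)"
      using ab by simp
    ultimately show ?thesis
      unfolding eqH using in1 ind by simp
  qed
  have interval: "(LINT t|lborel. indicator {a<..<b} t *\<^sub>R (FT t - indicator {0<..<T} t * H t)) = 0"
    if ab: "0 \<le> a" "a < b" "b \<le> T" for a b
  proof -
    define \<zeta> where "\<zeta> t = max 0 (t - a) - max 0 (t - b) - (b - a)" for t :: real
    \<comment> \<open>The offset 2 completes the second ramp at b - 1/n, so that \<zeta>n vanishes
      from there on and its support stays away from T even if b = T. The subtracted constant is the
      value of the difference of the ramp primitives after that time.\<close>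
    define \<zeta>n where "\<zeta>n n t = (ramp_int (n * (t - a)) - ramp_int (n * (t - b) + 2)) / n - (b - a - 2 / n)" for n t :: real
    define \<kappa> where "\<kappa> n t = ramp (n * (t - a)) - ramp (n * (t - b) + 2)" for n t :: real
    \<comment> \<open>For n from N on the interval has length at least 2/n, so both ramps are
      complete at time b - 1/n.\<close>
    obtain N :: nat where N: "2 / (b - a) < real N" using reals_Archimedean2 by blast
    have Npos: "0 < n \<and> 2 \<le> n * (b - a)" if "real N \<le> n" for n :: real
    proof -
      have "2 / (b - a) < n" "0 < 2 / (b - a)" using N that ab by auto
      then have "0 < n" by linarith
      with \<open>2 / (b - a) < n\<close> show ?thesis using ab by (simp add: pos_divide_less_eq less_imp_le)
    qed
    have eq: "(LINT t|lborel. FT t * \<kappa> n t) + (LINT t|lborel. fT t * \<zeta>n n t) + \<zeta>n n 0 * c0 = 0"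
      and z_close: "\<bar>\<zeta>n n t - \<zeta> t\<bar> \<le> 5 / n" and kap: "\<bar>\<kappa> n t\<bar> \<le> 1"
      if n: "real N \<le> n" for n t
    proof -
      note n' = Npos[OF n]
      have d: "(\<zeta>n n has_real_derivative \<kappa> n t) (at t)" for t
      proof -
        have 1: "((\<lambda>t. ramp_int (n * (t - a))) has_real_derivative ramp (n * (t - a)) * n) (at t)"
          by (rule DERIV_chain2[OF ramp_int_deriv]) (auto intro!: derivative_eq_intros)
        have 2: "((\<lambda>t. ramp_int (n * (t - b) + 2)) has_real_derivative ramp (n * (t - b) + 2) * n) (at t)"
          by (rule DERIV_chain2[OF ramp_int_deriv]) (auto intro!: derivative_eq_intros)
        have "(\<zeta>n n has_real_derivative (ramp (n * (t - a)) * n - ramp (n * (t - b) + 2) * n) / n - 0) (at t)"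
          unfolding \<zeta>n_def[abs_def] by (intro DERIV_diff DERIV_cdivide 1 2 DERIV_const)
        moreover have "(ramp (n * (t - a)) * n - ramp (n * (t - b) + 2) * n) / n - 0 = \<kappa> n t"
          using n' by (simp add: \<kappa>_def left_diff_distrib[symmetric])
        ultimately show ?thesis by simp
      qed
      have c: "continuous_on UNIV (\<kappa> n)"
        unfolding \<kappa>_def[abs_def] ramp_def by (intro continuous_intros)
      have z: "\<zeta>n n t = 0" if "t \<ge> b - 1 / n" for t
      proof -
        have 1: "1 \<le> n * (t - b) + 2" using that n' by (simp add: field_simps)
        have 2: "1 \<le> n * (t - a)" using 1 n' by (simp add: algebra_simps)
        show ?thesis unfolding \<zeta>n_def ramp_int_ge_1[OF 1] ramp_int_ge_1[OF 2] using n' by (simp add: field_simps)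
      qed
      have "\<exists>b<T. \<forall>t\<ge>b. \<zeta>n n t = 0"
      proof (intro exI conjI allI impI)
        have "0 < 1 / n" using n' by simp
        then show "b - 1 / n < T" using ab by linarith
      qed (rule z)
      from weak[OF d c this] have w: "(LINT t:{0<..<T}|lborel. F t * \<kappa> n t + f t * \<zeta>n n t) + \<zeta>n n 0 * c0 = 0" .
      show kap: "\<bar>\<kappa> n t\<bar> \<le> 1" for t
        using ramp_simps(3,4)[of "n * (t - a)"] ramp_simps(3,4)[of "n * (t - b) + 2"] by (simp add: \<kappa>_def)
      show zc: "\<bar>\<zeta>n n t - \<zeta> t\<bar> \<le> 5 / n" for t
      proof -
        have s1: "\<bar>ramp_int (n * (t - a)) - n * max 0 (t - a)\<bar> \<le> 1 / 2"
          using ramp_int_close[of "n * (t - a)"] n' by (simp add: max_mult_distrib_left)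
        have "\<bar>max 0 (n * (t - b) + 2) - max 0 (n * (t - b))\<bar> \<le> 2" by (auto simp: max_def)
        moreover have "max 0 (n * (t - b)) = n * max 0 (t - b)" using n' by (simp add: max_mult_distrib_left)
        ultimately have s2: "\<bar>ramp_int (n * (t - b) + 2) - n * max 0 (t - b)\<bar> \<le> 5 / 2"
          using ramp_int_close[of "n * (t - b) + 2"] by linarith
        \<comment> \<open>The three errors 1/2, 5/2 and 2 add up to the constant 5; the middle one
          is the shift by 2 plus the ramp error.\<close>
        have "n * (\<zeta>n n t - \<zeta> t) = (ramp_int (n * (t - a)) - n * max 0 (t - a)) - (ramp_int (n * (t - b) + 2) - n * max 0 (t - b)) + 2"
          using n' by (simp add: \<zeta>n_def \<zeta>_def field_simps)
        then have "\<bar>n * (\<zeta>n n t - \<zeta> t)\<bar> \<le> 5" using s1 s2 by linarith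
        then show ?thesis using n' by (simp add: abs_mult pos_le_divide_eq mult.commute)
      qed
      have cz: "continuous_on UNIV (\<zeta>n n)"
        by (intro continuous_at_imp_continuous_on ballI DERIV_isCont[OF d])
      have m: "\<kappa> n \<in> borel_measurable borel" "\<zeta>n n \<in> borel_measurable borel"
        using c cz by (auto intro: borel_measurable_continuous_onI)
      have zb: "\<bar>\<zeta> t\<bar> \<le> b - a" for t using ab by (auto simp: \<zeta>_def max_def)
      have i1: "integrable lborel (\<lambda>t. FT t * \<kappa> n t)"
        by (rule Bochner_Integration.integrable_bound[OF FT])
          (use m kap in \<open>auto simp: abs_mult intro!: mult_left_le\<close>)
      have i2: "integrable lborel (\<lambda>t. fT t * \<zeta>n n t)"
      proof (rule Bochner_Integration.integrable_bound[OF integrable_mult_right[OF integrable_norm[OF fT], of "b - a + 5 / n"]])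
        show "AE t in lborel. norm (fT t * \<zeta>n n t) \<le> norm ((b - a + 5 / n) * norm (fT t))"
        proof (rule AE_I2)
          fix t
          have "\<bar>\<zeta>n n t\<bar> \<le> b - a + 5 / n" using zb[of t] zc[of t] by linarith
          then have "\<bar>fT t\<bar> * \<bar>\<zeta>n n t\<bar> \<le> \<bar>fT t\<bar> * \<bar>b - a + 5 / n\<bar>" by (intro mult_left_mono) auto
          then show "norm (fT t * \<zeta>n n t) \<le> norm ((b - a + 5 / n) * norm (fT t))" by (simp add: abs_mult mult.commute)
        qed
      qed (use m in simp)
      have "(LINT t:{0<..<T}|lborel. F t * \<kappa> n t + f t * \<zeta>n n t) = (LINT t|lborel. FT t * \<kappa> n t + fT t * \<zeta>n n t)"
        unfolding set_lebesgue_integral_def FT_def fT_def by (simp add: algebra_simps)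
      also have "\<dots> = (LINT t|lborel. FT t * \<kappa> n t) + (LINT t|lborel. fT t * \<zeta>n n t)"
        using i1 i2 by simp
      finally show "(LINT t|lborel. FT t * \<kappa> n t) + (LINT t|lborel. fT t * \<zeta>n n t) + \<zeta>n n 0 * c0 = 0"
        using w by simp
    qed
    have km: "\<kappa> n \<in> borel_measurable borel" "\<zeta>n n \<in> borel_measurable borel" for n
      unfolding \<kappa>_def[abs_def] \<zeta>n_def[abs_def] ramp_def ramp_int_def pos_sq_def by measurable
    have ev: "\<forall>\<^sub>F n in sequentially. real N \<le> real n"
      using eventually_ge_at_top[of N] by eventually_elim simp
    have zlim: "(\<lambda>n. \<zeta>n (real n) t) \<longlonglongrightarrow> \<zeta> t" for t
    proof (rule Lim_null[THEN iffD2], rule Lim_null_comparison)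
      show "\<forall>\<^sub>F n in sequentially. norm (\<zeta>n (real n) t - \<zeta> t) \<le> 5 / real n"
        using ev by eventually_elim (use z_close in simp)
      show "(\<lambda>n. 5 / real n) \<longlonglongrightarrow> 0" by (rule lim_const_over_n)
    qed
    have klim: "(\<lambda>n. \<kappa> (real n) t) \<longlonglongrightarrow> indicator {a<..<b} t" for t
    proof (rule tendsto_eventually)
      have big: "\<forall>\<^sub>F n in sequentially. 1 \<le> real n * y" if "y > 0" for y :: real
      proof -
        obtain K :: nat where K: "1 / y < real K" using reals_Archimedean2 by blast
        show ?thesis using eventually_ge_at_top[of K]
        proof eventually_elim
          case (elim n)
          then have "1 / y < real n" using K by linarith
          then show ?case using that by (simp add: pos_divide_less_eq less_imp_le)
        qed
      qed
      have big2: "\<forall>\<^sub>F n in sequentially. real n * (t - b) + 2 \<le> 0" if "t < b"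
        using big[of "(b - t) / 2"] that by (auto elim!: eventually_mono simp: field_simps)
      consider "t \<le> a" | "a < t" "t < b" | "b \<le> t" by linarith
      then show "\<forall>\<^sub>F n in sequentially. \<kappa> (real n) t = indicator {a<..<b} t"
      proof cases
        case 1
        then have "t < b" using ab by simp
        from big2[OF this] show ?thesis
        proof eventually_elim
          case (elim n)
          have "real n * (t - a) \<le> 0" using 1 by (simp add: mult_nonneg_nonpos)
          then show ?case using elim 1 by (simp add: \<kappa>_def ramp_simps)
        qed
      next
        case 2
        then have "0 < t - a" by simp
        from big[OF this] big2[OF 2(2)] show ?thesis
          by eventually_elim (use 2 in \<open>simp add: \<kappa>_def ramp_simps\<close>)
      next
        case 3
        then have "0 < t - a" using ab by simp
        from big[OF this] show ?thesis
        proof eventually_elim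
          case (elim n)
          have "0 \<le> real n * (t - b)" using 3 by simp
          then show ?case using elim 3 by (simp add: \<kappa>_def ramp_simps)
        qed
      qed
    qed
    \<comment> \<open>The index is shifted by N because the bounds that dominate the integrands are
      established from N on.\<close>
    have L1: "(\<lambda>n. LINT t|lborel. FT t * \<kappa> (real (n + N)) t) \<longlonglongrightarrow> (LINT t|lborel. FT t * indicator {a<..<b} t)"
    proof (rule integral_dominated_convergence[OF _ _ integrable_norm[OF FT]])
      show "AE t in lborel. (\<lambda>n. FT t * \<kappa> (real (n + N)) t) \<longlonglongrightarrow> FT t * indicator {a<..<b} t"
        by (intro AE_I2 tendsto_mult_left LIMSEQ_ignore_initial_segment[OF klim])
      show "AE t in lborel. norm (FT t * \<kappa> (real (n + N)) t) \<le> norm (FT t)" for n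
        using kap[of "real (n + N)"] by (auto simp: abs_mult intro!: mult_left_le)
    qed (use km in measurable)
    have L2: "(\<lambda>n. LINT t|lborel. fT t * \<zeta>n (real (n + N)) t) \<longlonglongrightarrow> (LINT t|lborel. fT t * \<zeta> t)"
    proof (rule integral_dominated_convergence[OF _ _ integrable_mult_right[OF integrable_norm[OF fT], of "b - a + 5 * (b - a)"]])
      show "AE t in lborel. (\<lambda>n. fT t * \<zeta>n (real (n + N)) t) \<longlonglongrightarrow> fT t * \<zeta> t"
        by (intro AE_I2 tendsto_mult_left LIMSEQ_ignore_initial_segment[OF zlim])
      show "AE t in lborel. norm (fT t * \<zeta>n (real (n + N)) t) \<le> (b - a + 5 * (b - a)) * norm (fT t)" for n
      proof (rule AE_I2)
        fix t
        have p: "0 < real (n + N) \<and> 2 \<le> real (n + N) * (b - a)" by (rule Npos) simp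
        have "\<bar>\<zeta> t\<bar> \<le> b - a" using ab by (auto simp: \<zeta>_def max_def)
        moreover have "5 / real (n + N) \<le> 5 * (b - a)"
        proof -
          have "5 \<le> 5 * (b - a) * real (n + N)" using p by (simp only: mult.assoc mult.commute[of "b - a"]) linarith
          then show ?thesis using p by (simp only: pos_divide_le_eq)
        qed
        ultimately have "\<bar>\<zeta>n (real (n + N)) t\<bar> \<le> b - a + 5 * (b - a)" using z_close[of "real (n + N)" t] by linarith
        then show "norm (fT t * \<zeta>n (real (n + N)) t) \<le> (b - a + 5 * (b - a)) * norm (fT t)"
          by (simp only: real_norm_def abs_mult mult.commute[of _ "\<bar>fT t\<bar>"]) (rule mult_left_mono, simp_all)
      qed
    qed (use km in \<open>auto simp: \<zeta>_def\<close>)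
    have L3: "(\<lambda>n. \<zeta>n (real (n + N)) 0 * c0) \<longlonglongrightarrow> \<zeta> 0 * c0"
      by (intro tendsto_mult_right LIMSEQ_ignore_initial_segment[OF zlim])
    have "(\<lambda>n. 0) \<longlonglongrightarrow> (LINT t|lborel. FT t * indicator {a<..<b} t) + (LINT t|lborel. fT t * \<zeta> t) + \<zeta> 0 * c0"
      using tendsto_add[OF tendsto_add[OF L1 L2] L3] eq[of "real (_ + N)"] by simp
    then have "(LINT t|lborel. FT t * indicator {a<..<b} t) + (LINT t|lborel. fT t * \<zeta> t) + \<zeta> 0 * c0 = 0"
      using LIMSEQ_unique tendsto_const by blast
    moreover have "\<zeta> 0 = - (b - a)" using ab by (simp add: \<zeta>_def)
    moreover have "(LINT t|lborel. indicator {a<..<b} t *\<^sub>R H t) = c0 * (b - a) - (LINT s|lborel. fT s * \<zeta> s)"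
      using Fub[OF ab(2)] unfolding \<zeta>_def by blast
    ultimately have e: "(LINT t|lborel. indicator {a<..<b} t * FT t) = (LINT t|lborel. indicator {a<..<b} t *\<^sub>R H t)"
      by (simp add: algebra_simps)
    have "(LINT t|lborel. indicator {a<..<b} t *\<^sub>R (FT t - indicator {0<..<T} t * H t))
        = (LINT t|lborel. indicator {a<..<b} t *\<^sub>R FT t - indicator {a<..<b} t *\<^sub>R H t)"
      using ab by (intro Bochner_Integration.integral_cong refl) (auto simp: indicator_def)
    also have "\<dots> = 0"
      using e Fub[OF ab(2)] integrable_mult_indicator[OF _ FT, of "{a<..<b}"] by simp
    finally show ?thesis .
  qed
  define g where "g t = FT t - indicator {0<..<T} t * H t" for t
  have gi: "integrable lborel g" unfolding g_def using Fub[OF T] FT by simp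
  have gl: "(LINT t:{a<..<b}|lborel. g t) = 0" for a b
  proof (cases "max a 0 < min b T")
    case True
    have "(LINT t:{a<..<b}|lborel. g t) = (LINT t|lborel. indicator {max a 0<..<min b T} t *\<^sub>R (FT t - indicator {0<..<T} t * H t))"
      unfolding set_lebesgue_integral_def g_def
      by (intro Bochner_Integration.integral_cong refl) (auto simp: indicator_def FT_def)
    then show ?thesis using interval[of "max a 0" "min b T"] True by simp
  next
    case False
    have "(LINT t:{a<..<b}|lborel. g t) = (LINT t|(lborel :: real measure). 0)"
      unfolding set_lebesgue_integral_def g_def using False
      by (intro Bochner_Integration.integral_cong refl) (auto simp: indicator_def FT_def)
    then show ?thesis by simp
  qed
  have "(LINT t|lborel. g t) = (LINT t:{0<..<T}|lborel. g t)"
    unfolding set_lebesgue_integral_def g_def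
    by (intro Bochner_Integration.integral_cong refl) (auto simp: indicator_def FT_def)
  then have "AE t in lborel. g t = 0"
    using set_lebesgue_integral_eq_zero_on_intervals[OF gi gl] gl by simp
  then show ?thesis
    by eventually_elim (auto simp: g_def FT_def Hf)
qed

subsection \<open>Borel solutions of the continuity equation\<close>

text \<open>Borel data, nonnegative at every point and periodic at every time, replace the almost
  everywhere conditions of \<open>admissible\<close>, so that Fubini over \<open>lborel\<close> and
  pointwise convexity apply directly. The initial datum enters through one functional of the test
  function, common to all competitors, and keeps its Lebesgue integral.\<close>

definition weak_solution ::
  "real \<Rightarrow> (real ^ 'n \<Rightarrow> real) \<Rightarrow> (real \<times> (real ^ 'n) \<Rightarrow> real) \<Rightarrow> (real \<times> (real ^ 'n) \<Rightarrow> real ^ 'n) \<Rightarrow> bool" where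
  "weak_solution T m0 M V \<longleftrightarrow>
     M \<in> borel_measurable borel \<and> V \<in> borel_measurable borel \<and> (\<forall>z. 0 \<le> M z) \<and>
     (\<forall>t. periodic (\<lambda>x. M (t, x)) \<and> periodic (\<lambda>x. V (t, x))) \<and>
     set_integrable lborel ({0<..<T} \<times> unit_cell) M \<and>
     set_integrable lborel ({0<..<T} \<times> unit_cell) (\<lambda>z. M z *\<^sub>R V z) \<and>
     (AE t in lborel. t \<in> {0<..<T} \<longrightarrow> (LINT x:unit_cell|lborel. M (t, x)) = 1) \<and>
     (\<forall>\<phi> \<phi>t \<phi>x. C1c_test T \<phi> \<phi>t \<phi>x \<longrightarrow>
        (LINT z:{0<..<T} \<times> unit_cell|lborel. M z * \<phi>t z + (M z *\<^sub>R V z) \<bullet> \<phi>x z)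
        + (LINT x:unit_cell|lebesgue. \<phi> (0, x) * m0 x) = 0)"

lemma set_integral_Times:
  fixes g :: "real \<times> (real^'n) \<Rightarrow> real"
  assumes "set_integrable lborel (I \<times> A) g"
  shows "(LINT z:I \<times> A|lborel. g z) = (LINT t:I|lborel. (LINT x:A|lborel. g (t, x)))"
    and "set_integrable lborel I (\<lambda>t. LINT x:A|lborel. g (t, x))"
proof -
  have i: "integrable (lborel \<Otimes>\<^sub>M lborel) (\<lambda>z. indicator (I \<times> A) z *\<^sub>R g z)"
    using assms unfolding set_integrable_def lborel_prod .
  have e: "(LINT x|lborel. indicator (I \<times> A) (t, x) *\<^sub>R g (t, x)) = indicator I t *\<^sub>R (LINT x:A|lborel. g (t, x))" for t
    by (simp add: set_lebesgue_integral_def indicator_def)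
  show "(LINT z:I \<times> A|lborel. g z) = (LINT t:I|lborel. (LINT x:A|lborel. g (t, x)))"
    unfolding set_lebesgue_integral_def[of _ "I \<times> A"] set_lebesgue_integral_def[of _ I]
    using lborel_pair.integral_fst'[OF i] unfolding e lborel_prod by simp
  show "set_integrable lborel I (\<lambda>t. LINT x:A|lborel. g (t, x))"
    using lborel_pair.integrable_fst'[OF i] unfolding e set_integrable_def .
qed

lemma set_integrable_mult_bounded:
  fixes f g :: "'a::euclidean_space \<Rightarrow> real"
  assumes f: "set_integrable lborel A f" and g: "g \<in> borel_measurable borel" and B: "\<And>z. z \<in> A \<Longrightarrow> \<bar>g z\<bar> \<le> B"
  shows "set_integrable lborel A (\<lambda>z. f z * g z)"
proof -
  have i: "integrable lborel (\<lambda>z. indicator A z *\<^sub>R f z)" using f unfolding set_integrable_def .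
  have "integrable lborel (\<lambda>z. (indicator A z *\<^sub>R f z) * g z)"
  proof (rule Bochner_Integration.integrable_bound[OF integrable_mult_right[OF integrable_norm[OF i], of B]])
    show "(\<lambda>z. (indicator A z *\<^sub>R f z) * g z) \<in> borel_measurable lborel"
      using borel_measurable_times[OF borel_measurable_integrable[OF i], of g] g by simp
    show "AE z in lborel. norm ((indicator A z *\<^sub>R f z) * g z) \<le> norm (B * norm (indicator A z *\<^sub>R f z))"
    proof (rule AE_I2)
      fix z
      show "norm ((indicator A z *\<^sub>R f z) * g z) \<le> norm (B * norm (indicator A z *\<^sub>R f z))"
      proof (cases "z \<in> A")
        case True
        then have "\<bar>f z\<bar> * \<bar>g z\<bar> \<le> \<bar>f z\<bar> * \<bar>B\<bar>" using B[of z] by (intro mult_left_mono) auto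
        then show ?thesis using True by (simp add: abs_mult mult.commute)
      qed simp
    qed
  qed
  then show ?thesis unfolding set_integrable_def by (simp add: mult.assoc)
qed

lemma set_integrable_inner_bounded:
  fixes f g :: "'a::euclidean_space \<Rightarrow> 'b::euclidean_space"
  assumes f: "set_integrable lborel A f" and g: "g \<in> borel_measurable borel" and B: "\<And>z. z \<in> A \<Longrightarrow> norm (g z) \<le> B"
  shows "set_integrable lborel A (\<lambda>z. f z \<bullet> g z)"
proof -
  have i: "integrable lborel (\<lambda>z. indicator A z *\<^sub>R f z)" using f unfolding set_integrable_def .
  have "integrable lborel (\<lambda>z. (indicator A z *\<^sub>R f z) \<bullet> g z)"
  proof (rule Bochner_Integration.integrable_bound[OF integrable_mult_right[OF integrable_norm[OF i], of B]])
    show "(\<lambda>z. (indicator A z *\<^sub>R f z) \<bullet> g z) \<in> borel_measurable lborel"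
      using borel_measurable_inner[OF borel_measurable_integrable[OF i], of g] g by simp
    show "AE z in lborel. norm ((indicator A z *\<^sub>R f z) \<bullet> g z) \<le> norm (B * norm (indicator A z *\<^sub>R f z))"
    proof (rule AE_I2)
      fix z
      show "norm ((indicator A z *\<^sub>R f z) \<bullet> g z) \<le> norm (B * norm (indicator A z *\<^sub>R f z))"
      proof (cases "z \<in> A")
        case True
        have "\<bar>f z \<bullet> g z\<bar> \<le> norm (f z) * norm (g z)" by (rule Cauchy_Schwarz_ineq2)
        also have "\<dots> \<le> norm (f z) * \<bar>B\<bar>" using B[OF True] by (intro mult_left_mono) auto
        finally show ?thesis using True by (simp add: abs_mult mult.commute)
      qed simp
    qed
  qed
  then show ?thesis unfolding set_integrable_def by simp
qed

lemma compact_interval_bounded: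
  fixes h :: "real \<Rightarrow> real"
  assumes "continuous_on UNIV h"
  obtains B where "\<And>t. t \<in> {0<..<T} \<Longrightarrow> \<bar>h t\<bar> \<le> B"
proof -
  have "compact (h ` {0..T})"
    by (intro compact_continuous_image continuous_on_subset[OF assms]) auto
  then obtain B where B: "\<forall>y\<in>h ` {0..T}. norm y \<le> B"
    using compact_imp_bounded bounded_iff by blast
  show ?thesis by (rule that[of B]) (use B in auto)
qed

lemma borel_measurable_fst_compose:
  "h \<in> borel_measurable borel \<Longrightarrow> (\<lambda>z :: real \<times> (real^'n). h (fst z)) \<in> borel_measurable borel"
  by (rule measurable_compose[OF borel_measurable_fst_snd(1)])

lemma borel_measurable_snd_compose:
  "h \<in> borel_measurable borel \<Longrightarrow> (\<lambda>z :: real \<times> (real^'n). h (snd z)) \<in> borel_measurable borel"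
  by (rule measurable_compose[OF borel_measurable_fst_snd(2)])

lemma gderiv_continuous:
  assumes "\<And>x. GDERIV f x :> D x"
  shows "continuous_on UNIV f"
proof (intro continuous_at_imp_continuous_on ballI)
  fix x show "isCont f x" using has_derivative_continuous assms[of x] unfolding gderiv_def by blast
qed

lemma C1c_test_product:
  fixes \<phi> :: "real^'n \<Rightarrow> real"
  assumes \<phi>: "C1_torus \<phi> D" and z: "\<And>t. (\<zeta> has_real_derivative \<zeta>' t) (at t)"
    and z': "continuous_on UNIV \<zeta>'" and b: "\<exists>b<T. \<forall>t\<ge>b. \<zeta> t = 0"
  shows "C1c_test T (\<lambda>z. \<zeta> (fst z) * \<phi> (snd z)) (\<lambda>z. \<zeta>' (fst z) * \<phi> (snd z)) (\<lambda>z. \<zeta> (fst z) *\<^sub>R D (snd z))"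
proof -
  have D: "\<And>x. GDERIV \<phi> x :> D x" "continuous_on UNIV D" "periodic \<phi>" using \<phi> by (auto simp: C1_torus_def)
  have cz: "continuous_on UNIV \<zeta>"
    by (intro continuous_at_imp_continuous_on ballI DERIV_isCont[OF z])
  have cp: "continuous_on UNIV \<phi>"
    by (rule gderiv_continuous[OF D(1)])
  have der: "((\<lambda>z. \<zeta> (fst z) * \<phi> (snd z)) has_derivative
        (\<lambda>(\<tau>, h). (\<zeta>' (fst z) * \<phi> (snd z)) * \<tau> + (\<zeta> (fst z) *\<^sub>R D (snd z)) \<bullet> h)) (at z within S)" for z S
  proof -
    have 1: "((\<lambda>z. \<zeta> (fst z)) has_derivative (\<lambda>h. \<zeta>' (fst z) * fst h)) (at z)"
      using has_derivative_compose[OF has_derivative_fst[OF has_derivative_ident, of "at z"]] z[of "fst z"]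
      unfolding has_field_derivative_def by blast
    have 2: "((\<lambda>z. \<phi> (snd z)) has_derivative (\<lambda>h. snd h \<bullet> D (snd z))) (at z)"
      using has_derivative_compose[OF has_derivative_snd[OF has_derivative_ident, of "at z"]] D(1)[of "snd z"]
      unfolding gderiv_def by blast
    have "((\<lambda>z. \<zeta> (fst z) * \<phi> (snd z)) has_derivative
        (\<lambda>h. \<zeta> (fst z) * (snd h \<bullet> D (snd z)) + (\<zeta>' (fst z) * fst h) * \<phi> (snd z))) (at z)"
      by (rule has_derivative_mult[OF 1 2])
    moreover have "(\<lambda>h. \<zeta> (fst z) * (snd h \<bullet> D (snd z)) + (\<zeta>' (fst z) * fst h) * \<phi> (snd z))
       = (\<lambda>(\<tau>, h). (\<zeta>' (fst z) * \<phi> (snd z)) * \<tau> + (\<zeta> (fst z) *\<^sub>R D (snd z)) \<bullet> h)"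
      by (auto simp: fun_eq_iff inner_commute algebra_simps)
    ultimately show ?thesis using has_derivative_at_withinI by simp
  qed
  show ?thesis
    unfolding C1c_test_def
  proof (intro conjI ballI)
    show "periodic (\<lambda>x. \<zeta> (fst (t, x)) * \<phi> (snd (t, x)))" for t using D(3) by (simp add: periodic_def)
    show "continuous_on ({0..<T} \<times> UNIV) (\<lambda>z. \<zeta>' (fst z) * \<phi> (snd z))"
      by (intro continuous_intros continuous_on_compose2[OF z'] continuous_on_compose2[OF cp]) auto
    show "continuous_on ({0..<T} \<times> UNIV) (\<lambda>z. \<zeta> (fst z) *\<^sub>R D (snd z))"
      by (intro continuous_intros continuous_on_compose2[OF cz] continuous_on_compose2[OF D(2)]) auto
    show "\<exists>T'<T. \<forall>t\<in>{T'..<T} \<inter> {0..}. \<forall>x. \<zeta> (fst (t, x)) * \<phi> (snd (t, x)) = 0"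
      using b by auto
  qed (rule der)
qed

text \<open>Testing with products \<zeta>(t) \<phi>(x) turns the continuity equation into a weak
  ordinary differential equation for the moment of \<phi>, driven by the flux against the gradient
  of \<phi>. Integrability of the flux makes the moment agree almost everywhere with a continuous
  function of time.\<close>

lemma weak_solution_moment:
  fixes \<phi> :: "real^'n \<Rightarrow> real"
  assumes sol: "weak_solution T m0 M V" and T: "0 < T" and \<phi>: "C1_torus \<phi> D"
  defines "f \<equiv> \<lambda>t. LINT x:unit_cell|lborel. (M (t, x) *\<^sub>R V (t, x)) \<bullet> D x"
  shows "set_integrable lborel {0<..<T} f"
    and "AE t in lborel. t \<in> {0<..<T} \<longrightarrow> (LINT x:unit_cell|lborel. M (t, x) * \<phi> x)
        = (LINT x:unit_cell|lebesgue. \<phi> x * m0 x) + (LINT s:{0<..<t}|lborel. f s)"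
proof -
  define F where "F t = (LINT x:unit_cell|lborel. M (t, x) * \<phi> x)" for t
  define c0 where "c0 = (LINT x:unit_cell|lebesgue. \<phi> x * m0 x)"
  have D: "\<And>x. GDERIV \<phi> x :> D x" "continuous_on UNIV D" "periodic \<phi>" using \<phi> by (auto simp: C1_torus_def)
  have pD: "periodic D" by (rule periodic_gradient[OF D(3,1)])
  have cp: "continuous_on UNIV \<phi>"
    by (rule gderiv_continuous[OF D(1)])
  obtain Bp where Bp: "\<And>x. norm (\<phi> x) \<le> Bp" using periodic_bounded[OF D(3) cp] by blast
  obtain Bd where Bd: "\<And>x. norm (D x) \<le> Bd" using periodic_bounded[OF pD D(2)] by blast
  have mp: "\<phi> \<in> borel_measurable borel" "D \<in> borel_measurable borel"
    using cp D(2) by (auto intro: borel_measurable_continuous_onI)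
  let ?Q = "{0<..<T} \<times> unit_cell :: (real \<times> (real^'n)) set"
  have iM: "set_integrable lborel ?Q M" and iV: "set_integrable lborel ?Q (\<lambda>z. M z *\<^sub>R V z)"
    using sol by (auto simp: weak_solution_def)
  have i1: "set_integrable lborel ?Q (\<lambda>z. M z * \<phi> (snd z))"
    by (rule set_integrable_mult_bounded[OF iM borel_measurable_snd_compose[OF mp(1)], of Bp]) (use Bp in simp)
  have i2: "set_integrable lborel ?Q (\<lambda>z. (M z *\<^sub>R V z) \<bullet> D (snd z))"
    by (rule set_integrable_inner_bounded[OF iV borel_measurable_snd_compose[OF mp(2)], of Bd]) (use Bd in simp)
  have iF: "set_integrable lborel {0<..<T} F"
    using set_integral_Times(2)[OF i1] unfolding F_def by simp
  show if': "set_integrable lborel {0<..<T} f"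
    using set_integral_Times(2)[OF i2] unfolding f_def by simp
  have "AE t in lborel. t \<in> {0<..<T} \<longrightarrow> F t = c0 + (LINT s:{0<..<t}|lborel. f s)"
  proof (rule weak_derivative_imp_primitive[OF iF if' T])
    fix \<zeta> \<zeta>' :: "real \<Rightarrow> real"
    assume z: "\<And>t. (\<zeta> has_real_derivative \<zeta>' t) (at t)" and z': "continuous_on UNIV \<zeta>'"
      and b: "\<exists>b<T. \<forall>t\<ge>b. \<zeta> t = 0"
    have cz: "continuous_on UNIV \<zeta>"
      by (intro continuous_at_imp_continuous_on ballI DERIV_isCont[OF z])
    have mz: "\<zeta> \<in> borel_measurable borel" "\<zeta>' \<in> borel_measurable borel"
      using cz z' by (auto intro: borel_measurable_continuous_onI)
    obtain Bz where Bz: "\<And>t. t \<in> {0<..<T} \<Longrightarrow> \<bar>\<zeta> t\<bar> \<le> Bz" by (rule compact_interval_bounded[OF cz]) blast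
    obtain Bz' where Bz': "\<And>t. t \<in> {0<..<T} \<Longrightarrow> \<bar>\<zeta>' t\<bar> \<le> Bz'" by (rule compact_interval_bounded[OF z']) blast
    have j1: "set_integrable lborel ?Q (\<lambda>z. M z * \<phi> (snd z) * \<zeta>' (fst z))"
      by (rule set_integrable_mult_bounded[OF i1 borel_measurable_fst_compose[OF mz(2)], of Bz']) (use Bz' in auto)
    have j2: "set_integrable lborel ?Q (\<lambda>z. (M z *\<^sub>R V z) \<bullet> D (snd z) * \<zeta> (fst z))"
      by (rule set_integrable_mult_bounded[OF i2 borel_measurable_fst_compose[OF mz(1)], of Bz]) (use Bz in auto)
    have "(LINT z:?Q|lborel. M z * (\<zeta>' (fst z) * \<phi> (snd z)) + (M z *\<^sub>R V z) \<bullet> (\<zeta> (fst z) *\<^sub>R D (snd z)))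
        + (LINT x:unit_cell|lebesgue. (\<zeta> (fst (0, x)) * \<phi> (snd (0::real, x))) * m0 x) = 0"
      using sol C1c_test_product[OF \<phi> z z' b] unfolding weak_solution_def by blast
    also have "(LINT z:?Q|lborel. M z * (\<zeta>' (fst z) * \<phi> (snd z)) + (M z *\<^sub>R V z) \<bullet> (\<zeta> (fst z) *\<^sub>R D (snd z)))
        = (LINT z:?Q|lborel. M z * \<phi> (snd z) * \<zeta>' (fst z) + (M z *\<^sub>R V z) \<bullet> D (snd z) * \<zeta> (fst z))"
      by (simp add: mult_ac)
    also have "\<dots> = (LINT z:?Q|lborel. M z * \<phi> (snd z) * \<zeta>' (fst z)) + (LINT z:?Q|lborel. (M z *\<^sub>R V z) \<bullet> D (snd z) * \<zeta> (fst z))"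
      by (rule set_integral_add(2)[OF j1 j2])
    also have "\<dots> = (LINT t:{0<..<T}|lborel. F t * \<zeta>' t) + (LINT t:{0<..<T}|lborel. f t * \<zeta> t)"
      unfolding set_integral_Times(1)[OF j1] set_integral_Times(1)[OF j2] F_def f_def by simp
    also have "\<dots> = (LINT t:{0<..<T}|lborel. F t * \<zeta>' t + f t * \<zeta> t)"
    proof (rule set_integral_add(2)[symmetric])
      show "set_integrable lborel {0<..<T} (\<lambda>t. F t * \<zeta>' t)"
        by (rule set_integrable_mult_bounded[OF iF mz(2), of Bz']) (use Bz' in auto)
      show "set_integrable lborel {0<..<T} (\<lambda>t. f t * \<zeta> t)"
        by (rule set_integrable_mult_bounded[OF if' mz(1), of Bz]) (use Bz in auto)
    qed
    also have "(LINT x:unit_cell|lebesgue. (\<zeta> (fst (0, x)) * \<phi> (snd (0::real, x))) * m0 x) = \<zeta> 0 * c0"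
      unfolding c0_def by (simp add: mult.assoc)
    finally show "(LINT t:{0<..<T}|lborel. F t * \<zeta>' t + f t * \<zeta> t) + \<zeta> 0 * c0 = 0" .
  qed
  then show "AE t in lborel. t \<in> {0<..<T} \<longrightarrow> (LINT x:unit_cell|lborel. M (t, x) * \<phi> x)
        = (LINT x:unit_cell|lebesgue. \<phi> x * m0 x) + (LINT s:{0<..<t}|lborel. f s)"
    unfolding F_def c0_def .
qed

text \<open>A set of full measure meets (0, T) arbitrarily close to t, also at the end points. The
  points are taken different from t to fit the punctured limits of
  \<open>continuous_curve\<close>.\<close>

lemma AE_interval_sequence:
  fixes P :: "real \<Rightarrow> bool"
  assumes ae: "AE s in lborel. s \<in> {0<..<T} \<longrightarrow> P s" and T: "0 < T" and t: "t \<in> {0..T}"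
  obtains X where "\<And>j. X j \<in> {0<..<T}" "\<And>j. P (X j)" "\<And>j. X j \<noteq> t" "X \<longlonglongrightarrow> t"
proof -
  have "\<exists>s. s \<in> {0<..<T} \<and> P s \<and> s \<noteq> t \<and> \<bar>s - t\<bar> < 1 / Suc j" for j
  proof (rule ccontr)
    assume no: "\<not> ?thesis"
    define I where "I = {max 0 (t - 1 / Suc j)<..<min T (t + 1 / Suc j)}"
    have "AE s in lborel. s \<noteq> t" by (rule AE_lborel_singleton)
    with ae have "AE s in lborel. s \<notin> I"
    proof eventually_elim
      case (elim s)
      show ?case
      proof
        assume "s \<in> I"
        then have "s \<in> {0<..<T}" "\<bar>s - t\<bar> < 1 / Suc j" by (auto simp: I_def abs_less_iff)
        with elim no show False by blast
      qed
    qed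
    then have "I \<in> null_sets lborel" by (subst AE_iff_null_sets) (simp_all add: I_def)
    then have "emeasure lborel I = 0" by (rule null_setsD1)
    moreover have "max 0 (t - 1 / Suc j) < min T (t + 1 / Suc j)"
    proof -
      define e where "e = 1 / real (Suc j)"
      have "0 < e" by (simp add: e_def)
      then show ?thesis unfolding e_def[symmetric] using t T by auto
    qed
    then have "emeasure lborel I = ennreal (min T (t + 1 / Suc j) - max 0 (t - 1 / Suc j))"
      and "0 < min T (t + 1 / Suc j) - max 0 (t - 1 / Suc j)"
      unfolding I_def by (intro emeasure_lborel_Ioo less_imp_le, simp_all only: diff_gt_0_iff_gt)
    ultimately show False by (simp only: ennreal_eq_0_iff)
  qed
  then obtain X where X: "\<And>j. X j \<in> {0<..<T} \<and> P (X j) \<and> X j \<noteq> t \<and> \<bar>X j - t\<bar> < 1 / Suc j" by metis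
  have "X \<longlonglongrightarrow> t"
  proof (rule Lim_null[THEN iffD2], rule Lim_null_comparison)
    show "\<forall>\<^sub>F j in sequentially. norm (X j - t) \<le> 1 / Suc j"
      using X by (intro always_eventually allI) (auto intro: less_imp_le)
    show "(\<lambda>j. 1 / real (Suc j)) \<longlonglongrightarrow> 0" by (rule LIMSEQ_Suc[OF lim_const_over_n])
  qed
  then show ?thesis using that X by blast
qed

lemma primitive_continuous_seq:
  fixes f :: "real \<Rightarrow> real"
  assumes f: "set_integrable lborel {0<..<T} f" and X: "\<And>j. X j \<in> {0..T}" "X \<longlonglongrightarrow> t" and t: "t \<in> {0..T}"
  shows "(\<lambda>j. LINT s:{0<..<X j}|lborel. f s) \<longlonglongrightarrow> (LINT s:{0<..<t}|lborel. f s)"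
proof -
  define fT where "fT s = indicator {0<..<T} s *\<^sub>R f s" for s
  have fT: "integrable lborel fT" using f unfolding set_integrable_def fT_def .
  have e: "(LINT s:{0<..<u}|lborel. f s) = (LINT s|lborel. indicator {0<..<u} s * fT s)" if "u \<in> {0..T}" for u
    unfolding set_lebesgue_integral_def fT_def using that
    by (intro Bochner_Integration.integral_cong) (auto simp: indicator_def)
  have "(\<lambda>j. LINT s|lborel. indicator {0<..<X j} s * fT s) \<longlonglongrightarrow> (LINT s|lborel. indicator {0<..<t} s * fT s)"
  proof (rule integral_dominated_convergence[OF _ _ integrable_norm[OF fT]])
    have "AE s in lborel. s \<noteq> t" by (rule AE_lborel_singleton)
    then show "AE s in lborel. (\<lambda>j. indicator {0<..<X j} s * fT s) \<longlonglongrightarrow> indicator {0<..<t} s * fT s"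
    proof eventually_elim
      case (elim s)
      have "\<forall>\<^sub>F j in sequentially. indicator {0<..<X j} s * fT s = indicator {0<..<t} s * fT s"
      proof (cases "s < t")
        case True
        from order_tendstoD(1)[OF X(2) this] show ?thesis
          by eventually_elim (use True in \<open>simp add: indicator_def\<close>)
      next
        case False
        then have "t < s" using elim by simp
        from order_tendstoD(2)[OF X(2) this] show ?thesis
          by eventually_elim (use False in \<open>simp add: indicator_def\<close>)
      qed
      then show ?case by (rule tendsto_eventually)
    qed
  qed (use borel_measurable_integrable[OF fT] in \<open>auto simp: indicator_def\<close>)
  then show ?thesis using e[OF X(1)] e[OF t] by simp
qed

text \<open>
  The curve is determined by the moments of the countably many functions \<open>test_fun\<close>, which are
  continuous in time; compactness provides the values at exceptional times and the continuity.
\<close>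

theorem weak_solution_curve_exists:
  fixes M :: "real \<times> (real^'n) \<Rightarrow> real"
  assumes sol: "weak_solution T m0 M V" and T: "0 < T"
  shows "\<exists>\<mu>. continuous_curve T M \<mu>"
proof -
  define \<phi> where "\<phi> i = test_fun (fst i) (\<lambda>j. of_rat (snd i j))" for i :: "nat \<times> ('n \<Rightarrow> rat)"
  have "\<forall>i. \<exists>D. C1_torus (\<phi> i) D" unfolding \<phi>_def using test_fun_C1 by blast
  then obtain D where D: "\<And>i. C1_torus (\<phi> i) (D i)" by metis
  define f where "f i t = (LINT x:unit_cell|lborel. (M (t, x) *\<^sub>R V (t, x)) \<bullet> D i x)" for i t
  define H where "H i t = (LINT x:unit_cell|lebesgue. \<phi> i x * m0 x) + (LINT s:{0<..<t}|lborel. f i s)" for i t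
  have if': "set_integrable lborel {0<..<T} (f i)" for i
    unfolding f_def by (rule weak_solution_moment(1)[OF sol T D])
  have Hc: "(\<lambda>j. H i (X j)) \<longlonglongrightarrow> H i t" if "\<And>j. X j \<in> {0..T}" "X \<longlonglongrightarrow> t" "t \<in> {0..T}" for i X t
    unfolding H_def by (intro tendsto_add tendsto_const primitive_continuous_seq[OF if' that])
  define \<rho> where "\<rho> t = density lborel (\<lambda>x. ennreal (M (t, x) * indicator unit_cell x))" for t
  \<comment> \<open>\<open>H i\<close> is the continuous version of the i-th moment.
    \<open>K t \<nu>\<close> prescribes all moments at the time t itself, also at times where the
    slice of \<open>M\<close> says nothing; at most one measure satisfies it.\<close>
  define K where "K t \<nu> \<longleftrightarrow> torus_prob \<nu> \<and> (\<forall>i. (LINT x|\<nu>. \<phi> i x) = H i t)" for t \<nu>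
  have M0: "0 \<le> M z" for z using sol unfolding weak_solution_def by blast
  have Mm: "M \<in> borel_measurable borel" using sol by (simp add: weak_solution_def)
  have Mt [measurable]: "(\<lambda>x. M (t, x)) \<in> borel_measurable borel" for t
    by (rule measurable_compose[OF _ Mm]) simp
  have "AE t in lborel. \<forall>i. t \<in> {0<..<T} \<longrightarrow> (LINT x:unit_cell|lborel. M (t, x) * \<phi> i x) = H i t"
    unfolding AE_all_countable H_def f_def using weak_solution_moment(2)[OF sol T D] by blast
  moreover have "AE t in lborel. t \<in> {0<..<T} \<longrightarrow> (LINT x:unit_cell|lborel. M (t, x)) = 1"
    using sol by (simp add: weak_solution_def)
  ultimately have good: "AE t in lborel. t \<in> {0<..<T} \<longrightarrow> K t (\<rho> t)"
  proof eventually_elim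
    case (elim t)
    show ?case
    proof
      assume t: "t \<in> {0<..<T}"
      have one: "(LINT x|lborel. M (t, x) * indicator unit_cell x) = 1"
        using elim t by (simp add: set_lebesgue_integral_def mult.commute)
      \<comment> \<open>The integral of a non-integrable function is 0 by convention, so the value 1
        implies integrability.\<close>
      then have int: "integrable lborel (\<lambda>x. M (t, x) * indicator unit_cell x)"
        using not_integrable_integral_eq by fastforce
      have nn: "(\<integral>\<^sup>+x. ennreal (M (t, x) * indicator unit_cell x) \<partial>lborel) = 1"
        using nn_integral_eq_integral[OF int] one M0 by simp
      have s: "sets (\<rho> t) = sets borel" by (simp add: \<rho>_def)
      have e1: "emeasure (\<rho> t) UNIV = 1" using nn by (simp add: \<rho>_def emeasure_density)
      have "emeasure (\<rho> t) unit_cell = (\<integral>\<^sup>+x. ennreal (M (t, x) * indicator unit_cell x) * indicator unit_cell x \<partial>lborel)"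
        by (simp add: \<rho>_def emeasure_density)
      also have "\<dots> = (\<integral>\<^sup>+x. ennreal (M (t, x) * indicator unit_cell x) \<partial>lborel)"
        by (intro nn_integral_cong) (auto simp: indicator_def)
      finally have "torus_prob (\<rho> t)"
        unfolding torus_prob_def using nn s e1 by (auto intro!: prob_spaceI simp: \<rho>_def)
      moreover have "(LINT x|\<rho> t. \<phi> i x) = H i t" for i
      proof -
        have "(LINT x|\<rho> t. \<phi> i x) = (LINT x|lborel. (M (t, x) * indicator unit_cell x) *\<^sub>R \<phi> i x)"
          unfolding \<rho>_def using M0 by (intro integral_density) (auto simp: \<phi>_def)
        also have "\<dots> = (LINT x:unit_cell|lborel. M (t, x) * \<phi> i x)"
          unfolding set_lebesgue_integral_def by (intro Bochner_Integration.integral_cong) (auto simp: indicator_def)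
        also have "\<dots> = H i t" using elim(1) t by blast
        finally show ?thesis .
      qed
      ultimately show "K t (\<rho> t)" by (simp add: K_def)
    qed
  qed
  have uniq: "\<nu> = \<nu>'" if "K t \<nu>" "K t \<nu>'" for t \<nu> \<nu>'
  proof (rule torus_prob_eqI)
    fix k and a :: "'n \<Rightarrow> rat"
    show "(LINT x|\<nu>. test_fun k (\<lambda>i. of_rat (a i)) x) = (LINT x|\<nu>'. test_fun k (\<lambda>i. of_rat (a i)) x)"
      using that unfolding K_def \<phi>_def by (metis fst_conv snd_conv)
  qed (use that in \<open>auto simp: K_def\<close>)
  \<comment> \<open>W_2 convergence carries the moments of Lipschitz functions and
    \<open>H i\<close> is continuous, so a limit of measures with the moments at X j has the moments
    at t. This gives existence at exceptional times and, with uniqueness, continuity of the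
    curve.\<close>
  have compact: "\<exists>r \<nu>. strict_mono (r :: nat \<Rightarrow> nat) \<and> K t \<nu> \<and> (\<lambda>j. W2 (N (r j)) \<nu>) \<longlonglongrightarrow> 0"
    if X: "\<And>j. X j \<in> {0..T}" "X \<longlonglongrightarrow> t" "t \<in> {0..T}" and N: "\<And>j. K (X j) (N j)" for X t N
  proof -
    have "\<And>j. torus_prob (N j)" using N by (simp add: K_def)
    from torus_prob_seq_compact[of N, OF this] obtain r \<nu> where r: "strict_mono (r :: nat \<Rightarrow> nat)" "torus_prob \<nu>" "(\<lambda>j. W2 (N (r j)) \<nu>) \<longlonglongrightarrow> 0"
      by blast
    have "(LINT x|\<nu>. \<phi> i x) = H i t" for i
    proof -
      obtain L where L: "L-lipschitz_on UNIV (\<phi> i)" using C1_torus_lipschitz[OF D] .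
      have "(\<lambda>j. LINT x|N (r j). \<phi> i x) \<longlonglongrightarrow> (LINT x|\<nu>. \<phi> i x)"
      proof (rule W2_tendsto_lipschitz[OF _ r(2,3) _ L])
        show "\<forall>\<^sub>F j in sequentially. torus_prob (N (r j))" using N by (simp add: K_def)
        show "periodic (\<phi> i)" using D[of i] by (simp add: C1_torus_def)
      qed
      moreover have "(\<lambda>j. H i (X (r j))) \<longlonglongrightarrow> H i t"
        using LIMSEQ_subseq_LIMSEQ[OF Hc[OF X] r(1)] by (simp add: comp_def)
      moreover have "(LINT x|N (r j). \<phi> i x) = H i (X (r j))" for j using N unfolding K_def by blast
      ultimately show ?thesis using LIMSEQ_unique by simp
    qed
    then show ?thesis using r by (auto simp: K_def)
  qed
  have ex: "\<exists>\<nu>. K t \<nu>" if t: "t \<in> {0..T}" for t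
  proof -
    obtain X where X: "\<And>j. X j \<in> {0<..<T}" "\<And>j. K (X j) (\<rho> (X j))" "X \<longlonglongrightarrow> t"
      by (rule AE_interval_sequence[OF good T t]) blast
    have "\<And>j. X j \<in> {0..T}" using X(1) by (meson greaterThanLessThan_subseteq_atLeastAtMost_iff order_refl subsetD)
    from compact[OF this X(3) t X(2)] show ?thesis by blast
  qed
  define \<mu> where "\<mu> t = (SOME \<nu>. K t \<nu>)" for t
  have \<mu>: "K t (\<mu> t)" if "t \<in> {0..T}" for t
    unfolding \<mu>_def using someI_ex[OF ex[OF that]] .
  have "continuous_curve T M \<mu>"
    unfolding continuous_curve_def
  proof (intro conjI ballI)
    fix t assume t: "t \<in> {0..T}"
    show tp: "torus_prob (\<mu> t)" using \<mu>[OF t] by (simp add: K_def)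
    show "((\<lambda>s. W2 (\<mu> s) (\<mu> t)) \<longlongrightarrow> 0) (at t within {0..T})"
      unfolding tendsto_at_iff_sequentially
    proof (intro allI impI)
      fix X assume X: "\<forall>j. X j \<in> {0..T} - {t}" "X \<longlonglongrightarrow> t"
      show "((\<lambda>s. W2 (\<mu> s) (\<mu> t)) \<circ> X) \<longlonglongrightarrow> 0"
      \<comment> \<open>A subsequence staying away from \<open>\<mu> t\<close> would have a further
        one converging to a measure with the moments at t, that is, to \<open>\<mu> t\<close>
        itself.\<close>
      proof (rule ccontr)
        assume "\<not> ?thesis"
        then obtain e where e: "e > 0" "\<not> (\<forall>\<^sub>F j in sequentially. dist (W2 (\<mu> (X j)) (\<mu> t)) 0 < e)"
          unfolding tendsto_iff comp_def by blast
        from not_eventually_sequentiallyD[OF e(2)] obtain r :: "nat \<Rightarrow> nat"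
          where r: "strict_mono r" "\<And>n. \<not> dist (W2 (\<mu> (X (r n))) (\<mu> t)) 0 < e" by blast
        have Xr: "X (r j) \<in> {0..T}" for j using X(1) by blast
        have Xl: "(\<lambda>j. X (r j)) \<longlonglongrightarrow> t" using LIMSEQ_subseq_LIMSEQ[OF X(2) r(1)] by (simp add: comp_def)
        obtain r' \<nu> where r': "strict_mono (r' :: nat \<Rightarrow> nat)" "K t \<nu>" "(\<lambda>j. W2 (\<mu> (X (r (r' j)))) \<nu>) \<longlonglongrightarrow> 0"
          using compact[of "\<lambda>j. X (r j)" t "\<lambda>j. \<mu> (X (r j))", OF Xr Xl t \<mu>[OF Xr]] by blast
        have "\<nu> = \<mu> t" using uniq[OF r'(2) \<mu>[OF t]] .
        then have "\<forall>\<^sub>F j in sequentially. dist (W2 (\<mu> (X (r (r' j)))) (\<mu> t)) 0 < e"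
          using r'(3) e(1) unfolding tendsto_iff by blast
        then obtain j where "dist (W2 (\<mu> (X (r (r' j)))) (\<mu> t)) 0 < e"
          unfolding eventually_sequentially by blast
        then show False using r(2) by blast
      qed
    qed
  next
    show "AE t in lebesgue. t \<in> {0<..<T} \<longrightarrow>
        (\<forall>A\<in>sets borel. emeasure (\<mu> t) A = (\<integral>\<^sup>+x\<in>A \<inter> unit_cell. ennreal (M (t, x)) \<partial>lebesgue))"
    proof (rule AE_completion, use good in eventually_elim, intro impI ballI)
      fix t and A :: "(real^'n) set"
      assume K: "t \<in> {0<..<T} \<longrightarrow> K t (\<rho> t)" and t: "t \<in> {0<..<T}" and A: "A \<in> sets borel"
      then have "\<mu> t = \<rho> t" using uniq[OF \<mu>[of t]] by simp
      then have "emeasure (\<mu> t) A = (\<integral>\<^sup>+x. ennreal (M (t, x) * indicator unit_cell x) * indicator A x \<partial>lborel)"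
        using A by (simp add: \<rho>_def emeasure_density)
      also have "\<dots> = (\<integral>\<^sup>+x\<in>A \<inter> unit_cell. ennreal (M (t, x)) \<partial>lborel)"
        by (intro nn_integral_cong) (auto simp: indicator_def)
      finally show "emeasure (\<mu> t) A = (\<integral>\<^sup>+x\<in>A \<inter> unit_cell. ennreal (M (t, x)) \<partial>lebesgue)"
        by (simp add: nn_integral_completion)
    qed
  qed
  then show ?thesis by blast
qed

lemma continuous_curve_seq_tendsto:
  fixes f :: "real^'n \<Rightarrow> real"
  assumes c: "continuous_curve T m \<mu>" and X: "\<And>j. X j \<in> {0..T}" "\<And>j. X j \<noteq> t" "X \<longlonglongrightarrow> t" and t: "t \<in> {0..T}"
    and f: "periodic f" "L-lipschitz_on UNIV f"
  shows "(\<lambda>j. LINT x|\<mu> (X j). f x) \<longlonglongrightarrow> (LINT x|\<mu> t. f x)"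
proof -
  have c': "torus_prob (\<mu> s)" "((\<lambda>s. W2 (\<mu> s) (\<mu> t)) \<longlongrightarrow> 0) (at t within {0..T})" if "s \<in> {0..T}" for s
    using c that t unfolding continuous_curve_def by auto
  have "((\<lambda>s. W2 (\<mu> s) (\<mu> t)) \<circ> X) \<longlonglongrightarrow> 0"
    using c'(2)[OF t] X unfolding tendsto_at_iff_sequentially by blast
  then have "(\<lambda>j. W2 (\<mu> (X j)) (\<mu> t)) \<longlonglongrightarrow> 0" by (simp add: comp_def)
  then show ?thesis
    by (intro W2_tendsto_lipschitz[OF _ c'(1)[OF t] _ f] always_eventually allI c'(1) X(1))
qed

text \<open>Any two curves have the same density at almost every time. Times of agreement accumulate
  at T, and continuity of the test moments carries the agreement to T; this gives the definite
  description in \<open>final_measure\<close> its meaning.\<close>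

lemma final_measure_eq:
  fixes m :: "real \<times> (real^'n) \<Rightarrow> real"
  assumes c: "continuous_curve T m \<mu>" and T: "0 < T"
  shows "final_measure T m = \<mu> T"
  unfolding final_measure_def
proof (rule the_equality)
  show "\<exists>\<mu>'. continuous_curve T m \<mu>' \<and> \<mu> T = \<mu>' T" using c by blast
  fix \<nu> assume "\<exists>\<mu>'. continuous_curve T m \<mu>' \<and> \<nu> = \<mu>' T"
  then obtain \<mu>' where c': "continuous_curve T m \<mu>'" and \<nu>: "\<nu> = \<mu>' T" by blast
  have tp: "torus_prob (\<mu> s)" "torus_prob (\<mu>' s)" if "s \<in> {0..T}" for s
    using c c' that unfolding continuous_curve_def by auto
  have "AE t in lborel. t \<in> {0<..<T} \<longrightarrow>
        (\<forall>A\<in>sets borel. emeasure (\<mu> t) A = (\<integral>\<^sup>+x\<in>A \<inter> unit_cell. ennreal (m (t, x)) \<partial>lebesgue))"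
    "AE t in lborel. t \<in> {0<..<T} \<longrightarrow>
        (\<forall>A\<in>sets borel. emeasure (\<mu>' t) A = (\<integral>\<^sup>+x\<in>A \<inter> unit_cell. ennreal (m (t, x)) \<partial>lebesgue))"
    using c c' unfolding continuous_curve_def AE_completion_iff by auto
  then have ae: "AE t in lborel. t \<in> {0<..<T} \<longrightarrow> \<mu> t = \<mu>' t"
  proof eventually_elim
    case (elim t)
    show ?case
    proof
      assume t: "t \<in> {0<..<T}"
      show "\<mu> t = \<mu>' t"
      proof (rule measure_eqI)
        show "sets (\<mu> t) = sets (\<mu>' t)" using tp[of t] t by (simp add: torus_prob_def)
        fix A assume "A \<in> sets (\<mu> t)"
        then have "A \<in> sets borel" using tp[of t] t by (simp add: torus_prob_def)
        then show "emeasure (\<mu> t) A = emeasure (\<mu>' t) A" using elim t by simp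
      qed
    qed
  qed
  have TT: "T \<in> {0..T}" using T by simp
  obtain X where X: "\<And>j. X j \<in> {0<..<T}" "\<And>j. \<mu> (X j) = \<mu>' (X j)" "\<And>j. X j \<noteq> T" "X \<longlonglongrightarrow> T"
    by (rule AE_interval_sequence[OF ae T TT]) blast
  have X': "X j \<in> {0..T}" for j using X(1)[of j] by simp
  show "\<nu> = \<mu> T"
    unfolding \<nu>
  proof (rule torus_prob_eqI[OF tp(2)[OF TT] tp(1)[OF TT]])
    fix k and a :: "'n \<Rightarrow> rat"
    let ?f = "test_fun k (\<lambda>i. of_rat (a i))"
    obtain D where D: "C1_torus ?f D" using test_fun_C1 by blast
    obtain L where L: "L-lipschitz_on UNIV ?f" using C1_torus_lipschitz[OF D] .
    have p: "periodic ?f" using D by (simp add: C1_torus_def)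
    show "(LINT x|\<mu>' T. ?f x) = (LINT x|\<mu> T. ?f x)"
      using continuous_curve_seq_tendsto[OF c' X' X(3,4) TT p L] continuous_curve_seq_tendsto[OF c X' X(3,4) TT p L]
      unfolding X(2) by (rule LIMSEQ_unique)
  qed
qed

subsection \<open>Borel representatives\<close>

lemma AE_lborel_translate:
  fixes c :: "'a::euclidean_space"
  assumes "AE z in lborel. P z"
  shows "AE z in lborel. P (c + z)"
proof -
  obtain N where N: "N \<in> null_sets lborel" "{z \<in> space lborel. \<not> P z} \<subseteq> N"
    using assms unfolding eventually_ae_filter by blast
  have Nb: "N \<in> sets borel" using N(1) by auto
  have m: "(+) c \<in> borel \<rightarrow>\<^sub>M borel" by simp
  have "emeasure lborel ((+) c -` N) = emeasure (distr lborel borel ((+) c)) N"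
    using Nb by (subst emeasure_distr) simp_all
  also have "\<dots> = 0" using N(1) by (simp add: lborel_distr_plus null_setsD1)
  finally have "(+) c -` N \<in> null_sets lborel"
    using measurable_sets[OF m Nb] by (simp add: null_sets_def)
  then show ?thesis by (rule AE_I') (use N(2) in auto)
qed

text \<open>Countably many lattice translates of a null set are still null, so a periodic property
  that holds almost everywhere on the cell holds almost everywhere in space.\<close>

lemma AE_periodic_extend:
  fixes P :: "real \<times> (real^'n) \<Rightarrow> bool"
  assumes ae: "AE z in lborel. z \<in> I \<times> unit_cell \<longrightarrow> P z"
    and per: "\<And>t x k. t \<in> I \<Longrightarrow> k \<in> int_lattice \<Longrightarrow> P (t, x) \<Longrightarrow> P (t, x + k)"
  shows "AE z in lborel. fst z \<in> I \<longrightarrow> P z"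
proof -
  have "AE z in lborel. \<forall>k\<in>int_lattice. (0, k) + z \<in> I \<times> unit_cell \<longrightarrow> P ((0, k) + z)"
    unfolding AE_ball_countable[OF countable_int_lattice] using AE_lborel_translate[OF ae] by blast
  then show ?thesis
  proof eventually_elim
    case (elim z)
    show ?case
    proof
      assume t: "fst z \<in> I"
      define k where "k = snd z - tfrac (snd z)"
      have k1: "k \<in> int_lattice" by (simp add: k_def)
      then have k: "k \<in> int_lattice" "- k \<in> int_lattice" by simp_all
      have z: "(0, - k) + z = (fst z, tfrac (snd z))" by (simp add: k_def prod_eq_iff)
      have "(0, - k) + z \<in> I \<times> unit_cell \<longrightarrow> P ((0, - k) + z)" using elim k(2) by (rule bspec)
      then have "P (fst z, tfrac (snd z))" unfolding z using t by simp
      from per[OF t k(1) this] show "P z" by (simp add: k_def)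
    qed
  qed
qed

lemma borel_measurable_vec:
  fixes f :: "'a \<Rightarrow> real^'n"
  assumes "\<And>i. (\<lambda>z. f z $ i) \<in> borel_measurable M"
  shows "f \<in> borel_measurable M"
  by (subst borel_measurable_euclidean_space) (auto simp: Basis_vec_def inner_axis assms)

lemma lebesgue_borel_representative_vec:
  fixes f :: "'a::euclidean_space \<Rightarrow> real^'n"
  assumes "f \<in> borel_measurable lebesgue"
  shows "\<exists>f'\<in>borel_measurable borel. AE z in lborel. f z = f' z"
proof -
  have "(\<lambda>z. f z $ i) \<in> borel_measurable lebesgue" for i
    using borel_measurable_inner[OF assms borel_measurable_const[of "axis i 1"]] by (simp add: inner_axis)
  then have "\<exists>h\<in>borel_measurable lborel. AE z in lborel. f z $ i = h z" for i
    by (rule completion_ex_borel_measurable_real)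
  then obtain h where h: "\<And>i. h i \<in> borel_measurable lborel" "\<And>i. AE z in lborel. f z $ i = h i z" by metis
  have "AE z in lborel. \<forall>i\<in>UNIV. f z $ i = h i z"
    by (rule iffD2[OF AE_ball_countable[OF countable_finite[OF finite]]]) (use h(2) in blast)
  then have "AE z in lborel. f z = (\<chi> i. h i z)" by eventually_elim (simp add: vec_eq_iff)
  moreover have "(\<lambda>z. \<chi> i. h i z) \<in> borel_measurable borel"
  proof (rule borel_measurable_vec)
    fix i
    show "(\<lambda>z. (\<chi> i. h i z) $ i) \<in> borel_measurable borel"
      unfolding vec_lambda_beta using h(1)[of i] unfolding measurable_lborel2 .
  qed
  ultimately show ?thesis by (intro bexI[of _ "\<lambda>z. \<chi> i. h i z"])
qed

lemma measurable_pair_tfrac: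
  "(\<lambda>z :: real \<times> (real^'n). (fst z, tfrac (snd z))) \<in> borel_measurable borel"
  by (intro borel_measurable_Pair borel_measurable_fst_snd(1) borel_measurable_snd_compose measurable_tfrac)

lemma C1c_test_open_derivative:
  assumes "C1c_test T \<phi> \<phi>t \<phi>x" "t \<in> {0<..<T}"
  shows "(\<phi> has_derivative (\<lambda>(\<tau>, h). \<phi>t (t, x) * \<tau> + \<phi>x (t, x) \<bullet> h)) (at (t, x))"
proof -
  have "(t, x) \<in> {0..<T} \<times> UNIV" using assms(2) by auto
  then have "(\<phi> has_derivative (\<lambda>(\<tau>, h). \<phi>t (t, x) * \<tau> + \<phi>x (t, x) \<bullet> h)) (at (t, x) within {0..<T} \<times> UNIV)"
    using assms(1) unfolding C1c_test_def by blast
  moreover have "(t, x) \<in> interior ({0..<T} \<times> UNIV)"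
    using assms(2) by (simp add: interior_Times)
  ultimately show ?thesis using at_within_interior by metis
qed

lemma linear_pair_eqD:
  assumes "(\<lambda>(\<tau>, h). a * \<tau> + u \<bullet> h) = (\<lambda>(\<tau>, h). b * \<tau> + w \<bullet> h)"
  shows "a = (b :: real)" "u = w"
proof -
  have *: "a * \<tau> + u \<bullet> h = b * \<tau> + w \<bullet> h" for \<tau> h using fun_cong[OF assms, of "(\<tau>, h)"] by simp
  show "a = b" using *[of 1 0] by simp
  have "u \<bullet> h = w \<bullet> h" for h using *[of 0 h] by simp
  then show "u = w" using vector_eq_rdot[of u w] by blast
qed

text \<open>Periodicity is imposed on \<phi> alone. Uniqueness of the derivative transfers it to the
  derivatives at interior times, where the one-sided domain is not felt.\<close>

lemma C1c_test_periodic: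
  fixes \<phi> :: "real \<times> (real^'n) \<Rightarrow> real"
  assumes \<phi>: "C1c_test T \<phi> \<phi>t \<phi>x" and t: "t \<in> {0<..<T}"
  shows "periodic (\<lambda>x. \<phi>t (t, x))" "periodic (\<lambda>x. \<phi>x (t, x))"
proof -
  have "\<phi>t (t, x + k) = \<phi>t (t, x) \<and> \<phi>x (t, x + k) = \<phi>x (t, x)" if k: "k \<in> int_lattice" for x k
  proof -
    have 1: "((\<lambda>z. z + (0, k)) has_derivative (\<lambda>h. h)) (at (t, x))" by (auto intro!: derivative_eq_intros)
    have 2: "(\<phi> has_derivative (\<lambda>(\<tau>, h). \<phi>t (t, x + k) * \<tau> + \<phi>x (t, x + k) \<bullet> h)) (at ((t, x) + (0, k)))"
      using C1c_test_open_derivative[OF \<phi> t, of "x + k"] by simp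
    from has_derivative_compose[OF 1 2]
    have 3: "((\<lambda>z. \<phi> (z + (0, k))) has_derivative (\<lambda>(\<tau>, h). \<phi>t (t, x + k) * \<tau> + \<phi>x (t, x + k) \<bullet> h)) (at (t, x))" .
    have "(\<phi> has_derivative (\<lambda>(\<tau>, h). \<phi>t (t, x + k) * \<tau> + \<phi>x (t, x + k) \<bullet> h)) (at (t, x))"
    proof (rule has_derivative_transform_within_open[OF 3])
      show "open ({0<..<T} \<times> (UNIV :: (real^'n) set))" by (intro open_Times) auto
      show "\<phi> (z + (0, k)) = \<phi> z" if "z \<in> {0<..<T} \<times> UNIV" for z
      proof -
        have "periodic (\<lambda>x. \<phi> (fst z, x))" using \<phi> that unfolding C1c_test_def by force
        from periodicD[OF this k, of "snd z"] show ?thesis by (cases z) simp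
      qed
    qed (use t in auto)
    from has_derivative_unique[OF this C1c_test_open_derivative[OF \<phi> t, of x]]
    show ?thesis using linear_pair_eqD by blast
  qed
  then show "periodic (\<lambda>x. \<phi>t (t, x))" "periodic (\<lambda>x. \<phi>x (t, x))" by (auto simp: periodic_def)
qed

text \<open>The derivatives are continuous on the half-open interval [0, T), which is not compact.
  After some S < T the test function vanishes and so do its derivatives; before S periodicity
  reduces to a compact set.\<close>

lemma C1c_test_bounded:
  fixes \<phi> :: "real \<times> (real^'n) \<Rightarrow> real"
  assumes \<phi>: "C1c_test T \<phi> \<phi>t \<phi>x" and T: "0 < T"
  obtains B where "\<And>z. z \<in> {0<..<T} \<times> UNIV \<Longrightarrow> \<bar>\<phi>t z\<bar> \<le> B" "\<And>z. z \<in> {0<..<T} \<times> UNIV \<Longrightarrow> norm (\<phi>x z) \<le> B"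
proof -
  obtain T' where T': "T' < T" "\<And>t x. t \<in> {T'..<T} \<inter> {0..} \<Longrightarrow> \<phi> (t, x) = 0"
    using \<phi> unfolding C1c_test_def by blast
  define S where "S = max 0 T'"
  have S: "0 \<le> S" "S < T" using T T' by (auto simp: S_def)
  have sub: "{0..S} \<times> cbox 0 1 \<subseteq> {0..<T} \<times> (UNIV :: (real^'n) set)" using S by auto
  have cpt: "compact ({0..S} \<times> cbox (0::real^'n) 1)" by (intro compact_Times) auto
  have "compact (\<phi>t ` ({0..S} \<times> cbox 0 1))" "compact (\<phi>x ` ({0..S} \<times> cbox 0 1))"
    using \<phi> sub unfolding C1c_test_def by (auto intro!: compact_continuous_image cpt intro: continuous_on_subset)
  then obtain B1 B2 where B: "\<And>z. z \<in> {0..S} \<times> cbox 0 1 \<Longrightarrow> \<bar>\<phi>t z\<bar> \<le> B1" "\<And>z. z \<in> {0..S} \<times> cbox 0 1 \<Longrightarrow> norm (\<phi>x z) \<le> B2"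
    by (force dest!: compact_imp_bounded simp: bounded_iff)
  define B where "B = max 0 (max B1 B2)"
  have "\<bar>\<phi>t (t, x)\<bar> \<le> B \<and> norm (\<phi>x (t, x)) \<le> B" if t: "t \<in> {0<..<T}" for t x
  proof (cases "t \<le> S")
    case True
    have "(t, tfrac x) \<in> {0..S} \<times> cbox 0 1" using True t unit_cell_subset tfrac_in_cell by auto
    then have "\<bar>\<phi>t (t, tfrac x)\<bar> \<le> B1" "norm (\<phi>x (t, tfrac x)) \<le> B2" using B by blast+
    then show ?thesis
      using periodic_tfrac[OF C1c_test_periodic(1)[OF \<phi> t], of x] periodic_tfrac[OF C1c_test_periodic(2)[OF \<phi> t], of x]
      by (simp add: B_def le_max_iff_disj)
  next
    case False
    have "((\<lambda>_. 0) has_derivative (\<lambda>_. 0)) (at (t, x))" by simp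
    then have "(\<phi> has_derivative (\<lambda>_. 0)) (at (t, x))"
    proof (rule has_derivative_transform_within_open)
      show "open ({S<..<T} \<times> (UNIV :: (real^'n) set))" by (intro open_Times) auto
      show "0 = \<phi> z" if "z \<in> {S<..<T} \<times> UNIV" for z
        using T'(2)[of "fst z" "snd z"] that by (cases z) (auto simp: S_def)
    qed (use False t in auto)
    moreover have "(\<lambda>_. 0) = (\<lambda>(\<tau>, h). 0 * \<tau> + (0 :: real^'n) \<bullet> h)" by auto
    ultimately have "(\<phi> has_derivative (\<lambda>(\<tau>, h). 0 * \<tau> + 0 \<bullet> h)) (at (t, x))" by simp
    from has_derivative_unique[OF this C1c_test_open_derivative[OF \<phi> t, of x]]
    have "\<phi>t (t, x) = 0" "\<phi>x (t, x) = 0" using linear_pair_eqD by metis+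
    then show ?thesis by (simp add: B_def)
  qed
  then show ?thesis by (intro that[of B]) auto
qed

text \<open>Test functions are only given on \<open>[0,T)\<close>; they are replaced by these Borel extensions by zero.\<close>

lemma C1c_test_borel:
  fixes \<phi> :: "real \<times> (real^'n) \<Rightarrow> real"
  assumes "C1c_test T \<phi> \<phi>t \<phi>x"
  shows "(\<lambda>z. indicator ({0..<T} \<times> UNIV) z * \<phi>t z) \<in> borel_measurable borel"
    and "(\<lambda>z. indicator ({0..<T} \<times> UNIV) z *\<^sub>R \<phi>x z) \<in> borel_measurable borel"
  using assms unfolding C1c_test_def
  by (auto intro!: borel_measurable_continuous_on_indicator[of _ _, simplified] simp: real_scaleR_def[symmetric] simp del: real_scaleR_def)

lemma test_integrable:
  fixes \<phi> :: "real \<times> (real^'n) \<Rightarrow> real"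
  assumes M: "set_integrable lborel ({0<..<T} \<times> unit_cell) M"
    and W: "set_integrable lborel ({0<..<T} \<times> unit_cell) W"
    and \<phi>: "C1c_test T \<phi> \<phi>t \<phi>x" and T: "0 < T"
  shows "set_integrable lborel ({0<..<T} \<times> unit_cell) (\<lambda>z. M z * \<phi>t z + W z \<bullet> \<phi>x z)"
proof -
  let ?I = "{0..<T} \<times> (UNIV :: (real^'n) set)" and ?Q = "{0<..<T} \<times> unit_cell :: (real \<times> (real^'n)) set"
  obtain B where B: "\<And>z. z \<in> {0<..<T} \<times> UNIV \<Longrightarrow> \<bar>\<phi>t z\<bar> \<le> B" "\<And>z. z \<in> {0<..<T} \<times> UNIV \<Longrightarrow> norm (\<phi>x z) \<le> B"
    by (rule C1c_test_bounded[OF \<phi> T]) blast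
  have Qs: "z \<in> ?I \<and> z \<in> {0<..<T} \<times> UNIV" if "z \<in> ?Q" for z using that by auto
  have "set_integrable lborel ?Q (\<lambda>z. M z * (indicator ?I z * \<phi>t z))"
    by (rule set_integrable_mult_bounded[OF M C1c_test_borel(1)[OF \<phi>], of B]) (use B(1) Qs in \<open>simp add: indicator_def\<close>)
  moreover have "set_integrable lborel ?Q (\<lambda>z. W z \<bullet> (indicator ?I z *\<^sub>R \<phi>x z))"
    by (rule set_integrable_inner_bounded[OF W C1c_test_borel(2)[OF \<phi>], of B]) (use B(2) Qs in \<open>simp add: indicator_def\<close>)
  ultimately have "set_integrable lborel ?Q (\<lambda>z. M z * (indicator ?I z * \<phi>t z) + W z \<bullet> (indicator ?I z *\<^sub>R \<phi>x z))"
    by (rule set_integral_add(1))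
  moreover have "set_integrable lborel ?Q (\<lambda>z. M z * (indicator ?I z * \<phi>t z) + W z \<bullet> (indicator ?I z *\<^sub>R \<phi>x z))
      = set_integrable lborel ?Q (\<lambda>z. M z * \<phi>t z + W z \<bullet> \<phi>x z)"
    by (rule set_integrable_cong) (use Qs in \<open>auto simp: indicator_def\<close>)
  ultimately show ?thesis by simp
qed

lemma set_integrable_AE_borel:
  fixes f f' :: "'a::euclidean_space \<Rightarrow> 'b::euclidean_space"
  assumes "set_integrable lebesgue A f" "f' \<in> borel_measurable borel" "A \<in> sets borel"
    and ae: "AE z in lborel. z \<in> A \<longrightarrow> f z = f' z"
  shows "set_integrable lborel A f'" and "(LINT z:A|lebesgue. f z) = (LINT z:A|lborel. f' z)"
proof -
  have m: "(\<lambda>z. indicator A z *\<^sub>R f' z) \<in> borel_measurable lborel" using assms(2,3) by simp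
  have i: "integrable lebesgue (\<lambda>z. indicator A z *\<^sub>R f z)" using assms(1) unfolding set_integrable_def .
  have ae': "AE z in lebesgue. indicator A z *\<^sub>R f z = indicator A z *\<^sub>R f' z"
  proof (rule AE_completion)
    show "AE z in lborel. indicator A z *\<^sub>R f z = indicator A z *\<^sub>R f' z"
      using ae by eventually_elim (auto simp: indicator_def)
  qed
  have "integrable lebesgue (\<lambda>z. indicator A z *\<^sub>R f' z)"
    by (rule integrable_cong_AE_imp[OF i measurable_completion[OF m] ae'])
  then show "set_integrable lborel A f'" unfolding set_integrable_def using integrable_completion[OF m] by simp
  show "(LINT z:A|lebesgue. f z) = (LINT z:A|lborel. f' z)"
    unfolding set_lebesgue_integral_def integral_completion[OF m, symmetric]
    by (rule integral_cong_AE[OF borel_measurable_integrable[OF i] measurable_completion[OF m] ae'])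
qed

text \<open>m and v are Lebesgue measurable and determined up to null sets, whereas slicing,
  shifting and composing with \<open>J\<close> call for Borel functions. The agreement is extended
  from the cell to all of space, because later translates leave the cell.\<close>

lemma admissible_borel_representative:
  fixes m :: "real \<times> (real^'n) \<Rightarrow> real"
  assumes adm: "(m, v) \<in> admissible T m0" and T: "0 < T"
  obtains M V where "weak_solution T m0 M V" "AE z in lborel. fst z \<in> {0<..<T} \<longrightarrow> M z = m z \<and> V z = v z"
proof -
  let ?Q = "{0<..<T} \<times> unit_cell :: (real \<times> (real^'n)) set"
  have per: "periodic (\<lambda>x. m (t, x))" "periodic (\<lambda>x. v (t, x))" if "t \<in> {0<..<T}" for t
    using adm that unfolding admissible_def by auto
  have mi: "set_integrable lebesgue ?Q m" and m0: "AE z in lebesgue. z \<in> ?Q \<longrightarrow> 0 \<le> m z"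
    and mass: "AE t in lebesgue. t \<in> {0<..<T} \<longrightarrow> (LINT x:unit_cell|lebesgue. m (t, x)) = 1"
    and vm: "set_borel_measurable lebesgue ?Q v" and mvi: "set_integrable lebesgue ?Q (\<lambda>z. m z *\<^sub>R v z)"
    and weak: "\<And>\<phi> \<phi>t \<phi>x. C1c_test T \<phi> \<phi>t \<phi>x \<Longrightarrow>
        (LINT z:?Q|lebesgue. m z * \<phi>t z + (m z *\<^sub>R v z) \<bullet> \<phi>x z) + (LINT x:unit_cell|lebesgue. \<phi> (0, x) * m0 x) = 0"
    using adm unfolding admissible_def by blast+
  have "(\<lambda>z. indicator ?Q z *\<^sub>R m z) \<in> borel_measurable lebesgue"
    using mi unfolding set_integrable_def by (rule borel_measurable_integrable)
  from completion_ex_borel_measurable_real[OF this] obtain m1 where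
    m1: "m1 \<in> borel_measurable borel" "AE z in lborel. indicator ?Q z *\<^sub>R m z = m1 z" by auto
  obtain v1 where v1: "v1 \<in> borel_measurable borel" "AE z in lborel. indicator ?Q z *\<^sub>R v z = v1 z"
    using lebesgue_borel_representative_vec[OF vm[unfolded set_borel_measurable_def]] by blast
  \<comment> \<open>Evaluating at \<open>tfrac\<close> makes the version periodic at every time and
    the maximum with 0 makes it nonnegative at every point; on the cell this alters the values of m
    at most on a null set.\<close>
  define M where "M z = max 0 (m1 (fst z, tfrac (snd z)))" for z
  define V where "V z = v1 (fst z, tfrac (snd z))" for z
  have Mm [measurable]: "M \<in> borel_measurable borel"
    unfolding M_def[abs_def] by (intro borel_measurable_max borel_measurable_const measurable_compose[OF measurable_pair_tfrac m1(1)])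
  have Vm [measurable]: "V \<in> borel_measurable borel"
    unfolding V_def[abs_def] by (rule measurable_compose[OF measurable_pair_tfrac v1(1)])
  have Mp: "periodic (\<lambda>x. M (t, x))" and Vp: "periodic (\<lambda>x. V (t, x))" for t
    unfolding M_def V_def by (simp_all add: periodic_def tfrac_add_lattice)
  have "AE z in lborel. z \<in> ?Q \<longrightarrow> 0 \<le> m z" using m0 by (simp add: AE_completion_iff)
  with m1(2) v1(2) have aeQ: "AE z in lborel. z \<in> ?Q \<longrightarrow> M z = m z \<and> V z = v z"
    by eventually_elim (auto simp: M_def V_def tfrac_id)
  have ae: "AE z in lborel. fst z \<in> {0<..<T} \<longrightarrow> M z = m z \<and> V z = v z"
  proof (rule AE_periodic_extend[OF aeQ])
    fix t x and k :: "real^'n" assume "t \<in> {0<..<T}" "k \<in> int_lattice" "M (t, x) = m (t, x) \<and> V (t, x) = v (t, x)"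
    then show "M (t, x + k) = m (t, x + k) \<and> V (t, x + k) = v (t, x + k)"
      using periodicD[OF Mp] periodicD[OF Vp] periodicD[OF per(1)] periodicD[OF per(2)] by simp
  qed
  have Mi: "set_integrable lborel ?Q M"
    by (rule set_integrable_AE_borel(1)[OF mi Mm]) (use aeQ in \<open>auto elim!: eventually_mono\<close>)
  have Wi: "set_integrable lborel ?Q (\<lambda>z. M z *\<^sub>R V z)"
    by (rule set_integrable_AE_borel(1)[OF mvi]) (use aeQ in \<open>auto elim!: eventually_mono\<close>)
  have "weak_solution T m0 M V"
    unfolding weak_solution_def
  proof (intro conjI allI impI)
    show "0 \<le> M z" for z by (simp add: M_def)
    have "AE t in lborel. AE x in lborel. (t, x) \<in> ?Q \<longrightarrow> M (t, x) = m (t, x)"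
    proof -
      have "AE z in lborel. z \<in> ?Q \<longrightarrow> M z = m z" using aeQ by eventually_elim simp
      from lborel_pair.AE_pair[unfolded lborel_prod, OF this] show ?thesis .
    qed
    moreover have "AE t in lborel. t \<in> {0<..<T} \<longrightarrow> (LINT x:unit_cell|lebesgue. m (t, x)) = 1"
      using mass by (simp add: AE_completion_iff)
    ultimately show "AE t in lborel. t \<in> {0<..<T} \<longrightarrow> (LINT x:unit_cell|lborel. M (t, x)) = 1"
    proof eventually_elim
      case (elim t)
      show ?case
      proof
        assume t: "t \<in> {0<..<T}"
        have 1: "(LINT x:unit_cell|lebesgue. m (t, x)) = 1" using elim(2) t by blast
        have "set_integrable lebesgue unit_cell (\<lambda>x. m (t, x))"
          using 1 unfolding set_integrable_def set_lebesgue_integral_def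
          by (metis not_integrable_integral_eq zero_neq_one)
        moreover have "(\<lambda>x. M (t, x)) \<in> borel_measurable borel" by (rule measurable_compose[OF _ Mm]) simp
        moreover have "AE x in lborel. x \<in> unit_cell \<longrightarrow> m (t, x) = M (t, x)"
          using elim(1) by eventually_elim (use t in auto)
        ultimately show "(LINT x:unit_cell|lborel. M (t, x)) = 1"
          using set_integrable_AE_borel(2)[of unit_cell "\<lambda>x. m (t, x)" "\<lambda>x. M (t, x)"] 1 by simp
      qed
    qed
    fix \<phi> \<phi>t :: "real \<times> (real^'n) \<Rightarrow> real" and \<phi>x assume \<phi>: "C1c_test T \<phi> \<phi>t \<phi>x"
    let ?I = "{0..<T} \<times> (UNIV :: (real^'n) set)"
    let ?f = "\<lambda>z. m z * \<phi>t z + (m z *\<^sub>R v z) \<bullet> \<phi>x z"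
      and ?F = "\<lambda>z. M z * (indicator ?I z * \<phi>t z) + (M z *\<^sub>R V z) \<bullet> (indicator ?I z *\<^sub>R \<phi>x z)"
    note tm [measurable] = C1c_test_borel[OF \<phi>]
    have Fm: "?F \<in> borel_measurable borel" by measurable
    have cF: "(LINT z:?Q|lborel. ?F z) = (LINT z:?Q|lborel. M z * \<phi>t z + (M z *\<^sub>R V z) \<bullet> \<phi>x z)"
      by (rule set_lebesgue_integral_cong) (auto simp: indicator_def)
    have iF: "set_integrable lborel ?Q ?F"
    proof -
      have "set_integrable lborel ?Q ?F = set_integrable lborel ?Q (\<lambda>z. M z * \<phi>t z + (M z *\<^sub>R V z) \<bullet> \<phi>x z)"
        by (rule set_integrable_cong) (auto simp: indicator_def)
      then show ?thesis using test_integrable[OF Mi Wi \<phi> T] by simp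
    qed
    have mF: "(\<lambda>z. indicator ?Q z *\<^sub>R ?F z) \<in> borel_measurable lborel" using Fm by measurable
    have "(LINT z:?Q|lebesgue. ?f z) = (LINT z:?Q|lebesgue. ?F z)"
      unfolding set_lebesgue_integral_def
    proof (rule integral_cong_AE)
      show "AE z in lebesgue. indicator ?Q z *\<^sub>R ?f z = indicator ?Q z *\<^sub>R ?F z"
      proof (rule AE_completion)
        show "AE z in lborel. indicator ?Q z *\<^sub>R ?f z = indicator ?Q z *\<^sub>R ?F z"
          using aeQ by eventually_elim (auto simp: indicator_def)
      qed
      then have "AE z in lebesgue. indicator ?Q z *\<^sub>R ?F z = indicator ?Q z *\<^sub>R ?f z"
        by eventually_elim (rule sym)
      then show "(\<lambda>z. indicator ?Q z *\<^sub>R ?f z) \<in> borel_measurable lebesgue"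
        by (rule borel_measurable_AE[OF measurable_completion[OF mF]])
    qed (rule measurable_completion[OF mF])
    also have "\<dots> = (LINT z:?Q|lborel. ?F z)"
      unfolding set_lebesgue_integral_def by (rule integral_completion[OF mF])
    finally show "(LINT z:?Q|lborel. M z * \<phi>t z + (M z *\<^sub>R V z) \<bullet> \<phi>x z) + (LINT x:unit_cell|lebesgue. \<phi> (0, x) * m0 x) = 0"
      using weak[OF \<phi>] cF by simp
  qed (use Mp Vp Mi Wi in auto)
  then show ?thesis using ae by (rule that)
qed

text \<open>Competitors are built as Borel solutions; this returns them to the class over which
  minimality is known.\<close>

lemma weak_solution_admissible:
  fixes M :: "real \<times> (real^'n) \<Rightarrow> real"
  assumes sol: "weak_solution T m0 M V" and T: "0 < T"
  shows "(M, V) \<in> admissible T m0"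
proof -
  let ?Q = "{0<..<T} \<times> unit_cell :: (real \<times> (real^'n)) set"
  have [measurable]: "M \<in> borel_measurable borel" "V \<in> borel_measurable borel"
    and i: "set_integrable lborel ?Q M" "set_integrable lborel ?Q (\<lambda>z. M z *\<^sub>R V z)" and nn: "\<And>z. 0 \<le> M z"
    and mass: "AE t in lborel. t \<in> {0<..<T} \<longrightarrow> (LINT x:unit_cell|lborel. M (t, x)) = 1"
    and per: "\<And>t. periodic (\<lambda>x. M (t, x))" "\<And>t. periodic (\<lambda>x. V (t, x))"
    and weak: "\<And>\<phi> \<phi>t \<phi>x. C1c_test T \<phi> \<phi>t \<phi>x \<Longrightarrow>
        (LINT z:?Q|lborel. M z * \<phi>t z + (M z *\<^sub>R V z) \<bullet> \<phi>x z) + (LINT x:unit_cell|lebesgue. \<phi> (0, x) * m0 x) = 0"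
    using sol unfolding weak_solution_def by blast+
  have 1: "set_integrable lebesgue ?Q f" if "set_integrable lborel ?Q f"
    for f :: "real \<times> (real^'n) \<Rightarrow> 'b::euclidean_space"
    using that integrable_completion[of "\<lambda>z. indicator ?Q z *\<^sub>R f z" lborel] borel_measurable_integrable
    unfolding set_integrable_def by blast
  have mass': "(LINT x:unit_cell|lebesgue. M (t, x)) = (LINT x:unit_cell|lborel. M (t, x))" for t
  proof -
    have "(\<lambda>x. M (t, x)) \<in> borel_measurable borel" by (rule measurable_compose[of _ borel borel]) simp_all
    then have "(\<lambda>x. indicator unit_cell x *\<^sub>R M (t, x)) \<in> borel_measurable lborel" by simp
    then show ?thesis unfolding set_lebesgue_integral_def by (rule integral_completion)
  qed
  have 2: "(LINT z:?Q|lebesgue. M z * \<phi>t z + (M z *\<^sub>R V z) \<bullet> \<phi>x z) = (LINT z:?Q|lborel. M z * \<phi>t z + (M z *\<^sub>R V z) \<bullet> \<phi>x z)"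
    if "C1c_test T \<phi> \<phi>t \<phi>x" for \<phi> \<phi>t \<phi>x
    unfolding set_lebesgue_integral_def
    by (rule integral_completion[OF borel_measurable_integrable[OF test_integrable[OF i that T, unfolded set_integrable_def]]])
  show ?thesis
    unfolding admissible_def
  proof (clarify, intro conjI allI impI ballI)
    show "set_borel_measurable lebesgue ?Q V"
      unfolding set_borel_measurable_def by (intro measurable_completion) measurable
    show "AE t in lebesgue. t \<in> {0<..<T} \<longrightarrow> (LINT x:unit_cell|lebesgue. M (t, x)) = 1"
      unfolding mass' by (rule AE_completion[OF mass])
    show "(LINT z:?Q|lebesgue. M z * \<phi>t z + (M z *\<^sub>R V z) \<bullet> \<phi>x z) + (LINT x:unit_cell|lebesgue. \<phi> (0, x) * m0 x) = 0"
      if "C1c_test T \<phi> \<phi>t \<phi>x" for \<phi> \<phi>t \<phi>x using weak[OF that] 2[OF that] by simp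
  qed (use 1 i nn per in auto)
qed

subsection \<open>Shifted and averaged solutions\<close>

lemma spacetime_shift_integrable:
  fixes f :: "real \<times> (real^'n) \<Rightarrow> 'b::euclidean_space"
  assumes [measurable]: "f \<in> borel_measurable borel" "I \<in> sets borel" "a \<in> borel_measurable borel"
    and per: "\<And>t. t \<in> I \<Longrightarrow> periodic (\<lambda>x. f (t, x))"
    and int: "set_integrable lborel (I \<times> unit_cell) f"
  shows "set_integrable lborel (I \<times> unit_cell) (\<lambda>z. f (fst z, snd z + a (fst z)))"
proof -
  let ?h = "\<lambda>z. f (fst z, snd z + a (fst z))"
  have [measurable]: "?h \<in> borel_measurable borel"
    by (simp add: borel_prod[symmetric]) measurable
  have "(\<integral>\<^sup>+z\<in>I \<times> unit_cell. ennreal (norm (?h z)) \<partial>lborel) = (\<integral>\<^sup>+z\<in>I \<times> unit_cell. ennreal (norm (f z)) \<partial>lborel)"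
    using nn_integral_spacetime_shift[of "\<lambda>z. ennreal (norm (f z))" I a] per
    by (auto simp: periodic_def)
  moreover have e: "ennreal (norm (indicator A z *\<^sub>R c)) = ennreal (norm c) * indicator A z"
    for A and z :: "real \<times> (real^'n)" and c :: 'b
    by (simp add: indicator_def)
  ultimately show ?thesis
    using int unfolding set_integrable_def integrable_iff_bounded e by simp
qed

lemma cell_shift_integral_nonneg:
  fixes f :: "real^'n \<Rightarrow> real"
  assumes [measurable]: "f \<in> borel_measurable borel" and per: "periodic f" and nn: "\<And>x. 0 \<le> f x"
  shows "(LINT x:unit_cell|lborel. f (x + a)) = (LINT x:unit_cell|lborel. f x)"
proof -
  have e: "(LINT x:unit_cell|lborel. g x) = enn2real (\<integral>\<^sup>+x\<in>unit_cell. ennreal (g x) \<partial>lborel)"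
    if [measurable]: "g \<in> borel_measurable borel" and "\<And>x. 0 \<le> g x" for g :: "real^'n \<Rightarrow> real"
  proof -
    have "(LINT x:unit_cell|lborel. g x) = enn2real (\<integral>\<^sup>+x. ennreal (indicator unit_cell x *\<^sub>R g x) \<partial>lborel)"
      unfolding set_lebesgue_integral_def using that by (intro integral_eq_nn_integral) auto
    also have "(\<integral>\<^sup>+x. ennreal (indicator unit_cell x *\<^sub>R g x) \<partial>lborel) = (\<integral>\<^sup>+x\<in>unit_cell. ennreal (g x) \<partial>lborel)"
      by (intro nn_integral_cong) (auto simp: indicator_def)
    finally show ?thesis .
  qed
  have "(\<integral>\<^sup>+x\<in>unit_cell. ennreal (f (x + a)) \<partial>lborel) = (\<integral>\<^sup>+x\<in>unit_cell. ennreal (f x) \<partial>lborel)"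
    using per by (intro nn_integral_cell_shift[of "\<lambda>x. ennreal (f x)"]) (auto simp: periodic_def)
  then show ?thesis using nn by (subst (1 2) e) auto
qed

text \<open>A shift of the solution by +\<eta>(t)\<delta> becomes a shift of the test function by
  -\<eta>(t)\<delta>. The chain rule adds to the time derivative a term in \<eta>'(t)\<delta> and
  the spatial gradient, the source of the velocity correction of the shifted solution.\<close>

lemma C1c_test_shift:
  fixes \<phi> :: "real \<times> (real^'n) \<Rightarrow> real" and \<delta> :: "real^'n"
  assumes \<phi>: "C1c_test T \<phi> \<phi>t \<phi>x"
    and \<eta>: "\<And>t. (\<eta> has_real_derivative \<eta>' t) (at t)" and \<eta>': "continuous_on UNIV \<eta>'"
  defines "\<Phi> \<equiv> \<lambda>z. (fst z, snd z - \<eta> (fst z) *\<^sub>R \<delta>)"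
  shows "C1c_test T (\<lambda>z. \<phi> (\<Phi> z)) (\<lambda>z. \<phi>t (\<Phi> z) - \<eta>' (fst z) * (\<delta> \<bullet> \<phi>x (\<Phi> z))) (\<lambda>z. \<phi>x (\<Phi> z))"
proof -
  let ?S = "{0..<T} \<times> (UNIV :: (real^'n) set)"
  have c\<eta>: "continuous_on UNIV \<eta>"
    by (intro continuous_at_imp_continuous_on ballI DERIV_isCont[OF \<eta>])
  have c\<Phi>: "continuous_on ?S \<Phi>"
    unfolding \<Phi>_def by (intro continuous_intros continuous_on_compose2[OF c\<eta>]) auto
  have \<Phi>S: "\<Phi> ` ?S \<subseteq> ?S" by (auto simp: \<Phi>_def)
  have test: "\<And>t. t \<in> {0..<T} \<Longrightarrow> periodic (\<lambda>x. \<phi> (t, x))"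
    "\<And>z. z \<in> ?S \<Longrightarrow> (\<phi> has_derivative (\<lambda>(\<tau>, h). \<phi>t z * \<tau> + \<phi>x z \<bullet> h)) (at z within ?S)"
    "continuous_on ?S \<phi>t" "continuous_on ?S \<phi>x"
    using \<phi> unfolding C1c_test_def by blast+
  obtain T' where T': "T' < T" "\<And>t x. t \<in> {T'..<T} \<inter> {0..} \<Longrightarrow> \<phi> (t, x) = 0"
    using \<phi> unfolding C1c_test_def by blast
  have d\<Phi>: "(\<Phi> has_derivative (\<lambda>(\<tau>, h). (\<tau>, h - (\<eta>' (fst z) * \<tau>) *\<^sub>R \<delta>))) (at z within ?S)" for z
  proof -
    have "((\<lambda>z. \<eta> (fst z)) has_derivative (\<lambda>h. \<eta>' (fst z) * fst h)) (at z)"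
      using has_derivative_compose[OF has_derivative_fst[OF has_derivative_ident, of "at z"]] \<eta>[of "fst z"]
      unfolding has_field_derivative_def by blast
    then have "(\<Phi> has_derivative (\<lambda>h. (fst h, snd h - (\<eta>' (fst z) * fst h) *\<^sub>R \<delta>))) (at z)"
      unfolding \<Phi>_def
      by (intro has_derivative_Pair has_derivative_diff has_derivative_scaleR_left has_derivative_fst
          has_derivative_snd has_derivative_ident)
    then show ?thesis
      using has_derivative_at_withinI by (simp add: split_def)
  qed
  have der: "((\<lambda>z. \<phi> (\<Phi> z)) has_derivative
      (\<lambda>(\<tau>, h). (\<phi>t (\<Phi> z) - \<eta>' (fst z) * (\<delta> \<bullet> \<phi>x (\<Phi> z))) * \<tau> + \<phi>x (\<Phi> z) \<bullet> h)) (at z within ?S)"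
    if "z \<in> ?S" for z
  proof -
    have "((\<lambda>z. \<phi> (\<Phi> z)) has_derivative
        (\<lambda>y. (\<lambda>(\<tau>, h). \<phi>t (\<Phi> z) * \<tau> + \<phi>x (\<Phi> z) \<bullet> h) ((\<lambda>(\<tau>, h). (\<tau>, h - (\<eta>' (fst z) * \<tau>) *\<^sub>R \<delta>)) y))) (at z within ?S)"
      by (rule has_derivative_in_compose2[OF test(2) \<Phi>S that d\<Phi>])
    moreover have "(\<lambda>y. (\<lambda>(\<tau>, h). \<phi>t (\<Phi> z) * \<tau> + \<phi>x (\<Phi> z) \<bullet> h) ((\<lambda>(\<tau>, h). (\<tau>, h - (\<eta>' (fst z) * \<tau>) *\<^sub>R \<delta>)) y))
      = (\<lambda>(\<tau>, h). (\<phi>t (\<Phi> z) - \<eta>' (fst z) * (\<delta> \<bullet> \<phi>x (\<Phi> z))) * \<tau> + \<phi>x (\<Phi> z) \<bullet> h)"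
      by (auto simp: fun_eq_iff inner_diff_right inner_commute[of \<delta>] algebra_simps)
    ultimately show ?thesis by simp
  qed
  show ?thesis
    unfolding C1c_test_def
  proof (intro conjI ballI)
    show "periodic (\<lambda>x. \<phi> (\<Phi> (t, x)))" if "t \<in> {0..<T}" for t
      using periodic_shift[OF test(1)[OF that], of "- (\<eta> t *\<^sub>R \<delta>)"] by (simp add: \<Phi>_def)
    show "continuous_on ?S (\<lambda>z. \<phi>t (\<Phi> z) - \<eta>' (fst z) * (\<delta> \<bullet> \<phi>x (\<Phi> z)))"
      by (intro continuous_on_diff continuous_on_mult continuous_on_inner continuous_on_const
          continuous_on_compose2[OF test(3) c\<Phi> \<Phi>S] continuous_on_compose2[OF test(4) c\<Phi> \<Phi>S]
          continuous_on_compose2[OF \<eta>']) (auto intro!: continuous_intros)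
    show "continuous_on ?S (\<lambda>z. \<phi>x (\<Phi> z))"
      by (rule continuous_on_compose2[OF test(4) c\<Phi> \<Phi>S])
    show "\<exists>T'<T. \<forall>t\<in>{T'..<T} \<inter> {0..}. \<forall>x. \<phi> (\<Phi> (t, x)) = 0"
      using T' by (auto simp: \<Phi>_def)
  qed (rule der)
qed

text \<open>Undoing the shift in the integrals moves it to the test function, where
  \<open>C1c_test_shift\<close> applies; the extra term there matches the correction
  -\<eta>'\<delta> of the velocity. Since \<eta>(0) = 0 the initial datum is untouched.\<close>

lemma weak_solution_shift:
  fixes M :: "real \<times> (real^'n) \<Rightarrow> real"
  assumes sol: "weak_solution T m0 M V" and T: "0 < T"
    and \<eta>: "\<And>t. (\<eta> has_real_derivative \<eta>' t) (at t)" and \<eta>': "continuous_on UNIV \<eta>'" and \<eta>0: "\<eta> 0 = 0"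
  shows "weak_solution T m0 (\<lambda>z. M (fst z, snd z + \<eta> (fst z) *\<^sub>R \<delta>))
     (\<lambda>z. V (fst z, snd z + \<eta> (fst z) *\<^sub>R \<delta>) - \<eta>' (fst z) *\<^sub>R \<delta>)"
proof -
  let ?Q = "{0<..<T} \<times> unit_cell :: (real \<times> (real^'n)) set"
  define a where "a t = \<eta> t *\<^sub>R \<delta>" for t
  have Mm [measurable]: "M \<in> borel_measurable borel" and Vm [measurable]: "V \<in> borel_measurable borel"
    and i: "set_integrable lborel ?Q M" "set_integrable lborel ?Q (\<lambda>z. M z *\<^sub>R V z)" and nn: "\<And>z. 0 \<le> M z"
    and mass: "AE t in lborel. t \<in> {0<..<T} \<longrightarrow> (LINT x:unit_cell|lborel. M (t, x)) = 1"
    and per: "\<And>t. periodic (\<lambda>x. M (t, x))" "\<And>t. periodic (\<lambda>x. V (t, x))"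
    and weak: "\<And>\<phi> \<phi>t \<phi>x. C1c_test T \<phi> \<phi>t \<phi>x \<Longrightarrow>
        (LINT z:?Q|lborel. M z * \<phi>t z + (M z *\<^sub>R V z) \<bullet> \<phi>x z) + (LINT x:unit_cell|lebesgue. \<phi> (0, x) * m0 x) = 0"
    using sol unfolding weak_solution_def by blast+
  have c\<eta>: "continuous_on UNIV \<eta>"
    by (intro continuous_at_imp_continuous_on ballI DERIV_isCont[OF \<eta>])
  have m\<eta>: "\<eta> \<in> borel_measurable borel" and m\<eta>': "\<eta>' \<in> borel_measurable borel"
    using c\<eta> \<eta>' by (auto intro: borel_measurable_continuous_onI)
  have am [measurable]: "a \<in> borel_measurable borel" unfolding a_def[abs_def] using m\<eta> by simp
  have \<Phi>m: "(\<lambda>z :: real \<times> (real^'n). (fst z, snd z + a (fst z))) \<in> borel_measurable borel"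
    "(\<lambda>z :: real \<times> (real^'n). (fst z, snd z - a (fst z))) \<in> borel_measurable borel"
    by (intro borel_measurable_Pair borel_measurable_add borel_measurable_diff borel_measurable_fst_snd
        borel_measurable_fst_compose[OF am])+
  have \<eta>'m [measurable]: "(\<lambda>z :: real \<times> (real^'n). \<eta>' (fst z)) \<in> borel_measurable borel"
    by (rule borel_measurable_fst_compose[OF m\<eta>'])
  define M1 where "M1 z = M (fst z, snd z + a (fst z))" for z
  define V1 where "V1 z = V (fst z, snd z + a (fst z)) - \<eta>' (fst z) *\<^sub>R \<delta>" for z
  have M1m [measurable]: "M1 \<in> borel_measurable borel"
    unfolding M1_def[abs_def] by (rule measurable_compose[OF \<Phi>m(1) Mm])
  have V1m [measurable]: "V1 \<in> borel_measurable borel"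
    unfolding V1_def[abs_def] by (intro borel_measurable_diff borel_measurable_scaleR borel_measurable_const
        \<eta>'m measurable_compose[OF \<Phi>m(1) Vm])
  obtain Be where Be: "\<And>t. t \<in> {0<..<T} \<Longrightarrow> \<bar>\<eta>' t\<bar> \<le> Be" by (rule compact_interval_bounded[OF \<eta>']) blast
  have perW: "periodic (\<lambda>x. M (t, x) *\<^sub>R V (t, x))" for t using per[of t] by (simp add: periodic_def)
  have iM1: "set_integrable lborel ?Q M1"
    unfolding M1_def by (rule spacetime_shift_integrable[OF Mm _ am per(1) i(1)]) simp
  have iW: "set_integrable lborel ?Q (\<lambda>z. M (fst z, snd z + a (fst z)) *\<^sub>R V (fst z, snd z + a (fst z)))"
    by (rule spacetime_shift_integrable[OF _ _ am perW i(2)]) simp_all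
  have iE: "set_integrable lborel ?Q (\<lambda>z. (M1 z * \<eta>' (fst z)) *\<^sub>R \<delta>)"
  proof -
    have "set_integrable lborel ?Q (\<lambda>z. M1 z * \<eta>' (fst z))"
      by (rule set_integrable_mult_bounded[OF iM1 \<eta>'m, of Be]) (use Be in auto)
    then have "integrable lborel (\<lambda>z. (indicator ?Q z *\<^sub>R (M1 z * \<eta>' (fst z))) *\<^sub>R \<delta>)"
      unfolding set_integrable_def by (rule integrable_scaleR_left)
    then show ?thesis unfolding set_integrable_def by simp
  qed
  have iW1: "set_integrable lborel ?Q (\<lambda>z. M1 z *\<^sub>R V1 z)"
    using set_integral_diff(1)[OF iW iE] by (simp add: M1_def V1_def scaleR_diff_right)
  have "weak_solution T m0 M1 V1"
    unfolding weak_solution_def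
  proof (intro conjI allI impI)
    show "0 \<le> M1 z" for z by (simp add: M1_def nn)
    show "periodic (\<lambda>x. M1 (t, x))" for t using periodic_shift[OF per(1)[of t], of "a t"] by (simp add: M1_def)
    show "periodic (\<lambda>x. V1 (t, x))" for t
      using periodic_shift[OF per(2)[of t], of "a t"] by (simp add: V1_def periodic_def)
    have "(LINT x:unit_cell|lborel. M1 (t, x)) = (LINT x:unit_cell|lborel. M (t, x))" for t
    proof -
      have "(\<lambda>x. M (t, x)) \<in> borel_measurable borel" by (rule measurable_compose[OF _ Mm]) simp
      then show ?thesis using cell_shift_integral_nonneg[OF _ per(1)[of t] nn, of "a t"] by (simp add: M1_def)
    qed
    then show "AE t in lborel. t \<in> {0<..<T} \<longrightarrow> (LINT x:unit_cell|lborel. M1 (t, x)) = 1" using mass by simp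
    fix \<phi> \<phi>t :: "real \<times> (real^'n) \<Rightarrow> real" and \<phi>x assume \<phi>: "C1c_test T \<phi> \<phi>t \<phi>x"
    let ?I = "{0..<T} \<times> (UNIV :: (real^'n) set)"
    define \<Phi> where "\<Phi> z = (fst z, snd z - \<eta> (fst z) *\<^sub>R \<delta>)" for z :: "real \<times> (real^'n)"
    have \<psi>: "C1c_test T (\<lambda>z. \<phi> (\<Phi> z)) (\<lambda>z. \<phi>t (\<Phi> z) - \<eta>' (fst z) * (\<delta> \<bullet> \<phi>x (\<Phi> z))) (\<lambda>z. \<phi>x (\<Phi> z))"
      unfolding \<Phi>_def by (rule C1c_test_shift[OF \<phi> \<eta> \<eta>'])
    define ft where "ft z = indicator ?I z * \<phi>t z" for z
    define fx where "fx z = indicator ?I z *\<^sub>R \<phi>x z" for z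
    have ftm: "ft \<in> borel_measurable borel" and fxm: "fx \<in> borel_measurable borel"
      using C1c_test_borel[OF \<phi>] by (auto simp: ft_def[abs_def] fx_def[abs_def])
    \<comment> \<open>Read at the shifted point, \<open>F\<close> is the integrand of the new pair;
      read at the point itself, it is that of the old pair against the moved test function.\<close>
    define F where "F z = M z * ft (\<Phi> z) + (M z *\<^sub>R (V z - \<eta>' (fst z) *\<^sub>R \<delta>)) \<bullet> fx (\<Phi> z)" for z
    have \<Phi>m': "\<Phi> \<in> borel_measurable borel" using \<Phi>m(2) by (simp add: \<Phi>_def[abs_def] a_def)
    have ftm' [measurable]: "(\<lambda>z. ft (\<Phi> z)) \<in> borel_measurable borel" by (rule measurable_compose[OF \<Phi>m' ftm])
    have fxm' [measurable]: "(\<lambda>z. fx (\<Phi> z)) \<in> borel_measurable borel" by (rule measurable_compose[OF \<Phi>m' fxm])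
    have Fm: "F \<in> borel_measurable borel" unfolding F_def[abs_def] by measurable
    have FQ: "F z = M z * (\<phi>t (\<Phi> z) - \<eta>' (fst z) * (\<delta> \<bullet> \<phi>x (\<Phi> z))) + (M z *\<^sub>R V z) \<bullet> \<phi>x (\<Phi> z)"
      if "z \<in> ?Q" for z
    proof -
      have "\<Phi> z \<in> ?I" using that by (auto simp: \<Phi>_def)
      then show ?thesis by (simp add: F_def ft_def fx_def inner_diff_left algebra_simps)
    qed
    have iF: "set_integrable lborel ?Q F"
      using test_integrable[OF i \<psi> T] set_integrable_cong[of lborel lborel ?Q ?Q F, OF refl refl FQ] by simp
    have perF: "periodic (\<lambda>x. F (t, x))" if t: "t \<in> {0<..<T}" for t
    proof -
      have "periodic (\<lambda>x. ft (\<Phi> (t, x)))"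
        using periodic_shift[OF C1c_test_periodic(1)[OF \<phi> t], of "- (\<eta> t *\<^sub>R \<delta>)"] t by (simp add: ft_def \<Phi>_def indicator_def)
      moreover have "periodic (\<lambda>x. fx (\<Phi> (t, x)))"
        using periodic_shift[OF C1c_test_periodic(2)[OF \<phi> t], of "- (\<eta> t *\<^sub>R \<delta>)"] t by (simp add: fx_def \<Phi>_def indicator_def)
      ultimately show ?thesis using per[of t] by (simp add: F_def periodic_def)
    qed
    have "(LINT z:?Q|lborel. M1 z * \<phi>t z + (M1 z *\<^sub>R V1 z) \<bullet> \<phi>x z) = (LINT z:?Q|lborel. F (fst z, snd z + a (fst z)))"
    proof (rule set_lebesgue_integral_cong, simp, intro allI impI)
      fix z assume z: "z \<in> ?Q"
      have "\<Phi> (fst z, snd z + a (fst z)) = z" by (simp add: \<Phi>_def a_def)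
      moreover have "z \<in> ?I" using z by auto
      ultimately show "M1 z * \<phi>t z + (M1 z *\<^sub>R V1 z) \<bullet> \<phi>x z = F (fst z, snd z + a (fst z))"
        by (simp add: F_def ft_def fx_def M1_def V1_def)
    qed
    also have "\<dots> = (LINT z:?Q|lborel. F z)"
      by (rule spacetime_shift_integral(2)[OF Fm _ am perF iF]) simp
    also have "\<dots> = (LINT z:?Q|lborel. M z * (\<phi>t (\<Phi> z) - \<eta>' (fst z) * (\<delta> \<bullet> \<phi>x (\<Phi> z))) + (M z *\<^sub>R V z) \<bullet> \<phi>x (\<Phi> z))"
      by (rule set_lebesgue_integral_cong) (use FQ in auto)
    also have "\<dots> = - (LINT x:unit_cell|lebesgue. \<phi> (\<Phi> (0, x)) * m0 x)" using weak[OF \<psi>] by linarith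
    also have "\<dots> = - (LINT x:unit_cell|lebesgue. \<phi> (0, x) * m0 x)" by (simp add: \<Phi>_def \<eta>0)
    finally show "(LINT z:?Q|lborel. M1 z * \<phi>t z + (M1 z *\<^sub>R V1 z) \<bullet> \<phi>x z) + (LINT x:unit_cell|lebesgue. \<phi> (0, x) * m0 x) = 0"
      by simp
  qed (use iM1 iW1 in simp_all)
  then show ?thesis unfolding M1_def V1_def a_def .
qed

text \<open>The continuity equation is linear in density and momentum but not in the velocity, so
  the average is taken in the former and the velocity is recovered by division.\<close>

lemma weak_solution_average:
  fixes M1 M2 :: "real \<times> (real^'n) \<Rightarrow> real"
  assumes sol1: "weak_solution T m0 M1 V1" and sol2: "weak_solution T m0 M2 V2" and T: "0 < T"
  shows "weak_solution T m0 (\<lambda>z. (M1 z + M2 z) / 2) (\<lambda>z. (M1 z *\<^sub>R V1 z + M2 z *\<^sub>R V2 z) /\<^sub>R (M1 z + M2 z))"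
    (is "weak_solution T m0 ?M ?V")
proof -
  let ?Q = "{0<..<T} \<times> unit_cell :: (real \<times> (real^'n)) set"
  have m1 [measurable]: "M1 \<in> borel_measurable borel" "V1 \<in> borel_measurable borel"
    and i1: "set_integrable lborel ?Q M1" "set_integrable lborel ?Q (\<lambda>z. M1 z *\<^sub>R V1 z)" and nn1: "\<And>z. 0 \<le> M1 z"
    and mass1: "AE t in lborel. t \<in> {0<..<T} \<longrightarrow> (LINT x:unit_cell|lborel. M1 (t, x)) = 1"
    and per1: "\<And>t. periodic (\<lambda>x. M1 (t, x))" "\<And>t. periodic (\<lambda>x. V1 (t, x))"
    and weak1: "\<And>\<phi> \<phi>t \<phi>x. C1c_test T \<phi> \<phi>t \<phi>x \<Longrightarrow>
        (LINT z:?Q|lborel. M1 z * \<phi>t z + (M1 z *\<^sub>R V1 z) \<bullet> \<phi>x z) + (LINT x:unit_cell|lebesgue. \<phi> (0, x) * m0 x) = 0"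
    using sol1 unfolding weak_solution_def by blast+
  have m2 [measurable]: "M2 \<in> borel_measurable borel" "V2 \<in> borel_measurable borel"
    and i2: "set_integrable lborel ?Q M2" "set_integrable lborel ?Q (\<lambda>z. M2 z *\<^sub>R V2 z)" and nn2: "\<And>z. 0 \<le> M2 z"
    and mass2: "AE t in lborel. t \<in> {0<..<T} \<longrightarrow> (LINT x:unit_cell|lborel. M2 (t, x)) = 1"
    and per2: "\<And>t. periodic (\<lambda>x. M2 (t, x))" "\<And>t. periodic (\<lambda>x. V2 (t, x))"
    and weak2: "\<And>\<phi> \<phi>t \<phi>x. C1c_test T \<phi> \<phi>t \<phi>x \<Longrightarrow>
        (LINT z:?Q|lborel. M2 z * \<phi>t z + (M2 z *\<^sub>R V2 z) \<bullet> \<phi>x z) + (LINT x:unit_cell|lebesgue. \<phi> (0, x) * m0 x) = 0"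
    using sol2 unfolding weak_solution_def by blast+
  \<comment> \<open>Division by zero gives 0, which is harmless: where M1 + M2 vanishes, both
    densities vanish by nonnegativity. Elsewhere the factors 1/2 of density and momentum cancel in
    the velocity.\<close>
  have W: "?M z *\<^sub>R ?V z = (1 / 2) *\<^sub>R (M1 z *\<^sub>R V1 z + M2 z *\<^sub>R V2 z)" for z
  proof (cases "M1 z + M2 z = 0")
    case True
    then have "M1 z = 0" "M2 z = 0" using nn1[of z] nn2[of z] by linarith+
    then show ?thesis by simp
  next
    case False
    then show ?thesis by simp
  qed
  have half: "set_integrable lborel A (\<lambda>z. (1 / 2) *\<^sub>R f z)" if "set_integrable lborel A f"
    for A :: "'a::euclidean_space set" and f :: "'a \<Rightarrow> 'b::euclidean_space"
    using that by (rule set_integrable_scaleR_right)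
  have iM: "set_integrable lborel ?Q ?M"
    using half[OF set_integral_add(1)[OF i1(1) i2(1)]] by simp
  have iW: "set_integrable lborel ?Q (\<lambda>z. ?M z *\<^sub>R ?V z)"
    unfolding W by (rule half[OF set_integral_add(1)[OF i1(2) i2(2)]])
  have Vm: "?V \<in> borel_measurable borel" by measurable
  show ?thesis
    unfolding weak_solution_def
  proof (intro conjI allI impI)
    show "?M \<in> borel_measurable borel" by measurable
    show "0 \<le> ?M z" for z using nn1[of z] nn2[of z] by simp
    show "periodic (\<lambda>x. ?M (t, x))" "periodic (\<lambda>x. ?V (t, x))" for t
      using per1[of t] per2[of t] by (simp_all add: periodic_def)
    show "AE t in lborel. t \<in> {0<..<T} \<longrightarrow> (LINT x:unit_cell|lborel. ?M (t, x)) = 1"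
      using mass1 mass2
    proof eventually_elim
      case (elim t)
      show ?case
      proof
        assume t: "t \<in> {0<..<T}"
        have 1: "(LINT x:unit_cell|lborel. M1 (t, x)) = 1" "(LINT x:unit_cell|lborel. M2 (t, x)) = 1" using elim t by blast+
        then have "set_integrable lborel unit_cell (\<lambda>x. M1 (t, x))" "set_integrable lborel unit_cell (\<lambda>x. M2 (t, x))"
          unfolding set_integrable_def set_lebesgue_integral_def by (metis not_integrable_integral_eq zero_neq_one)+
        from set_integral_add(2)[OF this] 1 show "(LINT x:unit_cell|lborel. ?M (t, x)) = 1"
          by simp
      qed
    qed
    fix \<phi> \<phi>t :: "real \<times> (real^'n) \<Rightarrow> real" and \<phi>x assume \<phi>: "C1c_test T \<phi> \<phi>t \<phi>x"
    have "?M z * \<phi>t z + (?M z *\<^sub>R ?V z) \<bullet> \<phi>x z =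
       (1 / 2) *\<^sub>R ((M1 z * \<phi>t z + (M1 z *\<^sub>R V1 z) \<bullet> \<phi>x z) + (M2 z * \<phi>t z + (M2 z *\<^sub>R V2 z) \<bullet> \<phi>x z))" for z
      unfolding W by (simp add: inner_add_left algebra_simps add_divide_distrib)
    then have "(LINT z:?Q|lborel. ?M z * \<phi>t z + (?M z *\<^sub>R ?V z) \<bullet> \<phi>x z)
      = (LINT z:?Q|lborel. (1 / 2) *\<^sub>R ((M1 z * \<phi>t z + (M1 z *\<^sub>R V1 z) \<bullet> \<phi>x z) + (M2 z * \<phi>t z + (M2 z *\<^sub>R V2 z) \<bullet> \<phi>x z)))"
      by (simp only:)
    also have "\<dots> = (1 / 2) *\<^sub>R ((LINT z:?Q|lborel. M1 z * \<phi>t z + (M1 z *\<^sub>R V1 z) \<bullet> \<phi>x z)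
         + (LINT z:?Q|lborel. M2 z * \<phi>t z + (M2 z *\<^sub>R V2 z) \<bullet> \<phi>x z))"
      using set_integral_add(2)[OF test_integrable[OF i1 \<phi> T] test_integrable[OF i2 \<phi> T]]
      by (simp only: set_integral_scaleR_right)
    finally have eq: "(LINT z:?Q|lborel. ?M z * \<phi>t z + (?M z *\<^sub>R ?V z) \<bullet> \<phi>x z) = \<dots>" .
    have e: "(LINT z:?Q|lborel. M1 z * \<phi>t z + (M1 z *\<^sub>R V1 z) \<bullet> \<phi>x z) = - (LINT x:unit_cell|lebesgue. \<phi> (0, x) * m0 x)"
      "(LINT z:?Q|lborel. M2 z * \<phi>t z + (M2 z *\<^sub>R V2 z) \<bullet> \<phi>x z) = - (LINT x:unit_cell|lebesgue. \<phi> (0, x) * m0 x)"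
      using weak1[OF \<phi>] weak2[OF \<phi>] by linarith+
    show "(LINT z:?Q|lborel. ?M z * \<phi>t z + (?M z *\<^sub>R ?V z) \<bullet> \<phi>x z) + (LINT x:unit_cell|lebesgue. \<phi> (0, x) * m0 x) = 0"
      unfolding eq e by simp
  qed (use iM iW Vm in simp_all)
qed

subsection \<open>Uniform convexity\<close>

text \<open>In terms of density s and momentum p this is the midpoint convexity of |p|^2 / s. The
  triangle inequality reduces it to the speeds, where the defect is s1 s2 times the square of their
  difference.\<close>

lemma kinetic_energy_convex:
  fixes v1 v2 :: "'a::real_inner"
  assumes "0 \<le> s1" "0 \<le> s2"
  shows "(s1 + s2) / 2 * (norm ((s1 *\<^sub>R v1 + s2 *\<^sub>R v2) /\<^sub>R (s1 + s2)))\<^sup>2 \<le> (s1 * (norm v1)\<^sup>2 + s2 * (norm v2)\<^sup>2) / 2"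
proof (cases "s1 + s2 = 0")
  case True
  then show ?thesis using assms by simp
next
  case False
  then have S: "0 < s1 + s2" using assms by simp
  have "norm (s1 *\<^sub>R v1 + s2 *\<^sub>R v2) \<le> s1 * norm v1 + s2 * norm v2"
    using norm_triangle_ineq[of "s1 *\<^sub>R v1" "s2 *\<^sub>R v2"] assms by simp
  then have "(norm (s1 *\<^sub>R v1 + s2 *\<^sub>R v2))\<^sup>2 \<le> (s1 * norm v1 + s2 * norm v2)\<^sup>2"
    by (intro power_mono) auto
  also have "\<dots> \<le> (s1 + s2) * (s1 * (norm v1)\<^sup>2 + s2 * (norm v2)\<^sup>2)"
  proof -
    have "(s1 + s2) * (s1 * (norm v1)\<^sup>2 + s2 * (norm v2)\<^sup>2) - (s1 * norm v1 + s2 * norm v2)\<^sup>2 = s1 * s2 * (norm v1 - norm v2)\<^sup>2"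
      by (simp add: power2_eq_square algebra_simps)
    moreover have "0 \<le> s1 * s2 * (norm v1 - norm v2)\<^sup>2" using assms by simp
    ultimately show ?thesis by linarith
  qed
  finally have *: "(norm (s1 *\<^sub>R v1 + s2 *\<^sub>R v2))\<^sup>2 / (s1 + s2) \<le> s1 * (norm v1)\<^sup>2 + s2 * (norm v2)\<^sup>2"
    using S by (simp add: pos_divide_le_eq mult.commute)
  define S n where "S = s1 + s2" and "n = norm (s1 *\<^sub>R v1 + s2 *\<^sub>R v2)"
  have "norm ((s1 *\<^sub>R v1 + s2 *\<^sub>R v2) /\<^sub>R S) = n / S"
    using S by (simp add: n_def S_def divide_inverse mult.commute)
  moreover have "S / 2 * (n / S)\<^sup>2 = (n\<^sup>2 / S) / 2"
    by (simp add: power2_eq_square)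
  ultimately show ?thesis using * unfolding S_def[symmetric] n_def[symmetric] by simp
qed

section \<open>Midpoint gain of the congestion cost and continuity of \<open>J\<close>\<close>

lemma ennreal_half_add_half: "ennreal (1 / 2) * a + ennreal (1 / 2) * a = a"
proof -
  have "ennreal (1 / 2) + ennreal (1 / 2) = ennreal (1 / 2 + 1 / 2)" by (rule ennreal_plus[symmetric]) simp_all
  also have "1 / 2 + 1 / 2 = (1 :: real)" by simp
  finally show ?thesis by (simp only: distrib_right[symmetric] mult_1_left ennreal_1)
qed

lemma ennreal_midpoint_le_iff:
  assumes "0 \<le> p" "0 \<le> d" "0 \<le> a" "0 \<le> b"
  shows "ennreal p + ennreal d \<le> ennreal (1 / 2) * ennreal a + ennreal (1 / 2) * ennreal b \<longleftrightarrow> p + d \<le> (a + b) / 2"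
proof -
  have h: "0 \<le> (1 / 2 :: real)" by simp
  have "ennreal (1 / 2) * ennreal a + ennreal (1 / 2) * ennreal b = ennreal (1 / 2 * a + 1 / 2 * b)"
    unfolding ennreal_mult[OF h assms(3), symmetric] ennreal_mult[OF h assms(4), symmetric]
    by (rule ennreal_plus[symmetric]) (use assms in auto)
  also have "1 / 2 * a + 1 / 2 * b = (a + b) / 2" by (simp add: add_divide_distrib)
  finally have "ennreal (1 / 2) * ennreal a + ennreal (1 / 2) * ennreal b = ennreal ((a + b) / 2)" .
  moreover have "0 \<le> (a + b) / 2" using assms by simp
  ultimately show ?thesis using assms by (simp only: ennreal_plus[symmetric] ennreal_le_iff)
qed

text \<open>By \<open>primitive_bounds\<close> on both sides of s, \<open>g s\<close> is the slope
  of a line supporting the primitive at s, so the supremum in the conjugate is reached there. This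
  is the equality case of Young's inequality.\<close>

lemma conjugate_primitive_le:
  assumes g: "mono_on {0..} g" and s: "0 \<le> s" and fin: "g s < \<infinity>" "primitive g s < \<infinity>"
  shows "conjugate (primitive g) (enn2real (g s)) \<le> ereal (s * enn2real (g s) - enn2real (primitive g s))"
  unfolding conjugate_def
proof (rule SUP_least)
  fix r :: real
  define q p where "q = enn2real (g s)" and "p = enn2real (primitive g s)"
  have q: "g s = ennreal q" "0 \<le> q" and p: "primitive g s = ennreal p" "0 \<le> p"
    using fin by (auto simp: q_def p_def ennreal_enn2real_if)
  show "ereal (r * enn2real (g s)) - enn2ereal (primitive g r) \<le> ereal (s * enn2real (g s) - enn2real (primitive g s))"
  proof (cases "primitive g r")
    case top
    then show ?thesis by simp
  next
    case (real p')
    then have r: "0 \<le> r" by (auto simp: primitive_def split: if_splits)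
    have "r * q - p' \<le> s * q - p"
    proof (cases "s \<le> r")
      case True
      have "ennreal (p + q * (r - s)) = ennreal p + ennreal q * ennreal (r - s)"
        using True p q by (subst ennreal_plus) (auto simp: ennreal_mult)
      then have "ennreal (p + q * (r - s)) \<le> ennreal p'"
        using primitive_bounds(1)[OF g s True] unfolding q(1) p(1) real(2) by simp
      then have "p + q * (r - s) \<le> p'" using real(1) by (simp only: ennreal_le_iff)
      then show ?thesis by (simp add: algebra_simps)
    next
      case False
      have "ennreal (p' + q * (s - r)) = ennreal p' + ennreal q * ennreal (s - r)"
        using False real(1) q by (subst ennreal_plus) (auto simp: ennreal_mult)
      then have "ennreal p \<le> ennreal (p' + q * (s - r))"
        using primitive_bounds(2)[OF g r, of s] False unfolding q(1) p(1) real(2) by simp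
      moreover have "0 \<le> p' + q * (s - r)" using real(1) q False by simp
      ultimately have "p \<le> p' + q * (s - r)" by (simp only: ennreal_le_iff)
      then show ?thesis by (simp add: algebra_simps)
    qed
    then show ?thesis using real by (simp add: q_def[symmetric] p_def[symmetric] enn2ereal_ennreal)
  qed
qed

lemma primitive_mono:
  assumes g: "mono_on {0..} g"
  shows "0 \<le> a \<Longrightarrow> a \<le> b \<Longrightarrow> primitive g a \<le> primitive g b"
  using primitive_bounds(1)[OF g, of a b] by (meson le_iff_add order_trans)

lemma finite_domain_borel:
  assumes g: "mono_on {0..} g"
  shows "{s. 0 \<le> s \<and> primitive g s < \<infinity>} \<in> sets borel"
proof -
  have "is_interval {s. 0 \<le> s \<and> primitive g s < \<infinity>}"
    unfolding is_interval_1
  proof (intro ballI allI impI)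
    fix a b x assume ab: "a \<in> {s. 0 \<le> s \<and> primitive g s < \<infinity>}" "b \<in> {s. 0 \<le> s \<and> primitive g s < \<infinity>}" and x: "a \<le> x \<and> x \<le> b"
    then have "primitive g x \<le> primitive g b" by (intro primitive_mono[OF g]) auto
    with ab x show "x \<in> {s. 0 \<le> s \<and> primitive g s < \<infinity>}" by (auto intro: le_less_trans)
  qed
  then show ?thesis by (rule real_interval_borel_measurable)
qed

context
  fixes g :: "real \<Rightarrow> ennreal" and c :: real and J Js :: "real \<Rightarrow> real"
  assumes g: "mono_on {0..} g" and c: "0 < c"
    and coercive: "\<And>s q. ereal (s * q + c * \<bar>J s - Js q\<bar>\<^sup>2) \<le> enn2ereal (primitive g s) + conjugate (primitive g) q"
begin

text \<open>With the slope q of the midpoint, Young's inequality is an equality there, and adding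
  the coercivity inequalities at s0 and s1 cancels the linear terms. Averaging costs a factor 2, and
  so does bounding (J s0 - J s1)^2 by twice the sum of the squared distances of J s0 and J s1 to
  \<open>Js q\<close>; hence c/4.\<close>

lemma primitive_midpoint_gain_less:
  assumes s: "0 \<le> s0" "s0 < s1" and fin: "primitive g s0 < \<infinity>" "primitive g s1 < \<infinity>"
  shows "primitive g ((s0 + s1) / 2) + ennreal (c / 4 * (J s0 - J s1)\<^sup>2)
    \<le> ennreal (1 / 2) * primitive g s0 + ennreal (1 / 2) * primitive g s1"
proof -
  define r where "r = (s0 + s1) / 2"
  have r: "0 \<le> r" "s0 < r" "r < s1" using s by (auto simp: r_def)
  have b: "primitive g r + g r * ennreal (s1 - r) \<le> primitive g s1"
    by (rule primitive_bounds(1)[OF g r(1)]) (use r in simp)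
  then have fr: "primitive g r + g r * ennreal (s1 - r) < \<infinity>" using fin(2) by (rule le_less_trans)
  then have pr: "primitive g r < \<infinity>" by simp
  \<comment> \<open>This uses r < s1 strictly: an infinite slope at r would make the primitive
    infinite at s1.\<close>
  have gr: "g r < \<infinity>"
  proof (rule ccontr)
    assume "\<not> g r < \<infinity>"
    then have "g r = top" by (simp add: less_top[symmetric])
    then show False using fr r by (simp add: ennreal_top_mult)
  qed
  define q p where "q = enn2real (g r)" and "p = enn2real (primitive g r)"
  define p0 p1 where "p0 = enn2real (primitive g s0)" and "p1 = enn2real (primitive g s1)"
  have e: "primitive g r = ennreal p" "primitive g s0 = ennreal p0" "primitive g s1 = ennreal p1"
    and nn: "0 \<le> p" "0 \<le> p0" "0 \<le> p1"
    using pr fin by (auto simp: p_def p0_def p1_def ennreal_enn2real_if)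
  have conj: "conjugate (primitive g) q \<le> ereal (r * q - p)"
    unfolding q_def p_def by (rule conjugate_primitive_le[OF g r(1) gr pr])
  have i: "s * q + c * (J s - Js q)\<^sup>2 \<le> ps + (r * q - p)" if "primitive g s = ennreal ps" "0 \<le> ps" for s ps
  proof -
    have "ereal (s * q + c * \<bar>J s - Js q\<bar>\<^sup>2) \<le> enn2ereal (primitive g s) + conjugate (primitive g) q"
      by (rule coercive)
    also have "\<dots> \<le> ereal ps + ereal (r * q - p)"
      using that conj by (intro add_mono) (simp_all add: enn2ereal_ennreal)
    finally show ?thesis by simp
  qed
  have "2 * ((J s0 - Js q)\<^sup>2 + (J s1 - Js q)\<^sup>2) - (J s0 - J s1)\<^sup>2 = ((J s0 - Js q) + (J s1 - Js q))\<^sup>2"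
    by (simp add: power2_eq_square algebra_simps)
  then have "(J s0 - J s1)\<^sup>2 \<le> 2 * ((J s0 - Js q)\<^sup>2 + (J s1 - Js q)\<^sup>2)"
    using zero_le_power2[of "(J s0 - Js q) + (J s1 - Js q)"] by linarith
  then have "c / 4 * (J s0 - J s1)\<^sup>2 \<le> c / 4 * (2 * ((J s0 - Js q)\<^sup>2 + (J s1 - Js q)\<^sup>2))"
    using c by (intro mult_left_mono) auto
  also have "\<dots> = (c * (J s0 - Js q)\<^sup>2 + c * (J s1 - Js q)\<^sup>2) / 2" by (simp add: algebra_simps)
  also have "\<dots> \<le> (p0 + p1) / 2 - p"
  proof -
    have lin: "(A + B) / 2 \<le> (p0 + p1) / 2 - p"
      if "X + Y = 2 * Z" "X + A \<le> p0 + (Z - p)" "Y + B \<le> p1 + (Z - p)" for A B X Y Z :: real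
      using that by (simp add: field_simps)
    have "s0 * q + s1 * q = 2 * (r * q)" by (simp add: r_def algebra_simps)
    then show ?thesis using i[OF e(2) nn(2)] i[OF e(3) nn(3)] by (rule lin)
  qed
  finally have "p + c / 4 * (J s0 - J s1)\<^sup>2 \<le> (p0 + p1) / 2" by (simp only: le_diff_eq add.commute)
  then show ?thesis
    unfolding r_def[symmetric] e using c nn by (subst ennreal_midpoint_le_iff) auto
qed

lemma primitive_midpoint_gain:
  assumes s: "0 \<le> s0" "0 \<le> s1" and fin: "primitive g s0 < \<infinity>" "primitive g s1 < \<infinity>"
  shows "primitive g ((s0 + s1) / 2) + ennreal (c / 4 * (J s0 - J s1)\<^sup>2)
    \<le> ennreal (1 / 2) * primitive g s0 + ennreal (1 / 2) * primitive g s1"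
proof -
  consider "s0 < s1" | "s1 < s0" | "s0 = s1" by linarith
  then show ?thesis
  proof cases
    case 1
    then show ?thesis using primitive_midpoint_gain_less s fin by blast
  next
    case 2
    then show ?thesis using primitive_midpoint_gain_less[OF s(2) 2 fin(2,1)]
      by (simp add: add.commute power2_commute)
  next
    case 3
    then show ?thesis by (simp add: ennreal_half_add_half del: ennreal_half)
  qed
qed

text \<open>Coercivity at the slope 0, where the conjugate is at most 0 because the primitive is
  nonnegative. It is what makes J(m) square integrable.\<close>

lemma J_growth:
  assumes "0 \<le> s" "primitive g s < \<infinity>"
  shows "ennreal (c * (J s - Js 0)\<^sup>2) \<le> primitive g s"
proof -
  define p where "p = enn2real (primitive g s)"
  have p: "primitive g s = ennreal p" "0 \<le> p" using assms(2) by (auto simp: p_def ennreal_enn2real_if)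
  have "conjugate (primitive g) 0 \<le> 0"
    unfolding conjugate_def by (rule SUP_least) (simp add: zero_ereal_def[symmetric] enn2ereal_nonneg)
  then have "enn2ereal (primitive g s) + conjugate (primitive g) 0 \<le> ereal p + 0"
    using p by (intro add_mono) (simp_all add: enn2ereal_ennreal)
  with coercive[of s 0] have "ereal (s * 0 + c * \<bar>J s - Js 0\<bar>\<^sup>2) \<le> ereal p + 0" by (rule order_trans)
  then show ?thesis using p by (simp add: ennreal_leI)
qed

text \<open>The delicate case is a right end point of the domain of finiteness, where the primitive
  may jump to infinity: there the sequence stays at or left of s, and s itself supplies the
  dominating function. Otherwise some b > s does.\<close>

lemma primitive_seq_continuous:
  assumes S: "\<And>j. 0 \<le> S j" "\<And>j. primitive g (S j) < \<infinity>" and s: "0 \<le> s" "primitive g s < \<infinity>" and lim: "S \<longlonglongrightarrow> s"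
  shows "(\<lambda>j. primitive g (S j)) \<longlonglongrightarrow> primitive g s"
proof -
  obtain b where b: "0 \<le> b" "primitive g b < \<infinity>" "\<forall>\<^sub>F j in sequentially. S j \<le> b" "s \<le> b"
  proof (cases "\<exists>b>s. primitive g b < \<infinity>")
    case True
    then obtain b where "b > s" "primitive g b < \<infinity>" by blast
    then show ?thesis using order_tendstoD(2)[OF lim, of b] s
      by (intro that[of b]) (auto elim!: eventually_mono)
  next
    case False
    then have "S j \<le> s" for j using S(2)[of j] not_le by blast
    then show ?thesis using s by (intro that[of s]) auto
  qed
  obtain j0 where j0: "\<And>j. j \<ge> j0 \<Longrightarrow> S j \<le> b" using b(3) unfolding eventually_sequentially by blast
  have gm: "(\<lambda>r. g r * indicator {0..u} r) \<in> borel_measurable lborel" for u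
    using primitive_measurable[OF g, of "{0..u}"] by simp
  have "(\<lambda>j. \<integral>\<^sup>+r. g r * indicator {0..S (j + j0)} r \<partial>lborel) \<longlonglongrightarrow> (\<integral>\<^sup>+r. g r * indicator {0..s} r \<partial>lborel)"
  proof (rule nn_integral_dominated_convergence[where w="\<lambda>r. g r * indicator {0..b} r"])
    show "(\<integral>\<^sup>+r. g r * indicator {0..b} r \<partial>lborel) < \<infinity>" using b by (simp add: primitive_def)
    show "AE r in lborel. g r * indicator {0..S (j + j0)} r \<le> g r * indicator {0..b} r" for j
      using j0[of "j + j0"] by (intro AE_I2) (auto simp: indicator_def)
    have "AE r in lborel. r \<noteq> s" by (rule AE_lborel_singleton)
    then show "AE r in lborel. (\<lambda>j. g r * indicator {0..S (j + j0)} r) \<longlonglongrightarrow> g r * indicator {0..s} r"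
    proof eventually_elim
      case (elim r)
      have l: "(\<lambda>j. S (j + j0)) \<longlonglongrightarrow> s" by (rule LIMSEQ_ignore_initial_segment[OF lim])
      have "\<forall>\<^sub>F j in sequentially. g r * indicator {0..S (j + j0)} r = g r * indicator {0..s} r"
      proof (cases "r < s")
        case True
        from order_tendstoD(1)[OF l this] show ?thesis
          by eventually_elim (use True in \<open>simp add: indicator_def\<close>)
      next
        case False
        then have "s < r" using elim by simp
        from order_tendstoD(2)[OF l this] show ?thesis
          by eventually_elim (use \<open>s < r\<close> in \<open>simp add: indicator_def\<close>)
      qed
      then show ?case by (rule tendsto_eventually)
    qed
  qed (rule gm)+
  moreover have "\<not> S j < 0" for j using S(1)[of j] by simp
  ultimately have "(\<lambda>j. primitive g (S (j + j0))) \<longlonglongrightarrow> primitive g s"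
    using s(1) by (simp add: primitive_def)
  then show ?thesis by (rule LIMSEQ_offset)
qed

text \<open>The midpoint gain bounds (J s0 - J s1)^2 by a multiple of the midpoint convexity defect
  of the primitive, which tends to 0 by continuity of the primitive. Borel measurability of
  \<open>J\<close> on the finite domain rests on this.\<close>

lemma J_continuous: "continuous_on {s. 0 \<le> s \<and> primitive g s < \<infinity>} J"
  unfolding continuous_on_sequentially
proof (intro allI ballI impI)
  fix S s assume s: "s \<in> {s. 0 \<le> s \<and> primitive g s < \<infinity>}"
    and S: "(\<forall>n. S n \<in> {s. 0 \<le> s \<and> primitive g s < \<infinity>}) \<and> S \<longlonglongrightarrow> s"
  define p where "p u = enn2real (primitive g u)" for u
  have pe: "primitive g u = ennreal (p u)" if "primitive g u < \<infinity>" for u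
    using that by (simp add: p_def ennreal_enn2real_if)
  define R where "R n = (S n + s) / 2" for n
  have R: "0 \<le> R n" "primitive g (R n) < \<infinity>" for n
  proof -
    show 0: "0 \<le> R n" using S s by (simp add: R_def)
    have "R n \<le> max (S n) s" by (auto simp: R_def)
    then have "primitive g (R n) \<le> primitive g (max (S n) s)" by (rule primitive_mono[OF g 0])
    also have "\<dots> < \<infinity>" using S s by (simp add: max_def)
    finally show "primitive g (R n) < \<infinity>" .
  qed
  have "R \<longlonglongrightarrow> (s + s) / 2" unfolding R_def using S by (intro tendsto_intros) auto
  then have Rl: "R \<longlonglongrightarrow> s" by simp
  have pl: "(\<lambda>n. p (S n)) \<longlonglongrightarrow> p s" "(\<lambda>n. p (R n)) \<longlonglongrightarrow> p s"
    unfolding p_def using S s R Rl by (auto intro!: tendsto_enn2real primitive_seq_continuous simp: less_top[symmetric])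
  have bound: "(J (S n) - J s)\<^sup>2 \<le> 4 / c * ((p (S n) + p s) / 2 - p (R n))" for n
  proof -
    have 1: "primitive g (R n) + ennreal (c / 4 * (J (S n) - J s)\<^sup>2) \<le> ennreal (1 / 2) * primitive g (S n) + ennreal (1 / 2) * primitive g s"
      unfolding R_def using S s by (intro primitive_midpoint_gain) auto
    have e: "primitive g (S n) = ennreal (p (S n))" "primitive g s = ennreal (p s)" using S s pe by blast+
    have "p (R n) + c / 4 * (J (S n) - J s)\<^sup>2 \<le> (p (S n) + p s) / 2"
      using 1 c unfolding pe[OF R(2)] e by (subst (asm) ennreal_midpoint_le_iff) (auto simp: p_def)
    then show ?thesis using c by (simp add: field_simps)
  qed
  have "(\<lambda>n. 4 / c * ((p (S n) + p s) / 2 - p (R n))) \<longlonglongrightarrow> 4 / c * ((p s + p s) / 2 - p s)"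
    by (intro tendsto_intros pl) simp
  then have "(\<lambda>n. 4 / c * ((p (S n) + p s) / 2 - p (R n))) \<longlonglongrightarrow> 0" by simp
  then have "(\<lambda>n. (J (S n) - J s)\<^sup>2) \<longlonglongrightarrow> 0"
    by (rule tendsto_sandwich[OF always_eventually always_eventually tendsto_const, rotated 2]) (use bound in blast | simp)+
  then have "(\<lambda>n. sqrt ((J (S n) - J s)\<^sup>2)) \<longlonglongrightarrow> sqrt 0" by (rule tendsto_real_sqrt)
  then have "(\<lambda>n. J (S n) - J s) \<longlonglongrightarrow> 0" by (simp add: tendsto_rabs_zero_iff)
  then show "(J \<circ> S) \<longlonglongrightarrow> J s" unfolding comp_def using Lim_null by blast
qed

end

subsection \<open>Strong limits of convex combinations\<close>

text \<open>Convex combinations of the tail from N, formed by repeated midpoints because these are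
  what the parallelogram identity handles. Properties such as periodicity or bounds on pairings pass
  to the hull by induction.\<close>

inductive_set mid_hull :: "(nat \<Rightarrow> 'a \<Rightarrow> real) \<Rightarrow> nat \<Rightarrow> ('a \<Rightarrow> real) set"
  for Q N where
  base: "N \<le> n \<Longrightarrow> Q n \<in> mid_hull Q N"
| mid: "f \<in> mid_hull Q N \<Longrightarrow> h \<in> mid_hull Q N \<Longrightarrow> (\<lambda>x. (f x + h x) / 2) \<in> mid_hull Q N"

lemma mid_hull_antimono: "f \<in> mid_hull Q N \<Longrightarrow> K \<le> N \<Longrightarrow> f \<in> mid_hull Q K"
  by (induction rule: mid_hull.induct) (auto intro: mid_hull.intros)

text \<open>
  Mazur's lemma: by the parallelogram identity, midpoint combinations of almost minimal norm in the
  tails of a bounded sequence form a Cauchy sequence.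
\<close>

lemma mid_hull_L2_limit:
  fixes Q :: "nat \<Rightarrow> 'a \<Rightarrow> real"
  assumes fin: "finite_measure M" and Qm: "\<And>n. Q n \<in> borel_measurable M"
    and QB: "\<And>n. (\<integral>\<^sup>+x. ennreal ((Q n x)\<^sup>2) \<partial>M) \<le> ennreal B" and B: "0 \<le> B"
  shows "\<exists>f. (\<forall>k. f k \<in> mid_hull Q k \<and> f k \<in> borel_measurable M) \<and>
    (\<forall>k. (\<integral>\<^sup>+x. ennreal ((f k x)\<^sup>2) \<partial>M) \<le> ennreal B) \<and>
    (\<forall>k. (\<integral>\<^sup>+x. ennreal ((f k x - lim (\<lambda>j. f j x))\<^sup>2) \<partial>M) \<le> ennreal ((1 / 4) ^ k))"
proof -
  interpret finite_measure M by fact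
  have hull: "f \<in> borel_measurable M \<and> integrable M (\<lambda>x. (f x)\<^sup>2) \<and> (LINT x|M. (f x)\<^sup>2) \<le> B"
    if "f \<in> mid_hull Q N" for f N
    using that
  proof induction
    case (base n)
    have i: "integrable M (\<lambda>x. (Q n x)\<^sup>2)"
      unfolding integrable_iff_bounded using Qm[of n] QB[of n] by (auto intro: le_less_trans)
    have "ennreal (LINT x|M. (Q n x)\<^sup>2) \<le> ennreal B"
      using nn_integral_eq_integral[OF i] QB[of n] by simp
    then show ?case using i Qm B by (simp add: ennreal_le_iff)
  next
    case (mid f h)
    then have [measurable]: "f \<in> borel_measurable M" "h \<in> borel_measurable M" by auto
    have le: "((f x + h x) / 2)\<^sup>2 \<le> ((f x)\<^sup>2 + (h x)\<^sup>2) / 2" for x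
    proof -
      have "0 \<le> (f x - h x)\<^sup>2" by simp
      then show ?thesis by (simp add: power2_eq_square field_simps)
    qed
    have i: "integrable M (\<lambda>x. ((f x)\<^sup>2 + (h x)\<^sup>2) / 2)" using mid by simp
    have i': "integrable M (\<lambda>x. ((f x + h x) / 2)\<^sup>2)"
    proof (rule Bochner_Integration.integrable_bound[OF i])
      show "AE x in M. norm (((f x + h x) / 2)\<^sup>2) \<le> norm (((f x)\<^sup>2 + (h x)\<^sup>2) / 2)"
        using le by (intro AE_I2) simp
    qed measurable
    have "(LINT x|M. ((f x + h x) / 2)\<^sup>2) \<le> (LINT x|M. ((f x)\<^sup>2 + (h x)\<^sup>2) / 2)"
      by (rule integral_mono[OF i' i le])
    also have "\<dots> \<le> B" using mid by simp
    finally show ?case using i' by simp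
  qed
  define e where "e f = (LINT x|M. (f x)\<^sup>2)" for f :: "'a \<Rightarrow> real"
  \<comment> \<open>The least energy over the tail from N can only grow with N and stays below B, so
    it converges; almost minimal elements of far tails are then close to each other.\<close>
  define d where "d N = (INF f\<in>mid_hull Q N. e f)" for N
  have e0: "0 \<le> e f" for f unfolding e_def by simp
  have ne: "mid_hull Q N \<noteq> {}" for N using mid_hull.base[of N N Q] by blast
  have bb: "bdd_below (e ` mid_hull Q N)" for N using e0 by (intro bdd_belowI[where m=0]) auto
  have d_le: "d N \<le> e f" if "f \<in> mid_hull Q N" for f N
    unfolding d_def by (rule cINF_lower[OF bb that])
  have d_mono: "d N \<le> d K" if "N \<le> K" for N K
    unfolding d_def[of K] by (rule cINF_greatest[OF ne d_le]) (use mid_hull_antimono that in blast)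
  have d_bd: "d N \<le> B" for N
  proof -
    have "d N \<le> e (Q N)" by (rule d_le[OF mid_hull.base]) simp
    also have "\<dots> \<le> B" using hull[OF mid_hull.base, of N N] by (simp add: e_def)
    finally show ?thesis .
  qed
  have "incseq d" using d_mono by (simp add: incseq_def)
  moreover have "bdd_above (range d)" using d_bd by (intro bdd_aboveI[where M=B]) auto
  ultimately have dl: "d \<longlonglongrightarrow> (SUP N. d N)" by (rule LIMSEQ_incseq_SUP[rotated])
  define D where "D = (SUP N. d N)"
  have dD: "d N \<le> D" for N unfolding D_def by (rule cSUP_upper[OF UNIV_I \<open>bdd_above (range d)\<close>])
  have "\<exists>f\<in>mid_hull Q N. e f < d N + (1 / 2) ^ N" for N
    using cInf_lessD[of "e ` mid_hull Q N" "d N + (1 / 2) ^ N"] ne by (auto simp: d_def)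
  then obtain F where F: "\<And>N. F N \<in> mid_hull Q N" "\<And>N. e (F N) < d N + (1 / 2) ^ N" by metis
  have par: "integrable M (\<lambda>x. (F i x - F j x)\<^sup>2) \<and>
      (LINT x|M. (F i x - F j x)\<^sup>2) \<le> 2 * (D - d i) + 4 * (1 / 2) ^ i" if "i \<le> j" for i j
  proof -
    note hi = hull[OF F(1)[of i]] and hj = hull[OF F(1)[of j]]
    have m: "(\<lambda>x. (F i x + F j x) / 2) \<in> mid_hull Q i"
      by (intro mid_hull.mid F(1) mid_hull_antimono[OF F(1) that])
    note hm = hull[OF m]
    have eq: "(F i x - F j x)\<^sup>2 = 2 * (F i x)\<^sup>2 + 2 * (F j x)\<^sup>2 - 4 * ((F i x + F j x) / 2)\<^sup>2" for x
      by (simp add: power2_eq_square field_simps)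
    have 1: "integrable M (\<lambda>x. (F i x - F j x)\<^sup>2)" unfolding eq using hi hj hm by simp
    have 2: "(LINT x|M. (F i x - F j x)\<^sup>2) = 2 * e (F i) + 2 * e (F j) - 4 * e (\<lambda>x. (F i x + F j x) / 2)"
      unfolding eq e_def using hi hj hm by simp
    have 3: "d i \<le> e (\<lambda>x. (F i x + F j x) / 2)" by (rule d_le[OF m])
    have 4: "(1 / 2 :: real) ^ j \<le> (1 / 2) ^ i" using that by (intro power_decreasing) auto
    have 5: "e (F i) < d i + (1 / 2) ^ i" "e (F j) < d j + (1 / 2) ^ j" "d j \<le> D" using F(2) dD by auto
    have "(LINT x|M. (F i x - F j x)\<^sup>2) \<le> 2 * (D - d i) + 4 * (1 / 2) ^ i"
    proof -
      have lin: "2 * a + 2 * b - 4 * m \<le> 2 * (D - di) + 4 * p"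
        if "di \<le> m" "q \<le> p" "a < di + p" "b < dj + q" "dj \<le> D" for a b m di dj p q :: real
        using that by (smt (verit))
      show ?thesis unfolding 2 by (rule lin[OF 3 4 5])
    qed
    with 1 show ?thesis ..
  qed
  have tail: "(\<lambda>i. 2 * (D - d i) + 4 * (1 / 2) ^ i) \<longlonglongrightarrow> 0"
  proof -
    have "(\<lambda>i. 2 * (D - d i) + 4 * (1 / 2) ^ i) \<longlonglongrightarrow> 2 * (D - D) + 4 * 0"
      using dl unfolding D_def[symmetric] by (intro tendsto_intros LIMSEQ_realpow_zero) auto
    then show ?thesis by simp
  qed
  have "\<exists>K. \<forall>i\<ge>K. 2 * (D - d i) + 4 * (1 / 2) ^ i < (1 / 4) ^ k" for k
    using order_tendstoD(2)[OF tail, of "(1 / 4) ^ k"] unfolding eventually_sequentially by simp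
  then obtain K where K: "\<And>k i. K k \<le> i \<Longrightarrow> 2 * (D - d i) + 4 * (1 / 2) ^ i < (1 / 4) ^ k" by metis
  \<comment> \<open>The sum makes the index nondecreasing in k while it dominates both k and the
    threshold \<open>K k\<close>.\<close>
  define r where "r k = k + (\<Sum>j\<le>k. K j)" for k
  have r1: "k \<le> r k" "K k \<le> r k" for k
    using member_le_sum[of k "{..k}" K] by (auto simp: r_def)
  have r2: "r k \<le> r j" if "k \<le> j" for k j
    unfolding r_def using that by (intro add_mono sum_mono2) auto
  define f where "f k = F (r k)" for k
  have fh: "f k \<in> mid_hull Q k" for k unfolding f_def by (rule mid_hull_antimono[OF F(1) r1(1)])
  have fm [measurable]: "f k \<in> borel_measurable M" for k using hull[OF fh] by blast
  have diff: "(\<integral>\<^sup>+x. ennreal ((f k x - f j x)\<^sup>2) \<partial>M) \<le> ennreal ((1 / 4) ^ k)" if "k \<le> j" for k j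
  proof -
    note p = par[OF r2[OF that], folded f_def]
    have "(LINT x|M. (f k x - f j x)\<^sup>2) \<le> (1 / 4) ^ k" using p K[OF r1(2), of k] by linarith
    then show ?thesis using nn_integral_eq_integral[of M "\<lambda>x. (f k x - f j x)\<^sup>2"] p by (simp add: ennreal_leI)
  qed
  define V where "V = measure M (space M)"
  have "(\<integral>\<^sup>+x. (\<Sum>k. ennreal \<bar>f (Suc k) x - f k x\<bar>) \<partial>M) = (\<Sum>k. \<integral>\<^sup>+x. ennreal \<bar>f (Suc k) x - f k x\<bar> \<partial>M)"
    by (rule nn_integral_suminf) measurable
  also have "\<dots> \<le> (\<Sum>k. ennreal ((V + 1) * (1 / 2) ^ k))"
  proof (rule suminf_le)
    fix k
    \<comment> \<open>Converts L^2 rates into summable L^1 rates on a finite measure space: as the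
      squared difference has integral at most 4^(-k), both summands have integral of order
      2^(-k).\<close>
    have pt: "\<bar>f (Suc k) x - f k x\<bar> \<le> (1 / 2) ^ k + 2 ^ k * (f k x - f (Suc k) x)\<^sup>2" for x
    proof -
      define u where "u = \<bar>f (Suc k) x - f k x\<bar>"
      have p: "(2 :: real) ^ k * (1 / 2) ^ k = 1" by (simp add: power_mult_distrib[symmetric])
      have u: "0 \<le> u" by (simp add: u_def)
      have "u \<le> (1 / 2) ^ k + 2 ^ k * u\<^sup>2"
      proof (cases "u \<le> (1 / 2) ^ k")
        case True
        then show ?thesis by (simp add: add_increasing2)
      next
        case False
        then have "2 ^ k * (1 / 2) ^ k \<le> 2 ^ k * u" by (intro mult_left_mono) auto
        then have "1 \<le> 2 ^ k * u" unfolding p .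
        then have "1 * u \<le> (2 ^ k * u) * u" using u by (intro mult_right_mono)
        then have "u \<le> 2 ^ k * u\<^sup>2" by (simp add: power2_eq_square mult.assoc)
        moreover have "0 \<le> (1 / 2 :: real) ^ k" by simp
        ultimately show ?thesis by linarith
      qed
      moreover have "u\<^sup>2 = (f k x - f (Suc k) x)\<^sup>2" by (simp add: u_def power2_commute)
      ultimately show ?thesis by (simp add: u_def)
    qed
    have "(\<integral>\<^sup>+x. ennreal \<bar>f (Suc k) x - f k x\<bar> \<partial>M) \<le> (\<integral>\<^sup>+x. ennreal ((1 / 2) ^ k) + ennreal (2 ^ k) * ennreal ((f k x - f (Suc k) x)\<^sup>2) \<partial>M)"
    proof (rule nn_integral_mono)
      fix x
      have "ennreal \<bar>f (Suc k) x - f k x\<bar> \<le> ennreal ((1 / 2) ^ k + 2 ^ k * (f k x - f (Suc k) x)\<^sup>2)"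
        by (rule ennreal_leI[OF pt])
      also have "\<dots> = ennreal ((1 / 2) ^ k) + ennreal (2 ^ k * (f k x - f (Suc k) x)\<^sup>2)" by (rule ennreal_plus) auto
      also have "ennreal (2 ^ k * (f k x - f (Suc k) x)\<^sup>2) = ennreal (2 ^ k) * ennreal ((f k x - f (Suc k) x)\<^sup>2)"
        by (rule ennreal_mult) auto
      finally show "ennreal \<bar>f (Suc k) x - f k x\<bar> \<le> ennreal ((1 / 2) ^ k) + ennreal (2 ^ k) * ennreal ((f k x - f (Suc k) x)\<^sup>2)" .
    qed
    also have "\<dots> = ennreal ((1 / 2) ^ k) * emeasure M (space M) + ennreal (2 ^ k) * (\<integral>\<^sup>+x. ennreal ((f k x - f (Suc k) x)\<^sup>2) \<partial>M)"
      by (simp add: nn_integral_add nn_integral_cmult)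
    also have "\<dots> \<le> ennreal ((1 / 2) ^ k) * ennreal V + ennreal (2 ^ k) * ennreal ((1 / 4) ^ k)"
      using diff[of k "Suc k"] by (intro add_mono mult_left_mono) (auto simp: V_def emeasure_eq_measure)
    also have "\<dots> = ennreal ((1 / 2) ^ k * V + 2 ^ k * (1 / 4) ^ k)"
      by (subst ennreal_plus) (auto simp: V_def ennreal_mult)
    also have "(1 / 2) ^ k * V + 2 ^ k * (1 / 4) ^ k = (V + 1) * (1 / 2 :: real) ^ k"
      by (simp add: power_mult_distrib[symmetric] distrib_right mult.commute)
    finally show "(\<integral>\<^sup>+x. ennreal \<bar>f (Suc k) x - f k x\<bar> \<partial>M) \<le> ennreal ((V + 1) * (1 / 2) ^ k)" .
  qed simp_all
  also have "\<dots> < \<infinity>"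
  proof -
    have "summable (\<lambda>k. (V + 1) * (1 / 2 :: real) ^ k)" by (intro summable_mult summable_geometric) simp
    then have "(\<Sum>k. ennreal ((V + 1) * (1 / 2) ^ k)) = ennreal (\<Sum>k. (V + 1) * (1 / 2) ^ k)"
      by (intro suminf_ennreal2) (auto simp: V_def)
    then show ?thesis by simp
  qed
  finally have "AE x in M. (\<Sum>k. ennreal \<bar>f (Suc k) x - f k x\<bar>) \<noteq> \<infinity>"
    by (intro nn_integral_PInf_AE) auto
  then have conv: "AE x in M. (\<lambda>j. f j x) \<longlonglongrightarrow> lim (\<lambda>j. f j x)"
  proof eventually_elim
    case (elim x)
    then have "summable (\<lambda>k. \<bar>f (Suc k) x - f k x\<bar>)" by (intro summable_suminf_not_top) auto
    then have "summable (\<lambda>k. f (Suc k) x - f k x)" by (rule summable_rabs_cancel)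
    then obtain l where "(\<lambda>n. \<Sum>k<n. f (Suc k) x - f k x) \<longlonglongrightarrow> l" unfolding summable_def sums_def by blast
    moreover have "(\<Sum>k<n. f (Suc k) x - f k x) = f n x - f 0 x" for n by (rule sum_lessThan_telescope)
    ultimately have "(\<lambda>n. f n x - f 0 x) \<longlonglongrightarrow> l" by (simp only:)
    then have "(\<lambda>n. (f n x - f 0 x) + f 0 x) \<longlonglongrightarrow> l + f 0 x" by (intro tendsto_add tendsto_const)
    then have "convergent (\<lambda>n. f n x)" by (auto simp: convergent_def)
    then show ?case by (simp add: convergent_LIMSEQ_iff)
  qed
  have "(\<integral>\<^sup>+x. ennreal ((f k x - lim (\<lambda>j. f j x))\<^sup>2) \<partial>M) \<le> ennreal ((1 / 4) ^ k)" for k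
  proof -
    \<comment> \<open>Fatou's lemma in j passes the Cauchy estimate to the pointwise limit.\<close>
    have "AE x in M. ennreal ((f k x - lim (\<lambda>j. f j x))\<^sup>2) = liminf (\<lambda>j. ennreal ((f k x - f j x)\<^sup>2))"
      using conv
    proof eventually_elim
      case (elim x)
      then have "(\<lambda>j. ennreal ((f k x - f j x)\<^sup>2)) \<longlonglongrightarrow> ennreal ((f k x - lim (\<lambda>j. f j x))\<^sup>2)"
        by (intro tendsto_ennrealI tendsto_intros)
      from lim_imp_Liminf[OF sequentially_bot this] show ?case by simp
    qed
    then have "(\<integral>\<^sup>+x. ennreal ((f k x - lim (\<lambda>j. f j x))\<^sup>2) \<partial>M) = (\<integral>\<^sup>+x. liminf (\<lambda>j. ennreal ((f k x - f j x)\<^sup>2)) \<partial>M)"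
      by (rule nn_integral_cong_AE)
    also have "\<dots> \<le> liminf (\<lambda>j. \<integral>\<^sup>+x. ennreal ((f k x - f j x)\<^sup>2) \<partial>M)"
      by (rule nn_integral_liminf) measurable
    also have "\<dots> \<le> ennreal ((1 / 4) ^ k)"
    proof (rule Liminf_le)
      show "\<forall>\<^sub>F j in sequentially. (\<integral>\<^sup>+x. ennreal ((f k x - f j x)\<^sup>2) \<partial>M) \<le> ennreal ((1 / 4) ^ k)"
        using eventually_ge_at_top[of k] by eventually_elim (rule diff)
    qed simp
    finally show ?thesis .
  qed
  moreover have "(\<integral>\<^sup>+x. ennreal ((f k x)\<^sup>2) \<partial>M) \<le> ennreal B" for k
    using hull[OF fh[of k]] by (subst nn_integral_eq_integral) (auto intro: ennreal_leI)
  ultimately show ?thesis using fh fm by blast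
qed

subsection \<open>Weak gradients from difference quotients\<close>

lemma C1_torus_difference_quotient:
  fixes \<phi> :: "real^'n \<Rightarrow> real"
  assumes \<phi>: "C1_torus \<phi> D" and e: "norm e = 1" and \<epsilon>: "0 < \<epsilon>"
  shows "\<exists>h0>0. \<forall>h x. 0 < h \<longrightarrow> h < h0 \<longrightarrow> \<bar>(\<phi> (x - h *\<^sub>R e) - \<phi> x) / h + D x \<bullet> e\<bar> \<le> \<epsilon>"
proof -
  have D: "\<And>x. GDERIV \<phi> x :> D x" "continuous_on UNIV D" "periodic \<phi>" using \<phi> by (auto simp: C1_torus_def)
  have pD: "periodic D" by (rule periodic_gradient[OF D(3,1)])
  \<comment> \<open>A compact ball containing the cell and its displacements by vectors of length at
    most 1; periodicity moves x into the cell, so uniform continuity here gives a bound uniform in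
    x.\<close>
  let ?K = "cball (0 :: real^'n) (CARD('n) + 1)"
  have "uniformly_continuous_on ?K D"
    by (intro compact_uniformly_continuous continuous_on_subset[OF D(2)]) auto
  then obtain h1 where h1: "0 < h1" "\<And>x y. x \<in> ?K \<Longrightarrow> y \<in> ?K \<Longrightarrow> dist y x < h1 \<Longrightarrow> dist (D y) (D x) < \<epsilon>"
    unfolding uniformly_continuous_on_def using \<epsilon> by meson
  show ?thesis
  proof (intro exI[of _ "min h1 1"] conjI allI impI)
    show "0 < min h1 1" using h1 by simp
    fix h and x :: "real^'n" assume h: "0 < h" "h < min h1 1"
    define y where "y = tfrac x"
    have y: "norm y \<le> CARD('n)" unfolding y_def by (rule norm_unit_cell_le) simp
    have "\<exists>s. 0 < s \<and> s < h \<and> \<phi> (y - h *\<^sub>R e) - \<phi> (y - 0 *\<^sub>R e) = (h - 0) * (- (e \<bullet> D (y - s *\<^sub>R e)))"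
    proof (rule MVT2[OF h(1)])
      fix s :: real
      have "((\<lambda>s. y - s *\<^sub>R e) has_derivative (\<lambda>t. - (t *\<^sub>R e))) (at s)"
        by (auto intro!: derivative_eq_intros)
      from has_derivative_compose[OF this D(1)[unfolded gderiv_def]]
      have "((\<lambda>s. \<phi> (y - s *\<^sub>R e)) has_derivative (\<lambda>t. (- (t *\<^sub>R e)) \<bullet> D (y - s *\<^sub>R e))) (at s)" .
      moreover have "(\<lambda>t. (- (t *\<^sub>R e)) \<bullet> D (y - s *\<^sub>R e)) = (*) (- (e \<bullet> D (y - s *\<^sub>R e)))"
        by (auto simp: fun_eq_iff)
      ultimately show "((\<lambda>s. \<phi> (y - s *\<^sub>R e)) has_real_derivative - (e \<bullet> D (y - s *\<^sub>R e))) (at s)"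
        unfolding has_field_derivative_def by simp
    qed
    then obtain s where s: "0 < s" "s < h" "\<phi> (y - h *\<^sub>R e) - \<phi> y = - (h * (e \<bullet> D (y - s *\<^sub>R e)))" by auto
    have "norm (y - s *\<^sub>R e) \<le> norm y + s"
      using norm_triangle_ineq4[of y "s *\<^sub>R e"] e s(1) by simp
    then have K: "y \<in> ?K" "y - s *\<^sub>R e \<in> ?K" using y s h by auto
    have "dist (y - s *\<^sub>R e) y < h1" using s h e by (simp add: dist_norm)
    from h1(2)[OF K(1,2) this] have d: "norm (D y - D (y - s *\<^sub>R e)) \<le> \<epsilon>" by (simp add: dist_norm norm_minus_commute)
    have "(\<phi> (y - h *\<^sub>R e) - \<phi> y) / h = - (e \<bullet> D (y - s *\<^sub>R e))" using s(3) h(1) by simp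
    then have "(\<phi> (y - h *\<^sub>R e) - \<phi> y) / h + D y \<bullet> e = (D y - D (y - s *\<^sub>R e)) \<bullet> e"
      by (simp add: inner_diff_left inner_commute[of _ e] inner_diff_right)
    also have "\<bar>\<dots>\<bar> \<le> \<epsilon>" using Cauchy_Schwarz_ineq2[of "D y - D (y - s *\<^sub>R e)" e] d e by simp
    finally have "\<bar>(\<phi> (y - h *\<^sub>R e) - \<phi> y) / h + D y \<bullet> e\<bar> \<le> \<epsilon>" .
    moreover have "\<phi> (y - h *\<^sub>R e) = \<phi> (x - h *\<^sub>R e)"
      using periodicD[OF D(3) diff_tfrac_lattice, of "y - h *\<^sub>R e" x] by (simp add: y_def)
    moreover have "\<phi> y = \<phi> x" "D y = D x"
      unfolding y_def by (rule periodic_tfrac[OF D(3)], rule periodic_tfrac[OF pD])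
    ultimately show "\<bar>(\<phi> (x - h *\<^sub>R e) - \<phi> x) / h + D x \<bullet> e\<bar> \<le> \<epsilon>" by simp
  qed
qed

lemma cell_integrable_of_square:
  fixes f :: "real^'n \<Rightarrow> real"
  assumes [measurable]: "f \<in> borel_measurable borel" and fin: "(\<integral>\<^sup>+x\<in>unit_cell. ennreal ((f x)\<^sup>2) \<partial>lborel) < \<infinity>"
  shows "set_integrable lborel unit_cell f"
  unfolding set_integrable_def integrable_iff_bounded
proof
  show "(\<lambda>x. indicator unit_cell x *\<^sub>R f x) \<in> borel_measurable lborel" by measurable
  have pt: "ennreal \<bar>y\<bar> \<le> 1 + ennreal (y\<^sup>2)" for y :: real
  proof -
    have "0 \<le> (\<bar>y\<bar> - 1)\<^sup>2" by simp
    then have "\<bar>y\<bar> \<le> 1 + y\<^sup>2" by (simp add: power2_diff)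
    then have "ennreal \<bar>y\<bar> \<le> ennreal (1 + y\<^sup>2)" by (rule ennreal_leI)
    also have "\<dots> = ennreal 1 + ennreal (y\<^sup>2)" by (rule ennreal_plus) auto
    finally show ?thesis by simp
  qed
  have "(\<integral>\<^sup>+x. ennreal (norm (indicator unit_cell x *\<^sub>R f x)) \<partial>lborel) \<le>
     (\<integral>\<^sup>+x. indicator unit_cell x + ennreal ((f x)\<^sup>2) * indicator unit_cell x \<partial>lborel)"
    by (intro nn_integral_mono) (use pt in \<open>auto simp: indicator_def\<close>)
  also have "\<dots> = emeasure lborel (unit_cell :: (real^'n) set) + (\<integral>\<^sup>+x\<in>unit_cell. ennreal ((f x)\<^sup>2) \<partial>lborel)"
    by (subst nn_integral_add) auto
  also have "\<dots> < \<infinity>" using fin emeasure_unit_cell_finite[where 'n='n] by simp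
  finally show "(\<integral>\<^sup>+x. ennreal (norm (indicator unit_cell x *\<^sub>R f x)) \<partial>lborel) < \<infinity>" .
qed

lemma cell_shift_integral:
  fixes f :: "real^'n \<Rightarrow> real"
  assumes fm [measurable]: "f \<in> borel_measurable borel" and per: "periodic f" and i: "set_integrable lborel unit_cell f"
  shows "set_integrable lborel unit_cell (\<lambda>x. f (x + a))" and "(LINT x:unit_cell|lborel. f (x + a)) = (LINT x:unit_cell|lborel. f x)"
proof -
  have *: "(\<integral>\<^sup>+x\<in>unit_cell. u (f (x + a)) \<partial>lborel) = (\<integral>\<^sup>+x\<in>unit_cell. u (f x) \<partial>lborel)"
    if [measurable]: "u \<in> borel_measurable borel" for u :: "real \<Rightarrow> ennreal"
    using nn_integral_cell_shift[of "\<lambda>x. u (f x)" a] per by (auto simp: periodic_def)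
  have e: "u (indicator A x * r) = u r * indicator A x" if "u 0 = (0::ennreal)"
    for u :: "real \<Rightarrow> ennreal" and A and x :: "real^'n" and r :: real
    using that by (simp add: indicator_def)
  note e' = e[of "\<lambda>x. ennreal \<bar>x\<bar>", simplified] e[of "\<lambda>x. ennreal x", simplified] e[of "\<lambda>x. ennreal (- x)", simplified]
  show 1: "set_integrable lborel unit_cell (\<lambda>x. f (x + a))"
    using i *[of "\<lambda>x. ennreal \<bar>x\<bar>"] unfolding set_integrable_def integrable_iff_bounded
    by (simp only: real_scaleR_def real_norm_def e') simp
  show "(LINT x:unit_cell|lborel. f (x + a)) = (LINT x:unit_cell|lborel. f x)"
    using 1 i *[of "\<lambda>x. ennreal x"] *[of "\<lambda>x. ennreal (- x)"]
    unfolding set_integrable_def set_lebesgue_integral_def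
    by (simp only: real_scaleR_def real_lebesgue_integral_def e') simp
qed

text \<open>Cauchy-Schwarz on the cell, which has finite measure, turns L^2 into L^1 convergence,
  and \<phi> is bounded.\<close>

lemma tendsto_cell_integral_of_L2:
  fixes f :: "nat \<Rightarrow> real^'n \<Rightarrow> real"
  assumes fm: "\<And>k. f k \<in> borel_measurable borel" and wm: "w \<in> borel_measurable borel" and pm: "\<phi> \<in> borel_measurable borel"
    and fi: "\<And>k. set_integrable lborel unit_cell (f k)" and wi: "set_integrable lborel unit_cell w"
    and \<phi>B: "\<And>x. \<bar>\<phi> x\<bar> \<le> B"
    and lim: "(\<lambda>k. \<integral>\<^sup>+x\<in>unit_cell. ennreal ((f k x - w x)\<^sup>2) \<partial>lborel) \<longlonglongrightarrow> 0"
  shows "(\<lambda>k. LINT x:unit_cell|lborel. f k x * \<phi> x) \<longlonglongrightarrow> (LINT x:unit_cell|lborel. w x * \<phi> x)"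
proof -
  note [measurable] = fm wm pm
  let ?c = "indicator (unit_cell :: (real^'n) set) :: real^'n \<Rightarrow> ennreal"
  have B0: "0 \<le> B" using \<phi>B[of 0] by linarith
  have ip: "set_integrable lborel unit_cell (\<lambda>x. f k x * \<phi> x)" "set_integrable lborel unit_cell (\<lambda>x. w x * \<phi> x)" for k
    by (rule set_integrable_mult_bounded[OF _ pm \<phi>B], rule fi wi)+
  define A where "A k = (\<integral>\<^sup>+x\<in>unit_cell. ennreal ((f k x - w x)\<^sup>2) \<partial>lborel)" for k
  define N where "N k = (\<integral>\<^sup>+x. ennreal \<bar>f k x - w x\<bar> * ?c x \<partial>lborel)" for k
  have N2: "(N k)\<^sup>2 \<le> A k * emeasure lborel (unit_cell :: (real^'n) set)" for k
  proof -
    have "(\<integral>\<^sup>+x. (ennreal \<bar>f k x - w x\<bar> * ?c x) * ?c x \<partial>lborel)\<^sup>2 \<le>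
      (\<integral>\<^sup>+x. (ennreal \<bar>f k x - w x\<bar> * ?c x)\<^sup>2 \<partial>lborel) * (\<integral>\<^sup>+x. (?c x)\<^sup>2 \<partial>lborel)"
      by (rule Cauchy_Schwarz_nn_integral) measurable
    moreover have "(\<integral>\<^sup>+x. (ennreal \<bar>f k x - w x\<bar> * ?c x) * ?c x \<partial>lborel) = N k"
      unfolding N_def by (intro nn_integral_cong) (auto simp: indicator_def)
    moreover have "(\<integral>\<^sup>+x. (ennreal \<bar>f k x - w x\<bar> * ?c x)\<^sup>2 \<partial>lborel) = A k"
      unfolding A_def by (intro nn_integral_cong) (auto simp: indicator_def ennreal_power)
    moreover have "(\<integral>\<^sup>+x. (?c x)\<^sup>2 \<partial>lborel) = emeasure lborel (unit_cell :: (real^'n) set)"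
    proof -
      have "(\<integral>\<^sup>+x. (?c x)\<^sup>2 \<partial>lborel) = (\<integral>\<^sup>+x. ?c x \<partial>lborel)"
        by (intro nn_integral_cong) (auto simp: indicator_def)
      then show ?thesis by simp
    qed
    ultimately show ?thesis by simp
  qed
  have dN: "ennreal \<bar>(LINT x:unit_cell|lborel. f k x * \<phi> x) - (LINT x:unit_cell|lborel. w x * \<phi> x)\<bar> \<le> ennreal B * N k" for k
  proof -
    have "(LINT x:unit_cell|lborel. f k x * \<phi> x) - (LINT x:unit_cell|lborel. w x * \<phi> x)
      = (LINT x:unit_cell|lborel. f k x * \<phi> x - w x * \<phi> x)"
      by (rule set_integral_diff(2)[symmetric, OF ip])
    also have "ennreal \<bar>\<dots>\<bar> \<le> (\<integral>\<^sup>+x. ennreal (norm (indicator unit_cell x *\<^sub>R (f k x * \<phi> x - w x * \<phi> x))) \<partial>lborel)"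
      unfolding set_lebesgue_integral_def real_norm_def[symmetric]
      using set_integral_diff(1)[OF ip] unfolding set_integrable_def by (rule integral_norm_bound_ennreal)
    also have "\<dots> \<le> (\<integral>\<^sup>+x. ennreal B * (ennreal \<bar>f k x - w x\<bar> * ?c x) \<partial>lborel)"
    proof (rule nn_integral_mono)
      fix x
      have "\<bar>f k x * \<phi> x - w x * \<phi> x\<bar> = \<bar>\<phi> x\<bar> * \<bar>f k x - w x\<bar>" by (simp add: abs_mult[symmetric] algebra_simps)
      also have "\<dots> \<le> B * \<bar>f k x - w x\<bar>" by (intro mult_right_mono \<phi>B) simp
      finally have "ennreal \<bar>f k x * \<phi> x - w x * \<phi> x\<bar> \<le> ennreal B * ennreal \<bar>f k x - w x\<bar>"
        using B0 by (simp add: ennreal_mult[symmetric] ennreal_leI)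
      then show "ennreal (norm (indicator unit_cell x *\<^sub>R (f k x * \<phi> x - w x * \<phi> x))) \<le> ennreal B * (ennreal \<bar>f k x - w x\<bar> * ?c x)"
        by (simp add: indicator_def)
    qed
    also have "\<dots> = ennreal B * N k" unfolding N_def by (rule nn_integral_cmult) measurable
    finally show ?thesis .
  qed
  have "(\<lambda>k. emeasure lborel (unit_cell :: (real^'n) set) * A k) \<longlonglongrightarrow> emeasure lborel (unit_cell :: (real^'n) set) * 0"
    using lim emeasure_unit_cell_finite[where 'n='n] unfolding A_def[symmetric]
    by (intro ennreal_tendsto_cmult) auto
  then have "(\<lambda>k. A k * emeasure lborel (unit_cell :: (real^'n) set)) \<longlonglongrightarrow> 0" by (simp add: mult.commute)
  then have N2l: "(\<lambda>k. (N k)\<^sup>2) \<longlonglongrightarrow> 0"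
    by (rule tendsto_sandwich[OF always_eventually always_eventually tendsto_const, rotated 2]) (use N2 in auto)
  have Nl: "N \<longlonglongrightarrow> 0"
  proof (rule order_tendstoI)
    fix a :: ennreal assume "0 < a"
    then have "0 < a\<^sup>2" by (simp add: power2_eq_square ennreal_zero_less_mult_iff)
    from order_tendstoD(2)[OF N2l this] show "\<forall>\<^sub>F k in sequentially. N k < a"
    proof eventually_elim
      case (elim k)
      show ?case
      proof (rule ccontr)
        assume "\<not> N k < a"
        then have "a\<^sup>2 \<le> (N k)\<^sup>2" by (intro power_mono) auto
        with elim show False by simp
      qed
    qed
  qed simp
  then have "(\<lambda>k. ennreal B * N k) \<longlonglongrightarrow> ennreal B * 0"
    by (intro ennreal_tendsto_cmult) auto
  then have "(\<lambda>k. ennreal B * N k) \<longlonglongrightarrow> 0" by simp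
  then have "(\<lambda>k. ennreal \<bar>(LINT x:unit_cell|lborel. f k x * \<phi> x) - (LINT x:unit_cell|lborel. w x * \<phi> x)\<bar>) \<longlonglongrightarrow> 0"
    by (rule tendsto_sandwich[OF always_eventually always_eventually tendsto_const, rotated 2]) (use dN in auto)
  then have "(\<lambda>k. \<bar>(LINT x:unit_cell|lborel. f k x * \<phi> x) - (LINT x:unit_cell|lborel. w x * \<phi> x)\<bar>) \<longlonglongrightarrow> 0"
    by (intro tendsto_ennrealD) auto
  then show ?thesis using tendsto_rabs_zero_iff Lim_null by blast
qed

lemma borel_measurable_cell_integral:
  fixes f :: "real \<times> (real^'n) \<Rightarrow> ennreal"
  assumes [measurable]: "f \<in> borel_measurable borel"
  shows "(\<lambda>t. \<integral>\<^sup>+x\<in>unit_cell. f (t, x) \<partial>lborel) \<in> borel_measurable borel"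
proof -
  have "(\<lambda>z. f z * indicator (UNIV \<times> unit_cell) z) \<in> borel_measurable (lborel \<Otimes>\<^sub>M lborel)"
    unfolding lborel_prod by measurable
  from lborel.borel_measurable_nn_integral_fst[OF this] show ?thesis by (simp add: indicator_times)
qed

lemma AE_finite_slice:
  fixes f :: "real \<times> (real^'n) \<Rightarrow> ennreal"
  assumes f [measurable]: "f \<in> borel_measurable borel" and I [measurable]: "I \<in> sets borel"
    and fin: "(\<integral>\<^sup>+z\<in>I \<times> unit_cell. f z \<partial>lborel) < \<infinity>"
  shows "AE t in lborel. (\<integral>\<^sup>+x\<in>unit_cell. f (t, x) \<partial>lborel) * indicator I t \<noteq> \<infinity>"
proof (rule nn_integral_PInf_AE)
  note [measurable] = borel_measurable_cell_integral[OF f]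
  show "(\<lambda>t. (\<integral>\<^sup>+x\<in>unit_cell. f (t, x) \<partial>lborel) * indicator I t) \<in> borel_measurable lborel"
    by measurable
  show "(\<integral>\<^sup>+t. (\<integral>\<^sup>+x\<in>unit_cell. f (t, x) \<partial>lborel) * indicator I t \<partial>lborel) \<noteq> \<infinity>"
    using fin by (subst (asm) nn_integral_Times) auto
qed

text \<open>The difference quotients along e are bounded in L^2 of space-time, so midpoint
  combinations of their tails converge strongly to some w, with summable errors. Then almost every
  time slice converges in L^2 as well, and at such a time every test function may be inserted. The
  quotients tested against \<phi> tend to minus the pairing of \<open>U\<close> with the derivative
  of \<phi> along e, and so do their combinations.\<close>

lemma weak_partial_derivative:
  fixes U :: "real \<times> (real^'n) \<Rightarrow> real"
  assumes Um: "U \<in> borel_measurable borel" and per: "\<And>t. periodic (\<lambda>x. U (t, x))"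
    and I [measurable]: "I \<in> sets borel" and Ifin: "emeasure lborel I < \<infinity>"
    and U2: "(\<integral>\<^sup>+z\<in>I \<times> unit_cell. ennreal ((U z)\<^sup>2) \<partial>lborel) < \<infinity>"
    and K: "0 \<le> K" and diff: "\<And>\<delta>. (\<integral>\<^sup>+z\<in>I \<times> unit_cell. ennreal ((U (fst z, snd z + \<delta>) - U z)\<^sup>2) \<partial>lborel) \<le> ennreal (K * (norm \<delta>)\<^sup>2)"
    and e: "norm e = 1"
  shows "\<exists>w :: real \<times> (real^'n) \<Rightarrow> real. w \<in> borel_measurable borel \<and> (\<forall>t. periodic (\<lambda>x. w (t, x))) \<and>
    (\<integral>\<^sup>+z\<in>I \<times> unit_cell. ennreal ((w z)\<^sup>2) \<partial>lborel) < \<infinity> \<and>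
    (AE t in lborel. t \<in> I \<longrightarrow> (\<forall>\<phi> D. C1_torus \<phi> D \<longrightarrow>
       (LINT x:unit_cell|lborel. U (t, x) * (D x \<bullet> e)) = - (LINT x:unit_cell|lborel. w (t, x) * \<phi> x)))"
proof -
  note [measurable] = Um
  define S where "S = I \<times> (unit_cell :: (real^'n) set)"
  have Sm [measurable]: "S \<in> sets borel" unfolding S_def by measurable
  define M where "M = density lborel (indicator S :: real \<times> (real^'n) \<Rightarrow> ennreal)"
  have sM: "sets M = sets borel" by (simp add: M_def)
  have bM: "g \<in> borel_measurable M \<longleftrightarrow> g \<in> borel_measurable borel" for g :: "real \<times> (real^'n) \<Rightarrow> real"
    by (simp add: M_def)
  have nnM: "(\<integral>\<^sup>+z. g z \<partial>M) = (\<integral>\<^sup>+z\<in>I \<times> unit_cell. g z \<partial>lborel)" if [measurable]: "g \<in> borel_measurable borel"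
    for g :: "real \<times> (real^'n) \<Rightarrow> ennreal"
    unfolding M_def S_def[symmetric] by (subst nn_integral_density) (auto simp: mult.commute)
  have "emeasure lborel S = emeasure lborel I * emeasure lborel (unit_cell :: (real^'n) set)"
    unfolding S_def lborel_prod[symmetric] by (intro lborel.emeasure_pair_measure_Times) auto
  also have "\<dots> < \<infinity>" using Ifin emeasure_unit_cell_finite[where 'n='n] by (simp add: ennreal_mult_less_top)
  finally have Sfin: "emeasure lborel S < \<infinity>" .
  have "finite_measure M"
  proof
    have "emeasure M (space M) = emeasure lborel S" by (simp add: M_def emeasure_density)
    then show "emeasure M (space M) \<noteq> \<infinity>" using Sfin by simp
  qed
  define h where "h n = 1 / real (Suc n)" for n
  have h: "0 < h n" for n by (simp add: h_def)
  define Q where "Q n z = (U (fst z, snd z + h n *\<^sub>R e) - U z) / h n" for n z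
  have shm: "(\<lambda>z :: real \<times> (real^'n). (fst z, snd z + a)) \<in> borel_measurable borel" for a
    by (intro borel_measurable_Pair borel_measurable_add borel_measurable_const borel_measurable_fst_snd)
  have Ush [measurable]: "(\<lambda>z. U (fst z, snd z + a)) \<in> borel_measurable borel" for a
    by (rule measurable_compose[OF shm Um])
  have Qm: "Q n \<in> borel_measurable borel" for n unfolding Q_def[abs_def] by measurable
  have QB: "(\<integral>\<^sup>+z. ennreal ((Q n z)\<^sup>2) \<partial>M) \<le> ennreal K" for n
  proof -
    have "ennreal ((Q n z)\<^sup>2) = ennreal (1 / (h n)\<^sup>2) * ennreal ((U (fst z, snd z + h n *\<^sub>R e) - U z)\<^sup>2)" for z
      by (simp add: Q_def power_divide ennreal_mult[symmetric])
    then have "(\<integral>\<^sup>+z. ennreal ((Q n z)\<^sup>2) \<partial>M) = ennreal (1 / (h n)\<^sup>2) * (\<integral>\<^sup>+z\<in>I \<times> unit_cell. ennreal ((U (fst z, snd z + h n *\<^sub>R e) - U z)\<^sup>2) \<partial>lborel)"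
      using Qm by (subst nnM) (auto simp: mult.assoc nn_integral_cmult)
    also have "\<dots> \<le> ennreal (1 / (h n)\<^sup>2) * ennreal (K * (norm (h n *\<^sub>R e))\<^sup>2)"
      by (intro mult_left_mono diff) simp
    also have "\<dots> = ennreal K"
      using h[of n] e K by (simp add: ennreal_mult[symmetric] power_mult_distrib)
    finally show ?thesis .
  qed
  have "\<exists>f. (\<forall>k. f k \<in> mid_hull Q k \<and> f k \<in> borel_measurable M) \<and>
    (\<forall>k. (\<integral>\<^sup>+x. ennreal ((f k x)\<^sup>2) \<partial>M) \<le> ennreal K) \<and>
    (\<forall>k. (\<integral>\<^sup>+x. ennreal ((f k x - lim (\<lambda>j. f j x))\<^sup>2) \<partial>M) \<le> ennreal ((1 / 4) ^ k))"
    by (rule mid_hull_L2_limit[OF \<open>finite_measure M\<close> _ QB K]) (use Qm bM in blast)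
  then obtain f where fh: "\<And>k. f k \<in> mid_hull Q k" and fm': "\<And>k. f k \<in> borel_measurable M"
    and fK: "\<And>k. (\<integral>\<^sup>+z. ennreal ((f k z)\<^sup>2) \<partial>M) \<le> ennreal K"
    and fw': "\<And>k. (\<integral>\<^sup>+z. ennreal ((f k z - lim (\<lambda>j. f j z))\<^sup>2) \<partial>M) \<le> ennreal ((1 / 4) ^ k)" by blast
  have fm [measurable]: "f k \<in> borel_measurable borel" for k using fm' bM by blast
  define w where "w z = lim (\<lambda>j. f j z)" for z
  have wm [measurable]: "w \<in> borel_measurable borel" unfolding w_def[abs_def] by measurable
  have fw: "(\<integral>\<^sup>+z\<in>I \<times> unit_cell. ennreal ((f k z - w z)\<^sup>2) \<partial>lborel) \<le> ennreal ((1 / 4) ^ k)" for k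
    using fw'[of k] unfolding w_def[symmetric] by (subst (asm) nnM) auto
  have hp: "periodic (\<lambda>x. g (t, x))" if "g \<in> mid_hull Q N" for g N t
    using that
  proof induction
    case (base n)
    then show ?case using periodic_shift[OF per[of t], of "h n *\<^sub>R e"] per[of t] by (simp add: Q_def periodic_def)
  qed (simp add: periodic_def)
  have wp: "periodic (\<lambda>x. w (t, x))" for t
    using hp[OF fh] by (simp add: periodic_def w_def)
  have w2: "(\<integral>\<^sup>+z\<in>I \<times> unit_cell. ennreal ((w z)\<^sup>2) \<partial>lborel) < \<infinity>"
  proof -
    have "(w z)\<^sup>2 \<le> 2 * (f 0 z)\<^sup>2 + 2 * (f 0 z - w z)\<^sup>2" for z
    proof -
      have "0 \<le> (2 * f 0 z - w z)\<^sup>2" by simp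
      then show ?thesis by (simp add: power2_eq_square algebra_simps)
    qed
    then have "ennreal ((w z)\<^sup>2) \<le> ennreal (2 * (f 0 z)\<^sup>2 + 2 * (f 0 z - w z)\<^sup>2)" for z
      by (rule ennreal_leI)
    moreover have "ennreal (2 * (f 0 z)\<^sup>2 + 2 * (f 0 z - w z)\<^sup>2) = ennreal (2 * (f 0 z)\<^sup>2) + ennreal (2 * (f 0 z - w z)\<^sup>2)" for z
      by (rule ennreal_plus) auto
    ultimately have "ennreal ((w z)\<^sup>2) \<le> ennreal (2 * (f 0 z)\<^sup>2) + ennreal (2 * (f 0 z - w z)\<^sup>2)" for z
      by metis
    then have "(\<integral>\<^sup>+z. ennreal ((w z)\<^sup>2) \<partial>M) \<le> (\<integral>\<^sup>+z. 2 * ennreal ((f 0 z)\<^sup>2) + 2 * ennreal ((f 0 z - w z)\<^sup>2) \<partial>M)"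
      by (intro nn_integral_mono) (simp add: ennreal_mult)
    also have "\<dots> = 2 * (\<integral>\<^sup>+z. ennreal ((f 0 z)\<^sup>2) \<partial>M) + 2 * (\<integral>\<^sup>+z. ennreal ((f 0 z - w z)\<^sup>2) \<partial>M)"
    proof -
      have [measurable]: "f 0 \<in> borel_measurable M" "w \<in> borel_measurable M" using fm' bM wm by blast+
      show ?thesis by (simp add: nn_integral_add nn_integral_cmult)
    qed
    also have "\<dots> < \<infinity>"
      using fK[of 0] fw'[of 0] unfolding w_def[symmetric]
      by (auto simp: ennreal_mult_less_top intro: le_less_trans)
    finally show ?thesis by (subst (asm) nnM) auto
  qed
  define A where "A k t = (\<integral>\<^sup>+x\<in>unit_cell. ennreal ((f k (t, x) - w (t, x))\<^sup>2) \<partial>lborel)" for k t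
  have Am [measurable]: "A k \<in> borel_measurable borel" for k
    unfolding A_def[abs_def] by (rule borel_measurable_cell_integral[where f="\<lambda>z. ennreal ((f k z - w z)\<^sup>2)"]) measurable
  have AI: "(\<integral>\<^sup>+t\<in>I. A k t \<partial>lborel) \<le> ennreal ((1 / 4) ^ k)" for k
    using fw[of k] unfolding A_def by (subst (asm) nn_integral_Times) auto
  have "(\<integral>\<^sup>+t. (\<Sum>k. A k t * indicator I t) \<partial>lborel) = (\<Sum>k. \<integral>\<^sup>+t\<in>I. A k t \<partial>lborel)"
    by (rule nn_integral_suminf) measurable
  \<comment> \<open>The space-time errors are summable in k, so for almost every t in I the slice
    errors \<open>A k t\<close> are summable and tend to 0.\<close>
  also have "\<dots> \<le> (\<Sum>k. ennreal ((1 / 4) ^ k))" by (intro suminf_le AI) auto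
  also have "\<dots> = ennreal (\<Sum>k. (1 / 4) ^ k)" by (intro suminf_ennreal2 summable_geometric) auto
  finally have "(\<integral>\<^sup>+t. (\<Sum>k. A k t * indicator I t) \<partial>lborel) \<noteq> \<infinity>" by (auto simp: top_unique)
  then have ae1: "AE t in lborel. (\<Sum>k. A k t * indicator I t) \<noteq> \<infinity>" by (intro nn_integral_PInf_AE) auto
  have m1: "(\<lambda>z. ennreal ((U z)\<^sup>2)) \<in> borel_measurable borel"
    and m2: "(\<lambda>z. ennreal ((w z)\<^sup>2)) \<in> borel_measurable borel" by measurable
  have tm: "(\<lambda>x. g (t, x)) \<in> borel_measurable borel" if "g \<in> borel_measurable borel"
    for g :: "real \<times> (real^'n) \<Rightarrow> real" and t
    by (rule measurable_compose[OF _ that]) simp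
  have "AE t in lborel. t \<in> I \<longrightarrow> (\<forall>\<phi> D. C1_torus \<phi> D \<longrightarrow>
       (LINT x:unit_cell|lborel. U (t, x) * (D x \<bullet> e)) = - (LINT x:unit_cell|lborel. w (t, x) * \<phi> x))"
    using ae1 AE_finite_slice[OF m1 I U2] AE_finite_slice[OF m2 I w2]
  proof eventually_elim
    case (elim t)
    show ?case
    proof (intro impI allI)
      fix \<phi> :: "real^'n \<Rightarrow> real" and D assume t: "t \<in> I" and \<phi>: "C1_torus \<phi> D"
      have D: "\<And>x. GDERIV \<phi> x :> D x" "continuous_on UNIV D" "periodic \<phi>" using \<phi> by (auto simp: C1_torus_def)
      have pD: "periodic D" by (rule periodic_gradient[OF D(3,1)])
      have cp: "continuous_on UNIV \<phi>" by (rule gderiv_continuous[OF D(1)])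
      obtain Bp where Bp: "\<And>x. norm (\<phi> x) \<le> Bp" using periodic_bounded[OF D(3) cp] by blast
      obtain Bd where Bd: "\<And>x. norm (D x) \<le> Bd" using periodic_bounded[OF pD D(2)] by blast
      have mp [measurable]: "\<phi> \<in> borel_measurable borel" and mD [measurable]: "D \<in> borel_measurable borel"
        using cp D(2) by (auto intro: borel_measurable_continuous_onI)
      have Ui: "set_integrable lborel unit_cell (\<lambda>x. U (t, x))"
        using elim(2) t by (intro cell_integrable_of_square tm[OF Um]) (simp add: less_top)
      have wi: "set_integrable lborel unit_cell (\<lambda>x. w (t, x))"
        using elim(3) t by (intro cell_integrable_of_square tm[OF wm]) (simp add: less_top)
      define C where "C = (LINT x:unit_cell|lborel. \<bar>U (t, x)\<bar>)"
      have C0: "0 \<le> C" unfolding C_def set_lebesgue_integral_def by simp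
      define L where "L = (LINT x:unit_cell|lborel. U (t, x) * (D x \<bullet> e))"
      have Li: "set_integrable lborel unit_cell (\<lambda>x. U (t, x) * (D x \<bullet> e))"
      proof (rule set_integrable_mult_bounded[OF Ui, of _ Bd])
        show "\<bar>D x \<bullet> e\<bar> \<le> Bd" for x using Cauchy_Schwarz_ineq2[of "D x" e] Bd[of x] e by simp
      qed measurable
      have hi: "set_integrable lborel unit_cell (\<lambda>x. g (t, x))" if "g \<in> mid_hull Q N" for g N
        using that
      proof induction
        case (base n)
        have "set_integrable lborel unit_cell (\<lambda>x. U (t, x + h n *\<^sub>R e) - U (t, x))"
          by (rule set_integral_diff(1)[OF cell_shift_integral(1)[OF tm[OF Um] per Ui] Ui])
        then show ?case by (simp add: Q_def set_integrable_divide)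
      next
        case (mid g1 g2)
        from set_integral_add(1)[OF mid(3,4)] show ?case by (simp add: set_integrable_divide)
      qed
      have hi\<phi>: "set_integrable lborel unit_cell (\<lambda>x. g (t, x) * \<phi> x)" if "g \<in> mid_hull Q N" for g N
        by (rule set_integrable_mult_bounded[OF hi[OF that] mp, of Bp]) (use Bp in simp)
      \<comment> \<open>For a single quotient the difference is moved to \<phi> by shifting the cell
        integral, which gives this bound; averaging preserves it, so it holds on the hull of the
        tail.\<close>
      have pair: "\<bar>(LINT x:unit_cell|lborel. g (t, x) * \<phi> x) + L\<bar> \<le> \<epsilon> * C"
        if g: "g \<in> mid_hull Q N" and \<epsilon>: "\<And>n x. N \<le> n \<Longrightarrow> \<bar>(\<phi> (x - h n *\<^sub>R e) - \<phi> x) / h n + D x \<bullet> e\<bar> \<le> \<epsilon>" for g N \<epsilon>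
        using g
      proof induction
        case (base n)
        have i1: "set_integrable lborel unit_cell (\<lambda>x. U (t, x) * \<phi> (x - h n *\<^sub>R e))"
        proof (rule set_integrable_mult_bounded[OF Ui, of _ Bp])
          show "(\<lambda>x. \<phi> (x - h n *\<^sub>R e)) \<in> borel_measurable borel"
            by (rule measurable_compose[OF _ mp]) simp
        qed (use Bp in simp)
        have i2: "set_integrable lborel unit_cell (\<lambda>x. U (t, x) * \<phi> x)"
          by (rule set_integrable_mult_bounded[OF Ui mp, of Bp]) (use Bp in simp)
        have p1: "periodic (\<lambda>x. U (t, x) * \<phi> (x - h n *\<^sub>R e))"
          using per[of t] periodic_shift[OF D(3), of "- (h n *\<^sub>R e)"] by (simp add: periodic_def)
        have m1: "(\<lambda>x. U (t, x) * \<phi> (x - h n *\<^sub>R e)) \<in> borel_measurable borel"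
          by (intro borel_measurable_times tm[OF Um] measurable_compose[OF _ mp]) simp
        note s = cell_shift_integral[OF m1 p1 i1, of "h n *\<^sub>R e", simplified]
        have "(LINT x:unit_cell|lborel. Q n (t, x) * \<phi> x) = (LINT x:unit_cell|lborel. (U (t, x + h n *\<^sub>R e) * \<phi> x - U (t, x) * \<phi> x) / h n)"
          by (simp add: Q_def left_diff_distrib)
        also have "\<dots> = ((LINT x:unit_cell|lborel. U (t, x + h n *\<^sub>R e) * \<phi> x) - (LINT x:unit_cell|lborel. U (t, x) * \<phi> x)) / h n"
          using set_integral_diff(2)[OF s(1) i2] by (simp add: set_integral_divide_zero)
        also have "\<dots> = (LINT x:unit_cell|lborel. (U (t, x) * \<phi> (x - h n *\<^sub>R e) - U (t, x) * \<phi> x) / h n)"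
          unfolding s(2) using set_integral_diff(2)[OF i1 i2] by (simp add: set_integral_divide_zero)
        finally have "(LINT x:unit_cell|lborel. Q n (t, x) * \<phi> x) + L
          = (LINT x:unit_cell|lborel. (U (t, x) * \<phi> (x - h n *\<^sub>R e) - U (t, x) * \<phi> x) / h n + U (t, x) * (D x \<bullet> e))"
          unfolding L_def using set_integral_add(2)[OF set_integrable_divide[OF set_integral_diff(1)[OF i1 i2], of "h n"] Li] by simp
        also have "\<bar>\<dots>\<bar> \<le> (LINT x:unit_cell|lborel. \<epsilon> * \<bar>U (t, x)\<bar>)"
        proof -
          let ?F = "\<lambda>x. (U (t, x) * \<phi> (x - h n *\<^sub>R e) - U (t, x) * \<phi> x) / h n + U (t, x) * (D x \<bullet> e)"
          have Fi: "set_integrable lborel unit_cell ?F"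
            by (intro set_integral_add(1) Li set_integrable_divide set_integral_diff(1) i1 i2)
          have "\<bar>LINT x:unit_cell|lborel. ?F x\<bar> \<le> (LINT x|lborel. \<bar>indicator unit_cell x *\<^sub>R ?F x\<bar>)"
            unfolding set_lebesgue_integral_def by (rule integral_abs_bound)
          also have "\<dots> \<le> (LINT x:unit_cell|lborel. \<epsilon> * \<bar>U (t, x)\<bar>)"
            unfolding set_lebesgue_integral_def
          proof (rule integral_mono)
            show "integrable lborel (\<lambda>x. \<bar>indicator unit_cell x *\<^sub>R ?F x\<bar>)"
              using Fi unfolding set_integrable_def by (rule integrable_abs)
            show "integrable lborel (\<lambda>x. indicator unit_cell x *\<^sub>R (\<epsilon> * \<bar>U (t, x)\<bar>))"
              using set_integrable_mult_right[OF set_integrable_abs[OF Ui], of \<epsilon>] unfolding set_integrable_def by simp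
            fix x
            have "?F x = U (t, x) * ((\<phi> (x - h n *\<^sub>R e) - \<phi> x) / h n + D x \<bullet> e)"
              by (simp add: algebra_simps diff_divide_distrib)
            then have "\<bar>?F x\<bar> \<le> \<bar>U (t, x)\<bar> * \<epsilon>"
              using \<epsilon>[OF base, of x] by (simp add: abs_mult mult_left_mono)
            then show "\<bar>indicator unit_cell x *\<^sub>R ?F x\<bar> \<le> indicator unit_cell x *\<^sub>R (\<epsilon> * \<bar>U (t, x)\<bar>)"
              by (simp add: indicator_def mult.commute)
          qed
          finally show ?thesis .
        qed
        also have "\<dots> = \<epsilon> * C" unfolding C_def by simp
        finally show ?case .
      next
        case (mid g1 g2)
        have "(LINT x:unit_cell|lborel. (g1 (t, x) + g2 (t, x)) / 2 * \<phi> x)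
          = (LINT x:unit_cell|lborel. (g1 (t, x) * \<phi> x + g2 (t, x) * \<phi> x) / 2)"
          by (simp add: distrib_right)
        also have "\<dots> = ((LINT x:unit_cell|lborel. g1 (t, x) * \<phi> x) + (LINT x:unit_cell|lborel. g2 (t, x) * \<phi> x)) / 2"
          using set_integral_add(2)[OF hi\<phi>[OF mid(1)] hi\<phi>[OF mid(2)]] by (simp add: set_integral_divide_zero)
        finally have eq: "(LINT x:unit_cell|lborel. (g1 (t, x) + g2 (t, x)) / 2 * \<phi> x)
          = ((LINT x:unit_cell|lborel. g1 (t, x) * \<phi> x) + (LINT x:unit_cell|lborel. g2 (t, x) * \<phi> x)) / 2" .
        have lin: "\<bar>(a + b) / 2 + L\<bar> \<le> r" if "\<bar>a + L\<bar> \<le> r" "\<bar>b + L\<bar> \<le> r" for a b r :: real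
          using that by (simp add: abs_le_iff field_simps)
        show ?case unfolding eq by (rule lin[OF mid(3,4)])
      qed
      have l1: "(\<lambda>k. LINT x:unit_cell|lborel. f k (t, x) * \<phi> x) \<longlonglongrightarrow> (LINT x:unit_cell|lborel. w (t, x) * \<phi> x)"
      proof (rule tendsto_cell_integral_of_L2[OF tm[OF fm] tm[OF wm] mp hi[OF fh] wi])
        show "\<bar>\<phi> x\<bar> \<le> Bp" for x using Bp[of x] by simp
        have "(\<Sum>k. A k t) \<noteq> top" using elim(1) t by simp
        then have nt: "A k t \<noteq> top" for k by (metis ennreal_suminf_lessD less_top)
        have "(\<Sum>k. ennreal (enn2real (A k t))) \<noteq> top"
          using \<open>(\<Sum>k. A k t) \<noteq> top\<close> nt by (simp add: less_top)
        then have "summable (\<lambda>k. enn2real (A k t))" by (intro summable_suminf_not_top) auto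
        then have "(\<lambda>k. ennreal (enn2real (A k t))) \<longlonglongrightarrow> ennreal 0"
          by (intro tendsto_ennrealI summable_LIMSEQ_zero)
        then show "(\<lambda>k. \<integral>\<^sup>+x\<in>unit_cell. ennreal ((f k (t, x) - w (t, x))\<^sup>2) \<partial>lborel) \<longlonglongrightarrow> 0"
          using nt unfolding A_def[symmetric] by (simp add: less_top)
      qed
      have l2: "(\<lambda>k. (LINT x:unit_cell|lborel. f k (t, x) * \<phi> x) + L) \<longlonglongrightarrow> 0"
      proof (rule LIMSEQ_I)
        fix r :: real assume r: "0 < r"
        \<comment> \<open>C + 1 instead of C keeps the denominator positive when the slice of
          \<open>U\<close> vanishes.\<close>
        define \<epsilon> where "\<epsilon> = r / (2 * (C + 1))"
        have \<epsilon>: "0 < \<epsilon>" using r C0 by (simp add: \<epsilon>_def)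
        obtain h0 where h0: "0 < h0" "\<And>s x. 0 < s \<Longrightarrow> s < h0 \<Longrightarrow> \<bar>(\<phi> (x - s *\<^sub>R e) - \<phi> x) / s + D x \<bullet> e\<bar> \<le> \<epsilon>"
          using C1_torus_difference_quotient[OF \<phi> e \<epsilon>] by blast
        obtain N where N: "1 / real (Suc N) < h0" using nat_approx_posE[OF h0(1)] by blast
        have hN: "h n < h0" if "N \<le> n" for n
        proof -
          have "h n \<le> h N" unfolding h_def using that by (intro divide_left_mono) auto
          then show ?thesis using N by (simp add: h_def)
        qed
        have "norm ((LINT x:unit_cell|lborel. f k (t, x) * \<phi> x) + L - 0) < r" if "N \<le> k" for k
        proof -
          have "\<bar>(LINT x:unit_cell|lborel. f k (t, x) * \<phi> x) + L\<bar> \<le> \<epsilon> * C"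
            by (rule pair[OF fh]) (use hN h h0(2) that in \<open>meson order_trans\<close>)
          also have "\<dots> < r"
          proof -
            have "\<epsilon> * C \<le> \<epsilon> * (C + 1)" using \<epsilon> by simp
            also have "\<dots> = r / 2"
            proof -
              have "C + 1 \<noteq> 0" using C0 by simp
              then show ?thesis unfolding \<epsilon>_def times_divide_eq_left by (rule mult_divide_mult_cancel_right)
            qed
            finally show ?thesis using r by simp
          qed
          finally show ?thesis by simp
        qed
        then show "\<exists>no. \<forall>n\<ge>no. norm ((LINT x:unit_cell|lborel. f n (t, x) * \<phi> x) + L - 0) < r" by blast
      qed
      from LIMSEQ_unique[OF tendsto_add[OF l1 tendsto_const[of L]] l2]
      show "(LINT x:unit_cell|lborel. U (t, x) * (D x \<bullet> e)) = - (LINT x:unit_cell|lborel. w (t, x) * \<phi> x)"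
        unfolding L_def by linarith
    qed
  qed
  then show ?thesis using wm wp w2 by (intro exI[of _ w]) simp
qed

lemma in_L2_AE_borel:
  fixes f f' :: "'a::euclidean_space \<Rightarrow> 'b::euclidean_space"
  assumes f' [measurable]: "f' \<in> borel_measurable borel" and S [measurable]: "S \<in> sets borel"
    and ae: "AE z in lborel. z \<in> S \<longrightarrow> f z = f' z"
    and B: "(\<integral>\<^sup>+z\<in>S. ennreal ((norm (f' z))\<^sup>2) \<partial>lborel) \<le> ennreal B" "0 \<le> B"
  shows "in_L2 S f" and "L2_norm S f \<le> sqrt B"
proof -
  have m1: "(\<lambda>z. indicator S z *\<^sub>R f' z) \<in> borel_measurable lborel" by measurable
  have m2: "(\<lambda>z. indicator S z *\<^sub>R (norm (f' z))\<^sup>2) \<in> borel_measurable lborel" by measurable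
  have a1: "AE z in lebesgue. indicator S z *\<^sub>R f' z = indicator S z *\<^sub>R f z"
  proof (rule AE_completion)
    show "AE z in lborel. indicator S z *\<^sub>R f' z = indicator S z *\<^sub>R f z"
      using ae by eventually_elim (auto simp: indicator_def)
  qed
  have a2: "AE z in lebesgue. indicator S z *\<^sub>R (norm (f' z))\<^sup>2 = indicator S z *\<^sub>R (norm (f z))\<^sup>2"
  proof (rule AE_completion)
    show "AE z in lborel. indicator S z *\<^sub>R (norm (f' z))\<^sup>2 = indicator S z *\<^sub>R (norm (f z))\<^sup>2"
      using ae by eventually_elim (auto simp: indicator_def)
  qed
  have f1: "set_borel_measurable lebesgue S f"
    unfolding set_borel_measurable_def by (rule borel_measurable_AE[OF measurable_completion[OF m1] a1])
  have mf: "(\<lambda>z. indicator S z *\<^sub>R (norm (f z))\<^sup>2) \<in> borel_measurable lebesgue"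
    by (rule borel_measurable_AE[OF measurable_completion[OF m2] a2])
  have nn: "(\<integral>\<^sup>+z. ennreal (indicator S z *\<^sub>R (norm (f' z))\<^sup>2) \<partial>lborel) \<le> ennreal B"
  proof -
    have "(\<integral>\<^sup>+z. ennreal (indicator S z *\<^sub>R (norm (f' z))\<^sup>2) \<partial>lborel) = (\<integral>\<^sup>+z\<in>S. ennreal ((norm (f' z))\<^sup>2) \<partial>lborel)"
      by (intro nn_integral_cong) (auto simp: indicator_def)
    with B show ?thesis by simp
  qed
  have i': "integrable lborel (\<lambda>z. indicator S z *\<^sub>R (norm (f' z))\<^sup>2)"
    by (rule integrableI_nonneg[OF m2]) (use nn in \<open>auto intro: le_less_trans\<close>)
  have i: "integrable lebesgue (\<lambda>z. indicator S z *\<^sub>R (norm (f z))\<^sup>2)"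
    using integrable_cong_AE_imp[OF _ mf a2] integrable_completion[OF m2] i' by blast
  show "in_L2 S f" unfolding in_L2_def set_integrable_def using f1 i by simp
  have "(LINT z:S|lebesgue. (norm (f z))\<^sup>2) = (LINT z|lebesgue. indicator S z *\<^sub>R (norm (f' z))\<^sup>2)"
    unfolding set_lebesgue_integral_def
    by (rule integral_cong_AE[OF mf measurable_completion[OF m2]]) (use a2 in \<open>auto elim!: eventually_mono\<close>)
  also have "\<dots> = (LINT z|lborel. indicator S z *\<^sub>R (norm (f' z))\<^sup>2)" by (rule integral_completion[OF m2])
  also have "\<dots> \<le> B"
  proof -
    have "ennreal (LINT z|lborel. indicator S z *\<^sub>R (norm (f' z))\<^sup>2) \<le> ennreal B"
      using nn nn_integral_eq_integral[OF i'] by simp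
    then show ?thesis using B(2) by (simp only: ennreal_le_iff)
  qed
  finally show "L2_norm S f \<le> sqrt B" unfolding L2_norm_def by simp
qed

lemma set_integrable_vec:
  fixes f :: "'a::euclidean_space \<Rightarrow> real^'n"
  assumes [measurable]: "f \<in> borel_measurable borel" "A \<in> sets borel"
    and i: "\<And>i. set_integrable lborel A (\<lambda>x. f x $ i)"
  shows "set_integrable lborel A f"
  unfolding set_integrable_def
proof (rule Bochner_Integration.integrable_bound)
  show "integrable lborel (\<lambda>x. \<Sum>i\<in>UNIV. \<bar>indicator A x *\<^sub>R f x $ i\<bar>)"
    using i unfolding set_integrable_def by (intro Bochner_Integration.integrable_sum integrable_abs)
  show "AE x in lborel. norm (indicator A x *\<^sub>R f x) \<le> norm (\<Sum>i\<in>UNIV. \<bar>indicator A x *\<^sub>R f x $ i\<bar>)"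
  proof (rule AE_I2)
    fix x
    have "norm (indicator A x *\<^sub>R f x) \<le> (\<Sum>i\<in>UNIV. \<bar>(indicator A x *\<^sub>R f x) $ i\<bar>)" by (rule norm_le_l1_cart)
    also have "\<dots> = norm (\<Sum>i\<in>UNIV. \<bar>indicator A x *\<^sub>R f x $ i\<bar>)" by (simp add: sum_nonneg)
    finally show "norm (indicator A x *\<^sub>R f x) \<le> norm (\<Sum>i\<in>UNIV. \<bar>indicator A x *\<^sub>R f x $ i\<bar>)" .
  qed
qed measurable

lemma set_integral_vec_nth:
  fixes f :: "'a::euclidean_space \<Rightarrow> real^'n"
  assumes "set_integrable lborel A f"
  shows "(LINT x:A|lborel. f x) $ i = (LINT x:A|lborel. f x $ i)"
proof -
  have "(LINT x|lborel. (indicator A x *\<^sub>R f x) \<bullet> axis i 1) = (LINT x|lborel. indicator A x *\<^sub>R f x) \<bullet> axis i 1"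
    using assms unfolding set_integrable_def by (intro integral_inner_left) auto
  then show ?thesis by (simp add: set_lebesgue_integral_def inner_axis)
qed

lemma measurable_vec_nth' [measurable]: "(\<lambda>x :: real^'n. x $ i) \<in> borel_measurable borel"
  by (intro borel_measurable_continuous_onI continuous_intros)

lemma H1_torusI:
  fixes u u' :: "real^'n \<Rightarrow> real"
  assumes u [measurable]: "u \<in> borel_measurable borel" and w [measurable]: "w \<in> borel_measurable borel"
    and per: "periodic u'" "periodic w" and ae: "AE x in lborel. x \<in> unit_cell \<longrightarrow> u' x = u x"
    and u2: "(\<integral>\<^sup>+x\<in>unit_cell. ennreal ((u x)\<^sup>2) \<partial>lborel) < \<infinity>"
    and w2: "(\<integral>\<^sup>+x\<in>unit_cell. ennreal ((norm (w x))\<^sup>2) \<partial>lborel) < \<infinity>"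
    and weak: "\<And>\<phi> D i. C1_torus \<phi> D \<Longrightarrow> (LINT x:unit_cell|lborel. u x * (D x $ i)) = - (LINT x:unit_cell|lborel. w x $ i * \<phi> x)"
  shows "H1_torus u' w"
proof -
  have fin: "\<exists>B\<ge>0. X \<le> ennreal B" if "X < \<infinity>" for X
    using that by (cases X) auto
  have "in_L2 unit_cell u'"
  proof -
    obtain B where "0 \<le> B" "(\<integral>\<^sup>+x\<in>unit_cell. ennreal ((u x)\<^sup>2) \<partial>lborel) \<le> ennreal B" using fin[OF u2] by blast
    then show ?thesis by (intro in_L2_AE_borel(1)[OF u unit_cell_borel ae, of B]) simp_all
  qed
  moreover have "in_L2 unit_cell w"
  proof -
    obtain B where "0 \<le> B" "(\<integral>\<^sup>+x\<in>unit_cell. ennreal ((norm (w x))\<^sup>2) \<partial>lborel) \<le> ennreal B" using fin[OF w2] by blast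
    then show ?thesis by (intro in_L2_AE_borel(1)[OF w unit_cell_borel _, of _ B]) simp_all
  qed
  moreover have "(LINT x:unit_cell|lebesgue. u' x *\<^sub>R D x) = - (LINT x:unit_cell|lebesgue. \<phi> x *\<^sub>R w x)"
    if \<phi>: "C1_torus \<phi> D" for \<phi> D
  proof -
    have D: "\<And>x. GDERIV \<phi> x :> D x" "continuous_on UNIV D" "periodic \<phi>" using \<phi> by (auto simp: C1_torus_def)
    have pD: "periodic D" by (rule periodic_gradient[OF D(3,1)])
    have cp: "continuous_on UNIV \<phi>" by (rule gderiv_continuous[OF D(1)])
    obtain Bp where Bp: "\<And>x. norm (\<phi> x) \<le> Bp" using periodic_bounded[OF D(3) cp] by blast
    obtain Bd where Bd: "\<And>x. norm (D x) \<le> Bd" using periodic_bounded[OF pD D(2)] by blast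
    have [measurable]: "\<phi> \<in> borel_measurable borel" "D \<in> borel_measurable borel"
      using cp D(2) by (auto intro: borel_measurable_continuous_onI)
    have ui: "set_integrable lborel unit_cell u" by (rule cell_integrable_of_square[OF u u2])
    have wi: "set_integrable lborel unit_cell (\<lambda>x. w x $ i)" for i
    proof (rule cell_integrable_of_square)
      have "(w x $ i)\<^sup>2 \<le> (norm (w x))\<^sup>2" for x
        using component_le_norm_cart[of "w x" i] power_mono[of "\<bar>w x $ i\<bar>" "norm (w x)" 2] by simp
      then have "(\<integral>\<^sup>+x\<in>unit_cell. ennreal ((w x $ i)\<^sup>2) \<partial>lborel) \<le> (\<integral>\<^sup>+x\<in>unit_cell. ennreal ((norm (w x))\<^sup>2) \<partial>lborel)"
        by (intro nn_integral_mono mult_right_mono ennreal_leI) auto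
      then show "(\<integral>\<^sup>+x\<in>unit_cell. ennreal ((w x $ i)\<^sup>2) \<partial>lborel) < \<infinity>" using w2 by (rule le_less_trans)
    qed measurable
    have i1: "set_integrable lborel unit_cell (\<lambda>x. u x *\<^sub>R D x)"
    proof (rule set_integrable_vec)
      fix i
      have "set_integrable lborel unit_cell (\<lambda>x. u x * (D x $ i))"
      proof (rule set_integrable_mult_bounded[OF ui, of _ Bd])
        show "\<bar>D x $ i\<bar> \<le> Bd" for x using component_le_norm_cart[of "D x" i] Bd[of x] by linarith
      qed measurable
      then show "set_integrable lborel unit_cell (\<lambda>x. (u x *\<^sub>R D x) $ i)" by simp
    qed measurable
    have i2: "set_integrable lborel unit_cell (\<lambda>x. \<phi> x *\<^sub>R w x)"
    proof (rule set_integrable_vec)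
      fix i
      have "set_integrable lborel unit_cell (\<lambda>x. w x $ i * \<phi> x)"
        by (rule set_integrable_mult_bounded[OF wi, of _ Bp]) (use Bp in auto)
      then show "set_integrable lborel unit_cell (\<lambda>x. (\<phi> x *\<^sub>R w x) $ i)" by (simp add: mult.commute)
    qed measurable
    have m1: "(\<lambda>x. indicator unit_cell x *\<^sub>R (u x *\<^sub>R D x)) \<in> borel_measurable lborel"
      and m2: "(\<lambda>x. indicator unit_cell x *\<^sub>R (\<phi> x *\<^sub>R w x)) \<in> borel_measurable lborel" by measurable
    have a: "AE x in lebesgue. indicator unit_cell x *\<^sub>R (u x *\<^sub>R D x) = indicator unit_cell x *\<^sub>R (u' x *\<^sub>R D x)"
    proof (rule AE_completion)
      show "AE x in lborel. indicator unit_cell x *\<^sub>R (u x *\<^sub>R D x) = indicator unit_cell x *\<^sub>R (u' x *\<^sub>R D x)"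
        using ae by eventually_elim (auto simp: indicator_def)
    qed
    have "(LINT x:unit_cell|lebesgue. u' x *\<^sub>R D x) = (LINT x:unit_cell|lebesgue. u x *\<^sub>R D x)"
      unfolding set_lebesgue_integral_def
      by (rule integral_cong_AE[OF borel_measurable_AE[OF measurable_completion[OF m1] a] measurable_completion[OF m1]])
        (use a in \<open>auto elim!: eventually_mono\<close>)
    also have "\<dots> = (LINT x:unit_cell|lborel. u x *\<^sub>R D x)"
      unfolding set_lebesgue_integral_def by (rule integral_completion[OF m1])
    also have "\<dots> = - (LINT x:unit_cell|lborel. \<phi> x *\<^sub>R w x)"
      unfolding vec_eq_iff vector_uminus_component set_integral_vec_nth[OF i1] set_integral_vec_nth[OF i2]
      using weak[OF \<phi>] by (simp add: mult.commute)
    also have "(LINT x:unit_cell|lborel. \<phi> x *\<^sub>R w x) = (LINT x:unit_cell|lebesgue. \<phi> x *\<^sub>R w x)"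
      unfolding set_lebesgue_integral_def by (rule integral_completion[OF m2, symmetric])
    finally show ?thesis .
  qed
  ultimately show ?thesis
    unfolding H1_torus_def using per by (auto simp: C1_torus_def)
qed

text \<open>The components of the gradient come from the coordinate directions. One null set of
  times serves all periodic u' that agree with the slice of \<open>U\<close> up to a null set of the
  cell; in this form the result transfers to J(m), which is known up to null sets.\<close>

lemma weak_gradient:
  fixes U :: "real \<times> (real^'n) \<Rightarrow> real"
  assumes Um: "U \<in> borel_measurable borel" and per: "\<And>t. periodic (\<lambda>x. U (t, x))"
    and I [measurable]: "I \<in> sets borel" and Ifin: "emeasure lborel I < \<infinity>"
    and U2: "(\<integral>\<^sup>+z\<in>I \<times> unit_cell. ennreal ((U z)\<^sup>2) \<partial>lborel) < \<infinity>"
    and K: "0 \<le> K" and diff: "\<And>\<delta>. (\<integral>\<^sup>+z\<in>I \<times> unit_cell. ennreal ((U (fst z, snd z + \<delta>) - U z)\<^sup>2) \<partial>lborel) \<le> ennreal (K * (norm \<delta>)\<^sup>2)"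
  obtains w :: "real \<times> (real^'n) \<Rightarrow> real^'n" where "w \<in> borel_measurable borel"
    "(\<integral>\<^sup>+z\<in>I \<times> unit_cell. ennreal ((norm (w z))\<^sup>2) \<partial>lborel) < \<infinity>"
    "AE t in lborel. t \<in> I \<longrightarrow> (\<forall>u'. periodic u' \<longrightarrow> (AE x in lborel. x \<in> unit_cell \<longrightarrow> u' x = U (t, x)) \<longrightarrow> H1_torus u' (\<lambda>x. w (t, x)))"
proof -
  have "\<exists>w :: real \<times> (real^'n) \<Rightarrow> real. w \<in> borel_measurable borel \<and> (\<forall>t. periodic (\<lambda>x. w (t, x))) \<and>
    (\<integral>\<^sup>+z\<in>I \<times> unit_cell. ennreal ((w z)\<^sup>2) \<partial>lborel) < \<infinity> \<and>
    (AE t in lborel. t \<in> I \<longrightarrow> (\<forall>\<phi> D. C1_torus \<phi> D \<longrightarrow>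
       (LINT x:unit_cell|lborel. U (t, x) * (D x \<bullet> axis i 1)) = - (LINT x:unit_cell|lborel. w (t, x) * \<phi> x)))" for i
    by (rule weak_partial_derivative[OF Um per I Ifin U2 K diff]) (simp add: norm_eq_1 inner_axis_axis)
  note ex = this
  let ?P = "\<lambda>i w. w \<in> borel_measurable borel \<and> (\<forall>t. periodic (\<lambda>x. w (t, x))) \<and>
    (\<integral>\<^sup>+z\<in>I \<times> unit_cell. ennreal ((w z)\<^sup>2) \<partial>lborel) < \<infinity> \<and>
    (AE t in lborel. t \<in> I \<longrightarrow> (\<forall>\<phi> D. C1_torus \<phi> D \<longrightarrow>
       (LINT x:unit_cell|lborel. U (t, x) * (D x \<bullet> axis i 1)) = - (LINT x:unit_cell|lborel. w (t, x) * \<phi> x)))"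
  define wi :: "'n \<Rightarrow> real \<times> (real^'n) \<Rightarrow> real" where "wi i = (SOME w. ?P i w)" for i
  have P: "?P i (wi i)" for i unfolding wi_def by (rule someI_ex[OF ex])
  have wi: "\<forall>i. ?P i (wi i)" using P by (rule allI)
  define w where "w z = (\<chi> i. wi i z)" for z
  have wim [measurable]: "wi i \<in> borel_measurable borel" for i using wi by blast
  have wm [measurable]: "w \<in> borel_measurable borel"
  proof (rule borel_measurable_vec)
    fix i show "(\<lambda>z. w z $ i) \<in> borel_measurable borel" unfolding w_def vec_lambda_beta by (rule wim)
  qed
  have wp: "periodic (\<lambda>x. w (t, x))" for t using wi by (simp add: w_def periodic_def vec_eq_iff)
  have n2: "ennreal ((norm (w z))\<^sup>2) = (\<Sum>i\<in>UNIV. ennreal ((wi i z)\<^sup>2))" for z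
  proof -
    have "(norm (w z))\<^sup>2 = (\<Sum>i\<in>UNIV. (wi i z)\<^sup>2)"
      unfolding power2_norm_eq_inner by (simp add: inner_vec_def w_def power2_eq_square)
    then show ?thesis by (simp add: sum_ennreal)
  qed
  have w2: "(\<integral>\<^sup>+z\<in>I \<times> unit_cell. ennreal ((norm (w z))\<^sup>2) \<partial>lborel) < \<infinity>"
  proof -
    have "(\<integral>\<^sup>+z\<in>I \<times> unit_cell. ennreal ((norm (w z))\<^sup>2) \<partial>lborel) = (\<Sum>i\<in>UNIV. \<integral>\<^sup>+z\<in>I \<times> unit_cell. ennreal ((wi i z)\<^sup>2) \<partial>lborel)"
      unfolding n2 sum_distrib_right by (rule nn_integral_sum) measurable
    also have "\<dots> < \<infinity>" using wi by (simp add: less_top)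
    finally show ?thesis .
  qed
  have ae: "AE t in lborel. \<forall>i\<in>UNIV. t \<in> I \<longrightarrow> (\<forall>\<phi> D. C1_torus \<phi> D \<longrightarrow>
       (LINT x:unit_cell|lborel. U (t, x) * (D x \<bullet> axis i 1)) = - (LINT x:unit_cell|lborel. wi i (t, x) * \<phi> x))"
    by (rule iffD2[OF AE_ball_countable[OF countable_finite[OF finite]]]) (use wi in blast)
  have m1: "(\<lambda>z. ennreal ((U z)\<^sup>2)) \<in> borel_measurable borel" using Um by measurable
  have m2: "(\<lambda>z. ennreal ((norm (w z))\<^sup>2)) \<in> borel_measurable borel" by measurable
  have "AE t in lborel. t \<in> I \<longrightarrow> (\<forall>u'. periodic u' \<longrightarrow> (AE x in lborel. x \<in> unit_cell \<longrightarrow> u' x = U (t, x)) \<longrightarrow> H1_torus u' (\<lambda>x. w (t, x)))"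
    using ae AE_finite_slice[OF m1 I U2] AE_finite_slice[OF m2 I w2]
  proof eventually_elim
    case (elim t)
    show ?case
    proof (intro impI allI)
      fix u' assume t: "t \<in> I" and u': "periodic u'" "AE x in lborel. x \<in> unit_cell \<longrightarrow> u' x = U (t, x)"
      show "H1_torus u' (\<lambda>x. w (t, x))"
      proof (rule H1_torusI[OF _ _ u'(1) wp u'(2)])
        show "(\<lambda>x. U (t, x)) \<in> borel_measurable borel" by (rule measurable_compose[OF _ Um]) simp
        show "(\<lambda>x. w (t, x)) \<in> borel_measurable borel" by (rule measurable_compose[OF _ wm]) simp
        show "(\<integral>\<^sup>+x\<in>unit_cell. ennreal ((U (t, x))\<^sup>2) \<partial>lborel) < \<infinity>"
          "(\<integral>\<^sup>+x\<in>unit_cell. ennreal ((norm (w (t, x)))\<^sup>2) \<partial>lborel) < \<infinity>"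
          using elim(2,3) t by (simp_all add: less_top)
        show "(LINT x:unit_cell|lborel. U (t, x) * (D x $ i)) = - (LINT x:unit_cell|lborel. w (t, x) $ i * \<phi> x)"
          if "C1_torus \<phi> D" for \<phi> D i
          using elim(1) t that by (simp add: w_def inner_axis)
      qed
    qed
  qed
  then show ?thesis using that wm w2 by blast
qed

subsection \<open>The comparison argument\<close>

lemma AE_fst_slice:
  fixes P :: "real \<times> (real^'n) \<Rightarrow> bool"
  assumes "AE z in lborel. P z"
  shows "AE t in lborel. AE x in lborel. P (t, x)"
  using lborel_pair.AE_pair[unfolded lborel_prod, OF assms] .

lemma continuous_curve_AE_cong:
  fixes m M :: "real \<times> (real^'n) \<Rightarrow> real"
  assumes ae: "AE z in lborel. fst z \<in> {0<..<T} \<longrightarrow> M z = m z"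
  shows "continuous_curve T m \<mu> \<longleftrightarrow> continuous_curve T M \<mu>"
proof -
  have "AE t in lborel. t \<in> {0<..<T} \<longrightarrow> (\<forall>A. (\<integral>\<^sup>+x\<in>A \<inter> unit_cell. ennreal (m (t, x)) \<partial>lebesgue) = (\<integral>\<^sup>+x\<in>A \<inter> unit_cell. ennreal (M (t, x)) \<partial>lebesgue))"
    using AE_fst_slice[OF ae]
  proof eventually_elim
    case (elim t)
    show ?case
    proof (intro impI allI)
      fix A assume "t \<in> {0<..<T}"
      then have "AE x in lborel. ennreal (m (t, x)) * indicator (A \<inter> unit_cell) x = ennreal (M (t, x)) * indicator (A \<inter> unit_cell) x"
        using elim by (auto elim!: eventually_mono)
      from AE_completion[OF this] show "(\<integral>\<^sup>+x\<in>A \<inter> unit_cell. ennreal (m (t, x)) \<partial>lebesgue) = (\<integral>\<^sup>+x\<in>A \<inter> unit_cell. ennreal (M (t, x)) \<partial>lebesgue)"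
        by (rule nn_integral_cong_AE)
    qed
  qed
  from AE_completion[OF this]
  have *: "AE t in lebesgue. t \<in> {0<..<T} \<longrightarrow> (\<forall>A. (\<integral>\<^sup>+x\<in>A \<inter> unit_cell. ennreal (m (t, x)) \<partial>lebesgue) = (\<integral>\<^sup>+x\<in>A \<inter> unit_cell. ennreal (M (t, x)) \<partial>lebesgue))" .
  have "(AE t in lebesgue. t \<in> {0<..<T} \<longrightarrow> (\<forall>A\<in>sets borel. emeasure (\<mu> t) A = (\<integral>\<^sup>+x\<in>A \<inter> unit_cell. ennreal (m (t, x)) \<partial>lebesgue)))
    \<longleftrightarrow> (AE t in lebesgue. t \<in> {0<..<T} \<longrightarrow> (\<forall>A\<in>sets borel. emeasure (\<mu> t) A = (\<integral>\<^sup>+x\<in>A \<inter> unit_cell. ennreal (M (t, x)) \<partial>lebesgue)))"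
  proof (rule eventually_subst)
    show "AE t in lebesgue. (t \<in> {0<..<T} \<longrightarrow> (\<forall>A\<in>sets borel. emeasure (\<mu> t) A = (\<integral>\<^sup>+x\<in>A \<inter> unit_cell. ennreal (m (t, x)) \<partial>lebesgue)))
      = (t \<in> {0<..<T} \<longrightarrow> (\<forall>A\<in>sets borel. emeasure (\<mu> t) A = (\<integral>\<^sup>+x\<in>A \<inter> unit_cell. ennreal (M (t, x)) \<partial>lebesgue)))"
      using * by eventually_elim simp
  qed
  then show ?thesis unfolding continuous_curve_def by simp
qed

text \<open>The integrals and the curve behind the final measure depend on almost everywhere classes
  alone.\<close>

lemma functional_B_borel_representative:
  fixes m M :: "real \<times> (real^'n) \<Rightarrow> real"
  assumes ae: "AE z in lborel. fst z \<in> {0<..<T} \<longrightarrow> M z = m z \<and> V z = v z"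
  shows "functional_B T G \<Psi> (m, v) = functional_B T G \<Psi> (M, V)"
proof -
  have "AE z in lborel. fst z \<in> {0<..<T} \<longrightarrow> M z = m z" using ae by eventually_elim simp
  then have "final_measure T m = final_measure T M"
    unfolding final_measure_def by (simp add: continuous_curve_AE_cong)
  moreover have "(\<integral>\<^sup>+z\<in>{0<..<T} \<times> unit_cell. F (m z) (v z) \<partial>lebesgue) = (\<integral>\<^sup>+z\<in>{0<..<T} \<times> unit_cell. F (M z) (V z) \<partial>lebesgue)"
    for F :: "real \<Rightarrow> real^'n \<Rightarrow> ennreal"
  proof (rule nn_integral_cong_AE, rule AE_completion)
    show "AE z in lborel. F (m z) (v z) * indicator ({0<..<T} \<times> unit_cell) z = F (M z) (V z) * indicator ({0<..<T} \<times> unit_cell) z"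
      using ae by eventually_elim (auto simp: indicator_def)
  qed
  from this[of "\<lambda>a b. ennreal (a * (norm b)\<^sup>2)"] this[of "\<lambda>a b. ennreal (1 / 2 * a * (norm b)\<^sup>2) + G a"]
  show ?thesis unfolding functional_B_def using calculation by (simp only: split)
qed

lemma continuous_curve_integral:
  fixes M :: "real \<times> (real^'n) \<Rightarrow> real"
  assumes c: "continuous_curve T M \<mu>" and Mm: "M \<in> borel_measurable borel" and nn: "\<And>z. 0 \<le> M z"
    and f [measurable]: "f \<in> borel_measurable borel"
  shows "AE t in lborel. t \<in> {0<..<T} \<longrightarrow> (LINT x|\<mu> t. f x) = (LINT x:unit_cell|lborel. M (t, x) * f x)"
proof -
  have "AE t in lborel. t \<in> {0<..<T} \<longrightarrow>
        (\<forall>A\<in>sets borel. emeasure (\<mu> t) A = (\<integral>\<^sup>+x\<in>A \<inter> unit_cell. ennreal (M (t, x)) \<partial>lebesgue))"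
    using c unfolding continuous_curve_def AE_completion_iff by auto
  then show ?thesis
  proof eventually_elim
    case (elim t)
    show ?case
    proof
      assume t: "t \<in> {0<..<T}"
      have Mt [measurable]: "(\<lambda>x. M (t, x)) \<in> borel_measurable borel" by (rule measurable_compose[OF _ Mm]) simp
      have "\<mu> t = density lborel (\<lambda>x. ennreal (M (t, x) * indicator unit_cell x))"
      proof (rule measure_eqI)
        have s: "sets (\<mu> t) = sets borel" using c t unfolding continuous_curve_def torus_prob_def by auto
        then show "sets (\<mu> t) = sets (density lborel (\<lambda>x. ennreal (M (t, x) * indicator unit_cell x)))" by simp
        fix A assume "A \<in> sets (\<mu> t)"
        then have A [measurable]: "A \<in> sets borel" using s by simp
        have "emeasure (\<mu> t) A = (\<integral>\<^sup>+x\<in>A \<inter> unit_cell. ennreal (M (t, x)) \<partial>lborel)"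
          using elim t A by (simp add: nn_integral_completion)
        also have "\<dots> = (\<integral>\<^sup>+x. ennreal (M (t, x) * indicator unit_cell x) * indicator A x \<partial>lborel)"
          by (intro nn_integral_cong) (auto simp: indicator_def)
        finally show "emeasure (\<mu> t) A = emeasure (density lborel (\<lambda>x. ennreal (M (t, x) * indicator unit_cell x))) A"
          by (simp add: emeasure_density)
      qed
      then have "(LINT x|\<mu> t. f x) = (LINT x|density lborel (\<lambda>x. ennreal (M (t, x) * indicator unit_cell x)). f x)" by (simp only:)
      also have "\<dots> = (LINT x|lborel. (M (t, x) * indicator unit_cell x) *\<^sub>R f x)"
        using nn by (intro integral_density) auto
      also have "\<dots> = (LINT x:unit_cell|lborel. M (t, x) * f x)"
        unfolding set_lebesgue_integral_def by (intro Bochner_Integration.integral_cong) (auto simp: indicator_def)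
      finally show "(LINT x|\<mu> t. f x) = (LINT x:unit_cell|lborel. M (t, x) * f x)" .
    qed
  qed
qed

section \<open>The cost of the competitor\<close>

lemma second_difference_le:
  fixes \<Psi> :: "real^'n \<Rightarrow> real"
  assumes D: "\<And>x. GDERIV \<Psi> x :> D x" and L: "L-lipschitz_on UNIV D"
  shows "\<Psi> (x + \<delta>) + \<Psi> (x - \<delta>) \<le> 2 * \<Psi> x + 2 * L * (norm \<delta>)\<^sup>2"
proof -
  define f where "f s = \<Psi> (x + s *\<^sub>R \<delta>) + \<Psi> (x - s *\<^sub>R \<delta>)" for s :: real
  \<comment> \<open>The mean value theorem for the symmetric sum: its derivative is a difference of
    gradients at points 2 s \<delta> apart, so the first order terms cancel and the factor 2 L
    appears.\<close>
  have "\<exists>s. 0 < s \<and> s < 1 \<and> f 1 - f 0 = (1 - 0) * (\<delta> \<bullet> (D (x + s *\<^sub>R \<delta>) - D (x - s *\<^sub>R \<delta>)))"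
  proof (rule MVT2)
    fix s :: real
    have 1: "((\<lambda>s. x + s *\<^sub>R \<delta>) has_derivative (\<lambda>t. t *\<^sub>R \<delta>)) (at s)"
      and 2: "((\<lambda>s. x - s *\<^sub>R \<delta>) has_derivative (\<lambda>t. - (t *\<^sub>R \<delta>))) (at s)"
      by (auto intro!: derivative_eq_intros)
    have "(f has_derivative (\<lambda>t. (t *\<^sub>R \<delta>) \<bullet> D (x + s *\<^sub>R \<delta>) + (- (t *\<^sub>R \<delta>)) \<bullet> D (x - s *\<^sub>R \<delta>))) (at s)"
      unfolding f_def
      by (rule has_derivative_add[OF has_derivative_compose[OF 1 D[unfolded gderiv_def]] has_derivative_compose[OF 2 D[unfolded gderiv_def]]])
    moreover have "(\<lambda>t. (t *\<^sub>R \<delta>) \<bullet> D (x + s *\<^sub>R \<delta>) + (- (t *\<^sub>R \<delta>)) \<bullet> D (x - s *\<^sub>R \<delta>)) = (*) (\<delta> \<bullet> (D (x + s *\<^sub>R \<delta>) - D (x - s *\<^sub>R \<delta>)))"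
      by (auto simp: fun_eq_iff inner_diff_right algebra_simps)
    ultimately show "(f has_real_derivative \<delta> \<bullet> (D (x + s *\<^sub>R \<delta>) - D (x - s *\<^sub>R \<delta>))) (at s)"
      unfolding has_field_derivative_def by simp
  qed simp
  then obtain s where s: "0 < s" "s < 1" "f 1 - f 0 = \<delta> \<bullet> (D (x + s *\<^sub>R \<delta>) - D (x - s *\<^sub>R \<delta>))" by auto
  have L0: "0 \<le> L" using L by (rule lipschitz_on_nonneg)
  have "\<delta> \<bullet> (D (x + s *\<^sub>R \<delta>) - D (x - s *\<^sub>R \<delta>)) \<le> norm \<delta> * norm (D (x + s *\<^sub>R \<delta>) - D (x - s *\<^sub>R \<delta>))"
    using Cauchy_Schwarz_ineq2[of \<delta> "D (x + s *\<^sub>R \<delta>) - D (x - s *\<^sub>R \<delta>)"] by linarith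
  also have "\<dots> \<le> norm \<delta> * (L * (2 * norm \<delta>))"
  proof (rule mult_left_mono)
    have "norm (D (x + s *\<^sub>R \<delta>) - D (x - s *\<^sub>R \<delta>)) \<le> L * norm ((x + s *\<^sub>R \<delta>) - (x - s *\<^sub>R \<delta>))"
      using lipschitz_onD[OF L, of "x + s *\<^sub>R \<delta>" "x - s *\<^sub>R \<delta>"] by (simp add: dist_norm)
    also have "(x + s *\<^sub>R \<delta>) - (x - s *\<^sub>R \<delta>) = (2 * s) *\<^sub>R \<delta>" by (simp add: scaleR_2[symmetric])
    also have "L * norm ((2 * s) *\<^sub>R \<delta>) \<le> L * (2 * norm \<delta>)"
      using s L0 by (intro mult_left_mono) (auto simp: mult_left_le_one_le)
    finally show "norm (D (x + s *\<^sub>R \<delta>) - D (x - s *\<^sub>R \<delta>)) \<le> L * (2 * norm \<delta>)" .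
  qed simp
  also have "\<dots> = 2 * L * (norm \<delta>)\<^sup>2" by (simp add: power2_eq_square)
  finally show ?thesis using s(3) by (simp add: f_def)
qed

text \<open>Quadratic rather than linear, so that the derivative is continuous at t1; the price is
  the slope 2/t1 instead of 1/t1, bounded so for nonnegative times.\<close>

definition cutoff :: "real \<Rightarrow> real \<Rightarrow> real" where "cutoff t1 t = 1 - pos_sq (1 - t / t1)"
definition cutoff' :: "real \<Rightarrow> real \<Rightarrow> real" where "cutoff' t1 t = 2 * max 0 (1 - t / t1) / t1"

lemma cutoff_props:
  assumes "0 < t1"
  shows "(cutoff t1 has_real_derivative cutoff' t1 t) (at t)" "continuous_on UNIV (cutoff' t1)"
    "cutoff t1 0 = 0" "t1 \<le> t \<Longrightarrow> cutoff t1 t = 1" "0 \<le> t \<Longrightarrow> \<bar>cutoff' t1 t\<bar> \<le> 2 / t1"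
proof -
  have "((\<lambda>t. pos_sq (1 - t / t1)) has_real_derivative 2 * max 0 (1 - t / t1) * (- (1 / t1))) (at t)"
    by (rule DERIV_chain2[OF pos_sq_deriv]) (use assms in \<open>auto intro!: derivative_eq_intros\<close>)
  from DERIV_diff[OF DERIV_const[of 1] this]
  show "(cutoff t1 has_real_derivative cutoff' t1 t) (at t)"
    unfolding cutoff_def[abs_def] cutoff'_def by simp
  show "continuous_on UNIV (cutoff' t1)"
    unfolding cutoff'_def[abs_def] by (intro continuous_intros) (use assms in auto)
  show "cutoff t1 0 = 0" by (simp add: cutoff_def pos_sq_def)
  show "cutoff t1 t = 1" if "t1 \<le> t" using that assms by (simp add: cutoff_def pos_sq_def)
  show "\<bar>cutoff' t1 t\<bar> \<le> 2 / t1" if "0 \<le> t"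
    using that assms by (simp add: cutoff'_def divide_right_mono)
qed

text \<open>The final measure is known as a limit only, so the inequality is shown at almost every
  time after t1, where translation invariance moves \<delta> to \<Psi> and the second difference is
  integrated against a unit mass. Continuity of both curves, tested with the Lipschitz function
  \<Psi>, carries it to T. Half of the 2 L of the second difference remains.\<close>

lemma final_cost_average_le:
  fixes M :: "real \<times> (real^'n) \<Rightarrow> real" and \<Psi> :: "real^'n \<Rightarrow> real"
  assumes sol: "weak_solution T m0 M V" and T: "0 < T" and t1: "t1 < T"
    and solb: "weak_solution T m0 Mb Vb"
    and Mb: "\<And>t x. t1 < t \<Longrightarrow> Mb (t, x) = (M (t, x + \<delta>) + M (t, x - \<delta>)) / 2"
    and \<Psi>: "periodic \<Psi>" "\<And>x. GDERIV \<Psi> x :> D x" "L-lipschitz_on UNIV D"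
  shows "(LINT x|final_measure T Mb. \<Psi> x) \<le> (LINT x|final_measure T M. \<Psi> x) + L * (norm \<delta>)\<^sup>2"
proof -
  obtain \<mu> where \<mu>: "continuous_curve T M \<mu>" using weak_solution_curve_exists[OF sol T] by blast
  obtain \<mu>b where \<mu>b: "continuous_curve T Mb \<mu>b" using weak_solution_curve_exists[OF solb T] by blast
  have C1: "C1_torus \<Psi> D" using \<Psi> lipschitz_on_continuous_on[OF \<Psi>(3)] by (simp add: C1_torus_def)
  obtain K where K: "K-lipschitz_on UNIV \<Psi>" using C1_torus_lipschitz[OF C1] .
  have cp: "continuous_on UNIV \<Psi>" by (rule gderiv_continuous[OF \<Psi>(2)])
  have \<Psi>m [measurable]: "\<Psi> \<in> borel_measurable borel" using cp by (rule borel_measurable_continuous_onI)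
  obtain Bp where Bp: "\<And>x. norm (\<Psi> x) \<le> Bp" using periodic_bounded[OF \<Psi>(1) cp] by blast
  have Mm: "M \<in> borel_measurable borel" and nn: "\<And>z. 0 \<le> M z" and perM: "\<And>t. periodic (\<lambda>x. M (t, x))"
    and mass: "AE t in lborel. t \<in> {0<..<T} \<longrightarrow> (LINT x:unit_cell|lborel. M (t, x)) = 1"
    using sol unfolding weak_solution_def by blast+
  have Mbm: "Mb \<in> borel_measurable borel" and nnb: "\<And>z. 0 \<le> Mb z"
    using solb unfolding weak_solution_def by blast+
  have "AE t in lborel. t \<in> {0<..<T} \<longrightarrow> (t1 < t \<longrightarrow> (LINT x|\<mu>b t. \<Psi> x) \<le> (LINT x|\<mu> t. \<Psi> x) + L * (norm \<delta>)\<^sup>2)"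
    using continuous_curve_integral[OF \<mu> Mm nn \<Psi>m] continuous_curve_integral[OF \<mu>b Mbm nnb \<Psi>m] mass
  proof eventually_elim
    case (elim t)
    show ?case
    proof (intro impI)
      assume t: "t \<in> {0<..<T}" and tt: "t1 < t"
      have Mt [measurable]: "(\<lambda>x. M (t, x)) \<in> borel_measurable borel" by (rule measurable_compose[OF _ Mm]) simp
      have one: "(LINT x:unit_cell|lborel. M (t, x)) = 1" using elim(3) t by blast
      then have Mi: "set_integrable lborel unit_cell (\<lambda>x. M (t, x))"
        unfolding set_integrable_def set_lebesgue_integral_def by (metis not_integrable_integral_eq zero_neq_one)
      have sh [measurable]: "(\<lambda>x. \<Psi> (x + a)) \<in> borel_measurable borel" for a
        by (rule measurable_compose[OF _ \<Psi>m]) simp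
      have i: "set_integrable lborel unit_cell (\<lambda>x. M (t, x) * \<Psi> (x + a))" for a
        by (rule set_integrable_mult_bounded[OF Mi sh, where B=Bp]) (use Bp in simp)
      have p: "periodic (\<lambda>x. M (t, x) * \<Psi> (x + a))" for a
        using perM[of t] periodic_shift[OF \<Psi>(1), of a] by (simp add: periodic_def)
      have m: "(\<lambda>x. M (t, x) * \<Psi> (x + a)) \<in> borel_measurable borel" for a by measurable
      have s: "set_integrable lborel unit_cell (\<lambda>x. M (t, x + a) * \<Psi> x)"
        "(LINT x:unit_cell|lborel. M (t, x + a) * \<Psi> x) = (LINT x:unit_cell|lborel. M (t, x) * \<Psi> (x - a))" for a
        using cell_shift_integral[OF m[of "- a"] p[of "- a"] i[of "- a"], of a] by simp_all
      have i0: "set_integrable lborel unit_cell (\<lambda>x. M (t, x) * \<Psi> x)" using i[of 0] by simp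
      have "(LINT x|\<mu>b t. \<Psi> x) = (LINT x:unit_cell|lborel. (M (t, x + \<delta>) * \<Psi> x + M (t, x + - \<delta>) * \<Psi> x) / 2)"
        using elim(2) t by (simp add: Mb[OF tt] distrib_right)
      also have "\<dots> = ((LINT x:unit_cell|lborel. M (t, x + \<delta>) * \<Psi> x) + (LINT x:unit_cell|lborel. M (t, x + - \<delta>) * \<Psi> x)) / 2"
        using set_integral_add(2)[OF s(1)[of \<delta>] s(1)[of "- \<delta>"]] by (simp only: set_integral_divide_zero)
      also have "\<dots> = ((LINT x:unit_cell|lborel. M (t, x) * \<Psi> (x + - \<delta>)) + (LINT x:unit_cell|lborel. M (t, x) * \<Psi> (x + \<delta>))) / 2"
        unfolding s(2) by simp
      also have "\<dots> = (LINT x:unit_cell|lborel. (M (t, x) * \<Psi> (x + - \<delta>) + M (t, x) * \<Psi> (x + \<delta>)) / 2)"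
        using set_integral_add(2)[OF i[of "- \<delta>"] i[of \<delta>]] by (simp only: set_integral_divide_zero)
      also have "\<dots> \<le> (LINT x:unit_cell|lborel. M (t, x) * \<Psi> x + (L * (norm \<delta>)\<^sup>2) * M (t, x))"
        unfolding set_lebesgue_integral_def
      proof (rule integral_mono)
        show "integrable lborel (\<lambda>x. indicator unit_cell x *\<^sub>R ((M (t, x) * \<Psi> (x + - \<delta>) + M (t, x) * \<Psi> (x + \<delta>)) / 2))"
          using set_integrable_divide[OF set_integral_add(1)[OF i[of "- \<delta>"] i[of \<delta>]], of 2] unfolding set_integrable_def .
        show "integrable lborel (\<lambda>x. indicator unit_cell x *\<^sub>R (M (t, x) * \<Psi> x + (L * (norm \<delta>)\<^sup>2) * M (t, x)))"
          using set_integral_add(1)[OF i0 set_integrable_mult_right[OF Mi, of "L * (norm \<delta>)\<^sup>2"]] unfolding set_integrable_def .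
        fix x
        have "M (t, x) * (\<Psi> (x + \<delta>) + \<Psi> (x - \<delta>)) \<le> M (t, x) * (2 * \<Psi> x + 2 * L * (norm \<delta>)\<^sup>2)"
          by (intro mult_left_mono second_difference_le[OF \<Psi>(2,3)] nn)
        then have "(M (t, x) * \<Psi> (x + - \<delta>) + M (t, x) * \<Psi> (x + \<delta>)) / 2 \<le> M (t, x) * \<Psi> x + (L * (norm \<delta>)\<^sup>2) * M (t, x)"
          by (simp add: algebra_simps)
        then show "indicator unit_cell x *\<^sub>R ((M (t, x) * \<Psi> (x + - \<delta>) + M (t, x) * \<Psi> (x + \<delta>)) / 2)
          \<le> indicator unit_cell x *\<^sub>R (M (t, x) * \<Psi> x + (L * (norm \<delta>)\<^sup>2) * M (t, x))"
          by (intro scaleR_left_mono) auto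
      qed
      also have "\<dots> = (LINT x:unit_cell|lborel. M (t, x) * \<Psi> x) + (L * (norm \<delta>)\<^sup>2) * 1"
        unfolding one[symmetric]
        using set_integral_add(2)[OF i0 set_integrable_mult_right[OF Mi, of "L * (norm \<delta>)\<^sup>2"]] by simp
      finally show "(LINT x|\<mu>b t. \<Psi> x) \<le> (LINT x|\<mu> t. \<Psi> x) + L * (norm \<delta>)\<^sup>2"
        using elim(1) t by simp
    qed
  qed
  note ineq = this
  have TT: "T \<in> {0..T}" using T by simp
  obtain X where X: "\<And>j. X j \<in> {0<..<T}"
      "\<And>j. t1 < X j \<longrightarrow> (LINT x|\<mu>b (X j). \<Psi> x) \<le> (LINT x|\<mu> (X j). \<Psi> x) + L * (norm \<delta>)\<^sup>2" "\<And>j. X j \<noteq> T" "X \<longlonglongrightarrow> T"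
  proof (rule AE_interval_sequence[OF ineq T TT], goal_cases)
    case (1 X)
    show ?case by (rule 1(1)[OF 1(2) 1(3) 1(4) 1(5)])
  qed
  have X': "X j \<in> {0..T}" for j using X(1)[of j] by simp
  have l1: "(\<lambda>j. LINT x|\<mu>b (X j). \<Psi> x) \<longlonglongrightarrow> (LINT x|\<mu>b T. \<Psi> x)"
    by (rule continuous_curve_seq_tendsto[OF \<mu>b X' X(3,4) TT \<Psi>(1) K])
  have l2: "(\<lambda>j. (LINT x|\<mu> (X j). \<Psi> x) + L * (norm \<delta>)\<^sup>2) \<longlonglongrightarrow> (LINT x|\<mu> T. \<Psi> x) + L * (norm \<delta>)\<^sup>2"
    by (intro tendsto_add tendsto_const continuous_curve_seq_tendsto[OF \<mu> X' X(3,4) TT \<Psi>(1) K])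
  have "\<forall>\<^sub>F j in sequentially. t1 < X j" by (rule order_tendstoD(1)[OF X(4) t1])
  then have ev: "\<forall>\<^sub>F j in sequentially. (LINT x|\<mu>b (X j). \<Psi> x) \<le> (LINT x|\<mu> (X j). \<Psi> x) + L * (norm \<delta>)\<^sup>2"
    by eventually_elim (use X(2) in blast)
  show ?thesis
    unfolding final_measure_eq[OF \<mu> T] final_measure_eq[OF \<mu>b T]
    by (rule tendsto_le[OF sequentially_bot l2 l1 ev])
qed

text \<open>The case distinction in \<open>functional_B\<close> disappears: infinite kinetic energy
  already makes the first integral infinite.\<close>

lemma functional_B_eq:
  fixes M :: "real \<times> (real^'n) \<Rightarrow> real"
  assumes [measurable]: "M \<in> borel_measurable borel" "V \<in> borel_measurable borel" "(\<lambda>z. G (M z)) \<in> borel_measurable borel"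
    and nn: "\<And>z. 0 \<le> M z"
  shows "functional_B T G \<Psi> (M, V) =
    enn2ereal (\<integral>\<^sup>+z\<in>{0<..<T} \<times> unit_cell. (ennreal (1 / 2 * M z * (norm (V z))\<^sup>2) + G (M z)) \<partial>lborel)
    + ereal (LINT x|final_measure T M. \<Psi> x)"
proof -
  let ?Q = "{0<..<T} \<times> unit_cell :: (real \<times> (real^'n)) set"
  let ?X = "\<integral>\<^sup>+z\<in>?Q. (ennreal (1 / 2 * M z * (norm (V z))\<^sup>2) + G (M z)) \<partial>lborel"
  let ?E = "\<integral>\<^sup>+z\<in>?Q. ennreal (M z * (norm (V z))\<^sup>2) \<partial>lborel"
  have "?E \<le> (\<integral>\<^sup>+z. 2 * ((ennreal (1 / 2 * M z * (norm (V z))\<^sup>2) + G (M z)) * indicator ?Q z) \<partial>lborel)"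
  proof (rule nn_integral_mono)
    fix z
    have "ennreal (M z * (norm (V z))\<^sup>2) = 2 * ennreal (1 / 2 * M z * (norm (V z))\<^sup>2)"
      using nn[of z] by (subst ennreal_numeral[symmetric], subst ennreal_mult[symmetric]) auto
    also have "\<dots> \<le> 2 * (ennreal (1 / 2 * M z * (norm (V z))\<^sup>2) + G (M z))" by (intro mult_left_mono) auto
    finally show "ennreal (M z * (norm (V z))\<^sup>2) * indicator ?Q z \<le> 2 * ((ennreal (1 / 2 * M z * (norm (V z))\<^sup>2) + G (M z)) * indicator ?Q z)"
      unfolding mult.assoc[symmetric] by (rule mult_right_mono) simp
  qed
  also have "\<dots> = 2 * ?X" by (rule nn_integral_cmult) measurable
  finally have E: "?E \<le> 2 * ?X" .
  show ?thesis
  proof (cases "?E < \<infinity>")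
    case True
    then show ?thesis unfolding functional_B_def by (simp add: nn_integral_completion)
  next
    case False
    then have "\<infinity> \<le> ?E" by (simp only: not_less)
    then have "\<infinity> \<le> 2 * ?X" using E by (rule order_trans)
    then have "2 * ?X = \<infinity>" by (simp only: infinity_ennreal_def top_unique)
    then have "?X = \<infinity>" by (simp add: ennreal_mult_eq_top_iff)
    with False show ?thesis unfolding functional_B_def by (simp add: nn_integral_completion)
  qed
qed

section \<open>Estimates for a minimiser\<close>

lemma weak_solution_total_mass:
  fixes M :: "real \<times> (real^'n) \<Rightarrow> real"
  assumes sol: "weak_solution T m0 M V" and T: "0 < T"
  shows "(\<integral>\<^sup>+z\<in>{0<..<T} \<times> unit_cell. ennreal (M z) \<partial>lborel) = ennreal T"
proof -
  have Mm [measurable]: "M \<in> borel_measurable borel" and nn: "\<And>z. 0 \<le> M z"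
    and mass: "AE t in lborel. t \<in> {0<..<T} \<longrightarrow> (LINT x:unit_cell|lborel. M (t, x)) = 1"
    using sol unfolding weak_solution_def by blast+
  have "(\<integral>\<^sup>+z\<in>{0<..<T} \<times> unit_cell. ennreal (M z) \<partial>lborel)
      = (\<integral>\<^sup>+t\<in>{0<..<T}. (\<integral>\<^sup>+x\<in>unit_cell. ennreal (M (t, x)) \<partial>lborel) \<partial>lborel)"
    by (rule nn_integral_Times) measurable
  also have "\<dots> = (\<integral>\<^sup>+t. indicator {0<..<T} t \<partial>lborel)"
  proof (rule nn_integral_cong_AE)
    show "AE t in lborel. (\<integral>\<^sup>+x\<in>unit_cell. ennreal (M (t, x)) \<partial>lborel) * indicator {0<..<T} t = indicator {0<..<T} t"
      using mass
    proof eventually_elim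
      case (elim t)
      show ?case
      proof (cases "t \<in> {0<..<T}")
        case True
        with elim have one: "(LINT x|lborel. indicator unit_cell x *\<^sub>R M (t, x)) = 1" by (simp add: set_lebesgue_integral_def)
        then have "integrable lborel (\<lambda>x. indicator unit_cell x *\<^sub>R M (t, x))"
          by (metis not_integrable_integral_eq zero_neq_one)
        then have "(\<integral>\<^sup>+x. ennreal (indicator unit_cell x *\<^sub>R M (t, x)) \<partial>lborel) = 1"
          using nn one by (subst nn_integral_eq_integral) auto
        moreover have "(\<integral>\<^sup>+x. ennreal (indicator unit_cell x *\<^sub>R M (t, x)) \<partial>lborel) = (\<integral>\<^sup>+x\<in>unit_cell. ennreal (M (t, x)) \<partial>lborel)"
          by (intro nn_integral_cong) (auto simp: indicator_def)
        ultimately show ?thesis by simp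
      qed simp
    qed
  qed
  also have "\<dots> = ennreal T" using T by simp
  finally show ?thesis .
qed

lemma primitive_borel:
  assumes "mono_on {0..} g"
  shows "primitive g \<in> borel_measurable borel"
proof -
  have mono: "mono (\<lambda>s. primitive g (max 0 s))"
    by (intro monoI primitive_mono[OF assms]) auto
  have "(\<lambda>s. primitive g (max 0 s)) \<in> borel_measurable borel"
  proof (intro borel_measurableI_greater)
    fix a
    have "is_interval {s. a < primitive g (max 0 s)}"
      using mono unfolding is_interval_1 mono_def by (auto intro: less_le_trans)
    then show "{s \<in> space borel. a < primitive g (max 0 s)} \<in> sets borel"
      using real_interval_borel_measurable by simp
  qed
  then have "(\<lambda>s. if s < 0 then \<infinity> else primitive g (max 0 s)) \<in> borel_measurable borel" by measurable
  also have "(\<lambda>s. if s < 0 then \<infinity> else primitive g (max 0 s)) = primitive g"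
    by (auto simp: fun_eq_iff primitive_def)
  finally show ?thesis .
qed

text \<open>Where the primitive is infinite the coercivity says nothing about \<open>J\<close>,
  which need not be measurable there. Setting it to 0 gives a Borel function, and a minimiser takes
  such values on a null set only.\<close>

definition restrict_domain :: "(real \<Rightarrow> ennreal) \<Rightarrow> (real \<Rightarrow> real) \<Rightarrow> real \<Rightarrow> real" where
  "restrict_domain g J s = indicator {s. 0 \<le> s \<and> primitive g s < \<infinity>} s * J s"

context
  fixes g :: "real \<Rightarrow> ennreal" and c :: real and J Js :: "real \<Rightarrow> real"
  assumes g: "mono_on {0..} g" and c: "0 < c"
    and coercive: "\<And>s q. ereal (s * q + c * \<bar>J s - Js q\<bar>\<^sup>2) \<le> enn2ereal (primitive g s) + conjugate (primitive g) q"
begin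

lemma restrict_domain_borel: "restrict_domain g J \<in> borel_measurable borel"
  using borel_measurable_continuous_on_indicator[OF finite_domain_borel[OF g] J_continuous[OF g c coercive]]
  unfolding restrict_domain_def[abs_def] by simp

lemma restrict_domain_gain:
  assumes s: "0 \<le> s0" "0 \<le> s1"
  shows "primitive g ((s0 + s1) / 2) + ennreal (c / 4 * (restrict_domain g J s0 - restrict_domain g J s1)\<^sup>2)
    \<le> ennreal (1 / 2) * primitive g s0 + ennreal (1 / 2) * primitive g s1"
proof (cases "primitive g s0 < \<infinity> \<and> primitive g s1 < \<infinity>")
  case True
  then show ?thesis using primitive_midpoint_gain[OF g c coercive s] s by (simp add: restrict_domain_def)
next
  case False
  then have "primitive g s0 = top \<or> primitive g s1 = top" by (auto simp: less_top[symmetric])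
  then show ?thesis by (auto simp: ennreal_mult_top)
qed

text \<open>With (a + b)^2 \<le> 2 a^2 + 2 b^2 and b = \<open>Js 0\<close>, the growth of
  \<open>J\<close> is controlled by the congestion cost; on a cell of finite measure this puts J(m)
  into L^2.\<close>

lemma restrict_domain_growth:
  assumes "0 \<le> s"
  shows "ennreal ((restrict_domain g J s)\<^sup>2) \<le> ennreal (2 / c) * primitive g s + ennreal (2 * (Js 0)\<^sup>2)"
proof (cases "primitive g s < \<infinity>")
  case True
  have "0 \<le> (J s - 2 * Js 0)\<^sup>2" by simp
  then have "(J s)\<^sup>2 \<le> 2 * (J s - Js 0)\<^sup>2 + 2 * (Js 0)\<^sup>2"
    by (simp add: power2_eq_square algebra_simps)
  also have "2 * (J s - Js 0)\<^sup>2 = (2 / c) * (c * (J s - Js 0)\<^sup>2)" using c by simp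
  finally have "ennreal ((J s)\<^sup>2) \<le> ennreal ((2 / c) * (c * (J s - Js 0)\<^sup>2) + 2 * (Js 0)\<^sup>2)" by (rule ennreal_leI)
  also have "\<dots> = ennreal (2 / c) * ennreal (c * (J s - Js 0)\<^sup>2) + ennreal (2 * (Js 0)\<^sup>2)"
  proof -
    have "0 \<le> 2 / c" "0 \<le> 2 / c * (c * (J s - Js 0)\<^sup>2)" using c by simp_all
    then show ?thesis by (subst ennreal_plus) (simp_all only: ennreal_mult', simp)
  qed
  also have "\<dots> \<le> ennreal (2 / c) * primitive g s + ennreal (2 * (Js 0)\<^sup>2)"
    using J_growth[OF g c coercive assms True] by (intro add_right_mono mult_left_mono) auto
  finally show ?thesis using assms True by (simp add: restrict_domain_def)
next
  case False
  then show ?thesis by (simp add: restrict_domain_def)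
qed

context
  fixes T t1 L :: real and \<Psi> :: "real^'n \<Rightarrow> real" and D :: "real^'n \<Rightarrow> real^'n" and m0 M V
  assumes sol: "weak_solution T m0 M V" and t1: "0 < t1" "t1 < T"
    and min: "\<And>p. p \<in> admissible T m0 \<Longrightarrow> functional_B T (primitive g) \<Psi> (M, V) \<le> functional_B T (primitive g) \<Psi> p"
    and fin: "functional_B T (primitive g) \<Psi> (M, V) < \<infinity>"
    and \<Psi>: "periodic \<Psi>" "\<And>x. GDERIV \<Psi> x :> D x" "L-lipschitz_on UNIV D"
begin

lemma minimizer_finite_energy:
  "(\<integral>\<^sup>+z\<in>{0<..<T} \<times> unit_cell. (ennreal (1 / 2 * M z * (norm (V z))\<^sup>2) + primitive g (M z)) \<partial>lborel) < \<infinity>"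
proof -
  have [measurable]: "M \<in> borel_measurable borel" "V \<in> borel_measurable borel" and nn: "\<And>z. 0 \<le> M z"
    using sol unfolding weak_solution_def by blast+
  have [measurable]: "(\<lambda>z. primitive g (M z)) \<in> borel_measurable borel"
    by (rule measurable_compose[OF _ primitive_borel[OF g]]) simp
  have "functional_B T (primitive g) \<Psi> (M, V) =
    enn2ereal (\<integral>\<^sup>+z\<in>{0<..<T} \<times> unit_cell. (ennreal (1 / 2 * M z * (norm (V z))\<^sup>2) + primitive g (M z)) \<partial>lborel)
    + ereal (LINT x|final_measure T M. \<Psi> x)"
    by (rule functional_B_eq) (use nn in measurable)
  with fin show ?thesis by (auto simp: less_top[symmetric])
qed

lemma minimizer_finite_congestion:
  "(\<integral>\<^sup>+z\<in>{0<..<T} \<times> unit_cell. primitive g (M z) \<partial>lborel) < \<infinity>"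
  by (rule le_less_trans[OF _ minimizer_finite_energy]) (auto intro!: nn_integral_mono mult_right_mono)

lemma minimizer_finite_domain:
  "AE z in lborel. z \<in> {0<..<T} \<times> unit_cell \<longrightarrow> primitive g (M z) < \<infinity>"
proof -
  have [measurable]: "M \<in> borel_measurable borel" using sol unfolding weak_solution_def by blast
  have m [measurable]: "(\<lambda>z. primitive g (M z)) \<in> borel_measurable borel"
    by (rule measurable_compose[OF _ primitive_borel[OF g]]) simp
  have "(\<lambda>z. primitive g (M z) * indicator ({0<..<T} \<times> unit_cell) z) \<in> borel_measurable lborel" by measurable
  then have "AE z in lborel. primitive g (M z) * indicator ({0<..<T} \<times> unit_cell) z \<noteq> \<infinity>"
    by (rule nn_integral_PInf_AE[OF _ less_imp_neq[OF minimizer_finite_congestion]])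
  then show ?thesis by eventually_elim (auto simp: less_top)
qed

lemma minimizer_square_integrable:
  "(\<integral>\<^sup>+z\<in>{0<..<T} \<times> unit_cell. ennreal ((restrict_domain g J (M z))\<^sup>2) \<partial>lborel) < \<infinity>"
proof -
  let ?Q = "{0<..<T} \<times> unit_cell :: (real \<times> (real^'n)) set"
  have [measurable]: "M \<in> borel_measurable borel" and nn: "\<And>z. 0 \<le> M z" using sol unfolding weak_solution_def by blast+
  have m [measurable]: "(\<lambda>z. primitive g (M z)) \<in> borel_measurable borel"
    by (rule measurable_compose[OF _ primitive_borel[OF g]]) simp
  have "(\<integral>\<^sup>+z\<in>?Q. ennreal ((restrict_domain g J (M z))\<^sup>2) \<partial>lborel)
    \<le> (\<integral>\<^sup>+z. ennreal (2 / c) * (primitive g (M z) * indicator ?Q z) + ennreal (2 * (Js 0)\<^sup>2) * indicator ?Q z \<partial>lborel)"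
    by (intro nn_integral_mono) (auto simp: indicator_def intro!: restrict_domain_growth nn)
  also have "\<dots> = ennreal (2 / c) * (\<integral>\<^sup>+z\<in>?Q. primitive g (M z) \<partial>lborel) + ennreal (2 * (Js 0)\<^sup>2) * emeasure lborel ?Q"
    by (subst nn_integral_add, measurable, subst nn_integral_cmult, measurable, subst nn_integral_cmult_indicator, measurable)
  also have "\<dots> < \<infinity>"
  proof -
    have "emeasure lborel ?Q = emeasure lborel {0<..<T} * emeasure lborel (unit_cell :: (real^'n) set)"
      unfolding lborel_prod[symmetric] by (rule lborel.emeasure_pair_measure_Times) auto
    also have "\<dots> < \<infinity>" using emeasure_unit_cell_finite[where 'n='n] t1 by (simp add: ennreal_mult_less_top)
    finally show ?thesis using minimizer_finite_congestion by (simp add: ennreal_mult_less_top)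
  qed
  finally show ?thesis .
qed

text \<open>The difference is taken between translates in opposite directions, since averaging these
  two is what produces the gain. After t1 the cutoff is 1, so they are full translates by \<delta>
  and -\<delta>; the gain before t1 is simply discarded.\<close>

lemma minimizer_difference_bound:
  "(\<integral>\<^sup>+z\<in>{t1<..<T} \<times> unit_cell.
      ennreal ((restrict_domain g J (M (fst z, snd z + \<delta>)) - restrict_domain g J (M (fst z, snd z - \<delta>)))\<^sup>2) \<partial>lborel)
    \<le> ennreal (4 / c * (1 / 2 * T * (2 / t1)\<^sup>2 + L) * (norm \<delta>)\<^sup>2)"
proof -
  let ?Q = "{0<..<T} \<times> unit_cell :: (real \<times> (real^'n)) set"
  let ?G = "primitive g"
  let ?U = "restrict_domain g J"
  define \<eta> \<eta>' where "\<eta> = cutoff t1" and "\<eta>' = cutoff' t1"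
  have T: "0 < T" using t1 by simp
  have \<eta>: "\<And>t. (\<eta> has_real_derivative \<eta>' t) (at t)" "continuous_on UNIV \<eta>'" "\<eta> 0 = 0"
    "\<And>t. t1 \<le> t \<Longrightarrow> \<eta> t = 1" "\<And>t. 0 \<le> t \<Longrightarrow> \<bar>\<eta>' t\<bar> \<le> 2 / t1"
    unfolding \<eta>_def \<eta>'_def using cutoff_props[OF t1(1)] by auto
  have Mm [measurable]: "M \<in> borel_measurable borel" and Vm [measurable]: "V \<in> borel_measurable borel"
    and nn: "\<And>z. 0 \<le> M z" and per: "\<And>t. periodic (\<lambda>x. M (t, x))" "\<And>t. periodic (\<lambda>x. V (t, x))"
    using sol unfolding weak_solution_def by blast+
  have [measurable]: "?G \<in> borel_measurable borel" by (rule primitive_borel[OF g])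
  have [measurable]: "?U \<in> borel_measurable borel" by (rule restrict_domain_borel)
  define M1 M2 V1 V2 where "M1 z = M (fst z, snd z + \<eta> (fst z) *\<^sub>R \<delta>)"
    and "M2 z = M (fst z, snd z + \<eta> (fst z) *\<^sub>R (- \<delta>))"
    and "V1 z = V (fst z, snd z + \<eta> (fst z) *\<^sub>R \<delta>) - \<eta>' (fst z) *\<^sub>R \<delta>"
    and "V2 z = V (fst z, snd z + \<eta> (fst z) *\<^sub>R (- \<delta>)) - \<eta>' (fst z) *\<^sub>R (- \<delta>)" for z
  have s1: "weak_solution T m0 M1 V1" unfolding M1_def[abs_def] V1_def[abs_def]
    by (rule weak_solution_shift[OF sol T \<eta>(1,2,3)])
  have s2: "weak_solution T m0 M2 V2" unfolding M2_def[abs_def] V2_def[abs_def]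
    by (rule weak_solution_shift[OF sol T \<eta>(1,2,3)])
  define Mb Vb where "Mb z = (M1 z + M2 z) / 2" and "Vb z = (M1 z *\<^sub>R V1 z + M2 z *\<^sub>R V2 z) /\<^sub>R (M1 z + M2 z)" for z
  have sb: "weak_solution T m0 Mb Vb" unfolding Mb_def[abs_def] Vb_def[abs_def]
    by (rule weak_solution_average[OF s1 s2 T])
  have [measurable]: "M1 \<in> borel_measurable borel" "V1 \<in> borel_measurable borel" and nn1: "\<And>z. 0 \<le> M1 z"
    using s1 unfolding weak_solution_def by blast+
  have [measurable]: "M2 \<in> borel_measurable borel" "V2 \<in> borel_measurable borel" and nn2: "\<And>z. 0 \<le> M2 z"
    using s2 unfolding weak_solution_def by blast+
  have [measurable]: "Mb \<in> borel_measurable borel" "Vb \<in> borel_measurable borel" and nnb: "\<And>z. 0 \<le> Mb z"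
    using sb unfolding weak_solution_def by blast+
  define k where "k s v = ennreal (1 / 2 * s * (norm v)\<^sup>2)" for s and v :: "real^'n"
  have hm: "(\<lambda>z. ?G (f z)) \<in> borel_measurable borel" if "f \<in> borel_measurable borel" for f :: "real \<times> (real^'n) \<Rightarrow> real"
    using that by measurable
  define X where "X = (\<integral>\<^sup>+z\<in>?Q. (k (M z) (V z) + ?G (M z)) \<partial>lborel)"
  define Xb where "Xb = (\<integral>\<^sup>+z\<in>?Q. (k (Mb z) (Vb z) + ?G (Mb z)) \<partial>lborel)"
  \<comment> \<open>The excess kinetic energy: one half, times the mass T over space-time, times the
    bound (2 / t1)^2 |\<delta>|^2 for |\<eta>'\<delta>|^2.\<close>
  define R where "R = 1 / 2 * T * (2 / t1)\<^sup>2 * (norm \<delta>)\<^sup>2"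
  define E where "E = (\<integral>\<^sup>+z\<in>?Q. ennreal (c / 4 * (?U (M1 z) - ?U (M2 z))\<^sup>2) \<partial>lborel)"
  have R0: "0 \<le> R" using T by (simp add: R_def)
  have pt: "(k (Mb z) (Vb z) + ?G (Mb z)) + ennreal (c / 4 * (?U (M1 z) - ?U (M2 z))\<^sup>2)
      \<le> (ennreal (1 / 2) * k (M1 z) (V1 z) + ennreal (1 / 2) * k (M2 z) (V2 z))
        + (ennreal (1 / 2) * ?G (M1 z) + ennreal (1 / 2) * ?G (M2 z))" for z
  proof -
    have "k (Mb z) (Vb z) \<le> ennreal (1 / 2 * (1 / 2 * M1 z * (norm (V1 z))\<^sup>2) + 1 / 2 * (1 / 2 * M2 z * (norm (V2 z))\<^sup>2))"
      unfolding k_def using kinetic_energy_convex[OF nn1[of z] nn2[of z], of "V1 z" "V2 z"]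
      by (intro ennreal_leI) (simp add: Mb_def Vb_def)
    also have "\<dots> = ennreal (1 / 2) * k (M1 z) (V1 z) + ennreal (1 / 2) * k (M2 z) (V2 z)"
      unfolding k_def using nn1[of z] nn2[of z]
      by (subst ennreal_plus) (simp_all add: ennreal_mult'[symmetric] del: ennreal_half)
    finally have A: "k (Mb z) (Vb z) \<le> ennreal (1 / 2) * k (M1 z) (V1 z) + ennreal (1 / 2) * k (M2 z) (V2 z)" .
    have B: "?G (Mb z) + ennreal (c / 4 * (?U (M1 z) - ?U (M2 z))\<^sup>2) \<le> ennreal (1 / 2) * ?G (M1 z) + ennreal (1 / 2) * ?G (M2 z)"
      unfolding Mb_def by (rule restrict_domain_gain[OF nn1[of z] nn2[of z]])
    show ?thesis by (rule order_trans[OF eq_refl[OF add.assoc] add_mono[OF A B]])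
  qed
  have km [measurable]: "(\<lambda>z. k (f z) (h z)) \<in> borel_measurable borel"
    if [measurable]: "f \<in> borel_measurable borel" "h \<in> borel_measurable borel" for f h and dummy :: "real \<times> (real^'n)"
    unfolding k_def by measurable
  have am: "(\<lambda>t. \<eta> t *\<^sub>R d) \<in> borel_measurable borel" for d :: "real^'n"
  proof -
    have "continuous_on UNIV \<eta>" by (intro continuous_at_imp_continuous_on ballI DERIV_isCont[OF \<eta>(1)])
    then show ?thesis by (intro borel_measurable_continuous_onI continuous_intros)
  qed
  have \<eta>'m [measurable]: "\<eta>' \<in> borel_measurable borel" by (rule borel_measurable_continuous_onI[OF \<eta>(2)])
  \<comment> \<open>Translation of the slices leaves the congestion cost unchanged; in
    \<open>Kin\<close> it reduces the kinetic energy of a translate to that of the unshifted density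
    with the corrected velocity.\<close>
  have F: "(\<integral>\<^sup>+z\<in>?Q. ?G (M (fst z, snd z + \<eta> (fst z) *\<^sub>R d)) \<partial>lborel) = (\<integral>\<^sup>+z\<in>?Q. ?G (M z) \<partial>lborel)" for d
    by (rule nn_integral_spacetime_shift[OF hm[OF Mm] _ am]) (use per in \<open>auto simp: periodic_def\<close>)
  have fm: "(\<lambda>z::real \<times> (real^'n). \<eta>' (fst z)) \<in> borel_measurable borel"
    by (rule measurable_compose[OF _ \<eta>'m]) (rule borel_measurable_continuous_onI, intro continuous_intros)
  have Wm [measurable]: "(\<lambda>z. V z - \<eta>' (fst z) *\<^sub>R d) \<in> borel_measurable borel" for d
    using fm by measurable
  have Kin: "(\<integral>\<^sup>+z\<in>?Q. k (M (fst z, snd z + \<eta> (fst z) *\<^sub>R d)) (V (fst z, snd z + \<eta> (fst z) *\<^sub>R d) - \<eta>' (fst z) *\<^sub>R d) \<partial>lborel)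
      = (\<integral>\<^sup>+z\<in>?Q. k (M z) (V z - \<eta>' (fst z) *\<^sub>R d) \<partial>lborel)" for d
    using nn_integral_spacetime_shift[OF km[OF Mm Wm[of d]] _ am[of d], of "{0<..<T}"] per
    by (auto simp: periodic_def)
  have "Xb + E = (\<integral>\<^sup>+z\<in>?Q. ((k (Mb z) (Vb z) + ?G (Mb z)) + ennreal (c / 4 * (?U (M1 z) - ?U (M2 z))\<^sup>2)) \<partial>lborel)"
    unfolding Xb_def E_def distrib_right by (rule nn_integral_add[symmetric]) measurable
  also have "\<dots> \<le> (\<integral>\<^sup>+z. ((ennreal (1 / 2) * (k (M1 z) (V1 z) * indicator ?Q z) + ennreal (1 / 2) * (k (M2 z) (V2 z) * indicator ?Q z))
        + (ennreal (1 / 2) * (?G (M1 z) * indicator ?Q z) + ennreal (1 / 2) * (?G (M2 z) * indicator ?Q z))) \<partial>lborel)"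
    by (intro nn_integral_mono) (use pt in \<open>auto simp: indicator_def\<close>)
  also have "\<dots> = (ennreal (1 / 2) * (\<integral>\<^sup>+z\<in>?Q. k (M1 z) (V1 z) \<partial>lborel) + ennreal (1 / 2) * (\<integral>\<^sup>+z\<in>?Q. k (M2 z) (V2 z) \<partial>lborel))
        + (ennreal (1 / 2) * (\<integral>\<^sup>+z\<in>?Q. ?G (M1 z) \<partial>lborel) + ennreal (1 / 2) * (\<integral>\<^sup>+z\<in>?Q. ?G (M2 z) \<partial>lborel))"
  proof -
    have *: "(\<integral>\<^sup>+z. (h * a z + h * b z) + (h * d z + h * e z) \<partial>lborel)
      = (h * (\<integral>\<^sup>+z. a z \<partial>lborel) + h * (\<integral>\<^sup>+z. b z \<partial>lborel)) + (h * (\<integral>\<^sup>+z. d z \<partial>lborel) + h * (\<integral>\<^sup>+z. e z \<partial>lborel))"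
      if [measurable]: "a \<in> borel_measurable borel" "b \<in> borel_measurable borel" "d \<in> borel_measurable borel" "e \<in> borel_measurable borel"
      for a b d e :: "real \<times> (real^'n) \<Rightarrow> ennreal" and h
      by (simp add: nn_integral_add nn_integral_cmult)
    show ?thesis by (rule *) measurable
  qed
  also have "ennreal (1 / 2) * (\<integral>\<^sup>+z\<in>?Q. ?G (M1 z) \<partial>lborel) + ennreal (1 / 2) * (\<integral>\<^sup>+z\<in>?Q. ?G (M2 z) \<partial>lborel) = (\<integral>\<^sup>+z\<in>?Q. ?G (M z) \<partial>lborel)"
    unfolding M1_def M2_def F ennreal_half_add_half ..
  finally have avg: "Xb + E \<le> (ennreal (1 / 2) * (\<integral>\<^sup>+z\<in>?Q. k (M1 z) (V1 z) \<partial>lborel) + ennreal (1 / 2) * (\<integral>\<^sup>+z\<in>?Q. k (M2 z) (V2 z) \<partial>lborel))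
      + (\<integral>\<^sup>+z\<in>?Q. ?G (M z) \<partial>lborel)" .
  have kin: "ennreal (1 / 2) * (\<integral>\<^sup>+z\<in>?Q. k (M1 z) (V1 z) \<partial>lborel) + ennreal (1 / 2) * (\<integral>\<^sup>+z\<in>?Q. k (M2 z) (V2 z) \<partial>lborel)
      \<le> (\<integral>\<^sup>+z\<in>?Q. k (M z) (V z) \<partial>lborel) + ennreal R"
  proof -
    let ?\<kappa> = "1 / 2 * (2 / t1)\<^sup>2 * (norm \<delta>)\<^sup>2"
    have "ennreal (1 / 2) * (\<integral>\<^sup>+z\<in>?Q. k (M1 z) (V1 z) \<partial>lborel) + ennreal (1 / 2) * (\<integral>\<^sup>+z\<in>?Q. k (M2 z) (V2 z) \<partial>lborel)
        = ennreal (1 / 2) * (\<integral>\<^sup>+z\<in>?Q. k (M z) (V z - \<eta>' (fst z) *\<^sub>R \<delta>) \<partial>lborel)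
          + ennreal (1 / 2) * (\<integral>\<^sup>+z\<in>?Q. k (M z) (V z - \<eta>' (fst z) *\<^sub>R (- \<delta>)) \<partial>lborel)"
      unfolding M1_def M2_def V1_def V2_def Kin ..
    also have "\<dots> = (\<integral>\<^sup>+z. (ennreal (1 / 2) * (k (M z) (V z - \<eta>' (fst z) *\<^sub>R \<delta>) * indicator ?Q z)
          + ennreal (1 / 2) * (k (M z) (V z - \<eta>' (fst z) *\<^sub>R (- \<delta>)) * indicator ?Q z)) \<partial>lborel)"
      using km[OF Mm Wm[of \<delta>]] km[OF Mm Wm[of "- \<delta>"]] by (subst nn_integral_add) (simp_all add: nn_integral_cmult)
    also have "\<dots> \<le> (\<integral>\<^sup>+z. k (M z) (V z) * indicator ?Q z + ennreal ?\<kappa> * (ennreal (M z) * indicator ?Q z) \<partial>lborel)"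
    proof (rule nn_integral_mono)
      fix z
      show "ennreal (1 / 2) * (k (M z) (V z - \<eta>' (fst z) *\<^sub>R \<delta>) * indicator ?Q z)
          + ennreal (1 / 2) * (k (M z) (V z - \<eta>' (fst z) *\<^sub>R (- \<delta>)) * indicator ?Q z)
          \<le> k (M z) (V z) * indicator ?Q z + ennreal ?\<kappa> * (ennreal (M z) * indicator ?Q z)"
      proof (cases "z \<in> ?Q")
        case True
        then have z0: "0 \<le> fst z" by auto
        define e where "e = \<eta>' (fst z)"
        have e2: "e\<^sup>2 \<le> (2 / t1)\<^sup>2"
          using power_mono[OF \<eta>(5)[OF z0] abs_ge_zero, of 2] by (simp add: e_def)
        \<comment> \<open>The terms linear in \<delta> cancel between the two translates; the square
          of the correction survives.\<close>
        have "(norm (V z - e *\<^sub>R \<delta>))\<^sup>2 + (norm (V z - e *\<^sub>R (- \<delta>)))\<^sup>2 = 2 * (norm (V z))\<^sup>2 + 2 * (e\<^sup>2 * (norm \<delta>)\<^sup>2)"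
          unfolding power2_norm_eq_inner by (simp add: algebra_simps inner_commute power2_eq_square)
        also have "\<dots> \<le> 2 * (norm (V z))\<^sup>2 + 2 * ((2 / t1)\<^sup>2 * (norm \<delta>)\<^sup>2)"
          by (intro add_left_mono mult_left_mono mult_right_mono e2) auto
        finally have "M z / 4 * ((norm (V z - e *\<^sub>R \<delta>))\<^sup>2 + (norm (V z - e *\<^sub>R (- \<delta>)))\<^sup>2)
            \<le> M z / 4 * (2 * (norm (V z))\<^sup>2 + 2 * ((2 / t1)\<^sup>2 * (norm \<delta>)\<^sup>2))"
          using nn[of z] by (intro mult_left_mono) auto
        then have le: "1 / 2 * (1 / 2 * M z * (norm (V z - e *\<^sub>R \<delta>))\<^sup>2) + 1 / 2 * (1 / 2 * M z * (norm (V z - e *\<^sub>R (- \<delta>)))\<^sup>2)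
            \<le> 1 / 2 * M z * (norm (V z))\<^sup>2 + ?\<kappa> * M z"
          by (simp add: algebra_simps)
        have *: "ennreal (1 / 2) * ennreal p + ennreal (1 / 2) * ennreal q \<le> ennreal r + ennreal s * ennreal u"
          if "1 / 2 * p + 1 / 2 * q \<le> r + s * u" "0 \<le> p" "0 \<le> q" "0 \<le> r" "0 \<le> s" "0 \<le> u" for p q r s u :: real
        proof -
          have h: "0 \<le> (1 / 2 :: real)" by simp
          have "ennreal (1 / 2) * ennreal p + ennreal (1 / 2) * ennreal q = ennreal (1 / 2 * p + 1 / 2 * q)"
            unfolding ennreal_mult'[OF h, symmetric] using that by (intro ennreal_plus[symmetric]) auto
          also have "\<dots> \<le> ennreal (r + s * u)" using that(1) by (rule ennreal_leI)
          also have "\<dots> = ennreal r + ennreal s * ennreal u" using that by (simp add: ennreal_mult)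
          finally show ?thesis .
        qed
        have ind: "indicator ?Q z = (1 :: ennreal)" using True by simp
        show ?thesis
          unfolding ind mult_1_right k_def e_def[symmetric] by (rule *[OF le]) (use nn[of z] in auto)
      qed simp
    qed
    also have "\<dots> = (\<integral>\<^sup>+z\<in>?Q. k (M z) (V z) \<partial>lborel) + ennreal ?\<kappa> * (\<integral>\<^sup>+z\<in>?Q. ennreal (M z) \<partial>lborel)"
      by (subst nn_integral_add) (simp_all add: nn_integral_cmult)
    also have "ennreal ?\<kappa> * (\<integral>\<^sup>+z\<in>?Q. ennreal (M z) \<partial>lborel) = ennreal R"
      unfolding weak_solution_total_mass[OF sol T] R_def
      using T by (subst ennreal_mult'[symmetric]) (simp_all add: mult_ac)
    finally show ?thesis .
  qed
  have "Xb + E \<le> (\<integral>\<^sup>+z\<in>?Q. k (M z) (V z) \<partial>lborel) + ennreal R + (\<integral>\<^sup>+z\<in>?Q. ?G (M z) \<partial>lborel)"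
    by (rule order_trans[OF avg add_right_mono[OF kin]])
  moreover have "X = (\<integral>\<^sup>+z\<in>?Q. k (M z) (V z) \<partial>lborel) + (\<integral>\<^sup>+z\<in>?Q. ?G (M z) \<partial>lborel)"
    unfolding X_def distrib_right by (rule nn_integral_add) measurable
  ultimately have ineq: "Xb + E \<le> X + ennreal R" by (simp add: add_ac)
  have Xfin: "X < \<infinity>" using minimizer_finite_energy unfolding X_def k_def .
  then have "X + ennreal R < \<infinity>" by simp
  \<comment> \<open>All terms are finite, so the comparison can be continued in the reals, where
    energies may be subtracted.\<close>
  with ineq have fin': "Xb + E < \<infinity>" by (rule le_less_trans)
  define x xb e where "x = enn2real X" and "xb = enn2real Xb" and "e = enn2real E"
  have en: "X = ennreal x" "Xb = ennreal xb" "E = ennreal e" and pos: "0 \<le> x" "0 \<le> xb" "0 \<le> e"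
    using Xfin fin' by (auto simp: x_def xb_def e_def ennreal_enn2real_if)
  have i1: "xb + e \<le> x + R"
  proof -
    have "ennreal (xb + e) \<le> ennreal (x + R)" using ineq pos R0 unfolding en by simp
    then show ?thesis using pos R0 by (simp add: ennreal_le_iff del: ennreal_plus)
  qed
  \<comment> \<open>Minimality against the averaged pair. The unknown energies \<open>x\<close> and
    \<open>xb\<close> cancel against \<open>i1\<close> and leave a bound for the gain
    \<open>e\<close>.\<close>
  have i2: "x \<le> xb + L * (norm \<delta>)\<^sup>2"
  proof -
    have "functional_B T ?G \<Psi> (M, V) \<le> functional_B T ?G \<Psi> (Mb, Vb)"
      by (rule min[OF weak_solution_admissible[OF sb T]])
    moreover have "functional_B T ?G \<Psi> (M, V) = ereal (x + (LINT x|final_measure T M. \<Psi> x))"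
      using functional_B_eq[of M V ?G T \<Psi>, OF _ _ _ nn] en(1) pos unfolding X_def k_def by (simp add: enn2ereal_ennreal)
    moreover have "functional_B T ?G \<Psi> (Mb, Vb) = ereal (xb + (LINT x|final_measure T Mb. \<Psi> x))"
      using functional_B_eq[of Mb Vb ?G T \<Psi>, OF _ _ _ nnb] en(2) pos unfolding Xb_def k_def by (simp add: enn2ereal_ennreal)
    moreover have "(LINT x|final_measure T Mb. \<Psi> x) \<le> (LINT x|final_measure T M. \<Psi> x) + L * (norm \<delta>)\<^sup>2"
      by (rule final_cost_average_le[OF sol T t1(2) sb _ \<Psi>]) (simp add: Mb_def M1_def M2_def \<eta>(4))
    ultimately show ?thesis by simp
  qed
  have e_le: "e \<le> (1 / 2 * T * (2 / t1)\<^sup>2 + L) * (norm \<delta>)\<^sup>2"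
    using i1 i2 by (simp only: R_def distrib_right)
  have "(\<integral>\<^sup>+z\<in>{t1<..<T} \<times> unit_cell. ennreal ((?U (M (fst z, snd z + \<delta>)) - ?U (M (fst z, snd z - \<delta>)))\<^sup>2) \<partial>lborel)
      \<le> (\<integral>\<^sup>+z. ennreal (4 / c) * (ennreal (c / 4 * (?U (M1 z) - ?U (M2 z))\<^sup>2) * indicator ?Q z) \<partial>lborel)"
  proof (rule nn_integral_mono)
    fix z :: "real \<times> (real^'n)"
    show "ennreal ((?U (M (fst z, snd z + \<delta>)) - ?U (M (fst z, snd z - \<delta>)))\<^sup>2) * indicator ({t1<..<T} \<times> unit_cell) z
      \<le> ennreal (4 / c) * (ennreal (c / 4 * (?U (M1 z) - ?U (M2 z))\<^sup>2) * indicator ?Q z)"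
    proof (cases "z \<in> {t1<..<T} \<times> unit_cell")
      case True
      then have "M1 z = M (fst z, snd z + \<delta>)" "M2 z = M (fst z, snd z - \<delta>)"
        by (auto simp: M1_def M2_def \<eta>(4))
      moreover have "z \<in> ?Q" using True t1 by auto
      ultimately show ?thesis using True c by (simp add: ennreal_mult'[symmetric])
    qed simp
  qed
  also have "\<dots> = ennreal (4 / c) * E" unfolding E_def by (rule nn_integral_cmult) measurable
  also have "\<dots> = ennreal (4 / c * e)" unfolding en using c by (intro ennreal_mult'[symmetric]) simp
  also have "\<dots> \<le> ennreal (4 / c * (1 / 2 * T * (2 / t1)\<^sup>2 + L) * (norm \<delta>)\<^sup>2)"
    unfolding mult.assoc[of "4 / c"] using c by (intro ennreal_leI mult_left_mono e_le) simp
  finally show ?thesis .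
qed

end

end

text \<open>Carries the estimates from the Borel version back to the given solution. The symmetric
  difference with step \<delta>/2, read at a point shifted by \<delta>/2, is the one-sided
  difference with step \<delta>; the factor 1/4 from |\<delta>/2|^2 cancels the 4 in 4/c.\<close>

lemma solution_regular_representative:
  fixes m :: "real \<times> (real^'n) \<Rightarrow> real" and \<Psi> :: "real^'n \<Rightarrow> real"
  assumes T: "0 < T" and g: "mono_on {0..} g" and c: "0 < c"
    and coercive: "\<And>s q. ereal (s * q + c * \<bar>J s - Js q\<bar>\<^sup>2) \<le> enn2ereal (primitive g s) + conjugate (primitive g) q"
    and \<Psi>: "periodic \<Psi>" "\<And>x. GDERIV \<Psi> x :> D x" "L-lipschitz_on UNIV D"
    and sol: "is_solution T (primitive g) \<Psi> m0 m v"
  obtains U where "U \<in> borel_measurable borel" "\<And>t. periodic (\<lambda>x. U (t, x))"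
    "AE z in lborel. fst z \<in> {0<..<T} \<longrightarrow> J (m z) = U z"
    "(\<integral>\<^sup>+z\<in>{0<..<T} \<times> unit_cell. ennreal ((U z)\<^sup>2) \<partial>lborel) < \<infinity>"
    "\<And>t1 \<delta>. 0 < t1 \<Longrightarrow> t1 < T \<Longrightarrow>
      (\<integral>\<^sup>+z\<in>{t1<..<T} \<times> unit_cell. ennreal ((U (fst z, snd z + \<delta>) - U z)\<^sup>2) \<partial>lborel)
        \<le> ennreal ((1 / 2 * T * (2 / t1)\<^sup>2 + L) / c * (norm \<delta>)\<^sup>2)"
proof -
  have adm: "(m, v) \<in> admissible T m0" and fin: "functional_B T (primitive g) \<Psi> (m, v) < \<infinity>"
    and inf: "functional_B T (primitive g) \<Psi> (m, v) = (INF p\<in>admissible T m0. functional_B T (primitive g) \<Psi> p)"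
    using sol unfolding is_solution_def by blast+
  obtain M V where ws: "weak_solution T m0 M V" and rep: "AE z in lborel. fst z \<in> {0<..<T} \<longrightarrow> M z = m z \<and> V z = v z"
    by (rule admissible_borel_representative[OF adm T])
  note B = functional_B_borel_representative[OF rep, of "primitive g" \<Psi>]
  have min: "functional_B T (primitive g) \<Psi> (M, V) \<le> functional_B T (primitive g) \<Psi> p" if "p \<in> admissible T m0" for p
    unfolding B[symmetric] inf by (rule INF_lower[OF that])
  have fin': "functional_B T (primitive g) \<Psi> (M, V) < \<infinity>" using fin unfolding B .
  have Mm: "M \<in> borel_measurable borel" and nn: "\<And>z. 0 \<le> M z" and per: "\<And>t. periodic (\<lambda>x. M (t, x))"
    using ws unfolding weak_solution_def by blast+
  define U where "U z = restrict_domain g J (M z)" for z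
  have Um [measurable]: "U \<in> borel_measurable borel"
    unfolding U_def[abs_def] by (rule measurable_compose[OF Mm restrict_domain_borel[OF g c coercive]])
  have Up: "periodic (\<lambda>x. U (t, x))" for t using per[of t] by (simp add: U_def periodic_def)
  \<comment> \<open>Any time strictly between 0 and T serves as t1 here; the finiteness facts taken
    from the context do not involve it.\<close>
  have h: "0 < T / 2" "T / 2 < T" using T by auto
  have "AE z in lborel. z \<in> {0<..<T} \<times> unit_cell \<longrightarrow> primitive g (M z) < \<infinity>"
    by (rule minimizer_finite_domain[OF g c coercive ws h min fin' \<Psi>])
  then have "AE z in lborel. fst z \<in> {0<..<T} \<longrightarrow> primitive g (M z) < \<infinity>"
    by (rule AE_periodic_extend) (use per in \<open>simp add: periodic_def\<close>)
  then have ae: "AE z in lborel. fst z \<in> {0<..<T} \<longrightarrow> J (m z) = U z"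
    using rep
  proof eventually_elim
    case (elim z)
    then show ?case using nn[of z] by (auto simp: U_def restrict_domain_def)
  qed
  have U2: "(\<integral>\<^sup>+z\<in>{0<..<T} \<times> unit_cell. ennreal ((U z)\<^sup>2) \<partial>lborel) < \<infinity>"
    unfolding U_def by (rule minimizer_square_integrable[OF g c coercive ws h min fin' \<Psi>])
  have "(\<integral>\<^sup>+z\<in>{t1<..<T} \<times> unit_cell. ennreal ((U (fst z, snd z + \<delta>) - U z)\<^sup>2) \<partial>lborel)
        \<le> ennreal ((1 / 2 * T * (2 / t1)\<^sup>2 + L) / c * (norm \<delta>)\<^sup>2)" if t1: "0 < t1" "t1 < T" for t1 \<delta>
  proof -
    let ?h = "(1 / 2) *\<^sub>R \<delta>"
    let ?f = "\<lambda>z. ennreal ((U (fst z, snd z + ?h) - U (fst z, snd z - ?h))\<^sup>2)"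
    have shm: "(\<lambda>z. U (fst z, snd z + d)) \<in> borel_measurable borel" for d
      by (rule measurable_compose[OF _ Um]) (intro borel_measurable_continuous_onI continuous_intros)
    have fm: "?f \<in> borel_measurable borel"
      using shm[of ?h] shm[of "- ?h"] by simp
    have fp: "periodic (\<lambda>x. ?f (t, x))" for t
      using periodic_shift[OF Up[of t], of ?h] periodic_shift[OF Up[of t], of "- ?h"] by (simp add: periodic_def)
    have hh: "x + ?h + ?h = x + \<delta>" for x
      by (simp add: add.assoc scaleR_left_distrib[symmetric])
    have "(\<integral>\<^sup>+z\<in>{t1<..<T} \<times> unit_cell. ?f (fst z, snd z + ?h) \<partial>lborel) = (\<integral>\<^sup>+z\<in>{t1<..<T} \<times> unit_cell. ?f z \<partial>lborel)"
      by (rule nn_integral_spacetime_shift[OF fm, of "{t1<..<T}" "\<lambda>_. ?h"]) (use fp in auto)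
    then have "(\<integral>\<^sup>+z\<in>{t1<..<T} \<times> unit_cell. ennreal ((U (fst z, snd z + \<delta>) - U z)\<^sup>2) \<partial>lborel)
        = (\<integral>\<^sup>+z\<in>{t1<..<T} \<times> unit_cell. ?f z \<partial>lborel)"
      by (simp only: fst_conv snd_conv hh add_diff_cancel_right' prod.collapse)
    also have "\<dots> \<le> ennreal (4 / c * (1 / 2 * T * (2 / t1)\<^sup>2 + L) * (norm ?h)\<^sup>2)"
      unfolding U_def by (rule minimizer_difference_bound[OF g c coercive ws t1 min fin' \<Psi>])
    also have "4 / c * (1 / 2 * T * (2 / t1)\<^sup>2 + L) * (norm ?h)\<^sup>2 = (1 / 2 * T * (2 / t1)\<^sup>2 + L) / c * (norm \<delta>)\<^sup>2"
      using c by (simp add: power_divide field_simps)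
    finally show ?thesis .
  qed
  then show ?thesis using Um Up ae U2 by (rule that[rotated -1])
qed

section \<open>From open to closed time intervals, and the conclusion\<close>

lemma AE_fst_neq: "AE z in (lborel :: (real \<times> (real^'n)) measure). fst z \<noteq> a"
proof -
  have "emeasure (lborel :: (real \<times> (real^'n)) measure) ({a} \<times> UNIV) = emeasure lborel {a} * emeasure (lborel :: (real^'n) measure) UNIV"
    unfolding lborel_prod[symmetric] by (rule lborel.emeasure_pair_measure_Times) auto
  moreover have "({a} \<times> UNIV :: (real \<times> (real^'n)) set) \<in> sets borel" by (intro borel_closed closed_Times) auto
  ultimately have "{a} \<times> UNIV \<in> null_sets (lborel :: (real \<times> (real^'n)) measure)" by (simp add: null_sets_def)
  then show ?thesis by (rule AE_I') auto
qed

text \<open>m is controlled on the open interval (0, T), whereas the norms are over [t1, T]; the two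
  end slices are null sets.\<close>

lemma set_nn_integral_closed_slab:
  "(\<integral>\<^sup>+z\<in>{a..b} \<times> A. f z \<partial>lborel) = (\<integral>\<^sup>+z\<in>{a<..<b} \<times> A. f z \<partial>(lborel :: (real \<times> (real^'n)) measure))"
proof (rule nn_integral_cong_AE)
  show "AE z in lborel. f z * indicator ({a..b} \<times> A) z = f z * indicator ({a<..<b} \<times> A) z"
    using AE_fst_neq[of a] AE_fst_neq[of b] by eventually_elim (auto simp: indicator_def)
qed

lemma closed_slab_borel: "({a..b} \<times> unit_cell :: (real \<times> (real^'n)) set) \<in> sets borel"
  unfolding borel_prod[symmetric] by (intro pair_measureI) auto

theorem theorem4p3:
  fixes T c :: real and g :: "real \<Rightarrow> ennreal" and \<Psi> :: "real ^ 'n \<Rightarrow> real"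
  assumes "0 < T"
    and "mono_on {0..} g"
    and "C11_torus \<Psi>"
    and "0 < c"
  shows "(\<forall>t1>0. \<exists>C. \<forall>J Js m0 m v.
            prob_density_torus m0 \<longrightarrow>
            (\<forall>s q. ereal (s * q + c * \<bar>J s - Js q\<bar>\<^sup>2) \<le> enn2ereal (primitive g s) + conjugate (primitive g) q) \<longrightarrow>
            is_solution T (primitive g) \<Psi> m0 m v \<longrightarrow>
            (\<forall>\<delta>. in_L2 ({t1..T} \<times> unit_cell) (\<lambda>(t, x). J (m (t, x + \<delta>)) - J (m (t, x))) \<and>
                 L2_norm ({t1..T} \<times> unit_cell) (\<lambda>(t, x). J (m (t, x + \<delta>)) - J (m (t, x)))
                   \<le> C * norm \<delta>)) \<and>
         (\<forall>J Js m0 m v.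
            prob_density_torus m0 \<longrightarrow>
            (\<forall>s q. ereal (s * q + c * \<bar>J s - Js q\<bar>\<^sup>2) \<le> enn2ereal (primitive g s) + conjugate (primitive g) q) \<longrightarrow>
            is_solution T (primitive g) \<Psi> m0 m v \<longrightarrow>
            in_L2loc_H1 T (\<lambda>z. J (m z)))"
proof -
  obtain D L where \<Psi>: "periodic \<Psi>" "\<And>x. GDERIV \<Psi> x :> D x" "L-lipschitz_on UNIV D"
    using assms(3) unfolding C11_torus_def by blast
  have L: "0 \<le> L" using \<Psi>(3) by (rule lipschitz_on_nonneg)
  \<comment> \<open>For a \<ge> T the slab is a null set and every norm over it is 0; this covers t1
    and a at or beyond the final time.\<close>
  have trivial: "in_L2 ({a..T} \<times> unit_cell) f" "L2_norm ({a..T} \<times> unit_cell) f \<le> sqrt 0"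
    if "T \<le> a" for a and f :: "real \<times> (real^'n) \<Rightarrow> 'b::euclidean_space"
  proof -
    have ae: "AE z in lborel. z \<in> {a..T} \<times> unit_cell \<longrightarrow> f z = 0"
      using AE_fst_neq[of T] by eventually_elim (use that in auto)
    show "in_L2 ({a..T} \<times> unit_cell) f" "L2_norm ({a..T} \<times> unit_cell) f \<le> sqrt 0"
      using in_L2_AE_borel[OF borel_measurable_const closed_slab_borel ae, of 0] by simp_all
  qed
  have part1: "\<exists>C. \<forall>J Js m0 m v. prob_density_torus m0 \<longrightarrow>
      (\<forall>s q. ereal (s * q + c * \<bar>J s - Js q\<bar>\<^sup>2) \<le> enn2ereal (primitive g s) + conjugate (primitive g) q) \<longrightarrow>
      is_solution T (primitive g) \<Psi> m0 m v \<longrightarrow>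
      (\<forall>\<delta>. in_L2 ({t1..T} \<times> unit_cell) (\<lambda>(t, x). J (m (t, x + \<delta>)) - J (m (t, x))) \<and>
           L2_norm ({t1..T} \<times> unit_cell) (\<lambda>(t, x). J (m (t, x + \<delta>)) - J (m (t, x))) \<le> C * norm \<delta>)"
    if t1: "0 < t1" for t1
  proof (cases "t1 < T")
    case False
    then have "T \<le> t1" by simp
    from trivial[OF this] show ?thesis by (intro exI[of _ 0] allI impI conjI) simp_all
  next
    case True
    \<comment> \<open>Only T, t1, c and the Lipschitz constant of the gradient of \<Psi> enter, so
      the constant is fixed before \<open>J\<close>, \<open>Js\<close>, the initial datum and the
      solution.\<close>
    define B where "B = (1 / 2 * T * (2 / t1)\<^sup>2 + L) / c"
    have B: "0 \<le> B" using assms(1,4) L by (simp add: B_def)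
    show ?thesis
    proof (intro exI[of _ "sqrt B"] allI impI)
      fix J Js :: "real \<Rightarrow> real" and m0 m v and \<delta> :: "real^'n"
      assume coercive: "\<forall>s q. ereal (s * q + c * \<bar>J s - Js q\<bar>\<^sup>2) \<le> enn2ereal (primitive g s) + conjugate (primitive g) q"
        and sol: "is_solution T (primitive g) \<Psi> m0 m v"
      obtain U where Um: "U \<in> borel_measurable borel"
        and ae: "AE z in lborel. fst z \<in> {0<..<T} \<longrightarrow> J (m z) = U z"
        and diff: "\<And>t1 \<delta>. 0 < t1 \<Longrightarrow> t1 < T \<Longrightarrow>
          (\<integral>\<^sup>+z\<in>{t1<..<T} \<times> unit_cell. ennreal ((U (fst z, snd z + \<delta>) - U z)\<^sup>2) \<partial>lborel)
            \<le> ennreal ((1 / 2 * T * (2 / t1)\<^sup>2 + L) / c * (norm \<delta>)\<^sup>2)"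
        by (rule solution_regular_representative[OF assms(1,2,4) coercive[rule_format] \<Psi> sol]) blast
      define f' where "f' z = U (fst z, snd z + \<delta>) - U z" for z
      have f'm: "f' \<in> borel_measurable borel"
        unfolding f'_def[abs_def]
        by (intro borel_measurable_diff Um measurable_compose[OF _ Um] borel_measurable_continuous_onI continuous_intros)
      have sh: "(0, \<delta>) + z = (fst z, snd z + \<delta>)" for z :: "real \<times> (real^'n)" by (simp add: prod_eq_iff add.commute)
      \<comment> \<open>The representative agrees with J(m) almost everywhere, and so do their
        translates by (0, \<delta>), because a translate of a null set is null. The slice t = T,
        where nothing is known about m, is null.\<close>
      have "AE z in lborel. z \<in> {t1..T} \<times> unit_cell \<longrightarrow> (\<lambda>(t, x). J (m (t, x + \<delta>)) - J (m (t, x))) z = f' z"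
        using ae AE_lborel_translate[OF ae, of "(0, \<delta>)"] AE_fst_neq[of T]
      proof eventually_elim
        case (elim z)
        then show ?case using t1 unfolding sh by (cases z) (auto simp: f'_def)
      qed
      moreover have "(\<integral>\<^sup>+z\<in>{t1..T} \<times> unit_cell. ennreal ((norm (f' z))\<^sup>2) \<partial>lborel) \<le> ennreal (B * (norm \<delta>)\<^sup>2)"
        using diff[OF t1 True, of \<delta>] unfolding set_nn_integral_closed_slab f'_def B_def by simp
      ultimately have "in_L2 ({t1..T} \<times> unit_cell) (\<lambda>(t, x). J (m (t, x + \<delta>)) - J (m (t, x)))"
        "L2_norm ({t1..T} \<times> unit_cell) (\<lambda>(t, x). J (m (t, x + \<delta>)) - J (m (t, x))) \<le> sqrt (B * (norm \<delta>)\<^sup>2)"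
        using in_L2_AE_borel[OF f'm closed_slab_borel, of t1 T _ "B * (norm \<delta>)\<^sup>2"] B by auto
      then show "in_L2 ({t1..T} \<times> unit_cell) (\<lambda>(t, x). J (m (t, x + \<delta>)) - J (m (t, x))) \<and>
           L2_norm ({t1..T} \<times> unit_cell) (\<lambda>(t, x). J (m (t, x + \<delta>)) - J (m (t, x))) \<le> sqrt B * norm \<delta>"
        by (simp add: real_sqrt_mult)
    qed
  qed
  have part2: "in_L2loc_H1 T (\<lambda>z. J (m z))"
    if coercive: "\<forall>s q. ereal (s * q + c * \<bar>J s - Js q\<bar>\<^sup>2) \<le> enn2ereal (primitive g s) + conjugate (primitive g) q"
      and sol: "is_solution T (primitive g) \<Psi> m0 m v" for J Js m0 m v
    unfolding in_L2loc_H1_def in_L2_H1_def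
  proof (intro allI impI)
    fix a :: real assume a: "0 < a"
    show "\<exists>w. in_L2 ({a..T} \<times> unit_cell) (\<lambda>z. J (m z)) \<and> in_L2 ({a..T} \<times> unit_cell) w \<and>
      (AE t in lebesgue. t \<in> {a..T} \<longrightarrow> H1_torus (\<lambda>x. J (m (t, x))) (\<lambda>x. w (t, x)))"
    proof (cases "a < T")
      case False
      then have aT: "T \<le> a" by simp
      have "AE t in lborel. t \<in> {a..T} \<longrightarrow> H1_torus (\<lambda>x. J (m (t, x))) (\<lambda>x. 0)"
        using AE_lborel_singleton[of T] by eventually_elim (use aT in auto)
      from AE_completion[OF this] show ?thesis
        by (intro exI[of _ "\<lambda>_. 0"] conjI trivial(1)[OF aT])
    next
      case True
      obtain U where Um: "U \<in> borel_measurable borel" and Up: "\<And>t. periodic (\<lambda>x. U (t, x))"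
        and ae: "AE z in lborel. fst z \<in> {0<..<T} \<longrightarrow> J (m z) = U z"
        and U2: "(\<integral>\<^sup>+z\<in>{0<..<T} \<times> unit_cell. ennreal ((U z)\<^sup>2) \<partial>lborel) < \<infinity>"
        and diff: "\<And>t1 \<delta>. 0 < t1 \<Longrightarrow> t1 < T \<Longrightarrow>
          (\<integral>\<^sup>+z\<in>{t1<..<T} \<times> unit_cell. ennreal ((U (fst z, snd z + \<delta>) - U z)\<^sup>2) \<partial>lborel)
            \<le> ennreal ((1 / 2 * T * (2 / t1)\<^sup>2 + L) / c * (norm \<delta>)\<^sup>2)"
        by (rule solution_regular_representative[OF assms(1,2,4) coercive[rule_format] \<Psi> sol]) blast
      have per: "periodic (\<lambda>x. m (t, x))" if "t \<in> {0<..<T}" for t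
        using sol that unfolding is_solution_def admissible_def by blast
      have "(\<integral>\<^sup>+z\<in>{a<..<T} \<times> unit_cell. ennreal ((U z)\<^sup>2) \<partial>lborel)
          \<le> (\<integral>\<^sup>+z\<in>{0<..<T} \<times> unit_cell. ennreal ((U z)\<^sup>2) \<partial>lborel)"
        using a by (intro nn_integral_mono) (auto simp: indicator_def)
      then have U2': "(\<integral>\<^sup>+z\<in>{a<..<T} \<times> unit_cell. ennreal ((U z)\<^sup>2) \<partial>lborel) < \<infinity>" using U2 by (rule le_less_trans)
      have K: "0 \<le> (1 / 2 * T * (2 / a)\<^sup>2 + L) / c" using assms(1,4) L by simp
      have I: "{a<..<T} \<in> sets borel" "emeasure lborel {a<..<T} < \<infinity>" using True by auto
      obtain w :: "real \<times> (real^'n) \<Rightarrow> real^'n" where wm: "w \<in> borel_measurable borel"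
        and w2: "(\<integral>\<^sup>+z\<in>{a<..<T} \<times> unit_cell. ennreal ((norm (w z))\<^sup>2) \<partial>lborel) < \<infinity>"
        and wH: "AE t in lborel. t \<in> {a<..<T} \<longrightarrow> (\<forall>u'. periodic u' \<longrightarrow>
          (AE x in lborel. x \<in> unit_cell \<longrightarrow> u' x = U (t, x)) \<longrightarrow> H1_torus u' (\<lambda>x. w (t, x)))"
        by (rule weak_gradient[OF Um Up I U2' K diff[OF a True]])
      have fin: "\<exists>B\<ge>0. X \<le> ennreal B" if "X < \<infinity>" for X
        using that by (cases X) auto
      have ae': "AE z in lborel. z \<in> {a..T} \<times> unit_cell \<longrightarrow> J (m z) = U z"
        using ae AE_fst_neq[of T] by eventually_elim (use a in auto)
      obtain B1 where B1: "0 \<le> B1" "(\<integral>\<^sup>+z\<in>{a<..<T} \<times> unit_cell. ennreal ((U z)\<^sup>2) \<partial>lborel) \<le> ennreal B1"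
        using fin[OF U2'] by blast
      have 1: "in_L2 ({a..T} \<times> unit_cell) (\<lambda>z. J (m z))"
        using in_L2_AE_borel(1)[OF Um closed_slab_borel ae' _ B1(1)] B1(2) unfolding set_nn_integral_closed_slab by simp
      obtain B2 where B2: "0 \<le> B2" "(\<integral>\<^sup>+z\<in>{a<..<T} \<times> unit_cell. ennreal ((norm (w z))\<^sup>2) \<partial>lborel) \<le> ennreal B2"
        using fin[OF w2] by blast
      have 2: "in_L2 ({a..T} \<times> unit_cell) w"
        using in_L2_AE_borel(1)[OF wm closed_slab_borel _ _ B2(1), of a T w] B2(2) unfolding set_nn_integral_closed_slab by simp
      \<comment> \<open>At almost every time the slice of J(m) is periodic, as m is, and agrees with
        the slice of \<open>U\<close> up to a null set, which is the form in which
        \<open>weak_gradient\<close> applies.\<close>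
      have "AE t in lborel. t \<in> {a..T} \<longrightarrow> H1_torus (\<lambda>x. J (m (t, x))) (\<lambda>x. w (t, x))"
        using wH AE_fst_slice[OF ae] AE_lborel_singleton[of a] AE_lborel_singleton[of T]
      proof eventually_elim
        case (elim t)
        show ?case
        proof
          assume "t \<in> {a..T}"
          with elim(3,4) have t: "t \<in> {a<..<T}" by auto
          then have t0: "t \<in> {0<..<T}" using a by auto
          have "AE x in lborel. x \<in> unit_cell \<longrightarrow> J (m (t, x)) = U (t, x)"
            using elim(2) by eventually_elim (use t0 in simp)
          moreover have "periodic (\<lambda>x. J (m (t, x)))" using per[OF t0] by (simp add: periodic_def)
          ultimately show "H1_torus (\<lambda>x. J (m (t, x))) (\<lambda>x. w (t, x))" using elim(1) t by blast
        qed
      qed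
      from AE_completion[OF this] 1 2 show ?thesis by blast
    qed
  qed
  show ?thesis using part1 part2 by blast
qed

end
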